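(* Let $\omega:[0,2\pi]\to(0,\infty)$ be twice continuously differentiable with $\int_0^{2\pi}\omega(u)\,du=2\pi$. Let $\{a_k\}_{k\ge1}\cup\{b_k\}_{k\ge1}$ be independent standard Gaussian random variables, and let $(u_k)_{k\ge1}$ and $(v_k)_{k\ge1}$ be the systems of Sturm–Liouville eigenfunctions attached to $\omega$ for the conditions $(C)$ and $(D)$, respectively (as defined in the context). Define $$F_n(x)=\frac{1}{\sqrt n}\sum_{k=1}^n\big(a_k u_k(x)+b_k v_k(x)\big),\qquad x\in[0,2\pi],$$ and let $\mathcal N_n=\#\{x\in[0,2\pi]:F_n(x)=0\}$. Then there exists $0<V<\infty$ such that $$\lim_{n\to\infty}\frac{\operatorname{Var}(\mathcal N_n)}{n}=V,$$ and, as $n\to\infty$, the normalized variable $\dfrac{\mathcal N_n-\mathbb E\,\mathcal N_n}{\sqrt{\operatorname{Var}(\mathcal N_n)}}$ converges in distribution to the standard Gaussian law.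
   Context: Put $\Omega(x)=\int_0^x\omega(u)\,du$, an increasing bijection of $[0,2\pi]$ onto itself. Sturm–Liouville operator. Consider $\mathcal L=q-\frac{d^2}{dy^2}$ on $[0,2\pi]$, where $q(y)$ is the value of $\frac{\omega''}{2\omega^3}-\frac34\frac{(\omega')^2}{\omega^4}$ at the point $x=\Omega^{-1}(y)$. A nontrivial function $g$ is an eigenfunction of $\mathcal L$ with eigenvalue $\lambda$ if $\mathcal L g=\lambda g$, i.e. $-g''+qg=\lambda g$, together with the prescribed boundary conditions. Under the change of variables $y=\Omega(x)$, $g(y)=\omega(x)^{1/2}f(x)$, the equation $\mathcal Lg=\lambda g$ is equivalent to $f''(x)=-\lambda\,\omega^2(x)f(x)$ on $[0,2\pi]$. The systems $(u_k)$, $(v_k)$. The two sets of conditions are $(C)$: $g(0)\ne0$, $g'(0)=0$; $(D)$: $g(0)=g(2\pi)=0$. In each case let $(g_k)_{k\ge1}$ be an orthogonal system in $L^2([0,2\pi],dy)$ of real eigenfunctions of $\mathcal L$ (satisfying the corresponding condition), indexed by their phase so that the eigenvalue $\lambda_k$ of $g_k$ satisfies $\sqrt{\lambda_k}=\frac k2+O(\frac1k)$. The functions $u_k$ (case $(C)$) and $v_k$ (case $(D)$) are the eigenfunctions written in the variable $x$, i.e. $x\mapsto\omega(x)^{-1/2}g_k(\Omega(x))$, normalized to have leading constant $1$; that is, uniformly in $x\in[0,2\pi]$ as $k\to\infty$, $$u_k(x)=\frac{1}{\omega(x)^{1/2}}\cos\Big(\frac k2\Omega(x)\Big)+O\Big(\frac1k\Big),\qquad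 u_k'(x)=-\frac k2\,\omega(x)^{1/2}\sin\Big(\frac k2\Omega(x)\Big)+O(1),$$ $$v_k(x)=\frac{1}{\omega(x)^{1/2}}\sin\Big(\frac k2\Omega(x)\Big)+O\Big(\frac1k\Big),\qquad v_k'(x)=\frac k2\,\omega(x)^{1/2}\cos\Big(\frac k2\Omega(x)\Big)+O(1).$$ *)

theory Defs
  imports "HOL-Probability.Probability" "HOL-Library.Landau_Symbols"
begin

abbreviation ivl :: "real set" where
  "ivl \<equiv> {0..2 * pi}"

(* The derivative relative to [0, 2 pi], hence one-sided at the two end points.  It only
   depends on the restriction of f to [0, 2 pi]. *)
definition deriv_ivl :: "(real \<Rightarrow> real) \<Rightarrow> real \<Rightarrow> real" where
  "deriv_ivl f x = vector_derivative f (at x within ivl)"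

definition twice_diff_ivl :: "(real \<Rightarrow> real) \<Rightarrow> bool" where
  "twice_diff_ivl f \<longleftrightarrow> f differentiable_on ivl \<and> deriv_ivl f differentiable_on ivl"

definition C2_ivl :: "(real \<Rightarrow> real) \<Rightarrow> bool" where
  "C2_ivl f \<longleftrightarrow> twice_diff_ivl f \<and> continuous_on ivl (deriv_ivl (deriv_ivl f))"

definition Omega :: "(real \<Rightarrow> real) \<Rightarrow> real \<Rightarrow> real" where
  "Omega \<omega> x = integral {0..x} \<omega>"

definition sl_potential :: "(real \<Rightarrow> real) \<Rightarrow> real \<Rightarrow> real" where
  "sl_potential \<omega> y =
     (let x = the_inv_into ivl (Omega \<omega>) y
      in deriv_ivl (deriv_ivl \<omega>) x / (2 * \<omega> x ^ 3) - 3 / 4 * ((deriv_ivl \<omega> x)\<^sup>2 / \<omega> x ^ 4))"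

definition sl_operator :: "(real \<Rightarrow> real) \<Rightarrow> (real \<Rightarrow> real) \<Rightarrow> real \<Rightarrow> real" where
  "sl_operator \<omega> g y = sl_potential \<omega> y * g y - deriv_ivl (deriv_ivl g) y"

definition sl_eigenfunction :: "(real \<Rightarrow> real) \<Rightarrow> real \<Rightarrow> (real \<Rightarrow> real) \<Rightarrow> bool" where
  "sl_eigenfunction \<omega> lam g \<longleftrightarrow>
     twice_diff_ivl g \<and> (\<exists>y\<in>ivl. g y \<noteq> 0) \<and> (\<forall>y\<in>ivl. sl_operator \<omega> g y = lam * g y)"

definition cond_C :: "(real \<Rightarrow> real) \<Rightarrow> bool" where
  "cond_C g \<longleftrightarrow> g 0 \<noteq> 0 \<and> deriv_ivl g 0 = 0"

definition cond_D :: "(real \<Rightarrow> real) \<Rightarrow> bool" where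
  "cond_D g \<longleftrightarrow> g 0 = 0 \<and> g (2 * pi) = 0"

(* All systems are indexed by k >= 1; the value at index 0 is irrelevant.  Finitely many
   eigenvalues may be negative; sqrt is a total function on the reals, and the phase
   condition is asymptotic, so this does no harm. *)
definition sl_orthogonal_system ::
  "(real \<Rightarrow> real) \<Rightarrow> ((real \<Rightarrow> real) \<Rightarrow> bool) \<Rightarrow> (nat \<Rightarrow> real) \<Rightarrow> (nat \<Rightarrow> real \<Rightarrow> real) \<Rightarrow> bool" where
  "sl_orthogonal_system \<omega> bc lam g \<longleftrightarrow>
     (\<forall>k\<ge>1. sl_eigenfunction \<omega> (lam k) (g k) \<and> bc (g k)) \<and>
     (\<forall>j\<ge>1. \<forall>k\<ge>1. j \<noteq> k \<longrightarrow> (LBINT y:ivl. g j y * g k y) = 0) \<and>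
     (\<lambda>k. sqrt (lam k) - real k / 2) \<in> O(\<lambda>k. 1 / real k)"

(* w k is a nonzero multiple of an eigenfunction, written in the variable x; the factor c k
   is fixed up to O(1/k) by the asymptotics in sl_system_u and sl_system_v. *)
definition sl_system_in_x ::
  "(real \<Rightarrow> real) \<Rightarrow> ((real \<Rightarrow> real) \<Rightarrow> bool) \<Rightarrow> (nat \<Rightarrow> real \<Rightarrow> real) \<Rightarrow> bool" where
  "sl_system_in_x \<omega> bc w \<longleftrightarrow>
     (\<exists>lam g c. sl_orthogonal_system \<omega> bc lam g \<and>
        (\<forall>k\<ge>1. c k \<noteq> 0 \<and> (\<forall>x\<in>ivl. w k x = c k * (1 / sqrt (\<omega> x) * g k (Omega \<omega> x)))))"

definition unif_bigo :: "(nat \<Rightarrow> real \<Rightarrow> real) \<Rightarrow> (nat \<Rightarrow> real) \<Rightarrow> bool" where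
  "unif_bigo f h \<longleftrightarrow>
     (\<exists>K. \<forall>\<^sub>F k in sequentially. \<forall>x\<in>ivl. \<bar>f k x\<bar> \<le> K * h k)"

definition sl_system_u :: "(real \<Rightarrow> real) \<Rightarrow> (nat \<Rightarrow> real \<Rightarrow> real) \<Rightarrow> bool" where
  "sl_system_u \<omega> u \<longleftrightarrow>
     sl_system_in_x \<omega> cond_C u \<and>
     unif_bigo (\<lambda>k x. u k x - 1 / sqrt (\<omega> x) * cos (real k / 2 * Omega \<omega> x)) (\<lambda>k. 1 / real k) \<and>
     unif_bigo (\<lambda>k x. deriv_ivl (u k) x
                  - (- (real k / 2) * sqrt (\<omega> x) * sin (real k / 2 * Omega \<omega> x))) (\<lambda>k. 1)"

definition sl_system_v :: "(real \<Rightarrow> real) \<Rightarrow> (nat \<Rightarrow> real \<Rightarrow> real) \<Rightarrow> bool" where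
  "sl_system_v \<omega> v \<longleftrightarrow>
     sl_system_in_x \<omega> cond_D v \<and>
     unif_bigo (\<lambda>k x. v k x - 1 / sqrt (\<omega> x) * sin (real k / 2 * Omega \<omega> x)) (\<lambda>k. 1 / real k) \<and>
     unif_bigo (\<lambda>k x. deriv_ivl (v k) x
                  - (real k / 2) * sqrt (\<omega> x) * cos (real k / 2 * Omega \<omega> x)) (\<lambda>k. 1)"

definition random_sum ::
  "(nat \<Rightarrow> 's \<Rightarrow> real) \<Rightarrow> (nat \<Rightarrow> 's \<Rightarrow> real) \<Rightarrow> (nat \<Rightarrow> real \<Rightarrow> real) \<Rightarrow> (nat \<Rightarrow> real \<Rightarrow> real) \<Rightarrow>
     nat \<Rightarrow> 's \<Rightarrow> real \<Rightarrow> real" where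
  "random_sum a b u v n s x = 1 / sqrt (real n) * (\<Sum>k=1..n. a k s * u k x + b k s * v k x)"

definition zeros :: "(real \<Rightarrow> real) \<Rightarrow> real set" where
  "zeros f = {x\<in>ivl. f x = 0}"

(* card is 0 on infinite sets, so statements about num_zeros should be accompanied by the
   almost sure finiteness of the zero set. *)
definition num_zeros :: "(real \<Rightarrow> real) \<Rightarrow> real" where
  "num_zeros f = real (card (zeros f))"

end

theory Submission
  imports Defs "HOL-Real_Asymp.Real_Asymp" "HOL-Analysis.Harmonic_Numbers"
begin

text \<open>
  In the variable \<open>y = n \<Omega>(x)\<close> the sum becomes a Gaussian process on \<open>[0, 2 \<pi> n]\<close> whose covariance is,
  up to \<open>O(log n / n)\<close>, the stationary kernel with spectral measure uniform on \<open>[0, 1/2]\<close>, so it decays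
  like the inverse of the distance.  The number of zeros is the increasing limit of numbers of sign changes along
  dyadic grids.  One refinement step adds a sum of functionals of three neighbouring values; such
  functionals have square summable covariances (a power series in the Gram matrix), and the probability that one
  is nonzero is controlled by a small ball estimate.  Hence the number of zeros differs from the
  number of sign changes on a grid with \<open>m n\<close> cells by \<open>o(sqrt n)\<close> in \<open>L\<^sup>2\<close> as \<open>m\<close> grows.  Replacing the sign
  function by a bounded sine polynomial makes the count a sum of cosines of Gaussian variables.  For these the
  variance converges by dominated convergence and the characteristic function is found by Stein's method.
  The limit variance is positive because the sign changes are correlated with the quadratic
  form \<open>\<Sum> ((k/n)\<^sup>2 - 1/3) (a\<^sub>k\<^sup>2 + b\<^sub>k\<^sup>2 - 2)\<close>.
\<close>

text \<open>The obstacle is the decay of the covariance: the inverse distance is square summable but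
  not summable. Hence the local functionals are even, with covariances controlled by squares of Gram
  entries; products of two signs qualify, a single sign does not. Squaring also makes the model
  error harmless: \<open>n ^ 2\<close> pairs with error \<open>(log n / n) ^ 2\<close> contribute
  only \<open>(log n) ^ 2\<close>. No Hermite expansion is used: the covariance of two cosines
  contains \<open>cosh r - 1\<close>, whose power series plays the role of the chaos expansion. Row
  sums of absolute covariances still grow like \<open>log n\<close>; Stein's method tolerates this,
  its error being of order \<open>sqrt ((log n) ^ 3 / n)\<close>. For cells of half width
  \<open>h\<close> the variance of a sum of local functionals is at most a constant times
  \<open>A * n / h ^ 2\<close>, where \<open>A\<close> bounds their second moments, so a refinement
  step needs \<open>A\<close> to beat \<open>h ^ 2\<close> by a power; the exponent
  \<open>5/2\<close> supplies it and makes the dyadic errors a geometric series. The numbers 1, 1/12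
  and 1/80 are even moments of the uniform law on \<open>[0, 1/2]\<close>: the limiting variances of
  the process and its first two derivatives.\<close>

abbreviation "SN \<equiv> std_normal_distribution"

subsection \<open>Linear functionals of a finite Gaussian family\<close>

text \<open>Coefficient vectors stand for the Gaussian variables \<open>Z u\<close> introduced
  below. In this dictionary \<open>ip\<close> is the covariance and \<open>L2_set\<close> the
  standard deviation.\<close>

definition ip :: "'i set => ('i => real) => ('i => real) => real" where
 "ip J u v = (\<Sum>i\<in>J. u i * v i)"

lemma ip_commute: "ip J u v = ip J v u" by (simp add: ip_def mult.commute)

lemma ip_lin_left: "ip J (%i. p * u i + q * v i) w = p * ip J u w + q * ip J v w" by (simp add: ip_def sum.distrib sum_distrib_left algebra_simps)

lemma ip_lin_right: "ip J w (%i. p * u i + q * v i) = p * ip J w u + q * ip J w v" by (simp add: ip_def sum.distrib sum_distrib_left algebra_simps)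

lemma ip_add_left: "ip J (%i. u i + v i) w = ip J u w + ip J v w" by (simp add: ip_def sum.distrib algebra_simps)

lemma ip_add_right: "ip J w (%i. u i + v i) = ip J w u + ip J w v" by (simp add: ip_def sum.distrib algebra_simps)

lemma ip_diff_left: "ip J (%i. u i - v i) w = ip J u w - ip J v w" by (simp add: ip_def sum_subtractf algebra_simps)

lemma ip_diff_right: "ip J w (%i. u i - v i) = ip J w u - ip J w v" by (simp add: ip_def sum_subtractf algebra_simps)

lemma ip_scale_left: "ip J (%i. p * u i) w = p * ip J u w" by (simp add: ip_def sum_distrib_left algebra_simps)

lemma ip_scale_right: "ip J w (%i. p * u i) = p * ip J w u" by (simp add: ip_def sum_distrib_left algebra_simps)

lemma ip_sum_left: "ip J (%i. \<Sum>a\<in>A. f a * u a i) w = (\<Sum>a\<in>A. f a * ip J (u a) w)"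
proof -
 have "ip J (%i. \<Sum>a\<in>A. f a * u a i) w = (\<Sum>i\<in>J. \<Sum>a\<in>A. f a * u a i * w i)" by (simp add: ip_def sum_distrib_right)
 also have "\<dots> = (\<Sum>a\<in>A. \<Sum>i\<in>J. f a * u a i * w i)" by (rule sum.swap)
 finally show ?thesis by (simp add: ip_def sum_distrib_left mult.assoc)
qed

lemma ip_sum_right: "ip J w (%i. \<Sum>a\<in>A. f a * u a i) = (\<Sum>a\<in>A. f a * ip J w (u a))" by (subst (1 2) ip_commute) (rule ip_sum_left)

lemmas ip_simps = ip_lin_left ip_lin_right ip_add_left ip_add_right ip_diff_left ip_diff_right
 ip_scale_left ip_scale_right

lemma ip_self: "ip J u u = (L2_set u J)^2" by (simp add: ip_def L2_set_def sum_nonneg power2_eq_square)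

lemma ip_self_nonneg [simp]: "0 <= ip J u u" by (simp add: ip_self)

lemma L2_set_sqrt_ip: "L2_set u J = sqrt (ip J u u)" by (simp add: ip_self)

lemma ip_Cauchy: "\<bar>ip J u v\<bar> <= L2_set u J * L2_set v J"
proof -
 have "\<bar>ip J u v\<bar> <= (\<Sum>i\<in>J. \<bar>u i\<bar> * \<bar>v i\<bar>)"
  unfolding ip_def by (rule order_trans[OF sum_abs]) (simp add: abs_mult)
 then show ?thesis using L2_set_mult_ineq[of u v J] by linarith
qed

lemma ip_abs_le_half: "2 * \<bar>ip J u v\<bar> <= ip J u u + ip J v v"
proof -
 have "0 <= ip J (%i. u i - v i) (%i. u i - v i)" "0 <= ip J (%i. u i + v i) (%i. u i + v i)" by simp_all
 then show ?thesis unfolding ip_simps using ip_commute[of J u v] by linarith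
qed

lemma L2_set_diff_commute: "L2_set (%i. u i - v i) J = L2_set (%i. v i - u i) J" by (simp add: L2_set_def power2_commute)

lemma L2_set_triangle_diff: "L2_set (%i. u i - w i) J <= L2_set (%i. u i - v i) J + L2_set (%i. v i - w i) J"
 using L2_set_triangle_ineq[of "%i. u i - v i" "%i. v i - w i" J] by simp

lemma L2_set_scale: "L2_set (%i. c * u i) J = \<bar>c\<bar> * L2_set u J"
 using L2_set_right_distrib[of "\<bar>c\<bar>" u J] by (simp add: L2_set_def power_mult_distrib)

text \<open>Needed for vectors given by difference quotients: the mean value theorem applies only
  after pairing with a fixed vector, so a norm is bounded by testing the vector against
  itself.\<close>

lemma L2_set_le_of_dual:
 assumes "0 <= C" "\<bar>ip J u u\<bar> <= C * L2_set u J"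
 shows "L2_set u J <= C"
proof (cases "L2_set u J = 0")
 case False
 then have "L2_set u J > 0" using L2_set_nonneg[of u J] by linarith
 moreover have "L2_set u J * L2_set u J <= C * L2_set u J" using assms(2) by (simp add: ip_self power2_eq_square)
 ultimately show ?thesis using mult_right_le_imp_le by blast
qed (use assms in simp)

section \<open>Laws and moments of Gaussian linear functionals\<close>

locale gauss_vec = prob_space M for M :: "'s measure" +
 fixes J :: "'i set" and \<xi> :: "'i => 's => real"
 assumes fin: "finite J"
  and std: "!!i. i \<in> J ==> distributed M lborel (\<xi> i) std_normal_density"
  and indep: "indep_vars (%_. borel) \<xi> J"
begin

definition Z :: "('i => real) => 's => real" where
 "Z w s = (\<Sum>i\<in>J. w i * \<xi> i s)"

lemma xi_meas: "i \<in> J ==> \<xi> i \<in> borel_measurable M" using std[THEN distributed_measurable] by simp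

lemma Z_meas [measurable]: "Z w \<in> borel_measurable M" unfolding Z_def[abs_def] by (intro borel_measurable_sum borel_measurable_times xi_meas) auto

lemma Z_lin: "Z (%i. p * u i + q * v i) s = p * Z u s + q * Z v s" by (simp add: Z_def sum.distrib sum_distrib_left algebra_simps)

lemma Z_add: "Z (%i. u i + v i) s = Z u s + Z v s" by (simp add: Z_def sum.distrib algebra_simps)

lemma Z_diff: "Z (%i. u i - v i) s = Z u s - Z v s" by (simp add: Z_def sum_subtractf algebra_simps)

lemma Z_scale: "Z (%i. p * u i) s = p * Z u s" by (simp add: Z_def sum_distrib_left algebra_simps)

lemma distr_xi: "i \<in> J ==> distr M borel (\<xi> i) = SN" using std[THEN distributed_distr_eq_density, symmetric] by (simp cong: distr_cong)

lemma char_scale: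
 assumes "X \<in> borel_measurable M'"
 shows "char (distr M' borel (%s. c * X s)) t = char (distr M' borel X) (c * t)"
 unfolding char_def using assms by (subst (1 2) integral_distr) (auto simp: ac_simps)

lemma char_Z: "char (distr M borel (Z w)) t = exp (- (ip J w w * t^2) / 2)"
proof -
 have "char (distr M borel (Z w)) t = (\<Prod>i\<in>J. char (distr M borel (%s. w i * \<xi> i s)) t)" unfolding Z_def[abs_def]
  by (rule char_distr_sum, rule indep_vars_compose2[OF indep]) auto
 also have "\<dots> = (\<Prod>i\<in>J. complex_of_real (exp (- ((w i * t)^2) / 2)))"
  by (intro prod.cong refl) (simp add: char_scale[OF xi_meas] distr_xi char_std_normal_distribution)
 also have "\<dots> = complex_of_real (exp (\<Sum>i\<in>J. - ((w i * t)^2) / 2))" by (simp add: exp_sum[OF fin])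
 also have "(\<Sum>i\<in>J. - ((w i * t)^2) / 2) = - (ip J w w * t^2) / 2"
  by (simp add: ip_def power_mult_distrib power2_eq_square sum_distrib_right sum_negf
    flip: sum_divide_distrib) (simp add: algebra_simps)
 finally show ?thesis by simp
qed

text \<open>The law is written as the image of the standard normal law under scaling, rather than by
  a density, so that vectors of norm zero are covered.\<close>

lemma distr_Z: "distr M borel (Z w) = distr SN borel (%x. L2_set w J * x)"
proof (rule Levy_uniqueness)
 interpret N: real_distribution SN by (rule real_dist_normal_dist)
 show "real_distribution (distr M borel (Z w))" by (rule real_distribution_distr) simp
 show "real_distribution (distr SN borel (%x. L2_set w J * x))" by (rule N.real_distribution_distr) simp
 have "distr SN borel (%x. x) = SN" by (rule distr_id2) simp
 then show "char (distr M borel (Z w)) = char (distr SN borel (%x. L2_set w J * x))"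
  by (auto simp: fun_eq_iff char_Z char_scale[where X="%x. x"] char_std_normal_distribution
    ip_self power_mult_distrib simp flip: exp_of_real)
qed

lemma expectation_Z:
 fixes g :: "real => real"
 assumes [measurable]: "g \<in> borel_measurable borel"
 shows "expectation (%s. g (Z w s)) = (\<integral>x. g (L2_set w J * x) \<partial>SN)"
proof -
 have "expectation (%s. g (Z w s)) = integral\<^sup>L (distr M borel (Z w)) g" by (simp add: integral_distr)
 then show ?thesis by (simp add: distr_Z integral_distr)
qed

lemma integrable_Z_iff:
 fixes g :: "real => real"
 assumes [measurable]: "g \<in> borel_measurable borel"
 shows "integrable M (%s. g (Z w s)) \<longleftrightarrow> integrable SN (%x. g (L2_set w J * x))"
proof -
 have "integrable M (%s. g (Z w s)) \<longleftrightarrow> integrable (distr M borel (Z w)) g" by (simp add: integrable_distr_eq)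
 then show ?thesis by (simp add: distr_Z integrable_distr_eq)
qed

lemma integrable_bounded:
 fixes f :: "'s => real"
 assumes "f \<in> borel_measurable M" "!!s. \<bar>f s\<bar> <= B"
 shows "integrable M f" by (rule integrable_const_bound[where B=B]) (use assms in auto)

lemma iexp_Z: "(CLINT s|M. iexp (Z w s)) = exp (- ip J w w / 2)"
proof -
 have "char (distr M borel (Z w)) 1 = (CLINT s|M. iexp (Z w s))" unfolding char_def by (subst integral_distr) auto
 then show ?thesis using char_Z[of w 1] by (simp flip: exp_of_real)
qed

lemma expectation_cos: "expectation (%s. cos (Z w s)) = exp (- ip J w w / 2)"
 and expectation_sin: "expectation (%s. sin (Z w s)) = 0"
proof -
 have int: "integrable M (%s. iexp (Z w s))" by (rule integrable_iexp) auto
 have e: "complex_of_real (exp (- ip J w w / 2)) = exp (complex_of_real (- ip J w w / 2))" by (simp flip: exp_of_real)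
 have "expectation (%s. cos (Z w s)) = Re (CLINT s|M. iexp (Z w s))" using integral_Re[OF int] by (simp add: Re_exp)
 then show "expectation (%s. cos (Z w s)) = exp (- ip J w w / 2)"
  unfolding iexp_Z by (metis e Re_complex_of_real of_real_minus of_real_divide of_real_numeral)
 have "expectation (%s. sin (Z w s)) = Im (CLINT s|M. iexp (Z w s))" using integral_Im[OF int] by (simp add: Im_exp)
 then show "expectation (%s. sin (Z w s)) = 0" unfolding iexp_Z by (metis e Im_complex_of_real of_real_minus of_real_divide of_real_numeral)
qed

lemma integrable_cos [simp]: "integrable M (%s. cos (Z w s))" by (rule integrable_bounded[where B=1]) auto

lemma expectation_cos_cos:
 "expectation (%s. cos (Z u s) * cos (Z v s)) = exp (- (ip J u u + ip J v v) / 2) * cosh (ip J u v)"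
proof -
 have "(%s. cos (Z u s) * cos (Z v s)) =
  (%s. (cos (Z (%i. u i - v i) s) + cos (Z (%i. u i + v i) s)) / 2)" by (auto simp: cos_times_cos Z_add Z_diff)
 then have "expectation (%s. cos (Z u s) * cos (Z v s)) =
  (exp (- ip J (%i. u i - v i) (%i. u i - v i) / 2) + exp (- ip J (%i. u i + v i) (%i. u i + v i) / 2)) / 2" by (simp add: expectation_cos)
 also have "\<dots> = (exp (- (ip J u u + ip J v v) / 2 + ip J u v) + exp (- (ip J u u + ip J v v) / 2 + - ip J u v)) / 2"
  unfolding ip_simps using ip_commute[of J v u] by (simp add: field_simps)
 also have "\<dots> = exp (- (ip J u u + ip J v v) / 2) * cosh (ip J u v)" unfolding exp_add cosh_def by (simp add: algebra_simps)
 finally show ?thesis .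
qed

text \<open>The function \<open>cosh r - 1\<close> has neither a constant nor a linear term. This is
  the source of all bounds that are quadratic in the covariance.\<close>

lemma cov_cos_cos:
 "expectation (%s. cos (Z u s) * cos (Z v s)) - expectation (%s. cos (Z u s)) * expectation (%s. cos (Z v s))
  = exp (- (ip J u u + ip J v v) / 2) * (cosh (ip J u v) - 1)" unfolding expectation_cos_cos expectation_cos
 by (simp add: algebra_simps flip: exp_add) (simp add: field_simps)

lemma expectation_Z_sq: "expectation (%s. (Z w s)^2) = ip J w w"
 and integrable_Z_sq: "integrable M (%s. (Z w s)^2)" using std_normal_distribution_even_moments[of 1]
 by (simp_all add: expectation_Z[of "%x. x^2"] integrable_Z_iff[of "%x. x^2"] power_mult_distrib ip_self)

text \<open>The tenth moment serves the Markov bound in \<open>extra_facts\<close>; 945 is the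
  product of the odd numbers up to 9.\<close>

lemma expectation_Z_pow10: "expectation (%s. (Z w s) ^ 10) = 945 * (ip J w w) ^ 5"
 and integrable_Z_pow10: "integrable M (%s. (Z w s) ^ 10)" using std_normal_distribution_even_moments[of 5]
 by (simp_all add: expectation_Z[of "%x. x ^ 10"] integrable_Z_iff[of "%x. x ^ 10"] power_mult_distrib ip_self
   fact_numeral flip: power_mult)

end

text \<open>Stein's identity. The product of the density and \<open>h\<close> has derivative
  \<open>phi * h' - phi * x * h\<close>; it is integrated over the whole line, and the boundary
  terms vanish because \<open>h\<close> is bounded.\<close>

lemma std_normal_integral_ibp:
 fixes h h' :: "real => real"
 assumes d: "!!x. (h has_real_derivative h' x) (at x)" and c: "!!x. isCont h' x"
  and b: "!!x. \<bar>h x\<bar> <= B" and b': "!!x. \<bar>h' x\<bar> <= B"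
 shows "(\<integral>x. x * h x \<partial>SN) = (\<integral>x. h' x \<partial>SN)"
proof -
 let ?\<phi> = std_normal_density
 have ch: "continuous_on UNIV h" using d by (meson DERIV_isCont continuous_at_imp_continuous_on)
 have ch': "continuous_on UNIV h'" using c by (simp add: continuous_at_imp_continuous_on)
 have [measurable]: "h \<in> borel_measurable borel" "h' \<in> borel_measurable borel" using ch ch' by (auto intro: borel_measurable_continuous_onI)
 have i1: "integrable lborel (%x. ?\<phi> x * h' x)"
 proof (rule Bochner_Integration.integrable_bound)
  show "integrable lborel (%x. B * ?\<phi> x)" by simp
 qed (use b' in \<open>auto simp: abs_mult intro!: AE_I2 mult_mono order_trans[OF b'] simp: mult.commute[of B]\<close>)
 have i2: "integrable lborel (%x. ?\<phi> x * (x * h x))"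
 proof (rule Bochner_Integration.integrable_bound)
  show "integrable lborel (%x. B * (?\<phi> x * \<bar>x\<bar> ^ 1))"
   using integrable_std_normal_moment_abs[of 1] by (intro integrable_mult_right) simp
  show "AE x in lborel. norm (?\<phi> x * (x * h x)) <= norm (B * (?\<phi> x * \<bar>x\<bar> ^ 1))"
  proof (rule AE_I2)
   fix x
   have "B >= 0" using b[of 0] by linarith
   have "?\<phi> x * \<bar>x\<bar> * \<bar>h x\<bar> <= ?\<phi> x * \<bar>x\<bar> * B" by (rule mult_left_mono[OF b]) simp
   then show "norm (?\<phi> x * (x * h x)) <= norm (B * (?\<phi> x * \<bar>x\<bar> ^ 1))"
    using \<open>B >= 0\<close> by (simp add: abs_mult algebra_simps)
  qed
 qed simp
 have D0: "(?\<phi> has_real_derivative - x * ?\<phi> x) (at x)" for x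
 proof -
  have "((%x::real. exp (- x\<^sup>2 / 2)) has_real_derivative - x * exp (- x\<^sup>2 / 2)) (at x)"
   by (auto intro!: derivative_eq_intros simp: power2_eq_square)
  from DERIV_cmult[OF this, of "1 / sqrt (2 * pi)"] show ?thesis unfolding std_normal_density_def by (simp add: algebra_simps)
 qed
 have D: "((%x. ?\<phi> x * h x) has_vector_derivative (?\<phi> x * h' x - ?\<phi> x * (x * h x))) (at x)" for x
  unfolding has_real_derivative_iff_has_vector_derivative[symmetric] by (auto intro!: derivative_eq_intros d D0 simp: algebra_simps)
 have int: "integrable lborel (%x. ?\<phi> x * h' x - ?\<phi> x * (x * h x))" using i1 i2 by simp
 have lim: "((%x. ?\<phi> x * h x) \<longlongrightarrow> 0) F" if "(?\<phi> \<longlongrightarrow> 0) F" for F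
 proof (rule tendsto_norm_zero_cancel, rule tendsto_sandwich[OF _ _ tendsto_const])
  show "((%x. ?\<phi> x * B) \<longlongrightarrow> 0) F" using tendsto_mult_right[OF that, of B] by simp
  show "\<forall>\<^sub>F x in F. norm (?\<phi> x * h x) <= ?\<phi> x * B" by (auto simp: abs_mult intro!: always_eventually mult_left_mono b)
 qed (auto intro!: always_eventually)
 have top: "(?\<phi> \<longlongrightarrow> 0) at_top" unfolding std_normal_density_def by real_asymp
 have bot: "(?\<phi> \<longlongrightarrow> 0) at_bot" unfolding std_normal_density_def by real_asymp
 have "(LBINT x=-\<infinity>..\<infinity>. ?\<phi> x * h' x - ?\<phi> x * (x * h x)) = 0 - 0"
 proof (rule interval_integral_FTC_integrable[where F="%x. ?\<phi> x * h x"])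
  show "isCont (%x. ?\<phi> x * h' x - ?\<phi> x * (x * h x)) x" for x unfolding std_normal_density_def
   by (intro continuous_intros c DERIV_isCont[OF d]) auto
  show "set_integrable lborel (einterval (- \<infinity>) \<infinity>) (%x. ?\<phi> x * h' x - ?\<phi> x * (x * h x))"
   using int by (simp add: set_integrable_def)
  show "(((%x. ?\<phi> x * h x) \<circ> real_of_ereal) \<longlongrightarrow> 0) (at_right (- \<infinity>))"
   using lim[OF bot] by (simp add: ereal_tendsto_simps1)
  show "(((%x. ?\<phi> x * h x) \<circ> real_of_ereal) \<longlongrightarrow> 0) (at_left \<infinity>)"
   using lim[OF top] by (simp add: ereal_tendsto_simps1)
 qed (use D in auto)
 then have "(\<integral>x. ?\<phi> x * h' x - ?\<phi> x * (x * h x) \<partial>lborel) = 0"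
  by (simp add: interval_lebesgue_integral_def set_lebesgue_integral_def)
 then have "(\<integral>x. ?\<phi> x * h' x \<partial>lborel) = (\<integral>x. ?\<phi> x * (x * h x) \<partial>lborel)" using i1 i2 by simp
 then show ?thesis by (simp add: integral_density)
qed

context gauss_vec
begin

abbreviation vec :: "'s => 'i => real" where
 "vec s \<equiv> (\<lambda>i\<in>J. \<xi> i s)"

lemma vec_meas [measurable]: "vec \<in> measurable M (PiM J (%_. borel))" by (rule measurable_restrict) (rule xi_meas)

lemma distr_vec:
 assumes "J ~= {}"
 shows "distr M (PiM J (%_. borel)) vec = PiM J (%_. SN)"
proof -
 have "distr M (PiM J (%_. borel)) vec = PiM J (%i. distr M borel (\<xi> i))"
  using indep by (subst (asm) indep_vars_iff_distr_eq_PiM'[OF assms]) (auto simp: xi_meas)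
 also have "\<dots> = PiM J (%_. SN)" by (rule PiM_cong) (auto simp: distr_xi)
 finally show ?thesis .
qed

text \<open>Under the product law Fubini isolates the coordinate \<open>k\<close>, and the
  one-dimensional identity applies to every section \<open>x(k := y)\<close>. The uniform bounds
  provide all integrability.\<close>

lemma expectation_ibp:
 fixes \<Phi> \<Psi> :: "('i => real) => real"
 assumes k: "k \<in> J"
  and [measurable]: "\<Phi> \<in> borel_measurable (PiM J (%_. borel))" "\<Psi> \<in> borel_measurable (PiM J (%_. borel))"
  and D: "!!x y. ((%y. \<Phi> (x(k := y))) has_real_derivative \<Psi> (x(k := y))) (at y)"
  and C: "!!x y. isCont (%y. \<Psi> (x(k := y))) y"
  and B: "!!x. \<bar>\<Phi> x\<bar> <= B" and B': "!!x. \<bar>\<Psi> x\<bar> <= B"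
 shows "expectation (%s. \<xi> k s * \<Phi> (vec s)) = expectation (%s. \<Psi> (vec s))"
proof -
 interpret N: prob_space SN by (rule prob_space_normal_density) simp
 interpret P: product_prob_space "%_::'i. SN" by unfold_locales
 have J: "J ~= {}" using k by auto
 have ins: "insert k (J - {k}) = J" using k by auto
 let ?P = "PiM J (%_. SN)"
 note d = distr_vec[OF J]
 have mk: "(%x. x k) \<in> borel_measurable (PiM J (%_. borel))" using k by measurable
 have [measurable]: "(%x. x k * \<Phi> x) \<in> borel_measurable (PiM J (%_. borel))" by (intro borel_measurable_times mk) simp
 have e1: "expectation (%s. \<xi> k s * \<Phi> (vec s)) = (\<integral>x. x k * \<Phi> x \<partial>?P)"
  unfolding d[symmetric] using k by (subst integral_distr[OF vec_meas]) simp_all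
 have e2: "expectation (%s. \<Psi> (vec s)) = (\<integral>x. \<Psi> x \<partial>?P)"
  unfolding d[symmetric] by (subst integral_distr[OF vec_meas]) simp_all
 have "integrable M (%s. \<xi> k s * \<Phi> (vec s))"
 proof (rule Bochner_Integration.integrable_bound)
  have "integrable (distr M borel (\<xi> k)) (%x. x)" unfolding distr_xi[OF k] using integrable_std_normal_distribution_moment[of 1] by simp
  then have "integrable M (\<xi> k)" using integrable_distr_eq[OF xi_meas[OF k], of "%x. x"] by simp
  then show "integrable M (%s. B * \<xi> k s)" by simp
  have "B >= 0" using B[of undefined] by linarith
  then show "AE s in M. norm (\<xi> k s * \<Phi> (vec s)) <= norm (B * \<xi> k s)"
   using B by (auto simp: abs_mult mult.commute[of B] intro!: AE_I2 mult_left_mono)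
  show "(%s. \<xi> k s * \<Phi> (vec s)) \<in> borel_measurable M" using xi_meas[OF k] by simp
 qed
 then have i1: "integrable ?P (%x. x k * \<Phi> x)" unfolding d[symmetric] using k by (subst integrable_distr_eq[OF vec_meas]) simp_all
 have "integrable M (%s. \<Psi> (vec s))" by (rule integrable_bounded[OF _ B']) simp
 then have i2: "integrable ?P \<Psi>" unfolding d[symmetric] by (subst integrable_distr_eq[OF vec_meas]) simp_all
 have "(\<integral>x. x k * \<Phi> x \<partial>?P) = (\<integral>x. (\<integral>y. y * \<Phi> (x(k := y)) \<partial>SN) \<partial>PiM (J - {k}) (%_. SN))"
  using P.product_integral_insert[of "J - {k}" k "%x. x k * \<Phi> x"] i1 fin unfolding ins by simp
 also have "\<dots> = (\<integral>x. (\<integral>y. \<Psi> (x(k := y)) \<partial>SN) \<partial>PiM (J - {k}) (%_. SN))"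
  by (simp only: std_normal_integral_ibp[OF D C B B'])
 also have "\<dots> = (\<integral>x. \<Psi> x \<partial>?P)" using P.product_integral_insert[of "J - {k}" k \<Psi>] i2 fin unfolding ins by simp
 finally show ?thesis using e1 e2 by simp
qed

text \<open>The Gaussian that dominates the indicator of an interval is itself a mixture of cosines, so the small ball
 probability reduces to expectations of cosines of linear functionals.\<close>

lemma exp_sq_eq_integral_cos:
 "exp (- ((c * x)^2) / 2) = (\<integral>y. cos (c * y * x) \<partial>SN)"
proof -
 interpret N: real_distribution SN by (rule real_dist_normal_dist)
 have "char SN (c * x) = complex_of_real (exp (- ((c * x)^2) / 2))" by (simp add: char_std_normal_distribution)
 moreover have "Re (char SN (c * x)) = (\<integral>y. cos (c * x * y) \<partial>SN)" unfolding char_def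
  by (subst integral_Re[symmetric]) (auto intro!: N.integrable_iexp simp: Re_exp)
 ultimately show ?thesis by (simp add: ac_simps)
qed

text \<open>Fubini for the mixture of cosines. The bounded weight \<open>g\<close> allows the step
  to be applied once for each of the two variables in \<open>small_ball\<close>.\<close>

lemma expectation_mollify:
 assumes [measurable]: "g \<in> borel_measurable M" and B: "!!s. \<bar>g s\<bar> <= B"
 shows "expectation (%s. exp (- ((c * Z u s)^2) / 2) * g s)
   = (\<integral>y. expectation (%s. cos (c * y * Z u s) * g s) \<partial>SN)"
proof -
 interpret N: real_distribution SN by (rule real_dist_normal_dist)
 interpret Q: pair_sigma_finite M SN ..
 interpret QP: pair_prob_space M SN ..
 have "integrable (M \<Otimes>\<^sub>M SN) (%(s, y). cos (c * y * Z u s) * g s)"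
 proof (rule QP.integrable_const_bound[where B=B])
  show "AE z in M \<Otimes>\<^sub>M SN. norm (case z of (s, y) => cos (c * y * Z u s) * g s) <= B"
  proof (rule AE_I2, clarify)
   fix s y
   have "\<bar>cos (c * y * Z u s)\<bar> * \<bar>g s\<bar> <= 1 * \<bar>g s\<bar>" by (intro mult_right_mono) auto
   then show "norm (cos (c * y * Z u s) * g s) <= B" using B[of s] by (simp add: abs_mult)
  qed
 qed measurable
 from Q.Fubini_integral[OF this]
 show ?thesis unfolding exp_sq_eq_integral_cos by simp
qed

text \<open>The standard normal density is replaced by its maximum, and the remaining Gaussian is
  integrated exactly.\<close>

lemma std_normal_gaussian_integral_le:
 assumes "c > 0" "k > 0"
 shows "(\<integral>y. exp (- (k * (c * y)^2) / 2) \<partial>SN) <= 1 / (c * sqrt k)"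
proof -
 define sg where "sg = 1 / (c * sqrt k)"
 have s: "sg > 0" using assms by (simp add: sg_def)
 have e: "exp (- (k * (c * y)^2) / 2) = sqrt (2 * pi * sg^2) * normal_density 0 sg y" for y
  using s assms by (simp add: normal_density_def sg_def power_mult_distrib power_divide field_simps)
 have "(\<integral>y. exp (- (k * (c * y)^2) / 2) \<partial>SN)
   = (\<integral>y. std_normal_density y * exp (- (k * (c * y)^2) / 2) \<partial>lborel)" by (simp add: integral_density)
 also have "\<dots> <= (\<integral>y. sg * normal_density 0 sg y \<partial>lborel)"
 proof (rule integral_mono_AE)
  show "AE y in lborel. std_normal_density y * exp (- (k * (c * y)^2) / 2) <= sg * normal_density 0 sg y"
  proof (rule AE_I2)
   fix y
   have "std_normal_density y <= 1 / sqrt (2 * pi)" by (simp add: std_normal_density_def field_simps)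
   then have "std_normal_density y * exp (- (k * (c * y)^2) / 2) <= 1 / sqrt (2 * pi) * exp (- (k * (c * y)^2) / 2)" by (intro mult_right_mono) auto
   also have "\<dots> = sg * normal_density 0 sg y" unfolding e using s by (simp add: real_sqrt_mult)
   finally show "std_normal_density y * exp (- (k * (c * y)^2) / 2) <= sg * normal_density 0 sg y" .
  qed
  show "integrable lborel (%y. sg * normal_density 0 sg y)" using s by simp
  show "integrable lborel (%y. std_normal_density y * exp (- (k * (c * y)^2) / 2))"
   by (rule Bochner_Integration.integrable_bound[of _ std_normal_density])
    (use assms in \<open>auto intro!: AE_I2 mult_left_le simp: abs_mult\<close>)
 qed
 also have "\<dots> = sg" using s by simp
 finally show ?thesis by (simp add: sg_def)
qed

text \<open>Both indicators are dominated by Gaussians, whose joint expectation is a double mixture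
  of \<open>exp (- q / 2)\<close> with \<open>q\<close> the quadratic form of the pair. The lower
  bound \<open>ka\<close> on this form decouples the two integrals. The domination costs
  \<open>exp 1 <= 3\<close>.\<close>

lemma small_ball:
 assumes a: "a > 0" and b: "b > 0" and ka: "ka > 0"
  and nd: "!!p q. ka * (p^2 + q^2) <= ip J (%i. p * u i + q * v i) (%i. p * u i + q * v i)"
 shows "prob {s \<in> space M. \<bar>Z u s\<bar> <= a \<and> \<bar>Z v s\<bar> <= b} <= 3 * a * b / ka"
proof -
 let ?N = SN
 interpret N: real_distribution ?N by (rule real_dist_normal_dist)
 define G where "G x = exp (- (x^2) / 2 :: real)" for x
 define g where "g s = G (1 / b * Z v s)" for s
 have [measurable]: "g \<in> borel_measurable M" unfolding g_def G_def by measurable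
 have G1: "\<bar>G x\<bar> <= 1" "0 <= G x" for x by (simp_all add: G_def)
 have Gi: "exp (-1/2) <= G x" if "\<bar>x\<bar> <= 1" for x using abs_square_le_1[of x] that by (simp add: G_def)
 have gint: "integrable M (%s. G (1 / a * Z u s) * g s)"
 proof (rule integrable_bounded[where B=1])
  show "(%s. G (1 / a * Z u s) * g s) \<in> borel_measurable M" unfolding G_def by measurable
  fix s
  have "\<bar>G (1 / a * Z u s)\<bar> * \<bar>g s\<bar> <= 1 * 1" unfolding g_def by (intro mult_mono G1) auto
  then show "\<bar>G (1 / a * Z u s) * g s\<bar> <= 1" by (simp add: abs_mult)
 qed
 define C where "C y z = expectation (%s. cos (1 / b * z * Z v s) * cos (1 / a * y * Z u s))" for y z
 define E where "E y z = exp (- (ka * (1 / b * z)^2) / 2) * exp (- (ka * (1 / a * y)^2) / 2)" for y z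
 define S where "S = {s \<in> space M. \<bar>Z u s\<bar> <= a \<and> \<bar>Z v s\<bar> <= b}"
 have [measurable]: "S \<in> events" unfolding S_def by measurable
 have "prob S * exp (-1) <= expectation (%s. G (1 / a * Z u s) * g s)"
 proof -
  have "prob S * exp (-1) = expectation (%s. exp (-1) * indicator S s)" by simp
  also have "\<dots> <= expectation (%s. G (1 / a * Z u s) * g s)"
  proof (rule integral_mono[OF _ gint])
   fix s assume "s \<in> space M"
   show "exp (-1) * indicator S s <= G (1 / a * Z u s) * g s"
   proof (cases "s \<in> S")
    case True
    then have "exp (-1/2) * exp (-1/2) <= G (1 / a * Z u s) * g s"
     unfolding g_def using a b by (intro mult_mono Gi G1) (auto simp: S_def abs_mult field_simps)
    then show ?thesis using True by (simp flip: exp_add)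
   qed (use G1 in \<open>simp add: g_def\<close>)
  next
   show "integrable M (%s. exp (-1) * indicator S s :: real)"
    by (intro integrable_mult_right integrable_real_indicator) (auto simp: emeasure_eq_measure)
  qed
  finally show ?thesis .
 qed
 also have "expectation (%s. G (1 / a * Z u s) * g s)
   = (\<integral>y. expectation (%s. cos (1 / a * y * Z u s) * g s) \<partial>?N)"
  unfolding G_def by (rule expectation_mollify[where B=1]) (auto simp: g_def G_def)
 \<comment> \<open>The second Gaussian factor is mollified in turn, with the cosine of the first
   variable as weight.\<close>
 also have "\<dots> = (\<integral>y. (\<integral>z. C y z \<partial>?N) \<partial>?N)" unfolding g_def G_def C_def
  by (subst expectation_mollify[where B=1 and g="%s. cos (1 / a * y * Z u s)" for y, symmetric])
   (auto simp: mult.commute)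
 also have "\<dots> <= (\<integral>y. (\<integral>z. E y z \<partial>?N) \<partial>?N)"
 proof -
  have eb: "C y z
   = (exp (- ip J (%i. 1 / a * y * u i + 1 / b * z * v i) (%i. 1 / a * y * u i + 1 / b * z * v i) / 2)
    + exp (- ip J (%i. 1 / a * y * u i + (- (1 / b * z)) * v i) (%i. 1 / a * y * u i + (- (1 / b * z)) * v i) / 2)) / 2" for y z
  proof -
   have "(%s. cos (1 / b * z * Z v s) * cos (1 / a * y * Z u s)) = (%s.
    (cos (Z (%i. 1 / a * y * u i + 1 / b * z * v i) s) + cos (Z (%i. 1 / a * y * u i + (- (1 / b * z)) * v i) s)) / 2)"
    unfolding Z_lin by (auto simp: cos_add cos_diff)
   then show ?thesis by (simp only: C_def expectation_cos integrable_cos Bochner_Integration.integral_add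
      Bochner_Integration.integral_divide_zero)
  qed
  have le: "C y z
    <= E y z" for y z
  proof -
   have "exp (- ip J (%i. 1 / a * y * u i + r * v i) (%i. 1 / a * y * u i + r * v i) / 2)
     <= E y z" if "r^2 = (1 / b * z)^2" for r using nd[of "1 / a * y" r] that by (simp flip: exp_add add: E_def algebra_simps)
   from this[of "1 / b * z"] this[of "- (1 / b * z)"] show ?thesis unfolding eb by simp
  qed
  have ge: "0 <= C y z" for y z unfolding eb by simp
  have e1: "exp (- (ka * t) / 2) <= 1" if "t >= 0" for t using ka that by simp
  have pm: "E y z <= 1" for y z unfolding E_def by (rule mult_le_one[OF e1 _ e1]) simp_all
  have mb1: "(%y. (\<integral>z. C y z \<partial>?N)) \<in> borel_measurable borel" unfolding C_def by measurable
  have iz: "integrable ?N (%z. C y z)" for y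
  proof (rule N.integrable_const_bound[where B=1])
   show "AE z in ?N. norm (C y z) <= 1" using ge le pm by (intro AE_I2) (simp, meson order_trans)
  qed (simp add: C_def)
  have iz2: "integrable ?N (%z. E y z)" for y by (rule N.integrable_const_bound[where B=1]) (use pm in \<open>auto simp: E_def\<close>)
  have b1: "(\<integral>z. C y z \<partial>?N) <= 1" for y
  proof -
   have "(\<integral>z. C y z \<partial>?N) <= (\<integral>z. 1 \<partial>?N)"
    by (rule integral_mono[OF iz]) (use le pm order_trans in \<open>auto, blast\<close>)
   then show ?thesis using N.prob_space by simp
  qed
  have b2: "0 <= (\<integral>z. C y z \<partial>?N)" for y by (rule Bochner_Integration.integral_nonneg) (rule ge)
  show ?thesis
  proof (rule integral_mono)
   show "integrable ?N (%y. (\<integral>z. C y z \<partial>?N))" by (rule N.integrable_const_bound[where B=1]) (use b1 b2 mb1 in auto)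
   show "integrable ?N (%y. (\<integral>z. E y z \<partial>?N))" unfolding E_def Bochner_Integration.integral_mult_left_zero
    by (intro integrable_mult_right N.integrable_const_bound[where B=1]) (use e1 in auto)
   show "(\<integral>z. C y z \<partial>?N)
    <= (\<integral>z. E y z \<partial>?N)" for y by (rule integral_mono[OF iz iz2 le])
  qed
 qed
 also have "\<dots> = (\<integral>z. exp (- (ka * (1 / b * z)^2) / 2) \<partial>?N) * (\<integral>y. exp (- (ka * (1 / a * y)^2) / 2) \<partial>?N)"
  by (simp add: E_def Bochner_Integration.integral_mult_left_zero)
 also have "\<dots> <= (1 / (1 / b * sqrt ka)) * (1 / (1 / a * sqrt ka))"
  using a b ka by (intro mult_mono std_normal_gaussian_integral_le Bochner_Integration.integral_nonneg) auto
 also have "\<dots> = a * b / ka" using a b ka by (simp add: field_simps)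
 finally have "prob S * exp (-1) <= a * b / ka" .
 then have "prob S <= exp 1 * (a * b / ka)" by (simp add: exp_minus field_simps)
 also have "\<dots> <= 3 * (a * b / ka)" using exp_le a b ka by (intro mult_right_mono) auto
 finally show ?thesis by (simp add: S_def)
qed

text \<open>This makes the covariance bound below independent of the dimension and of the variances.\<close>

lemma cosh_minus_one_le: "exp (- \<bar>r\<bar>) * (cosh r - 1) <= \<bar>r::real\<bar>"
proof -
 have "exp (- \<bar>r\<bar>) * (cosh r - 1) = exp (- \<bar>r\<bar>) * cosh \<bar>r\<bar> - exp (- \<bar>r\<bar>)" by (simp add: algebra_simps)
 also have "\<dots> = (1 + exp (- 2 * \<bar>r\<bar>)) / 2 - exp (- \<bar>r\<bar>)" by (simp add: cosh_def algebra_simps flip: exp_add)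
 also have "\<dots> <= 1 - exp (- \<bar>r\<bar>)" by simp
 also have "\<dots> <= \<bar>r\<bar>" using exp_ge_add_one_self[of "- \<bar>r\<bar>"] by linarith
 finally show ?thesis .
qed

text \<open>The half sum of the variances is at least \<open>\<bar>ip J u v\<bar>\<close>, which
  bounds the prefactor by \<open>exp (- \<bar>r\<bar>)\<close>. The linear bound holds for all
  vectors and is what the row sums in Stein's method need.\<close>

lemma cov_cos_cos_le:
 "\<bar>expectation (%s. cos (Z u s) * cos (Z v s)) - expectation (%s. cos (Z u s)) * expectation (%s. cos (Z v s))\<bar>
  <= \<bar>ip J u v\<bar>"
proof -
 have "cosh (ip J u v) - 1 >= 0" using cosh_real_ge_1[of "ip J u v"] by linarith
 moreover have "exp (- (ip J u u + ip J v v) / 2) <= exp (- \<bar>ip J u v\<bar>)" using ip_abs_le_half[of J u v] by simp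
 ultimately have "exp (- (ip J u u + ip J v v) / 2) * (cosh (ip J u v) - 1) <= exp (- \<bar>ip J u v\<bar>) * (cosh (ip J u v) - 1)"
  by (intro mult_right_mono) auto
 then show ?thesis unfolding cov_cos_cos using cosh_minus_one_le[of "ip J u v"] \<open>cosh (ip J u v) - 1 >= 0\<close> by simp
qed

end

subsection \<open>Decorrelation of even functionals\<close>

text \<open>One factor of the bilinear form is opened and its coordinates are absorbed into the
  coefficients. This is the induction step for powers, in which the coefficients must therefore be
  arbitrary.\<close>

lemma sum_expand_one_factor:
 fixes c :: "'j => real" and d :: "'k => real"
 shows "(\<Sum>j\<in>A. \<Sum>k\<in>B. c j * d k * ((\<Sum>a\<in>D. \<Sum>b\<in>E. R a b * x j a * y k b) * w j k))
  = (\<Sum>a\<in>D. \<Sum>b\<in>E. R a b * (\<Sum>j\<in>A. \<Sum>k\<in>B. (c j * x j a) * (d k * y k b) * w j k))"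
proof -
 have "(\<Sum>j\<in>A. \<Sum>k\<in>B. c j * d k * ((\<Sum>a\<in>D. \<Sum>b\<in>E. R a b * x j a * y k b) * w j k))
  = (\<Sum>j\<in>A. \<Sum>k\<in>B. \<Sum>a\<in>D. \<Sum>b\<in>E. R a b * ((c j * x j a) * (d k * y k b) * w j k))"
  by (simp add: sum_distrib_left sum_distrib_right algebra_simps)
 also have "\<dots> = (\<Sum>j\<in>A. \<Sum>a\<in>D. \<Sum>k\<in>B. \<Sum>b\<in>E. R a b * ((c j * x j a) * (d k * y k b) * w j k))"
  by (intro sum.cong refl sum.swap)
 also have "\<dots> = (\<Sum>a\<in>D. \<Sum>j\<in>A. \<Sum>k\<in>B. \<Sum>b\<in>E. R a b * ((c j * x j a) * (d k * y k b) * w j k))"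
  by (rule sum.swap)
 also have "\<dots> = (\<Sum>a\<in>D. \<Sum>j\<in>A. \<Sum>b\<in>E. \<Sum>k\<in>B. R a b * ((c j * x j a) * (d k * y k b) * w j k))"
  by (intro sum.cong refl sum.swap)
 also have "\<dots> = (\<Sum>a\<in>D. \<Sum>b\<in>E. \<Sum>j\<in>A. \<Sum>k\<in>B. R a b * ((c j * x j a) * (d k * y k b) * w j k))"
  by (intro sum.cong refl sum.swap)
 finally show ?thesis by (simp add: sum_distrib_left)
qed

lemma sum_expand_one_factor_diag:
 fixes c :: "'j => real" and d :: "'k => real"
 shows "(\<Sum>j\<in>A. \<Sum>k\<in>B. c j * d k * (\<Sum>a\<in>D. x j a * y k a) ^ Suc p)
  = (\<Sum>a\<in>D. \<Sum>j\<in>A. \<Sum>k\<in>B. (c j * x j a) * (d k * y k a) * (\<Sum>a\<in>D. x j a * y k a) ^ p)"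
proof -
 have "(\<Sum>j\<in>A. \<Sum>k\<in>B. c j * d k * (\<Sum>a\<in>D. x j a * y k a) ^ Suc p)
  = (\<Sum>j\<in>A. \<Sum>k\<in>B. \<Sum>a\<in>D. (c j * x j a) * (d k * y k a) * (\<Sum>a\<in>D. x j a * y k a) ^ p)"
  by (simp add: sum_distrib_left sum_distrib_right algebra_simps)
 also have "\<dots> = (\<Sum>j\<in>A. \<Sum>a\<in>D. \<Sum>k\<in>B. (c j * x j a) * (d k * y k a) * (\<Sum>a\<in>D. x j a * y k a) ^ p)"
  by (intro sum.cong refl sum.swap)
 also have "\<dots> = (\<Sum>a\<in>D. \<Sum>j\<in>A. \<Sum>k\<in>B. (c j * x j a) * (d k * y k a) * (\<Sum>a\<in>D. x j a * y k a) ^ p)"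
  by (rule sum.swap)
 finally show ?thesis .
qed

text \<open>Entrywise powers of a Gram matrix are positive semidefinite: opening one factor writes
  the form as a sum of forms with a smaller exponent and new coefficients.\<close>

lemma power_kernel_nonneg:
 fixes c :: "'j => real"
 shows "0 <= (\<Sum>j\<in>A. \<Sum>k\<in>A. c j * c k * (\<Sum>a\<in>D. x j a * x k a) ^ p)"
proof (induction p arbitrary: c)
 case 0
 have "(\<Sum>j\<in>A. \<Sum>k\<in>A. c j * c k) = (\<Sum>j\<in>A. c j) * (\<Sum>k\<in>A. c k)" by (simp add: sum_product)
 then show ?case by simp
next
 case (Suc p)
 show ?case unfolding sum_expand_one_factor_diag by (intro sum_nonneg Suc.IH)
qed

text \<open>Hilbert--Schmidt estimate for tensor powers, by induction on the power: each step splits off one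
 factor of the bilinear form and applies Cauchy--Schwarz over the pairs of coordinates.\<close>

lemma power_kernel_le:
 fixes c :: "'j => real"
 shows "\<bar>\<Sum>j\<in>A. \<Sum>k\<in>B. c j * d k * (\<Sum>a\<in>D. \<Sum>b\<in>E. R a b * x j a * y k b) ^ p\<bar>
 <= sqrt (\<Sum>a\<in>D. \<Sum>b\<in>E. (R a b)^2) ^ p * (sqrt (\<Sum>j\<in>A. \<Sum>k\<in>A. c j * c k * (\<Sum>a\<in>D. x j a * x k a) ^ p)
  * sqrt (\<Sum>j\<in>B. \<Sum>k\<in>B. d j * d k * (\<Sum>b\<in>E. y j b * y k b) ^ p))"
proof (induction p arbitrary: c d)
 case 0
 have "(\<Sum>j\<in>A. \<Sum>k\<in>A. c j * c k) = (\<Sum>j\<in>A. c j)^2" "(\<Sum>j\<in>B. \<Sum>k\<in>B. d j * d k) = (\<Sum>j\<in>B. d j)^2"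
  "(\<Sum>j\<in>A. \<Sum>k\<in>B. c j * d k) = (\<Sum>j\<in>A. c j) * (\<Sum>j\<in>B. d j)" by (simp_all add: sum_product power2_eq_square)
 then show ?case by (simp add: abs_mult)
next
 case (Suc p)
 define \<rho> where "\<rho> = sqrt (\<Sum>a\<in>D. \<Sum>b\<in>E. (R a b)^2)"
 define Q where "Q a = (\<Sum>j\<in>A. \<Sum>k\<in>A. (c j * x j a) * (c k * x k a) * (\<Sum>a\<in>D. x j a * x k a) ^ p)" for a
 define Q' where "Q' b = (\<Sum>j\<in>B. \<Sum>k\<in>B. (d j * y j b) * (d k * y k b) * (\<Sum>b\<in>E. y j b * y k b) ^ p)" for b
 define T where "T a b = (\<Sum>j\<in>A. \<Sum>k\<in>B. (c j * x j a) * (d k * y k b) * (\<Sum>a\<in>D. \<Sum>b\<in>E. R a b * x j a * y k b) ^ p)" for a b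
 have Qn: "Q a >= 0" "Q' b >= 0" for a b unfolding Q_def Q'_def by (rule power_kernel_nonneg)+
 have \<rho>: "\<rho> >= 0" unfolding \<rho>_def by (simp add: sum_nonneg)
 have T: "\<bar>T a b\<bar> <= \<rho> ^ p * (sqrt (Q a) * sqrt (Q' b))" for a b unfolding T_def Q_def Q'_def \<rho>_def by (rule Suc.IH)
 have "(\<Sum>j\<in>A. \<Sum>k\<in>B. c j * d k * (\<Sum>a\<in>D. \<Sum>b\<in>E. R a b * x j a * y k b) ^ Suc p)
  = (\<Sum>a\<in>D. \<Sum>b\<in>E. R a b * T a b)" unfolding power_Suc T_def by (rule sum_expand_one_factor)
 also have "\<bar>\<dots>\<bar> <= (\<Sum>a\<in>D. \<Sum>b\<in>E. \<bar>R a b\<bar> * (\<rho> ^ p * (sqrt (Q a) * sqrt (Q' b))))"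
  by (intro order_trans[OF sum_abs] sum_mono) (auto simp: abs_mult intro!: order_trans[OF sum_abs] sum_mono mult_left_mono T)
 also have "\<dots> = \<rho> ^ p * (\<Sum>(a, b)\<in>D \<times> E. \<bar>R a b\<bar> * \<bar>sqrt (Q a) * sqrt (Q' b)\<bar>)"
  using Qn by (simp add: sum_distrib_left sum.cartesian_product case_prod_unfold algebra_simps)
 also have "(\<Sum>(a, b)\<in>D \<times> E. \<bar>R a b\<bar> * \<bar>sqrt (Q a) * sqrt (Q' b)\<bar>)
   <= L2_set (%(a, b). R a b) (D \<times> E) * L2_set (%(a, b). sqrt (Q a) * sqrt (Q' b)) (D \<times> E)"
  using L2_set_mult_ineq[of "%(a, b). R a b" "%(a, b). sqrt (Q a) * sqrt (Q' b)" "D \<times> E"] by (simp add: case_prod_unfold)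
 also have "L2_set (%(a, b). R a b) (D \<times> E) = \<rho>" by (simp add: L2_set_def \<rho>_def sum.cartesian_product case_prod_unfold)
 also have "L2_set (%(a, b). sqrt (Q a) * sqrt (Q' b)) (D \<times> E) = sqrt (\<Sum>a\<in>D. Q a) * sqrt (\<Sum>b\<in>E. Q' b)"
 proof -
  have "(\<Sum>z\<in>D \<times> E. (case z of (a, b) => sqrt (Q a) * sqrt (Q' b))^2) = (\<Sum>a\<in>D. \<Sum>b\<in>E. Q a * Q' b)"
   using Qn by (simp add: sum.cartesian_product case_prod_unfold power_mult_distrib)
  then show ?thesis by (simp add: L2_set_def sum_product real_sqrt_mult flip: sum_product)
 qed
 finally have "\<bar>\<Sum>j\<in>A. \<Sum>k\<in>B. c j * d k * (\<Sum>a\<in>D. \<Sum>b\<in>E. R a b * x j a * y k b) ^ Suc p\<bar>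
   <= \<rho> ^ p * (\<rho> * (sqrt (\<Sum>a\<in>D. Q a) * sqrt (\<Sum>b\<in>E. Q' b)))" using \<rho> by (simp add: mult_left_mono)
 then show ?case unfolding \<rho>_def[symmetric] sum_expand_one_factor_diag[where c=c and d=c] sum_expand_one_factor_diag[where c=d and d=d]
  by (fold Q_def Q'_def) (simp add: algebra_simps)
qed

section \<open>Covariances of even functionals of two Gaussian triples\<close>

context gauss_vec
begin

definition cv :: "('s => real) => ('s => real) => real" where
 "cv f g = expectation (%s. f s * g s) - expectation f * expectation g"

definition in_span :: "(nat => 'i => real) => ('i => real) => bool" where
 "in_span e u \<longleftrightarrow> (\<exists>\<alpha>. \<forall>i\<in>J. u i = (\<Sum>a<3. \<alpha> a * e a i))"

definition ortho3 :: "(nat => 'i => real) => bool" where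
 "ortho3 e \<longleftrightarrow> (\<forall>a<3. \<forall>b<3. ip J (e a) (e b) = (if a = b then 1 else 0))"

definition trig :: "(nat => 'i => real) => ('s => real) => bool" where
 "trig e f \<longleftrightarrow> (\<exists>(n::nat) c x. f = (%s. \<Sum>j<n. c j * cos (Z (%i. \<Sum>a<3. x j a * e a i) s)))"

text \<open>Uniformly bounded pointwise limits are the weakest closure under which covariances pass
  to the limit by dominated convergence, and it contains the discontinuous sign products.\<close>

definition limtrig :: "(nat => 'i => real) => ('s => real) => bool" where
 "limtrig e f \<longleftrightarrow> (\<exists>F B. (\<forall>m. trig e (F m)) \<and> (\<forall>m s. \<bar>F m s\<bar> <= B) \<and> (\<forall>s. (%m. F m s) \<longlonglongrightarrow> f s))"

lemma Z_cong: "(!!i. i \<in> J ==> u i = v i) ==> Z u s = Z v s" by (simp add: Z_def)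

lemma cv_cos_sum:
 assumes f: "f = (%s. \<Sum>j\<in>A. c j * cos (Z (th j) s))" and g: "g = (%s. \<Sum>k\<in>B. d k * cos (Z (et k) s))"
 shows "cv f g = (\<Sum>j\<in>A. \<Sum>k\<in>B. (c j * exp (- ip J (th j) (th j) / 2)) * (d k * exp (- ip J (et k) (et k) / 2))
   * (cosh (ip J (th j) (et k)) - 1))"
proof -
 have int: "integrable M (%s. cos (Z u s) * cos (Z v s))" for u v by (rule integrable_bounded[where B=1]) (auto simp: abs_mult intro!: mult_le_one)
 have "expectation (%s. f s * g s) = expectation (%s. \<Sum>j\<in>A. \<Sum>k\<in>B. c j * d k * (cos (Z (th j) s) * cos (Z (et k) s)))"
  unfolding f g by (simp add: sum_product algebra_simps)
 also have "\<dots> = (\<Sum>j\<in>A. \<Sum>k\<in>B. c j * d k * expectation (%s. cos (Z (th j) s) * cos (Z (et k) s)))"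
  using int by (simp add: Bochner_Integration.integral_sum integrable_mult_right)
 finally have 1: "expectation (%s. f s * g s) = \<dots>" .
 have 2: "expectation f = (\<Sum>j\<in>A. c j * expectation (%s. cos (Z (th j) s)))"
  "expectation g = (\<Sum>k\<in>B. d k * expectation (%s. cos (Z (et k) s)))" unfolding f g by (simp_all add: Bochner_Integration.integral_sum)
 have "cv f g = (\<Sum>j\<in>A. \<Sum>k\<in>B. c j * d k * (expectation (%s. cos (Z (th j) s) * cos (Z (et k) s))
   - expectation (%s. cos (Z (th j) s)) * expectation (%s. cos (Z (et k) s))))"
  unfolding cv_def 1 2 by (simp add: sum_product sum_subtractf[symmetric] algebra_simps)
 also have "\<dots> = (\<Sum>j\<in>A. \<Sum>k\<in>B. (c j * exp (- ip J (th j) (th j) / 2)) * (d k * exp (- ip J (et k) (et k) / 2))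
   * (cosh (ip J (th j) (et k)) - 1))" unfolding cov_cos_cos by (intro sum.cong refl) (simp add: exp_add[symmetric] field_simps flip: exp_add)
 finally show ?thesis .
qed

lemma integrable_sq_bounded:
 assumes "f \<in> borel_measurable M" "!!s. \<bar>f s\<bar> <= B"
 shows "integrable M (%s. (f s)^2 :: real)"
proof (rule integrable_bounded[where B="B^2"])
 show "\<bar>(f s)^2\<bar> <= B^2" for s using power_mono[OF assms(2)[of s], of 2] by simp
qed (use assms in simp)

lemma cv_self_nonneg:
 assumes "f \<in> borel_measurable M" "!!s. \<bar>f s\<bar> <= B"
 shows "0 <= cv f f"
proof -
 have "B >= 0" using assms(2)[of undefined] by linarith
 then have "\<bar>f s * f s\<bar> <= B * B" for s unfolding abs_mult using assms(2) by (intro mult_mono) auto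
 then have "integrable M (%s. f s * f s)" "integrable M f" using assms by (auto intro!: integrable_bounded)
 then have "cv f f = variance f" by (subst variance_eq) (auto simp: cv_def power2_eq_square)
 then show ?thesis by simp
qed

lemma cosh_sub_one_sums:
 "(%n. (if even n \<and> n > 0 then 1 / fact n else 0) * x ^ n) sums (cosh x - 1 :: real)"
proof -
 have "(%n. (if even n then x ^ n /\<^sub>R fact n else 0) - (if n = 0 then 1 else 0)) sums (cosh x - 1)"
  by (intro sums_diff cosh_converges) (use sums_If_finite_set[of "{0}" "%_. 1::real"] in simp)
 also have "(%n. (if even n then x ^ n /\<^sub>R fact n else 0) - (if n = 0 then 1 else 0))
  = (%n. (if even n \<and> n > 0 then 1 / fact n else 0) * x ^ n)" by (auto simp: fun_eq_iff divide_inverse)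
 finally show ?thesis .
qed

text \<open>A bound for the maximal correlation of even functions of two Gaussian triples by the
  squared Hilbert-Schmidt norm \<open>r ^ 2\<close> of their cross covariance. The series of
  \<open>cosh - 1\<close> is expanded, every power is estimated by \<open>power_kernel_le\<close>,
  and Cauchy-Schwarz over the powers reassembles the two diagonal series into \<open>cv f f\<close>
  and \<open>cv g g\<close>.\<close>

lemma trig_cv_le:
 assumes f: "trig e f" and g: "trig e' g" and oe: "ortho3 e" and oe': "ortho3 e'"
  and \<rho>: "(\<Sum>a<3. \<Sum>b<3. (ip J (e a) (e' b))^2) <= 1"
 shows "\<bar>cv f g\<bar> <= (\<Sum>a<3. \<Sum>b<3. (ip J (e a) (e' b))^2) * (sqrt (cv f f) * sqrt (cv g g))"
proof -
 obtain n :: nat and c x where f: "f = (%s. \<Sum>j<n. c j * cos (Z (%i. \<Sum>a<3. x j a * e a i) s))"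
  using f unfolding trig_def by (elim exE) (rule that)
 obtain m :: nat and d y where g: "g = (%s. \<Sum>j<m. d j * cos (Z (%i. \<Sum>a<3. y j a * e' a i) s))"
  using g unfolding trig_def by (elim exE) (rule that)
 define R where "R a b = ip J (e a) (e' b)" for a b
 define r where "r = sqrt (\<Sum>a<3. \<Sum>b<3. (R a b)^2)"
 have r: "0 <= r" "r <= 1" "r^2 = (\<Sum>a<3. \<Sum>b<3. (R a b)^2)" using \<rho> by (auto simp: r_def R_def sum_nonneg)
 have ipx: "ip J (%i. \<Sum>a<3. x j a * e a i) (%i. \<Sum>a<3. x k a * e a i) = (\<Sum>a<3. x j a * x k a)" for j k
  using oe by (simp add: ip_sum_left ip_sum_right ortho3_def if_distrib[of "%z. _ * z"] sum.delta cong: if_cong)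
 have ipy: "ip J (%i. \<Sum>a<3. y j a * e' a i) (%i. \<Sum>a<3. y k a * e' a i) = (\<Sum>a<3. y j a * y k a)" for j k
  using oe' by (simp add: ip_sum_left ip_sum_right ortho3_def if_distrib[of "%z. _ * z"] sum.delta cong: if_cong)
 have ipxy: "ip J (%i. \<Sum>a<3. x j a * e a i) (%i. \<Sum>a<3. y k a * e' a i) = (\<Sum>a<3. \<Sum>b<3. R a b * x j a * y k b)" for j k
  unfolding ip_sum_left ip_sum_right by (simp add: R_def sum_distrib_left algebra_simps)
 \<comment> \<open>The variance factors are absorbed into the coefficients, so that only powers of
   inner products remain.\<close>
 define c' where "c' j = c j * exp (- (\<Sum>a<3. x j a * x j a) / 2)" for j
 define d' where "d' j = d j * exp (- (\<Sum>a<3. y j a * y j a) / 2)" for j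
 define w where "w p = (if even p \<and> p > 0 then 1 / fact p else 0 :: real)" for p :: nat
 define P where "P p = (\<Sum>j<n. \<Sum>k<m. c' j * d' k * (\<Sum>a<3. \<Sum>b<3. R a b * x j a * y k b) ^ p)" for p
 define Q where "Q p = (\<Sum>j<n. \<Sum>k<n. c' j * c' k * (\<Sum>a<3. x j a * x k a) ^ p)" for p
 define Q' where "Q' p = (\<Sum>j<m. \<Sum>k<m. d' j * d' k * (\<Sum>a<3. y j a * y k a) ^ p)" for p
 have Qn: "Q p >= 0" "Q' p >= 0" for p unfolding Q_def Q'_def by (rule power_kernel_nonneg)+
 have wn: "w p >= 0" for p by (simp add: w_def)
 have S: "(%p. w p * (\<Sum>j<n1. \<Sum>k<n2. A j * B k * X j k ^ p)) sums (\<Sum>j<n1. \<Sum>k<n2. A j * B k * (cosh (X j k) - 1))"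
  for n1 n2 :: nat and A B :: "nat => real" and X
 proof -
  have "(%p. \<Sum>j<n1. \<Sum>k<n2. A j * B k * (w p * X j k ^ p)) sums (\<Sum>j<n1. \<Sum>k<n2. A j * B k * (cosh (X j k) - 1))"
   unfolding w_def by (intro sums_sum sums_mult cosh_sub_one_sums)
  then show ?thesis by (simp add: sum_distrib_left algebra_simps)
 qed
 have sfg: "(%p. w p * P p) sums cv f g" unfolding cv_cos_sum[OF f g] P_def ipx ipy ipxy c'_def[symmetric] d'_def[symmetric] by (rule S)
 have sff: "(%p. w p * Q p) sums cv f f" unfolding cv_cos_sum[OF f f] Q_def ipx c'_def[symmetric] by (rule S)
 have sgg: "(%p. w p * Q' p) sums cv g g" unfolding cv_cos_sum[OF g g] Q'_def ipy d'_def[symmetric] by (rule S)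
 have P: "\<bar>w p * P p\<bar> <= r^2 * (sqrt (w p * Q p) * sqrt (w p * Q' p))" for p
 proof (cases "even p \<and> p > 0")
  case True
  \<comment> \<open>Only even positive powers carry weight, and \<open>r <= 1\<close>, so every
    \<open>r ^ p\<close> is at most \<open>r ^ 2\<close>.\<close>
  then have "p >= 2" by presburger
  then have "r ^ p <= r ^ 2" by (intro power_decreasing r)
  have "\<bar>P p\<bar> <= r ^ p * (sqrt (Q p) * sqrt (Q' p))" unfolding P_def r_def Q_def Q'_def by (rule power_kernel_le)
  also have "\<dots> <= r ^ 2 * (sqrt (Q p) * sqrt (Q' p))" by (intro mult_right_mono \<open>r ^ p <= r ^ 2\<close>) (simp add: Qn)
  finally have "w p * \<bar>P p\<bar> <= w p * (r ^ 2 * (sqrt (Q p) * sqrt (Q' p)))" by (intro mult_left_mono wn)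
  then show ?thesis using wn[of p] by (simp add: abs_mult real_sqrt_mult algebra_simps)
 next
  case False
  then have "w p = 0" by (auto simp: w_def)
  then show ?thesis by simp
 qed
 have part: "\<bar>\<Sum>p<N. w p * P p\<bar> <= r^2 * (sqrt (cv f f) * sqrt (cv g g))" for N
 proof -
  have cvn: "0 <= cv f f" by (rule sums_le[OF _ sums_zero sff]) (simp add: wn Qn)
  have L: "L2_set (%p. sqrt (w p * Q p)) {..<N} <= sqrt (cv f f)" unfolding L2_set_def using sum_le_suminf[of "%p. w p * Q p" "{..<N}"] sff wn Qn
   by (simp add: sums_iff)
  have L': "L2_set (%p. sqrt (w p * Q' p)) {..<N} <= sqrt (cv g g)" unfolding L2_set_def using sum_le_suminf[of "%p. w p * Q' p" "{..<N}"] sgg wn Qn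
   by (simp add: sums_iff)
  have "\<bar>\<Sum>p<N. w p * P p\<bar> <= (\<Sum>p<N. r^2 * (sqrt (w p * Q p) * sqrt (w p * Q' p)))"
   by (rule order_trans[OF sum_abs]) (intro sum_mono P)
  also have "\<dots> = r^2 * (\<Sum>p<N. \<bar>sqrt (w p * Q p)\<bar> * \<bar>sqrt (w p * Q' p)\<bar>)" using wn Qn by (simp add: sum_distrib_left)
  also have "\<dots> <= r^2 * (L2_set (%p. sqrt (w p * Q p)) {..<N} * L2_set (%p. sqrt (w p * Q' p)) {..<N})"
   by (intro mult_left_mono L2_set_mult_ineq) simp
  also have "\<dots> <= r^2 * (sqrt (cv f f) * sqrt (cv g g))" by (intro mult_left_mono mult_mono L L') (use cvn in \<open>auto \<close>)
  finally show ?thesis .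
 qed
 have "(%N. \<bar>\<Sum>p<N. w p * P p\<bar>) \<longlonglongrightarrow> \<bar>cv f g\<bar>" using sfg unfolding sums_def by (intro tendsto_rabs)
 then have "\<bar>cv f g\<bar> <= r^2 * (sqrt (cv f f) * sqrt (cv g g))" by (rule LIMSEQ_le_const2) (use part in blast)
 then show ?thesis using r by (simp add: R_def)
qed

lemma trig_meas: "trig e f ==> f \<in> borel_measurable M" unfolding trig_def by auto

lemma limtrig_meas: "limtrig e f ==> f \<in> borel_measurable M" unfolding limtrig_def
proof (elim exE conjE)
 fix F B assume "\<forall>m. trig e (F m)" "\<forall>s. (%m. F m s) \<longlonglongrightarrow> f s"
 then show "f \<in> borel_measurable M" using borel_measurable_LIMSEQ_real[of M F f] trig_meas by blast
qed

lemma limtrig_bounded: "limtrig e f ==> \<exists>B. \<forall>s. \<bar>f s\<bar> <= B" unfolding limtrig_def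
proof (elim exE conjE)
 fix F B assume *: "\<forall>m s. \<bar>F m s\<bar> <= B" "\<forall>s. (%m. F m s) \<longlonglongrightarrow> f s"
 have "\<bar>f s\<bar> <= B" for s by (rule LIMSEQ_le_const2[OF tendsto_rabs[OF *(2)[rule_format, of s]]]) (use * in auto)
 then show ?thesis by blast
qed

lemma cv_tendsto:
 assumes F: "!!m. F m \<in> borel_measurable M" "!!m s. \<bar>F m s\<bar> <= B" "!!s. (%m. F m s) \<longlonglongrightarrow> f s"
  and G: "!!m. G m \<in> borel_measurable M" "!!m s. \<bar>G m s\<bar> <= C" "!!s. (%m. G m s) \<longlonglongrightarrow> g s"
 shows "(%m. cv (F m) (G m)) \<longlonglongrightarrow> cv f g"
proof -
 have [measurable]: "f \<in> borel_measurable M" "g \<in> borel_measurable M"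
  by (rule borel_measurable_LIMSEQ_real[OF F(3) F(1)], rule borel_measurable_LIMSEQ_real[OF G(3) G(1)])
 have B: "B >= 0" using F(2)[of 0 undefined] by linarith
 have b: "\<bar>F m s\<bar> * \<bar>G m s\<bar> <= B * C" for m s using F(2) G(2) B by (intro mult_mono) auto
 note [measurable] = F(1) G(1)
 have 1: "(%m. expectation (%s. F m s * G m s)) \<longlonglongrightarrow> expectation (%s. f s * g s)"
  by (rule integral_dominated_convergence[where w="%_. B * C"])
   (use F(3) G(3) b in \<open>auto simp: abs_mult intro!: tendsto_mult\<close>)
 have 2: "(%m. expectation (F m)) \<longlonglongrightarrow> expectation f" by (rule integral_dominated_convergence[where w="%_. B"]) (use F in auto)
 have 3: "(%m. expectation (G m)) \<longlonglongrightarrow> expectation g" by (rule integral_dominated_convergence[where w="%_. C"]) (use G in auto)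
 show ?thesis unfolding cv_def by (intro tendsto_diff tendsto_mult 1 2 3)
qed

lemma cv_le_moment2:
 assumes "f \<in> borel_measurable M" "!!s. \<bar>f s\<bar> <= B"
 shows "cv f f <= expectation (%s. (f s)^2)" by (simp add: cv_def power2_eq_square)

lemma expectation_Cauchy:
 fixes f g :: "'s => real"
 assumes [measurable]: "f \<in> borel_measurable M" "g \<in> borel_measurable M"
  and i: "integrable M (%s. (f s)^2)" "integrable M (%s. (g s)^2)"
 shows "\<bar>expectation (%s. f s * g s)\<bar> <= sqrt (expectation (%s. (f s)^2)) * sqrt (expectation (%s. (g s)^2))"
  and "integrable M (%s. f s * g s)"
proof -
 show int: "integrable M (%s. f s * g s)"
 proof (rule Bochner_Integration.integrable_bound)
  show "integrable M (%s. (f s)^2 + (g s)^2)" using i by simp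
  have "2 * \<bar>f s * g s\<bar> <= (f s)^2 + (g s)^2" for s
   using sum_squares_bound[of "\<bar>f s\<bar>" "\<bar>g s\<bar>"] by (simp add: abs_mult mult.assoc)
  then have "\<bar>f s * g s\<bar> <= (f s)^2 + (g s)^2" for s by (smt (verit) abs_ge_zero)
  then show "AE s in M. norm (f s * g s) <= norm ((f s)^2 + (g s)^2)" by (intro AE_I2) auto
 qed simp
 define a b where "a = expectation (%s. (f s)^2)" and "b = expectation (%s. (g s)^2)"
 have ab: "a >= 0" "b >= 0" by (simp_all add: a_def b_def)
 define x where "x = \<bar>expectation (%s. f s * g s)\<bar>"
 have *: "2 * t * x <= a + t^2 * b" if "t >= 0" for t
 proof -
  have "2 * t * \<bar>f s * g s\<bar> <= (f s)^2 + t^2 * (g s)^2" for s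
   using sum_squares_bound[of "\<bar>f s\<bar>" "t * \<bar>g s\<bar>"] that by (simp add: abs_mult power_mult_distrib algebra_simps)
  then have "expectation (%s. 2 * t * \<bar>f s * g s\<bar>) <= expectation (%s. (f s)^2 + t^2 * (g s)^2)" using int i by (intro integral_mono) auto
  then have "2 * t * expectation (%s. \<bar>f s * g s\<bar>) <= a + t^2 * b" using i by (simp add: a_def b_def)
  moreover have "x <= expectation (%s. \<bar>f s * g s\<bar>)" unfolding x_def by (rule integral_abs_bound)
  then have "2 * t * x <= 2 * t * expectation (%s. \<bar>f s * g s\<bar>)" using that by (intro mult_left_mono) auto
  ultimately show ?thesis by linarith
 qed
 have "x^2 <= a * b"
 \<comment> \<open>If \<open>b = 0\<close>, arbitrarily large \<open>t\<close> in the quadratic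
   inequality force \<open>x = 0\<close>; otherwise \<open>t = x / b\<close> is optimal.\<close>
 proof (cases "b = 0")
  case True
  have "x = 0"
  proof (rule ccontr)
   assume "x ~= 0"
   then have "x > 0" by (simp add: x_def)
   then have "2 * (a + 1) <= a" using *[of "(a + 1) / x"] ab True by simp
   then show False using ab by simp
  qed
  then show ?thesis using ab by simp
 next
  case False
  then have "b > 0" using ab by simp
  then show ?thesis using *[of "x / b"] by (simp add: x_def power2_eq_square field_simps)
 qed
 then have "x <= sqrt (a * b)" by (rule real_le_rsqrt)
 then show "\<bar>expectation (%s. f s * g s)\<bar> <= sqrt (expectation (%s. (f s)^2)) * sqrt (expectation (%s. (g s)^2))"
  by (simp add: x_def a_def b_def real_sqrt_mult)
qed

lemma variance_le_moment2:
 fixes f :: "'s => real"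
 assumes "f \<in> borel_measurable M" "integrable M (%s. (f s)^2)"
 shows "variance f <= expectation (%s. (f s)^2)" using variance_eq[OF square_integrable_imp_integrable[OF assms] assms(2)] by simp

text \<open>For cross covariance norm at most 1 the bound is the limit of \<open>trig_cv_le\<close>.
  Otherwise \<open>r > 1\<close> and plain Cauchy-Schwarz for the centred functionals already gives
  \<open>A\<close>.\<close>

lemma limtrig_cv_le:
 assumes f: "limtrig e f" and g: "limtrig e' g" and o: "ortho3 e" "ortho3 e'"
  and r: "(\<Sum>a<3. \<Sum>b<3. (ip J (e a) (e' b))^2) <= r"
  and A: "expectation (%s. (f s)^2) <= A" "expectation (%s. (g s)^2) <= A"
 shows "\<bar>cv f g\<bar> <= r * A"
proof -
 define \<rho> where "\<rho> = (\<Sum>a<3. \<Sum>b<3. (ip J (e a) (e' b))^2)"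
 obtain F B where F: "!!m. trig e (F m)" "!!m s. \<bar>F m s\<bar> <= B" "!!s. (%m. F m s) \<longlonglongrightarrow> f s"
  using f unfolding limtrig_def by blast
 obtain G C where G: "!!m. trig e' (G m)" "!!m s. \<bar>G m s\<bar> <= C" "!!s. (%m. G m s) \<longlonglongrightarrow> g s"
  using g unfolding limtrig_def by blast
 have \<rho>0: "\<rho> >= 0" by (simp add: \<rho>_def sum_nonneg)
 obtain Bf where Bf: "!!s. \<bar>f s\<bar> <= Bf" using limtrig_bounded[OF f] by blast
 obtain Bg where Bg: "!!s. \<bar>g s\<bar> <= Bg" using limtrig_bounded[OF g] by blast
 note mf = limtrig_meas[OF f] and mg = limtrig_meas[OF g]
 have A0: "0 <= A" using A(1) order_trans[OF Bochner_Integration.integral_nonneg[of M "%s. (f s)^2"]] by simp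
 have vf: "cv f f <= A" "cv g g <= A" using cv_le_moment2[OF mf Bf] cv_le_moment2[OF mg Bg] A by auto
 have nf: "cv f f >= 0" "cv g g >= 0" using cv_self_nonneg[OF mf Bf] cv_self_nonneg[OF mg Bg] by auto
 have sq: "sqrt (cv f f) * sqrt (cv g g) <= A"
 proof -
  have "sqrt (cv f f) * sqrt (cv g g) <= sqrt A * sqrt A" using vf nf by (intro mult_mono) auto
  then show ?thesis using A0 by simp
 qed
 show ?thesis
 proof (cases "\<rho> <= 1")
  case True
  have "\<bar>cv f g\<bar> <= \<rho> * (sqrt (cv f f) * sqrt (cv g g))"
  proof (rule LIMSEQ_le)
   show "(%m. \<bar>cv (F m) (G m)\<bar>) \<longlonglongrightarrow> \<bar>cv f g\<bar>"
    by (intro tendsto_rabs cv_tendsto[OF trig_meas[OF F(1)] F(2,3) trig_meas[OF G(1)] G(2,3)])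
   show "(%m. \<rho> * (sqrt (cv (F m) (F m)) * sqrt (cv (G m) (G m)))) \<longlonglongrightarrow> \<rho> * (sqrt (cv f f) * sqrt (cv g g))"
    by (intro tendsto_mult tendsto_const tendsto_real_sqrt
      cv_tendsto[OF trig_meas[OF F(1)] F(2,3) trig_meas[OF F(1)] F(2,3)]
      cv_tendsto[OF trig_meas[OF G(1)] G(2,3) trig_meas[OF G(1)] G(2,3)])
   show "\<exists>N. \<forall>n\<ge>N. \<bar>cv (F n) (G n)\<bar> <= \<rho> * (sqrt (cv (F n) (F n)) * sqrt (cv (G n) (G n)))"
    using trig_cv_le[OF F(1) G(1) o] True unfolding \<rho>_def by blast
  qed
  also have "\<dots> <= \<rho> * A" by (intro mult_left_mono sq \<rho>0)
  also have "\<dots> <= r * A" using r A0 by (intro mult_right_mono) (auto simp: \<rho>_def)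
  finally show ?thesis .
 next
  case False
  define f' where "f' s = f s - expectation f" for s
  define g' where "g' s = g s - expectation g" for s
  have [measurable]: "f \<in> borel_measurable M" "g \<in> borel_measurable M" by (fact mf mg)+
  have i: "integrable M f" "integrable M g" using Bf Bg by (auto intro!: integrable_bounded)
  have i2: "integrable M (%s. (f s)^2)" "integrable M (%s. (g s)^2)" by (rule integrable_sq_bounded[OF mf Bf], rule integrable_sq_bounded[OF mg Bg])
  have ifg: "integrable M (%s. f s * g s)" by (rule expectation_Cauchy(2)) (use i2 in auto)
  have i2': "integrable M (%s. (f' s)^2)" "integrable M (%s. (g' s)^2)" unfolding f'_def g'_def power2_diff using i i2 by auto
  have "expectation (%s. f' s * g' s) = cv f g" unfolding f'_def g'_def cv_def using i ifg by (simp add: algebra_simps prob_space)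
  moreover have "expectation (%s. (f' s)^2) <= A" "expectation (%s. (g' s)^2) <= A"
   unfolding f'_def g'_def using A variance_le_moment2[OF mf i2(1)] variance_le_moment2[OF mg i2(2)] by auto
  moreover have "\<bar>expectation (%s. f' s * g' s)\<bar> <= sqrt (expectation (%s. (f' s)^2)) * sqrt (expectation (%s. (g' s)^2))"
   by (rule expectation_Cauchy(1)) (use i2' in \<open>auto simp: f'_def[abs_def] g'_def[abs_def]\<close>)
  moreover have "sqrt (expectation (%s. (f' s)^2)) * sqrt (expectation (%s. (g' s)^2)) <= sqrt A * sqrt A"
   using calculation(2,3) A0 by (intro mult_mono) auto
  ultimately have "\<bar>cv f g\<bar> <= sqrt A * sqrt A" by linarith
  also have "\<dots> = A" using A0 by simp
  also have "\<dots> <= r * A" using mult_right_mono[of 1 r A] False r A0 by (simp add: \<rho>_def)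
  finally show ?thesis .
 qed
qed

end

subsection \<open>Trigonometric approximation of the sign function\<close>

lemma sum_append_nat:
 fixes f g :: "nat => 'a :: comm_monoid_add"
 shows "(\<Sum>j<m + n. if j < m then f j else g (j - m)) = (\<Sum>j<m. f j) + (\<Sum>j<n. g j)"
proof (induction n)
 case (Suc n)
 then show ?case by (simp add: add.assoc)
qed simp

text \<open>Frequencies are arbitrary reals, so the class is stable under rescaling the
  argument.\<close>

definition sinpoly :: "(real => real) => bool" where
 "sinpoly S \<longleftrightarrow> (\<exists>(n::nat) c p. S = (%x. \<Sum>j<n. c j * sin (p j * x)))"

lemma sinpoly_scale: "sinpoly S ==> sinpoly (%x. a * S x)" unfolding sinpoly_def
proof (elim exE)
 fix n :: nat and c p assume "S = (%x. \<Sum>j<n. c j * sin (p j * x))"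
 then have "(%x. a * S x) = (%x. \<Sum>j<n. (a * c j) * sin (p j * x))" by (simp add: sum_distrib_left mult.assoc)
 then show "\<exists>(n::nat) c p. (%x. a * S x) = (%x. \<Sum>j<n. c j * sin (p j * x))" by (intro exI)
qed

lemma sinpoly_rescale: "sinpoly S ==> sinpoly (%x. S (a * x))" unfolding sinpoly_def
proof (elim exE)
 fix n :: nat and c p assume "S = (%x. \<Sum>j<n. c j * sin (p j * x))"
 then have "(%x. S (a * x)) = (%x. \<Sum>j<n. c j * sin ((p j * a) * x))" by (simp add: mult.assoc)
 then show "\<exists>(n::nat) c p. (%x. S (a * x)) = (%x. \<Sum>j<n. c j * sin (p j * x))" by (intro exI)
qed

lemma sinpoly_add: "sinpoly S ==> sinpoly T ==> sinpoly (%x. S x + T x)"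
proof -
 assume "sinpoly S" "sinpoly T"
 then obtain m n :: nat and c p d q where e: "S = (%x. \<Sum>j<m. c j * sin (p j * x))" "T = (%x. \<Sum>j<n. d j * sin (q j * x))"
  unfolding sinpoly_def by (elim exE) (rule that)
 have "(%x. S x + T x) = (%x. \<Sum>j<m + n. (if j < m then c j else d (j - m)) * sin ((if j < m then p j else q (j - m)) * x))"
  unfolding e sum_append_nat[symmetric] by (intro ext sum.cong) auto
 then show ?thesis unfolding sinpoly_def by (intro exI)
qed

lemma sinpoly_sin: "sinpoly (%x. sin (a * x))"
proof -
 have "(%x. sin (a * x)) = (%x. \<Sum>j<(1::nat). 1 * sin (a * x))" by simp
 then show ?thesis unfolding sinpoly_def by (intro exI)
qed

lemma sinpoly_0: "sinpoly (%x. 0)" using sinpoly_scale[OF sinpoly_sin, of 0] by simp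

lemma sinpoly_sum: "finite A ==> (!!a. a \<in> A ==> sinpoly (S a)) ==> sinpoly (%x. \<Sum>a\<in>A. S a x)"
 by (induction A rule: finite_induct) (auto intro: sinpoly_0 sinpoly_add)

lemma sinpoly_mult_sin_sq:
 assumes "sinpoly S" shows "sinpoly (%x. (sin x)^2 * S x)"
proof -
 obtain n :: nat and c p where e: "S = (%x. \<Sum>j<n. c j * sin (p j * x))" using assms unfolding sinpoly_def by (elim exE) (rule that)
 have *: "(sin x)^2 * sin (p * x) = 1/2 * sin (p * x) + (- 1/4 * sin ((p + 2) * x) + - 1/4 * sin ((p - 2) * x))" for p x :: real
 proof -
  have "sin ((p + 2) * x) + sin ((p - 2) * x) = 2 * sin (p * x) * cos (2 * x)" by (simp add: algebra_simps sin_add sin_diff)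
  then have "sin ((p + 2) * x) + sin ((p - 2) * x) = 2 * sin (p * x) * (1 - 2 * (sin x)^2)" by (simp only: cos_double_sin)
  moreover have "t * s = 1/2 * s + (- 1/4 * A + - 1/4 * B)" if "A + B = 2 * s * (1 - 2 * t)" for A B s t :: real
   using that by (simp add: algebra_simps)
  ultimately show ?thesis by blast
 qed
 have eq: "(%x. (sin x)^2 * S x) = (%x. \<Sum>j<n. c j * (1/2 * sin (p j * x) + (- 1/4 * sin ((p j + 2) * x) + - 1/4 * sin ((p j - 2) * x))))"
  unfolding e *[symmetric] by (simp add: sum_distrib_left algebra_simps)
 show ?thesis unfolding eq by (intro sinpoly_sum sinpoly_scale sinpoly_add sinpoly_sin) simp
qed

lemma sinpoly_sin_odd_power: "sinpoly (%x. sin x ^ (2 * j + 1))"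
proof (induction j)
 case 0
 show ?case using sinpoly_sin[of 1] by simp
next
 case (Suc j)
 from sinpoly_mult_sin_sq[OF this] show ?case by (simp add: power2_eq_square mult.assoc flip: power_Suc)
qed

text \<open>The odd primitive of the Landau kernel \<open>(1 - u^2) ^ N\<close>.\<close>

definition landau :: "nat => real => real" where
 "landau N u = (\<Sum>j\<le>N. (real (N choose j) * (- 1) ^ j / (2 * j + 1)) * u ^ (2 * j + 1))"

lemma landau_deriv: "(landau N has_real_derivative (1 - u^2) ^ N) (at u within A)"
proof -
 have "(1 - u^2) ^ N = (\<Sum>j\<le>N. real (N choose j) * (- u\<^sup>2) ^ j)" using binomial_ring[of "- u\<^sup>2" 1 N] by (simp add: algebra_simps)
 also have "\<dots> = (\<Sum>j\<le>N. (real (N choose j) * (- 1) ^ j / (2 * j + 1)) * ((2 * j + 1) * u ^ (2 * j)))"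
 proof (intro sum.cong refl)
  fix j
  have "(- u\<^sup>2) ^ j = (- 1) ^ j * u ^ (2 * j)" by (simp add: power_minus[of "u^2"] power_mult)
  then show "real (N choose j) * (- u\<^sup>2) ^ j = (real (N choose j) * (- 1) ^ j / (2 * j + 1)) * ((2 * j + 1) * u ^ (2 * j))" by simp
 qed
 finally have e: "(1 - u^2) ^ N = \<dots>" .
 have "((%u. u ^ (2 * j + 1)) has_real_derivative real (2 * j + 1) * u ^ (2 * j)) (at u within A)" for j
  using DERIV_pow[of "2 * j + 1" u A] by (simp add: add.commute)
 then show ?thesis unfolding landau_def[abs_def] e by (intro DERIV_sum DERIV_cmult)
qed

lemma landau_0 [simp]: "landau N 0 = 0" by (simp add: landau_def)

lemma landau_minus: "landau N (- u) = - landau N u" by (simp add: landau_def sum_negf[symmetric])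

lemma landau_mono:
 assumes "-1 <= u" "u <= v" "v <= 1" shows "landau N u <= landau N v"
proof (rule DERIV_nonneg_imp_nondecreasing[OF assms(2)])
 fix x assume "u <= x" "x <= v"
 then have "x^2 <= 1" using assms by (simp add: abs_square_le_1)
 then show "\<exists>y. DERIV (landau N) x :> y \<and> 0 <= y" using landau_deriv[of N x UNIV] by (intro exI[of _ "(1 - x^2) ^ N"]) simp
qed

text \<open>On \<open>[0, 1]\<close> the kernel is at least \<open>(1 - x) ^ N\<close>, whose
  integral is \<open>1 / (N + 1)\<close>.\<close>

lemma landau_1: "1 / (N + 1) <= landau N 1"
proof -
 define h where "h u = landau N u - 1 / (N + 1) * (1 - (1 - u) ^ Suc N)" for u :: real
 have "h 0 <= h 1"
 proof (rule DERIV_nonneg_imp_nondecreasing[of 0 1])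
  fix x :: real assume x: "0 <= x" "x <= 1"
  have "(h has_real_derivative ((1 - x^2) ^ N - (1 - x) ^ N)) (at x)" unfolding h_def[abs_def]
   by (rule derivative_eq_intros landau_deriv refl)+ (simp add: field_simps)
  moreover have "(1 - x) ^ N <= (1 - x^2) ^ N" using x by (intro power_mono) (auto simp: power2_eq_square mult_left_le)
  ultimately show "\<exists>y. DERIV h x :> y \<and> 0 <= y" by force
 qed simp
 then show ?thesis by (simp add: h_def add.commute)
qed

text \<open>The kernel decreases on \<open>[0, 1]\<close> and the remaining interval has length at
  most 1.\<close>

lemma landau_tail:
 assumes "0 <= u" "u <= 1" shows "landau N 1 - landau N u <= (1 - u^2) ^ N"
proof (cases "u < 1")
 case True
 obtain z where z: "u < z" "z < 1" "landau N 1 - landau N u = (1 - u) * (1 - z^2) ^ N"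
  using MVT2[OF True, of "landau N" "%z. (1 - z^2) ^ N"] landau_deriv by metis
 have z2: "z^2 <= 1" "u^2 <= z^2" using z assms by (auto simp: abs_square_le_1 intro!: power_mono)
 then have "(1 - z^2) ^ N <= (1 - u^2) ^ N" by (intro power_mono) auto
 then have "(1 - u) * (1 - z^2) ^ N <= 1 * (1 - u^2) ^ N" using assms z2 by (intro mult_mono) auto
 then show ?thesis using z by simp
qed (use assms in simp)

lemma half_le_sin: "0 <= x ==> x <= 1 ==> x / 2 <= sin (x::real)"
proof -
 assume x: "0 <= x" "x <= 1"
 have "sin 0 - 0 / 2 <= sin x - x / 2"
 proof (rule DERIV_nonneg_imp_nondecreasing[OF x(1), of "%x. sin x - x / 2"])
  fix y assume y: "0 <= y" "y <= x"
  have "cos (pi / 3) <= cos y" using y x pi_gt3 by (intro cos_monotone_0_pi_le) auto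
  then show "\<exists>d. ((%x. sin x - x / 2) has_real_derivative d) (at y) \<and> 0 <= d"
   by (intro exI[of _ "cos y - 1 / 2"]) (auto intro!: derivative_eq_intros simp: cos_60)
 qed
 then show ?thesis by simp
qed

text \<open>The argument \<open>x / m\<close> moves every fixed \<open>x\<close> into the region
  where the sine is monotone. There \<open>sin (x / m)\<close> is at least
  \<open>x / (2 * m)\<close>, and with exponent \<open>m ^ 4\<close> the kernel is at most
  \<open>exp (- (x ^ 2 * m ^ 2 / 4))\<close>, which beats the polynomial normalization.\<close>

definition sgn_approx :: "nat => real => real" where
 "sgn_approx m x = landau (m ^ 4) (sin (x / m)) / landau (m ^ 4) 1"

lemma landau_1_pos: "0 < landau N 1" by (rule less_le_trans[OF _ landau_1]) simp

lemma sgn_approx_sinpoly: "sinpoly (sgn_approx m)"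
proof -
 let ?N = "m ^ 4"
 have "sinpoly (%x. 1 / landau ?N 1 * landau ?N (sin x))"
  unfolding landau_def[of _ "sin _"] by (intro sinpoly_sum sinpoly_scale sinpoly_sin_odd_power) simp
 from sinpoly_rescale[OF this, of "1 / m"] show ?thesis by (simp add: sgn_approx_def[abs_def])
qed

lemma sgn_approx_minus: "sgn_approx m (- x) = - sgn_approx m x" by (simp add: sgn_approx_def landau_minus)

lemma sgn_approx_le_1: "\<bar>sgn_approx m x\<bar> <= 1"
proof -
 have "landau (m ^ 4) (sin (x / m)) <= landau (m ^ 4) 1" "- landau (m ^ 4) 1 <= landau (m ^ 4) (sin (x / m))"
  unfolding landau_minus[symmetric] by (auto intro!: landau_mono)
 then show ?thesis using landau_1_pos[of "m ^ 4"] by (simp add: sgn_approx_def abs_le_iff field_simps)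
qed

lemma sgn_approx_tendsto: "(%m. sgn_approx m x) \<longlonglongrightarrow> sgn x"
proof -
 have pos: "(%m. sgn_approx m x) \<longlonglongrightarrow> 1" if x: "x > 0" for x
 proof -
  have "(%m. 1 - sgn_approx m x) \<longlonglongrightarrow> 0"
  proof (rule tendsto_sandwich[OF _ _ tendsto_const])
   show "\<forall>\<^sub>F m in sequentially. 0 <= 1 - sgn_approx m x"
    using sgn_approx_le_1[of _ x] by (intro always_eventually) (auto simp: abs_le_iff)
   have "\<forall>\<^sub>F m in sequentially. real m > max 1 x" by real_asymp
   \<comment> \<open>The factor \<open>m ^ 4 + 1\<close> comes from \<open>landau_1\<close>, the
     exponential from \<open>landau_tail\<close> and \<open>half_le_sin\<close>.\<close>
   then show "\<forall>\<^sub>F m in sequentially. 1 - sgn_approx m x <= (real m ^ 4 + 1) * exp (- (x^2 / 4 * (real m)^2))"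
   proof eventually_elim
    case (elim m)
    define u where "u = sin (x / m)"
    have y: "0 <= x / m" "x / m <= 1" using x elim by auto
    have u: "x / m / 2 <= u" "u <= 1" unfolding u_def using half_le_sin[OF y] by auto
    have u0: "0 <= u" using order_trans[OF divide_nonneg_pos[OF y(1), of 2] u(1)] by simp
    have u2: "u^2 <= 1" using u u0 by (simp add: abs_square_le_1)
    have "1 - sgn_approx m x = (landau (m ^ 4) 1 - landau (m ^ 4) u) / landau (m ^ 4) 1"
     using landau_1_pos[of "m ^ 4"] by (simp add: sgn_approx_def u_def field_simps)
    also have "\<dots> <= (1 - u^2) ^ (m ^ 4) / (1 / (m ^ 4 + 1))"
     using landau_1[of "m ^ 4"] landau_tail[OF u0 u(2), of "m ^ 4"] landau_1_pos[of "m ^ 4"] u2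
     by (intro frac_le) (auto simp: add.commute add_pos_nonneg)
    also have "\<dots> = (real m ^ 4 + 1) * (1 - u^2) ^ (m ^ 4)" by simp
    also have "(1 - u^2) ^ (m ^ 4) <= exp (- u\<^sup>2) ^ (m ^ 4)" using u2 exp_ge_add_one_self[of "- u\<^sup>2"] by (intro power_mono) auto
    also have "\<dots> = exp (- (u^2 * real m ^ 4))" by (simp flip: exp_of_nat_mult add: mult.commute)
    also have "\<dots> <= exp (- (x^2 / 4 * (real m)^2))"
    proof -
     have "(x / m / 2)^2 * real m ^ 4 <= u^2 * real m ^ 4" using u y by (intro mult_right_mono power_mono) auto
     also have "(x / m / 2)^2 * real m ^ 4 = x^2 / 4 * (real m)^2" using elim by (simp add: power2_eq_square power4_eq_xxxx field_simps)
     finally show ?thesis by simp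
    qed
    finally show ?case by (simp add: mult_left_mono)
   qed
   define a where "a = x^2 / 4"
   have "a > 0" using x by (simp add: a_def)
   then have "(%m. (real m ^ 4 + 1) * exp (- (a * (real m)^2))) \<longlonglongrightarrow> 0" by real_asymp
   then show "(%m. (real m ^ 4 + 1) * exp (- (x^2 / 4 * (real m)^2))) \<longlonglongrightarrow> 0" by (simp add: a_def)
  qed
  from tendsto_diff[OF tendsto_const this, of 1] show ?thesis by simp
 qed
 consider "x > 0" | "x = 0" | "x < 0" by linarith
 then show ?thesis
 proof cases
  case 2
  then show ?thesis by (simp add: sgn_approx_def)
 next
  case 3
  then have "(%m. - sgn_approx m (- x)) \<longlonglongrightarrow> - 1" by (intro tendsto_minus pos) simp
  then show ?thesis using 3 by (simp add: sgn_approx_minus)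
 qed (use pos in simp)
qed

section \<open>Sign products as limits of cosine sums\<close>

context gauss_vec
begin

lemma trig_cos: "in_span e w ==> trig e (%s. cos (Z w s))"
proof -
 assume "in_span e w"
 then obtain \<alpha> where \<alpha>: "!!i. i \<in> J ==> w i = (\<Sum>a<3. \<alpha> a * e a i)" unfolding in_span_def by blast
 have "(%s. cos (Z w s)) = (%s. \<Sum>j<(1::nat). 1 * cos (Z (%i. \<Sum>a<3. \<alpha> a * e a i) s))" using Z_cong[OF \<alpha>] by simp
 then show ?thesis unfolding trig_def by (intro exI)
qed

lemma trig_scale: "trig e f ==> trig e (%s. a * f s)"
proof -
 assume "trig e f"
 then obtain n :: nat and c x where "f = (%s. \<Sum>j<n. c j * cos (Z (%i. \<Sum>a<3. x j a * e a i) s))" unfolding trig_def by (elim exE) (rule that)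
 then have "(%s. a * f s) = (%s. \<Sum>j<n. (a * c j) * cos (Z (%i. \<Sum>a<3. x j a * e a i) s))" by (simp add: sum_distrib_left mult.assoc)
 then show ?thesis unfolding trig_def by (intro exI)
qed

lemma trig_add: "trig e f ==> trig e g ==> trig e (%s. f s + g s)"
proof -
 assume "trig e f" "trig e g"
 then obtain m n :: nat and c x d y where e: "f = (%s. \<Sum>j<m. c j * cos (Z (%i. \<Sum>a<3. x j a * e a i) s))"
  "g = (%s. \<Sum>j<n. d j * cos (Z (%i. \<Sum>a<3. y j a * e a i) s))" unfolding trig_def by (elim exE) (rule that)
 have "(%s. f s + g s) = (%s. \<Sum>j<m + n. (if j < m then c j else d (j - m)) *
    cos (Z (%i. \<Sum>a<3. (if j < m then x j else y (j - m)) a * e a i) s))" unfolding e sum_append_nat[symmetric] by (intro ext sum.cong) auto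
 then show ?thesis unfolding trig_def by (intro exI)
qed

lemma in_span_0: "in_span e (%_. 0)" unfolding in_span_def by (intro exI[of _ "%_. 0"]) simp

lemma in_span_lin: "in_span e u ==> in_span e v ==> in_span e (%i. p * u i + q * v i)" unfolding in_span_def
proof (elim exE)
 fix \<alpha> be assume "\<forall>i\<in>J. u i = (\<Sum>a<3. \<alpha> a * e a i)" "\<forall>i\<in>J. v i = (\<Sum>a<3. be a * e a i)"
 then show "\<exists>\<alpha>. \<forall>i\<in>J. p * u i + q * v i = (\<Sum>a<3. \<alpha> a * e a i)"
  by (intro exI[of _ "%a. p * \<alpha> a + q * be a"]) (simp add: sum.distrib sum_distrib_left algebra_simps)
qed

lemma trig_const: "trig e (%s. a)" using trig_scale[OF trig_cos[OF in_span_0], of e a] by (simp add: Z_def)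

lemma trig_sum: "finite A ==> (!!a. a \<in> A ==> trig e (S a)) ==> trig e (%x. \<Sum>a\<in>A. S a x)"
 by (induction A rule: finite_induct) (auto intro: trig_const trig_add)

text \<open>The product of two odd sums is even: the product formula turns two sines into cosines of
  a difference and a sum of functionals.\<close>

lemma trig_sinpoly_mult:
 assumes S: "sinpoly S" and T: "sinpoly T" and u: "in_span e u" and v: "in_span e v"
 shows "trig e (%s. S (Z u s) * T (Z v s))"
proof -
 obtain n :: nat and c p where S: "S = (%x. \<Sum>j<n. c j * sin (p j * x))" using S unfolding sinpoly_def by (elim exE) (rule that)
 obtain m :: nat and d q where T: "T = (%x. \<Sum>j<m. d j * sin (q j * x))" using T unfolding sinpoly_def by (elim exE) (rule that)
 have ss: "sin (p * Z u s) * sin (q * Z v s) = 1/2 * cos (Z (%i. p * u i + (- q) * v i) s)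
   + (-1/2) * cos (Z (%i. p * u i + q * v i) s)" for p q s unfolding Z_lin by (simp add: sin_times_sin)
 have eq: "(%s. S (Z u s) * T (Z v s)) = (%s. \<Sum>j<n. \<Sum>k<m. (c j * d k) * (1/2 * cos (Z (%i. p j * u i + (- q k) * v i) s)
   + (-1/2) * cos (Z (%i. p j * u i + q k * v i) s)))" unfolding ss[symmetric] S T by (simp add: sum_product algebra_simps)
 show ?thesis unfolding eq by (intro trig_sum trig_scale trig_add trig_cos in_span_lin u v) auto
qed

lemma limtrig_trig: "trig e f ==> (!!s. \<bar>f s\<bar> <= B) ==> limtrig e f" unfolding limtrig_def by (intro exI[of _ "%_. f"] exI[of _ B]) auto

lemma limtrig_const: "limtrig e (%s. a)" by (rule limtrig_trig[OF trig_const, of _ "\<bar>a\<bar>"]) simp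

lemma limtrig_lin:
 assumes "limtrig e f" "limtrig e g" shows "limtrig e (%s. p * f s + q * g s)"
proof -
 obtain F B where F: "!!m. trig e (F m)" "!!m s. \<bar>F m s\<bar> <= B" "!!s. (%m. F m s) \<longlonglongrightarrow> f s"
  using assms(1) unfolding limtrig_def by blast
 obtain G C where G: "!!m. trig e (G m)" "!!m s. \<bar>G m s\<bar> <= C" "!!s. (%m. G m s) \<longlonglongrightarrow> g s"
  using assms(2) unfolding limtrig_def by blast
 have "trig e (%s. p * F m s + q * G m s)" for m by (intro trig_add trig_scale F G)
 moreover have "\<bar>p * F m s + q * G m s\<bar> <= \<bar>p\<bar> * B + \<bar>q\<bar> * C" for m s
  by (rule order_trans[OF abs_triangle_ineq]) (auto simp: abs_mult intro!: add_mono mult_left_mono F G)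
 moreover have "(%m. p * F m s + q * G m s) \<longlonglongrightarrow> p * f s + q * g s" for s by (intro tendsto_intros F G)
 ultimately show ?thesis unfolding limtrig_def
  by (intro exI[of _ "%m s. p * F m s + q * G m s"] exI[of _ "\<bar>p\<bar> * B + \<bar>q\<bar> * C"]) auto
qed

lemma limtrig_sgn_mult:
 assumes "in_span e u" "in_span e v"
 shows "limtrig e (%s. sgn (Z u s) * sgn (Z v s))" unfolding limtrig_def
proof (intro exI[of _ "%m s. sgn_approx m (Z u s) * sgn_approx m (Z v s)"] exI[of _ 1] conjI allI)
 show "trig e (%s. sgn_approx m (Z u s) * sgn_approx m (Z v s))" for m by (intro trig_sinpoly_mult sgn_approx_sinpoly assms)
 show "\<bar>sgn_approx m (Z u s) * sgn_approx m (Z v s)\<bar> <= 1" for m s using sgn_approx_le_1 by (simp add: abs_mult mult_le_one)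
 show "(%m. sgn_approx m (Z u s) * sgn_approx m (Z v s)) \<longlonglongrightarrow> sgn (Z u s) * sgn (Z v s)" for s
  by (intro tendsto_mult sgn_approx_tendsto)
qed

end

subsection \<open>Characteristic functions of trigonometric statistics\<close>

text \<open>Used to differentiate under an expectation, where the Taylor remainder is controlled by
  a second moment.\<close>

lemma DERIV_of_quadratic_bound:
 fixes f :: "real => real"
 assumes "!!d. \<bar>f (s + d) - f s - d * D\<bar> <= C * d^2"
 shows "(f has_real_derivative D) (at s)" unfolding DERIV_def
proof (rule LIM_I)
 fix r :: real assume r: "r > 0"
 show "\<exists>e>0. \<forall>x. x ~= 0 \<and> norm (x - 0) < e --> norm ((f (s + x) - f s) / x - D) < r"
 proof (intro exI[of _ "r / (\<bar>C\<bar> + 1)"] conjI allI impI)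
  fix x :: real assume x: "x ~= 0 \<and> norm (x - 0) < r / (\<bar>C\<bar> + 1)"
  have e: "(f (s + x) - f s) / x - D = (f (s + x) - f s - x * D) / x" using x by (simp add: field_simps)
  have x2: "x^2 = \<bar>x\<bar> * \<bar>x\<bar>" by (simp add: power2_eq_square)
  have "norm ((f (s + x) - f s) / x - D) = \<bar>f (s + x) - f s - x * D\<bar> / \<bar>x\<bar>" unfolding e by (simp only: real_norm_def abs_divide)
  also have "\<dots> <= (C * x^2) / \<bar>x\<bar>" by (intro divide_right_mono assms) simp
  also have "\<dots> = C * \<bar>x\<bar>"
   unfolding x2 using x by (simp only: mult.assoc[symmetric] nonzero_mult_div_cancel_right abs_eq_0 not_False_eq_True)
  also have "\<dots> <= (\<bar>C\<bar> + 1) * \<bar>x\<bar>" by (intro mult_right_mono) auto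
  also have "\<dots> < r" using x by (simp add: field_simps)
  finally show "norm ((f (s + x) - f s) / x - D) < r" .
 qed (use r in auto)
qed

lemma cos_taylor2:
 fixes a b :: real
 shows "\<bar>cos (a + b) - cos a + b * sin a\<bar> <= b^2"
proof -
 define z where "z = iexp a * (iexp b - (1 + \<i> * b))"
 have "(\<Sum>k\<le>1. (\<i> * b) ^ k / fact k) = 1 + \<i> * b" by simp
 then have "cmod (iexp b - (1 + \<i> * b)) <= b^2 / 2" using iexp_approx1[of b 1] by (simp add: power2_eq_square)
 then have z: "cmod z <= b^2" unfolding z_def norm_mult norm_exp_i_times using zero_le_power2[of b] by linarith
 have "Re z = cos (a + b) - cos a + b * sin a" unfolding z_def by (simp add: Re_exp Im_exp cos_add sin_add algebra_simps)
 then show ?thesis using abs_Re_le_cmod[of z] z by simp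
qed

lemma sin_taylor2: "\<bar>sin (a + b) - sin a - b * cos a\<bar> <= b^2" for a b :: real
 using cos_taylor2[of "a - pi / 2" b] by (simp add: cos_add cos_diff sin_diff sin_add algebra_simps)

context gauss_vec
begin

text \<open>Phase and weight make one statement serve twice: with a weight for the interpolation in
  \<open>stein_step\<close>, and with a phase for the characteristic function in
  \<open>trig_stat_char\<close>, where the phase \<open>- pi / 2\<close> produces the sine.\<close>

lemma DERIV_expectation_cos:
 assumes [measurable]: "X \<in> borel_measurable M" "G \<in> borel_measurable M"
  and X2: "integrable M (%s. (X s)^2)" and G: "!!s. \<bar>G s\<bar> <= B"
 shows "((%t. expectation (%s. cos (t * X s + p) * G s)) has_real_derivative
   - expectation (%s. X s * sin (t * X s + p) * G s)) (at t)"
proof -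
 have B: "B >= 0" using G[of undefined] by linarith
 have X: "integrable M X" by (rule square_integrable_imp_integrable[OF _ X2]) simp
 have b1: "integrable M (%s. f s * G s)" if "f \<in> borel_measurable M" "!!s. \<bar>f s\<bar> <= 1" for f
 proof (rule integrable_bounded[where B="1 * B"])
  show "\<bar>f s * G s\<bar> <= 1 * B" for s unfolding abs_mult using that G by (intro mult_mono) auto
 qed (use that in simp)
 have b2: "integrable M (%s. X s * f s * G s)" if [measurable]: "f \<in> borel_measurable M" and f: "!!s. \<bar>f s\<bar> <= 1" for f
 proof (rule Bochner_Integration.integrable_bound)
  show "integrable M (%s. B * X s)" using X by simp
  have "\<bar>X s\<bar> * (\<bar>f s\<bar> * \<bar>G s\<bar>) <= \<bar>X s\<bar> * (1 * B)" for s using f G B by (intro mult_left_mono mult_mono) auto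
  then show "AE s in M. norm (X s * f s * G s) <= norm (B * X s)" using B by (auto simp: abs_mult mult_ac)
 qed simp
 have key: "\<bar>expectation (%s. F s)\<bar> <= (B * expectation (%s. (X s)^2)) * d^2"
  if "integrable M F" "!!s. \<bar>F s\<bar> <= (d * X s)^2 * B" for F and d :: real
 proof -
  have "\<bar>expectation F\<bar> <= expectation (%s. \<bar>F s\<bar>)" by (rule integral_abs_bound)
  also have "\<dots> <= expectation (%s. (B * d^2) * (X s)^2)" using that X2 by (intro integral_mono) (auto simp: power_mult_distrib mult_ac)
  finally show ?thesis by (simp add: mult_ac)
 qed
 show ?thesis
 proof (rule DERIV_of_quadratic_bound)
  fix d
  let ?F = "%s. (cos (t * X s + p + d * X s) - cos (t * X s + p) + d * X s * sin (t * X s + p)) * G s"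
  have i: "integrable M (%s. cos ((t + d) * X s + p) * G s)" "integrable M (%s. cos (t * X s + p) * G s)"
    "integrable M (%s. X s * sin (t * X s + p) * G s)" by (intro b1 b2; simp)+
  have F: "?F = (%s. cos ((t + d) * X s + p) * G s - cos (t * X s + p) * G s - d * - (X s * sin (t * X s + p) * G s))" by (auto simp: algebra_simps)
  have "\<bar>expectation ?F\<bar> <= (B * expectation (%s. (X s)^2)) * d^2"
  proof (rule key)
   show "integrable M ?F" unfolding F using i by simp
   show "\<bar>?F s\<bar> <= (d * X s)^2 * B" for s unfolding abs_mult using cos_taylor2[of "t * X s + p" "d * X s"] G B by (intro mult_mono) auto
  qed
  then show "\<bar>expectation (%s. cos ((t + d) * X s + p) * G s) - expectation (%s. cos (t * X s + p) * G s)
   - d * - expectation (%s. X s * sin (t * X s + p) * G s)\<bar> <= (B * expectation (%s. (X s)^2)) * d^2" unfolding F using i by simp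
 qed
qed

lemma cv_sin_sin_le:
 "\<bar>cv (%s. sin (Z a s) * sin (Z b s)) (%s. sin (Z c s) * sin (Z d s))\<bar>
  <= \<bar>ip J a c\<bar> + \<bar>ip J a d\<bar> + \<bar>ip J b c\<bar> + \<bar>ip J b d\<bar>"
proof -
 have ss: "sin (Z a s) * sin (Z b s) = (cos (Z (%i. a i - b i) s) - cos (Z (%i. a i + b i) s)) / 2" for a b s
  unfolding Z_add Z_diff by (simp add: sin_times_sin)
 have int: "integrable M (%s. cos (Z u s) * cos (Z v s))" for u v by (rule integrable_bounded[where B=1]) (auto simp: abs_mult intro!: mult_le_one)
 define K where "K u v = expectation (%s. cos (Z u s) * cos (Z v s)) - expectation (%s. cos (Z u s)) * expectation (%s. cos (Z v s))" for u v
 have e: "expectation (%s. (cos (Z u1 s) - cos (Z u2 s)) / 2 * ((cos (Z v1 s) - cos (Z v2 s)) / 2))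
  = (expectation (%s. cos (Z u1 s) * cos (Z v1 s)) - expectation (%s. cos (Z u1 s) * cos (Z v2 s))
   - expectation (%s. cos (Z u2 s) * cos (Z v1 s)) + expectation (%s. cos (Z u2 s) * cos (Z v2 s))) / 4" for u1 u2 v1 v2
 proof -
  have "(%s. (cos (Z u1 s) - cos (Z u2 s)) / 2 * ((cos (Z v1 s) - cos (Z v2 s)) / 2)) = (%s. (cos (Z u1 s) * cos (Z v1 s) -
   cos (Z u1 s) * cos (Z v2 s) - cos (Z u2 s) * cos (Z v1 s) + cos (Z u2 s) * cos (Z v2 s)) / 4)" by (auto simp: algebra_simps)
  then show ?thesis using int by simp
 qed
 have "cv (%s. (cos (Z u1 s) - cos (Z u2 s)) / 2) (%s. (cos (Z v1 s) - cos (Z v2 s)) / 2)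
  = (K u1 v1 - K u1 v2 - K u2 v1 + K u2 v2) / 4" for u1 u2 v1 v2 unfolding cv_def e K_def by (simp add: field_simps)
 note cvK = this
 have Kb: "\<bar>K u v\<bar> <= \<bar>ip J u v\<bar>" for u v unfolding K_def by (rule cov_cos_cos_le)
 have "\<bar>cv (%s. (cos (Z u1 s) - cos (Z u2 s)) / 2) (%s. (cos (Z v1 s) - cos (Z v2 s)) / 2)\<bar>
  <= (\<bar>ip J u1 v1\<bar> + \<bar>ip J u1 v2\<bar> + \<bar>ip J u2 v1\<bar> + \<bar>ip J u2 v2\<bar>) / 4" for u1 u2 v1 v2
 proof -
  have aux: "\<bar>(p - q - r + t) / 4\<bar> <= (P + Q + R + T) / 4"
   if "\<bar>p\<bar> <= P" "\<bar>q\<bar> <= Q" "\<bar>r\<bar> <= R" "\<bar>t\<bar> <= T" for p q r t P Q R T :: real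
   using that by (auto simp: abs_le_iff)
  show ?thesis unfolding cvK by (intro aux Kb)
 qed
 note this[of "%i. a i - b i" "%i. a i + b i" "%i. c i - d i" "%i. c i + d i"]
 also have "(\<bar>ip J (%i. a i - b i) (%i. c i - d i)\<bar> + \<bar>ip J (%i. a i - b i) (%i. c i + d i)\<bar>
   + \<bar>ip J (%i. a i + b i) (%i. c i - d i)\<bar> + \<bar>ip J (%i. a i + b i) (%i. c i + d i)\<bar>) / 4
   <= \<bar>ip J a c\<bar> + \<bar>ip J a d\<bar> + \<bar>ip J b c\<bar> + \<bar>ip J b d\<bar>"
 proof -
  have av: "(p + q + r + t) / 4 <= S" if "p <= S" "q <= S" "r <= S" "t <= S" for p q r t S :: real using that by simp
  have tri: "\<bar>x + y + (z + w)\<bar> <= \<bar>x\<bar> + \<bar>y\<bar> + \<bar>z\<bar> + \<bar>w\<bar>" for x y z w :: real by linarith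
  show ?thesis unfolding ip_simps
   using tri[of "ip J a c" "- ip J a d" "- ip J b c" "ip J b d"] tri[of "ip J a c" "ip J a d" "- ip J b c" "- ip J b d"]
    tri[of "ip J a c" "- ip J a d" "ip J b c" "- ip J b d"] tri[of "ip J a c" "ip J a d" "ip J b c" "ip J b d"]
   by (intro av) (simp_all add: algebra_simps)
 qed
 finally show ?thesis unfolding ss .
qed

lemma cv_sum_sum:
 assumes [measurable]: "!!m. m \<in> A ==> f m \<in> borel_measurable M"
  and f: "!!m s. m \<in> A ==> \<bar>f m s\<bar> <= B"
 shows "cv (%s. \<Sum>m\<in>A. b m * f m s) (%s. \<Sum>m\<in>A. b m * f m s) = (\<Sum>m\<in>A. \<Sum>k\<in>A. b m * b k * cv (f m) (f k))"
proof -
 have i1: "integrable M (f m)" if "m \<in> A" for m by (rule integrable_bounded[OF _ f]) (use that in auto)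
 have i2: "integrable M (%s. f m s * f k s)" if "m \<in> A" "k \<in> A" for m k
 proof (rule integrable_bounded[where B="B * B"])
  have "B >= 0" using f[OF that(1), of undefined] by linarith
  then show "\<bar>f m s * f k s\<bar> <= B * B" for s unfolding abs_mult using f that by (intro mult_mono) auto
 qed (use that in simp)
 have 1: "expectation (%s. (\<Sum>m\<in>A. b m * f m s) * (\<Sum>m\<in>A. b m * f m s)) = (\<Sum>m\<in>A. \<Sum>k\<in>A. b m * b k * expectation (%s. f m s * f k s))"
 proof -
  have "(%s. (\<Sum>m\<in>A. b m * f m s) * (\<Sum>m\<in>A. b m * f m s)) = (%s. \<Sum>m\<in>A. \<Sum>k\<in>A. b m * b k * (f m s * f k s))"
   by (auto simp: sum_product algebra_simps)
  then show ?thesis using i2 by (simp add: Bochner_Integration.integral_sum)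
 qed
 have 2: "expectation (%s. \<Sum>m\<in>A. b m * f m s) = (\<Sum>m\<in>A. b m * expectation (f m))"
  using i1 by (simp add: Bochner_Integration.integral_sum)
 show ?thesis unfolding cv_def 1 2 by (simp add: sum_product sum_subtractf[symmetric] algebra_simps)
qed

text \<open>The double sum of sines is the derivative of the Stein interpolation. Its variance is a
  fourfold sum whose coefficients supply two Gram factors and whose covariances supply a third one
  linking the two pairs.\<close>

lemma variance_sin_sin_sum_le:
 fixes th :: "'m => 'i => real" and La :: real
 assumes A: "finite A" and La: "!!m. m \<in> A ==> (\<Sum>k\<in>A. \<bar>ip J (th m) (th k)\<bar>) <= La"
  and s: "0 <= s" "s <= 1" and b: "!!m k. m \<in> A ==> k \<in> A ==> \<bar>b m k\<bar> <= be * \<bar>ip J (th m) (th k)\<bar>" and be: "be >= 0"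
 defines "T \<equiv> (%x. \<Sum>(m, k)\<in>A \<times> A. b m k * (sin (Z (%i. s * th m i) x) * sin (Z (th k) x)))"
 shows "cv T T <= be^2 * (4 * card A * La ^ 3)"
proof (cases "A = {}")
 case True
 then show ?thesis by (simp add: T_def cv_def)
next
 case False
 then obtain m0 where "m0 \<in> A" by blast
 have "0 <= (\<Sum>k\<in>A. \<bar>ip J (th m0) (th k)\<bar>)" by (rule sum_nonneg) simp
 then have La0: "La >= 0" using La[OF \<open>m0 \<in> A\<close>] by linarith
 define g where "g m k = \<bar>ip J (th m) (th k)\<bar>" for m k
 have gs: "g m k = g k m" for m k by (simp add: g_def ip_commute)
 have g0: "g m k >= 0" for m k by (simp add: g_def)
 have row: "(\<Sum>k\<in>A. g m k) <= La" if "m \<in> A" for m using La[OF that] by (simp add: g_def)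
 have row': "(\<Sum>m\<in>A. g m k) <= La" if "k \<in> A" for k using row[OF that] by (simp add: gs)
 have T: "T = (%x. \<Sum>p\<in>A \<times> A. b (fst p) (snd p) * (sin (Z (%i. s * th (fst p) i) x) * sin (Z (th (snd p)) x)))"
  by (simp add: T_def case_prod_unfold)
 have cvb: "\<bar>cv (%x. sin (Z (%i. s * th m i) x) * sin (Z (th k) x)) (%x. sin (Z (%i. s * th m' i) x) * sin (Z (th k') x))\<bar>
  <= g m m' + g m k' + g k m' + g k k'" for m k m' k'
 proof -
  have le: "s * x <= x" if "x >= 0" for x using s that by (simp add: mult_left_le_one_le)
  have le2: "s * (s * x) <= x" if "x >= 0" for x using le[OF mult_nonneg_nonneg[OF s(1) that]] le[OF that] by linarith
  show ?thesis by (rule order_trans[OF cv_sin_sin_le]) (use s in \<open>auto simp: ip_simps abs_mult g_def intro!: add_mono le le2\<close>)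
 qed
 have "cv T T = (\<Sum>p\<in>A \<times> A. \<Sum>q\<in>A \<times> A. b (fst p) (snd p) * b (fst q) (snd q) *
  cv (%x. sin (Z (%i. s * th (fst p) i) x) * sin (Z (th (snd p)) x)) (%x. sin (Z (%i. s * th (fst q) i) x) * sin (Z (th (snd q)) x)))"
  unfolding T by (rule cv_sum_sum[where B=1]) (auto simp: abs_mult intro!: mult_le_one)
 also have "\<dots> <= (\<Sum>p\<in>A \<times> A. \<Sum>q\<in>A \<times> A. (be * g (fst p) (snd p)) * (be * g (fst q) (snd q)) *
   (g (fst p) (fst q) + g (fst p) (snd q) + g (snd p) (fst q) + g (snd p) (snd q)))"
 proof (intro sum_mono)
  fix p q assume "p \<in> A \<times> A" "q \<in> A \<times> A"
  then have bb: "\<bar>b (fst p) (snd p)\<bar> <= be * g (fst p) (snd p)" "\<bar>b (fst q) (snd q)\<bar> <= be * g (fst q) (snd q)"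
   using b by (auto simp: g_def)
  show "b (fst p) (snd p) * b (fst q) (snd q) *
  cv (%x. sin (Z (%i. s * th (fst p) i) x) * sin (Z (th (snd p)) x)) (%x. sin (Z (%i. s * th (fst q) i) x) * sin (Z (th (snd q)) x))
  <= (be * g (fst p) (snd p)) * (be * g (fst q) (snd q)) *
   (g (fst p) (fst q) + g (fst p) (snd q) + g (snd p) (fst q) + g (snd p) (snd q))"
   by (rule order_trans[OF abs_ge_self], unfold abs_mult, intro mult_mono bb cvb)
    (auto intro!: mult_nonneg_nonneg add_nonneg_nonneg g0 be)
 qed
 also have "\<dots> = be^2 * (\<Sum>m\<in>A. \<Sum>k\<in>A. \<Sum>m'\<in>A. \<Sum>k'\<in>A. g m k * g m' k' * (g m m' + g m k' + g k m' + g k k'))"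
  by (simp add: sum.cartesian_product' sum_distrib_left power2_eq_square algebra_simps)
 \<comment> \<open>In each of the four sums the three Gram factors form a path through all four
   indices. Summing along the path costs \<open>La\<close> for each edge and \<open>card A\<close>
   for the starting point.\<close>
 also have "(\<Sum>m\<in>A. \<Sum>k\<in>A. \<Sum>m'\<in>A. \<Sum>k'\<in>A. g m k * g m' k' * (g m m' + g m k' + g k m' + g k k'))
  = (\<Sum>m\<in>A. \<Sum>k\<in>A. \<Sum>m'\<in>A. \<Sum>k'\<in>A. g m k * (g m m' * g m' k')) + (\<Sum>m\<in>A. \<Sum>k\<in>A. \<Sum>m'\<in>A. \<Sum>k'\<in>A. g m k * (g m k' * g k' m'))
  + (\<Sum>m\<in>A. \<Sum>k\<in>A. \<Sum>m'\<in>A. \<Sum>k'\<in>A. g m k * (g k m' * g m' k')) + (\<Sum>m\<in>A. \<Sum>k\<in>A. \<Sum>m'\<in>A. \<Sum>k'\<in>A. g m k * (g k k' * g k' m'))"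
  unfolding sum.distrib[symmetric] by (intro sum.cong refl) (simp add: distrib_left mult_ac gs)
 also have "\<dots> <= card A * La ^ 3 + card A * La ^ 3 + card A * La ^ 3 + card A * La ^ 3"
 proof -
  have in2: "(\<Sum>m'\<in>A. \<Sum>k'\<in>A. g m m' * g m' k') <= La * La" if "m \<in> A" for m
  proof -
   have "(\<Sum>m'\<in>A. \<Sum>k'\<in>A. g m m' * g m' k') <= (\<Sum>m'\<in>A. g m m' * La)"
    unfolding sum_distrib_left[symmetric] by (intro sum_mono mult_left_mono row g0)
   also have "\<dots> <= La * La" unfolding sum_distrib_right[symmetric] by (intro mult_right_mono row that La0)
   finally show ?thesis .
  qed
  have in2': "(\<Sum>m'\<in>A. \<Sum>k'\<in>A. g m k' * g k' m') <= La * La" if "m \<in> A" for m by (subst sum.swap) (rule in2[OF that])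
  have a: "(\<Sum>m\<in>A. \<Sum>k\<in>A. \<Sum>m'\<in>A. \<Sum>k'\<in>A. g m k * h m k m' k') <= card A * La ^ 3"
   if h: "!!m k. m \<in> A ==> k \<in> A ==> (\<Sum>m'\<in>A. \<Sum>k'\<in>A. h m k m' k') <= La * La" for h
  proof -
   have "(\<Sum>m\<in>A. \<Sum>k\<in>A. \<Sum>m'\<in>A. \<Sum>k'\<in>A. g m k * h m k m' k') <= (\<Sum>m\<in>A. \<Sum>k\<in>A. g m k * (La * La))"
    unfolding sum_distrib_left[symmetric] by (intro sum_mono mult_left_mono h g0)
   also have "\<dots> <= (\<Sum>m\<in>A. La * (La * La))"
    unfolding sum_distrib_right[symmetric] by (intro sum_mono mult_right_mono row) (use La0 in auto)
   finally show ?thesis by (simp add: power3_eq_cube mult.assoc)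
  qed
  show ?thesis by (intro add_mono a in2 in2')
 qed
 finally show ?thesis by (simp add: mult_left_mono)
qed

end

section \<open>Stein's method for centred sums of cosines\<close>

context gauss_vec
begin

lemma cv_eq_centered:
 fixes f g :: "'s => real"
 assumes "integrable M f" "integrable M g" "integrable M (%s. f s * g s)"
 shows "cv f g = expectation (%s. (f s - expectation f) * (g s - expectation g))"
proof -
 have "(%s. (f s - expectation f) * (g s - expectation g))
  = (%s. f s * g s - expectation g * f s - expectation f * g s + expectation f * expectation g)" by (auto simp: algebra_simps)
 then show ?thesis using assms by (simp add: cv_def prob_space)
qed

lemma cv_Cauchy:
 fixes f g :: "'s => real"
 assumes [measurable]: "f \<in> borel_measurable M" "g \<in> borel_measurable M"
  and i2: "integrable M (%s. (f s)^2)" "integrable M (%s. (g s)^2)"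
 shows "\<bar>cv f g\<bar> <= sqrt (cv f f) * sqrt (cv g g)"
proof -
 have i: "integrable M f" "integrable M g" using i2 by (auto intro: square_integrable_imp_integrable)
 have ifg: "integrable M (%s. f s * g s)" by (rule expectation_Cauchy(2)) (use i2 in auto)
 have i2': "integrable M (%s. (f s - expectation f)^2)" "integrable M (%s. (g s - expectation g)^2)" unfolding power2_diff using i i2 by auto
 have cc: "cv f f = expectation (%s. (f s - expectation f)^2)" "cv g g = expectation (%s. (g s - expectation g)^2)"
  using cv_eq_centered[OF i(1) i(1)] cv_eq_centered[OF i(2) i(2)] i2 by (simp_all add: power2_eq_square)
 show ?thesis unfolding cc cv_eq_centered[OF i ifg] by (rule expectation_Cauchy(1)) (use i2' in auto)
qed

lemma cv_self: "integrable M (%s. (f s)^2) ==> f \<in> borel_measurable M ==> cv f f = variance f"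
 by (subst variance_eq[OF square_integrable_imp_integrable]) (simp_all add: cv_def power2_eq_square)

text \<open>The subtracted exponential is the expectation of the cosine, so the statistic is
  centred.\<close>

definition trig_stat :: "'m set => ('m => real) => ('m => 'i => real) => 's => real" where
 "trig_stat A c th s = (\<Sum>m\<in>A. c m * (cos (Z (th m) s) - exp (- ip J (th m) (th m) / 2)))"

lemma trig_stat_meas [measurable]: "trig_stat A c th \<in> borel_measurable M" unfolding trig_stat_def[abs_def] by measurable

lemma abs_cos_minus_exp: "x >= 0 ==> \<bar>cos y - exp (- (x / 2))\<bar> <= (2::real)"
proof -
 assume "x >= 0"
 then have "exp (- (x / 2)) <= 1" by simp
 moreover have "exp (- (x / 2)) > 0" "cos y <= 1" "- 1 <= cos y" by auto
 ultimately show ?thesis by linarith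
qed

lemma trig_stat_bounded: "\<bar>trig_stat A c th s\<bar> <= (\<Sum>m\<in>A. \<bar>c m\<bar> * 2)" unfolding trig_stat_def
 by (rule order_trans[OF sum_abs]) (auto simp: abs_mult intro!: sum_mono mult_left_mono abs_cos_minus_exp)

text \<open>The functional \<open>Z\<close> transported to the space of coordinate vectors, where
  partial derivatives make sense.\<close>

definition lin :: "('i => real) => ('i => real) => real" where
 "lin w x = (\<Sum>i\<in>J. w i * x i)"

lemma lin_vec: "lin w (vec s) = Z w s" by (simp add: lin_def Z_def)

lemma lin_meas [measurable]: "lin w \<in> borel_measurable (PiM J (%_. borel))" unfolding lin_def[abs_def] by measurable

lemma DERIV_lin:
 assumes "k \<in> J" shows "((%y. lin w (x(k := y))) has_real_derivative w k) (at y)"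
proof -
 have e: "lin w (x(k := y)) = w k * y + (\<Sum>i\<in>J - {k}. w i * x i)" for y
  unfolding lin_def using assms fin by (subst sum.remove[of J k]) (auto intro!: sum.cong)
 show ?thesis unfolding e by (auto intro!: derivative_eq_intros)
qed

lemma isCont_lin: "k \<in> J ==> isCont (%y. lin w (x(k := y))) y" by (rule DERIV_isCont[OF DERIV_lin])

text \<open>One Stein step. The interpolation \<open>K s\<close> between the independent (\<open>s = 0\<close>) and the actual
 (\<open>s = 1\<close>) situation has, after integration by parts, the covariance of \<open>h' (t W)\<close> with a double sum of
 sines as its derivative.\<close>

lemma stein_step:
 fixes th :: "'m => 'i => real" and La ka t :: real
 assumes A: "finite A" and La: "!!m. m \<in> A ==> (\<Sum>k\<in>A. \<bar>ip J (th m) (th k)\<bar>) <= La"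
  and c: "!!m. m \<in> A ==> \<bar>c m\<bar> <= ka" and ka: "ka >= 0"
  and h: "!!x. (h has_real_derivative h' x) (at x)" "!!x. \<bar>h x\<bar> <= 1" "!!x. \<bar>h' x\<bar> <= 1" "!!x. isCont h' x"
 defines "W \<equiv> trig_stat A c th"
 shows "\<bar>expectation (%s. W s * h (t * W s)) - t * expectation (%s. (W s)^2) * expectation (%s. h' (t * W s))\<bar>
  <= \<bar>t\<bar> * (2 * ka^2 * sqrt (card A * La ^ 3))"
proof -
 have [measurable]: "h \<in> borel_measurable borel" "h' \<in> borel_measurable borel"
  using DERIV_isCont[OF h(1)] h(4) by (auto intro!: borel_measurable_continuous_onI continuous_at_imp_continuous_on)
 have [measurable]: "W \<in> borel_measurable M" unfolding W_def by simp
 define e where "e = expectation (%s. h' (t * W s))"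
 have ih': "integrable M (%s. h' (t * W s))" by (rule integrable_bounded[where B=1]) (auto intro: h)
 have e1: "\<bar>e\<bar> <= 1"
 proof -
  have "\<bar>e\<bar> <= expectation (%s. \<bar>h' (t * W s)\<bar>)" unfolding e_def by (rule integral_abs_bound)
  also have "\<dots> <= expectation (%s. 1)" using ih' h(3) by (intro integral_mono) auto
  finally show ?thesis by (simp add: prob_space)
 qed
 have tb: "\<bar>t * h' y - t * e\<bar> <= \<bar>t\<bar> * 1 + \<bar>t\<bar> * 1" for y
 proof -
  have "\<bar>t * h' y\<bar> <= \<bar>t\<bar> * 1" "\<bar>t * e\<bar> <= \<bar>t\<bar> * 1" unfolding abs_mult by (intro mult_left_mono h e1; simp)+
  then show ?thesis using abs_triangle_ineq4[of "t * h' y" "t * e"] by linarith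
 qed
 define q where "q m = ip J (th m) (th m)" for m
 \<comment> \<open>The weight is chosen so that \<open>w m z\<close> times the expectation of
   \<open>cos (z * Z (th m))\<close> does not depend on \<open>z\<close>. The derivative in
   \<open>z\<close> then sees only the interaction with the remaining terms.\<close>
 define w where "w m z = exp (- (1 - z^2) * q m / 2)" for m and z :: real
 define Wf where "Wf x = (\<Sum>m\<in>A. c m * (cos (lin (th m) x) - exp (- q m / 2)))" for x
 have Wf: "Wf (vec s) = W s" for s by (simp add: Wf_def W_def trig_stat_def lin_vec q_def)
 define BW where "BW = (\<Sum>m\<in>A. \<bar>c m\<bar> * 2)"
 have q0: "q m >= 0" for m by (simp add: q_def)
 have WfB: "\<bar>Wf x\<bar> <= BW" for x unfolding Wf_def BW_def
  by (rule order_trans[OF sum_abs]) (auto simp: abs_mult intro!: sum_mono mult_left_mono abs_cos_minus_exp q0)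
 have [measurable]: "Wf \<in> borel_measurable (PiM J (%_. borel))" unfolding Wf_def[abs_def] by measurable
 \<comment> \<open>Subtracting \<open>t * e * Wf\<close> removes the main term
   \<open>t * E W^2 * E h'\<close> in advance; the derivative of \<open>G\<close> contains
   \<open>h'\<close> minus its mean, so a covariance appears.\<close>
 define G where "G x = h (t * Wf x) - t * e * Wf x" for x
 define BG where "BG = 1 + \<bar>t\<bar> * BW"
 have GB: "\<bar>G x\<bar> <= BG" for x
 proof -
  have "\<bar>t * e * Wf x\<bar> <= \<bar>t\<bar> * 1 * BW" unfolding abs_mult by (intro mult_mono e1 WfB) auto
  then show ?thesis unfolding G_def BG_def using h(2)[of "t * Wf x"] by simp
 qed
 have [measurable]: "G \<in> borel_measurable (PiM J (%_. borel))" unfolding G_def[abs_def] by measurable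
 define dW where "dW k x = (\<Sum>m\<in>A. c m * (- sin (lin (th m) x) * th m k))" for k x
 have DW: "((%y. Wf (x(k := y))) has_real_derivative dW k (x(k := y))) (at y)" if "k \<in> J" for k x y unfolding Wf_def dW_def
  by (rule DERIV_sum, rule DERIV_cmult) (auto intro!: derivative_eq_intros DERIV_lin that)
 have dWB: "\<bar>dW k x\<bar> <= (\<Sum>m\<in>A. \<bar>c m\<bar> * \<bar>th m k\<bar>)" for k x unfolding dW_def
  by (rule order_trans[OF sum_abs]) (auto simp: abs_mult intro!: sum_mono mult_left_mono mult_left_le_one_le)
 have [measurable]: "dW k \<in> borel_measurable (PiM J (%_. borel))" for k unfolding dW_def[abs_def] by measurable
 define T where "T z = (%x. \<Sum>(m, k)\<in>A \<times> A. (c m * c k * w m z * ip J (th m) (th k)) * (sin (Z (%i. z * th m i) x) * sin (Z (th k) x)))" for z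
 \<comment> \<open>The part of the integrated-by-parts expression in which the derivative falls on
   \<open>G\<close>.\<close>
 define R where "R m z s = sin (z * Z (th m) s) * (t * h' (t * W s) - t * e) * (\<Sum>k\<in>A. c k * (- sin (Z (th k) s) * ip J (th m) (th k)))" for m z s
 have iR: "integrable M (R m z)" for m z
 proof (rule integrable_bounded[where B="1 * (\<bar>t\<bar> * 1 + \<bar>t\<bar> * 1) * (\<Sum>k\<in>A. \<bar>c k\<bar> * (1 * \<bar>ip J (th m) (th k)\<bar>))"])
  fix s
  have "\<bar>\<Sum>k\<in>A. c k * (- sin (Z (th k) s) * ip J (th m) (th k))\<bar> <= (\<Sum>k\<in>A. \<bar>c k\<bar> * (1 * \<bar>ip J (th m) (th k)\<bar>))"
   by (rule order_trans[OF sum_abs]) (auto simp: abs_mult intro!: sum_mono mult_left_mono mult_left_le_one_le)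
  then show "\<bar>R m z s\<bar> <= 1 * (\<bar>t\<bar> * 1 + \<bar>t\<bar> * 1) * (\<Sum>k\<in>A. \<bar>c k\<bar> * (1 * \<bar>ip J (th m) (th k)\<bar>))"
   unfolding R_def abs_mult by (intro mult_mono tb) auto
 qed (simp add: R_def[abs_def])
 have icG: "integrable M (%s. cos (z * Z (th m) s) * G (vec s))" for m z
 proof (rule integrable_bounded[where B="1 * BG"])
  show "\<bar>cos (z * Z (th m) s) * G (vec s)\<bar> <= 1 * BG" for s unfolding abs_mult by (intro mult_mono GB) auto
 qed simp
 have ibp: "expectation (%s. Z (th m) s * sin (z * Z (th m) s) * G (vec s))
  = z * q m * expectation (%s. cos (z * Z (th m) s) * G (vec s))
   + expectation (R m z)" for m z
 proof -
  define \<Phi> where "\<Phi> x = sin (z * lin (th m) x) * G x" for x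
  define \<Psi> where "\<Psi> k x = z * th m k * (cos (z * lin (th m) x) * G x)
    + sin (z * lin (th m) x) * ((t * h' (t * Wf x) - t * e) * dW k x)" for k x
  have [measurable]: "\<Phi> \<in> borel_measurable (PiM J (%_. borel))" "\<Psi> k \<in> borel_measurable (PiM J (%_. borel))" for k
   unfolding \<Phi>_def[abs_def] \<Psi>_def[abs_def] by measurable
  have \<Phi>B: "\<bar>\<Phi> x\<bar> <= BG" for x
  proof -
   have "\<bar>\<Phi> x\<bar> <= 1 * BG" unfolding \<Phi>_def abs_mult by (intro mult_mono GB) auto
   then show ?thesis by simp
  qed
  have BG0: "BG >= 0" using GB[of undefined] by linarith
  define B where "B k = \<bar>z * th m k\<bar> * (1 * BG) + 1 * ((\<bar>t\<bar> * 1 + \<bar>t\<bar> * 1) * (\<Sum>m\<in>A. \<bar>c m\<bar> * \<bar>th m k\<bar>))" for k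
  have \<Psi>B: "\<bar>\<Psi> k x\<bar> <= B k" for k x unfolding \<Psi>_def B_def
   by (intro order_trans[OF abs_triangle_ineq] add_mono; unfold abs_mult; intro mult_mono GB dWB tb) (auto intro!: BG0)
  have B0: "B k >= 0" for k using \<Psi>B[of k undefined] by linarith
  have step: "expectation (%s. \<xi> k s * \<Phi> (vec s)) = expectation (%s. \<Psi> k (vec s))" if k: "k \<in> J" for k
  proof (rule expectation_ibp[OF k, where B="BG + B k"])
   fix x y
   have DG: "((%y. G (x(k := y))) has_real_derivative (t * h' (t * Wf (x(k := y))) - t * e) * dW k (x(k := y))) (at y)"
   proof -
    have "((%y. h (t * Wf (x(k := y)))) has_real_derivative h' (t * Wf (x(k := y))) * (t * dW k (x(k := y)))) (at y)"
     by (rule DERIV_chain2[OF h(1)]) (auto intro!: derivative_eq_intros DW k)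
    then show ?thesis unfolding G_def by (auto intro!: derivative_eq_intros DW k simp: algebra_simps)
   qed
   show "((%y. \<Phi> (x(k := y))) has_real_derivative \<Psi> k (x(k := y))) (at y)" unfolding \<Phi>_def \<Psi>_def
    by (rule derivative_eq_intros DG DERIV_lin k refl)+ (simp add: algebra_simps)
   have cW: "isCont (%y. Wf (x(k := y))) y" by (rule DERIV_isCont[OF DW[OF k]])
   have ch: "isCont (%y. h' (t * Wf (x(k := y)))) y" by (rule isCont_o2[OF _ h(4)]) (intro continuous_intros cW)
   show "isCont (%y. \<Psi> k (x(k := y))) y" unfolding \<Psi>_def dW_def by (intro continuous_intros ch DERIV_isCont[OF DG] isCont_lin k)
   show "\<bar>\<Phi> x\<bar> <= BG + B k" using \<Phi>B[of x] B0[of k] by linarith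
   show "\<bar>\<Psi> k x\<bar> <= BG + B k" using \<Psi>B[of k x] BG0 by linarith
  qed simp_all
  have i\<Phi>: "integrable M (%s. \<xi> k s * \<Phi> (vec s))" if k: "k \<in> J" for k
  proof (rule Bochner_Integration.integrable_bound)
   have "integrable (distr M borel (\<xi> k)) (%x. x)" unfolding distr_xi[OF k] using integrable_std_normal_distribution_moment[of 1] by simp
   then have "integrable M (\<xi> k)" using integrable_distr_eq[OF xi_meas[OF k], of "%x. x"] by simp
   then show "integrable M (%s. BG * \<xi> k s)" by simp
   show "AE s in M. norm (\<xi> k s * \<Phi> (vec s)) <= norm (BG * \<xi> k s)"
    using \<Phi>B BG0 by (auto simp: abs_mult mult.commute[of BG] intro!: AE_I2 mult_left_mono)
   show "(%s. \<xi> k s * \<Phi> (vec s)) \<in> borel_measurable M" using xi_meas[OF k] by simp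
  qed
  have i\<Psi>: "integrable M (%s. \<Psi> k (vec s))" for k by (rule integrable_bounded[OF _ \<Psi>B]) simp
  have "(%s. Z (th m) s * sin (z * Z (th m) s) * G (vec s)) = (%s. \<Sum>k\<in>J. th m k * (\<xi> k s * \<Phi> (vec s)))"
  proof
   fix s
   have "(\<Sum>k\<in>J. th m k * (\<xi> k s * \<Phi> (vec s))) = Z (th m) s * \<Phi> (vec s)"
    unfolding Z_def sum_distrib_right by (simp add: mult.assoc)
   then show "Z (th m) s * sin (z * Z (th m) s) * G (vec s) = (\<Sum>k\<in>J. th m k * (\<xi> k s * \<Phi> (vec s)))"
    by (simp add: \<Phi>_def lin_vec mult.assoc)
  qed
  then have "expectation (%s. Z (th m) s * sin (z * Z (th m) s) * G (vec s)) = (\<Sum>k\<in>J. th m k * expectation (%s. \<Psi> k (vec s)))"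
   using i\<Phi> step by (simp add: Bochner_Integration.integral_sum)
  also have "\<dots> = expectation (%s. \<Sum>k\<in>J. th m k * \<Psi> k (vec s))" using i\<Psi> by (simp add: Bochner_Integration.integral_sum)
  also have "(%s. \<Sum>k\<in>J. th m k * \<Psi> k (vec s)) = (%s. z * q m * (cos (z * Z (th m) s) * G (vec s)) + R m z s)"
  proof
   fix s
   have dWs: "(\<Sum>k\<in>J. th m k * dW k (vec s)) = (\<Sum>k\<in>A. c k * (- sin (Z (th k) s) * ip J (th m) (th k)))"
   proof -
    have "(\<Sum>k\<in>J. th m k * dW k (vec s)) = (\<Sum>k\<in>J. \<Sum>l\<in>A. c l * (- sin (Z (th l) s) * (th m k * th l k)))"
     unfolding dW_def lin_vec sum_distrib_left by (intro sum.cong refl) simp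
    also have "\<dots> = (\<Sum>l\<in>A. \<Sum>k\<in>J. c l * (- sin (Z (th l) s) * (th m k * th l k)))" by (rule sum.swap)
    finally show ?thesis unfolding ip_def sum_distrib_left .
   qed
   have "(\<Sum>k\<in>J. th m k * \<Psi> k (vec s)) = (\<Sum>k\<in>J. z * (cos (z * Z (th m) s) * G (vec s)) * (th m k * th m k)
    + sin (z * Z (th m) s) * (t * h' (t * W s) - t * e) * (th m k * dW k (vec s)))"
    unfolding \<Psi>_def lin_vec Wf by (intro sum.cong refl) (simp add: algebra_simps)
   also have "\<dots> = z * (cos (z * Z (th m) s) * G (vec s)) * q m
    + sin (z * Z (th m) s) * (t * h' (t * W s) - t * e) * (\<Sum>k\<in>J. th m k * dW k (vec s))"
    unfolding q_def ip_def by (simp add: sum.distrib sum_distrib_left)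
   finally show "(\<Sum>k\<in>J. th m k * \<Psi> k (vec s)) = z * q m * (cos (z * Z (th m) s) * G (vec s)) + R m z s"
    unfolding dWs R_def by (simp add: mult_ac)
  qed
  also have "expectation \<dots> = z * q m * expectation (%s. cos (z * Z (th m) s) * G (vec s)) + expectation (R m z)" using icG iR by simp
  finally show ?thesis .
 qed
 \<comment> \<open>At \<open>z = 1\<close> the weight is 1, at \<open>z = 0\<close> it is the mean
   of the cosine, so \<open>K 1 - K 0\<close> is the expectation of \<open>W * G\<close>.\<close>
 define K where "K z = (\<Sum>m\<in>A. c m * (w m z * expectation (%s. cos (z * Z (th m) s) * G (vec s))))" for z
 define K' where "K' z = (\<Sum>m\<in>A. c m * (- w m z * expectation (R m z)))" for z
 have DK: "(K has_real_derivative K' z) (at z)" for z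
 proof -
  have Dw: "(w m has_real_derivative z * q m * w m z) (at z)" for m unfolding w_def by (auto intro!: derivative_eq_intros)
  have DE: "((%z. expectation (%s. cos (z * Z (th m) s) * G (vec s))) has_real_derivative
    - expectation (%s. Z (th m) s * sin (z * Z (th m) s) * G (vec s))) (at z)" for m
   by (rule DERIV_expectation_cos[where p=0, simplified, OF _ _ integrable_Z_sq GB]) auto
  show ?thesis unfolding K_def K'_def
  proof (rule DERIV_sum, rule DERIV_cmult)
   fix m
   show "((%z. w m z * expectation (%s. cos (z * Z (th m) s) * G (vec s))) has_real_derivative
   - w m z * expectation (R m z)) (at z)" by (rule DERIV_cong[OF DERIV_mult[OF Dw DE]]) (simp only: ibp, simp add: algebra_simps)
  qed
 qed
 have iG: "integrable M (%s. G (vec s))" by (rule integrable_bounded[OF _ GB]) simp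
 have WB: "\<bar>W s\<bar> <= BW" for s unfolding Wf[symmetric] by (rule WfB)
 have "K 1 - K 0 = expectation (%s. W s * G (vec s))"
 proof -
  have "(%s. W s * G (vec s)) = (%s. \<Sum>m\<in>A. c m * (cos (Z (th m) s) * G (vec s) - exp (- q m / 2) * G (vec s)))"
   unfolding W_def trig_stat_def q_def[symmetric] sum_distrib_right by (intro ext sum.cong refl) (simp add: algebra_simps)
  then have "expectation (%s. W s * G (vec s)) = (\<Sum>m\<in>A. c m * (expectation (%s. cos (Z (th m) s) * G (vec s))
    - exp (- q m / 2) * expectation (%s. G (vec s))))" using iG icG[of 1] by (simp add: Bochner_Integration.integral_sum)
  then show ?thesis by (simp add: K_def w_def sum_subtractf[symmetric] algebra_simps)
 qed
 also have "\<dots> = expectation (%s. W s * h (t * W s)) - t * expectation (%s. (W s)^2) * e"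
 proof -
  have BW0: "BW >= 0" using WB[of undefined] by linarith
  have "integrable M (%s. W s * h (t * W s))"
  proof (rule integrable_bounded[where B="BW * 1"])
   show "\<bar>W s * h (t * W s)\<bar> <= BW * 1" for s unfolding abs_mult by (intro mult_mono WB h BW0) auto
  qed simp
  moreover have "integrable M (%s. (W s)^2)" by (rule integrable_sq_bounded[OF _ WB]) simp
  moreover have "(%s. W s * G (vec s)) = (%s. W s * h (t * W s) - t * e * (W s)^2)" by (auto simp: G_def Wf power2_eq_square algebra_simps)
  ultimately show ?thesis by simp
 qed
 finally have K10: "K 1 - K 0 = \<dots>" .
 \<comment> \<open>One intermediate \<open>z\<close> suffices, because the variance bound for
   \<open>T z\<close> is uniform in \<open>z\<close>.\<close>
 obtain z where z: "0 < z" "z < 1" "K 1 - K 0 = K' z" using MVT2[of 0 1 K K'] DK by auto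
 define BT where "BT = (\<Sum>(m, k)\<in>A \<times> A. \<bar>c m * c k * w m z * ip J (th m) (th k)\<bar> * 1)"
 have BT: "\<bar>T z s\<bar> <= BT" for s unfolding T_def BT_def case_prod_unfold
  by (intro order_trans[OF sum_abs]; unfold abs_mult[of "_ * _" "sin _ * sin _"]; intro sum_mono mult_left_mono)
   (auto simp: abs_mult mult_le_one)
 have [measurable]: "T z \<in> borel_measurable M" unfolding T_def by measurable
 have "K' z = t * cv (%s. h' (t * W s)) (T z)"
 proof -
  have Tf: "T z s = (\<Sum>m\<in>A. \<Sum>k\<in>A. c m * c k * w m z * ip J (th m) (th k) * (sin (z * Z (th m) s) * sin (Z (th k) s)))" for s
   unfolding T_def by (simp add: sum.cartesian_product Z_scale)
  have iT: "integrable M (T z)" by (rule integrable_bounded[OF _ BT]) simp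
  have ihT: "integrable M (%s. h' (t * W s) * T z s)"
  proof (rule integrable_bounded[where B="1 * BT"])
   show "\<bar>h' (t * W s) * T z s\<bar> <= 1 * BT" for s unfolding abs_mult by (intro mult_mono BT h) auto
  qed simp
  have "K' z = expectation (%s. \<Sum>m\<in>A. c m * (- w m z * R m z s))" unfolding K'_def using iR by (simp add: Bochner_Integration.integral_sum)
  also have "(%s. \<Sum>m\<in>A. c m * (- w m z * R m z s)) = (%s. t * (h' (t * W s) * T z s - e * T z s))"
  proof
   fix s
   have "(\<Sum>m\<in>A. c m * (- w m z * R m z s))
    = (t * h' (t * W s) - t * e) * T z s" unfolding Tf R_def sum_distrib_left by (intro sum.cong refl) (simp add: algebra_simps)
   then show "(\<Sum>m\<in>A. c m * (- w m z * R m z s)) = t * (h' (t * W s) * T z s - e * T z s)" by (simp add: algebra_simps)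
  qed
  also have "expectation \<dots> = t * cv (%s. h' (t * W s)) (T z)" using iT ihT by (simp add: cv_def e_def)
  finally show ?thesis .
 qed
 moreover have "\<bar>cv (%s. h' (t * W s)) (T z)\<bar> <= 1 * sqrt (cv (T z) (T z))"
 proof -
  have T2: "integrable M (%s. (T z s)^2)" by (rule integrable_sq_bounded[OF _ BT]) simp
  have h2: "integrable M (%s. (h' (t * W s))^2)" by (rule integrable_sq_bounded[where B=1]) (auto intro: h)
  have "cv (%s. h' (t * W s)) (%s. h' (t * W s)) <= expectation (%s. (h' (t * W s))^2)" by (rule cv_le_moment2[where B=1]) (auto intro: h)
  also have "\<dots> <= expectation (%s. 1)" using h2 h(3) by (intro integral_mono) (auto simp: abs_square_le_1)
  finally have "sqrt (cv (%s. h' (t * W s)) (%s. h' (t * W s))) <= 1" by (simp add: prob_space)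
  moreover have "0 <= cv (T z) (T z)" using cv_self[OF T2] by simp
  ultimately have "sqrt (cv (%s. h' (t * W s)) (%s. h' (t * W s))) * sqrt (cv (T z) (T z)) <= 1 * sqrt (cv (T z) (T z))"
   by (intro mult_right_mono) auto
  moreover have "\<bar>cv (%s. h' (t * W s)) (T z)\<bar>
    <= sqrt (cv (%s. h' (t * W s)) (%s. h' (t * W s))) * sqrt (cv (T z) (T z))" by (rule cv_Cauchy[OF _ _ h2 T2]) simp_all
  ultimately show ?thesis by (rule order_trans[rotated])
 qed
 moreover have "cv (T z) (T z) <= (ka^2)^2 * (4 * card A * La ^ 3)" unfolding T_def
 proof (rule variance_sin_sin_sum_le[OF A La])
  fix m k assume mk: "m \<in> A" "k \<in> A"
  have "w m z <= 1"
  proof -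
   have "z^2 <= 1" using z by (simp add: abs_square_le_1)
   then have "0 <= (1 - z^2) * q m" using q0[of m] by (intro mult_nonneg_nonneg) auto
   then show ?thesis unfolding w_def by (simp add: algebra_simps)
  qed
  moreover have "w m z >= 0" by (simp add: w_def)
  ultimately have "\<bar>c m\<bar> * \<bar>c k\<bar> * \<bar>w m z\<bar> <= ka * ka * 1" using c mk ka by (intro mult_mono) auto
  then show "\<bar>c m * c k * w m z * ip J (th m) (th k)\<bar> <= ka^2 * \<bar>ip J (th m) (th k)\<bar>"
   unfolding abs_mult power2_eq_square by (intro mult_right_mono) auto
 qed (use z in auto)
 then have "sqrt (cv (T z) (T z)) <= sqrt ((ka^2)^2 * (4 * card A * La ^ 3))" by (rule real_sqrt_le_mono)
 then have "sqrt (cv (T z) (T z)) <= 2 * ka^2 * sqrt (card A * La ^ 3)"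
 proof -
  have e: "sqrt ((ka^2)^2) = ka^2" by (simp only: real_sqrt_abs abs_of_nonneg zero_le_power2)
  assume "sqrt (cv (T z) (T z)) <= sqrt ((ka^2)^2 * (4 * card A * La ^ 3))"
  then show ?thesis unfolding of_nat_mult of_nat_numeral real_sqrt_mult e real_sqrt_four by (simp add: mult_ac)
 qed
 ultimately have "\<bar>K' z\<bar> <= \<bar>t\<bar> * (2 * ka^2 * sqrt (card A * La ^ 3))"
  by (simp only: abs_mult mult_1) (intro mult_left_mono, auto)
 then show ?thesis using z K10 unfolding e_def by simp
qed

text \<open>The Stein step says that \<open>f t = E cos (t * W + p)\<close> nearly solves
  \<open>f' = - t * v * f\<close>. Multiplication by the integrating factor
  \<open>exp (v * t^2 / 2)\<close> and the mean value inequality give the Gaussian profile with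
  error \<open>t^2 * D\<close>.\<close>

lemma trig_stat_char:
 fixes th :: "'m => 'i => real" and La ka t :: real
 assumes A: "finite A" and La: "!!m. m \<in> A ==> (\<Sum>k\<in>A. \<bar>ip J (th m) (th k)\<bar>) <= La"
  and c: "!!m. m \<in> A ==> \<bar>c m\<bar> <= ka" and ka: "ka >= 0"
 defines "W \<equiv> trig_stat A c th"
 defines "D \<equiv> 2 * ka^2 * sqrt (card A * La ^ 3)"
 defines "v \<equiv> expectation (%s. (W s)^2)"
 shows "\<bar>expectation (%s. cos (t * W s)) - exp (- (v * t^2) / 2)\<bar> <= t^2 * D"
  and "\<bar>expectation (%s. sin (t * W s))\<bar> <= t^2 * D"
proof -
 have [measurable]: "W \<in> borel_measurable M" unfolding W_def by simp
 have W2: "integrable M (%s. (W s)^2)" unfolding W_def by (rule integrable_sq_bounded[OF _ trig_stat_bounded]) simp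
 have v: "v >= 0" by (simp add: v_def)
 have D: "D >= 0" if "A ~= {}"
 proof -
  from that obtain m where m: "m \<in> A" by blast
  have "0 <= (\<Sum>k\<in>A. \<bar>ip J (th m) (th k)\<bar>)" by (rule sum_nonneg) simp
  then have "La >= 0" using La[OF m] by linarith
  then show ?thesis by (simp add: D_def)
 qed
 have D: "D >= 0" using D by (cases "A = {}") (auto simp: D_def)
 have main: "\<bar>f t - f 0 * exp (- (v * t^2) / 2)\<bar> <= t^2 * D"
  if Df: "!!t. (f has_real_derivative f' t) (at t)" and b: "!!t. \<bar>f' t + t * v * f t\<bar> <= \<bar>t\<bar> * D" for f f'
 proof -
  define E where "E x = exp (v * x^2 / 2)" for x
  define g where "g x = f x * E x" for x
  have Dg: "(g has_real_derivative (f' x + x * v * f x) * E x) (at x within S)" for x S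
  proof -
   have "(E has_real_derivative x * v * E x) (at x within S)" unfolding E_def by (auto intro!: derivative_eq_intros)
   from DERIV_mult[OF DERIV_subset[OF Df subset_UNIV] this]
   show ?thesis unfolding g_def by (rule DERIV_cong) (simp add: algebra_simps)
  qed
  have "norm (g t - g 0) <= (\<bar>t\<bar> * D * E t) * norm (t - 0)"
  proof (rule field_differentiable_bound[where S="cball 0 \<bar>t\<bar>"])
   fix x :: real assume x: "x \<in> cball 0 \<bar>t\<bar>"
   show "(g has_field_derivative (f' x + x * v * f x) * E x) (at x within cball 0 \<bar>t\<bar>)" by (rule Dg)
   have "x^2 <= t^2" using x by (simp add: abs_le_square_iff)
   then have "E x <= E t" unfolding E_def using v by (simp add: mult_left_mono)
   moreover have "\<bar>f' x + x * v * f x\<bar> <= \<bar>t\<bar> * D" using b[of x] x mult_right_mono[of "\<bar>x\<bar>" "\<bar>t\<bar>" D] D by simp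
   ultimately show "norm ((f' x + x * v * f x) * E x) <= \<bar>t\<bar> * D * E t"
    unfolding real_norm_def abs_mult using D by (intro mult_mono) (auto simp: E_def)
  qed auto
  then have "\<bar>f t * E t - f 0\<bar> <= (t^2 * D) * E t"
  proof -
   have "\<bar>t\<bar> * D * E t * \<bar>t\<bar> = (\<bar>t\<bar> * \<bar>t\<bar>) * D * E t" by (simp only: mult_ac)
   also have "\<bar>t\<bar> * \<bar>t\<bar> = t^2" by (simp add: power2_eq_square)
   finally have e: "\<bar>t\<bar> * D * E t * \<bar>t\<bar> = t^2 * D * E t" .
   have "\<bar>g t - g 0\<bar> <= t^2 * D * E t" using \<open>norm (g t - g 0) <= (\<bar>t\<bar> * D * E t) * norm (t - 0)\<close>
    unfolding real_norm_def diff_zero e .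
   then show ?thesis by (simp add: g_def E_def)
  qed
  then have le: "\<bar>f t * E t - f 0\<bar> * inverse (E t) <= (t^2 * D) * E t * inverse (E t)" by (intro mult_right_mono) (auto simp: E_def)
  have i: "inverse (E t) = exp (- (v * t^2) / 2)" by (simp add: E_def exp_minus)
  have E0: "E t > 0" by (simp add: E_def)
  have "\<bar>f t * E t - f 0\<bar> * inverse (E t) = \<bar>(f t * E t - f 0) * inverse (E t)\<bar>" using E0 by (simp add: abs_mult)
  also have "(f t * E t - f 0) * inverse (E t) = f t - f 0 * exp (- (v * t^2) / 2)" unfolding i[symmetric] using E0 by (simp add: field_simps)
  finally have "\<bar>f t * E t - f 0\<bar> * inverse (E t) = \<bar>f t - f 0 * exp (- (v * t^2) / 2)\<bar>" .
  moreover have "(t^2 * D) * E t * inverse (E t) = t^2 * D" using E0 by simp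
  ultimately show ?thesis using le by argo
 qed
 have *: "\<bar>expectation (%s. cos (t * W s + p)) - expectation (%s. cos (0 * W s + p)) * exp (- (v * t^2) / 2)\<bar> <= t^2 * D" for p
 proof (rule main)
  fix t
  show "((%t. expectation (%s. cos (t * W s + p))) has_real_derivative - expectation (%s. W s * sin (t * W s + p))) (at t)"
   using DERIV_expectation_cos[of W "%_. 1" 1, OF _ _ W2] by simp
  have "\<bar>expectation (%s. W s * sin (t * W s + p)) - t * v * expectation (%s. cos (t * W s + p))\<bar> <= \<bar>t\<bar> * D"
   unfolding W_def v_def D_def by (rule stein_step[OF A La c ka]) (auto intro!: derivative_eq_intros)
  then show "\<bar>- expectation (%s. W s * sin (t * W s + p)) + t * v * expectation (%s. cos (t * W s + p))\<bar> <= \<bar>t\<bar> * D" by linarith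
 qed
 show "\<bar>expectation (%s. cos (t * W s)) - exp (- (v * t^2) / 2)\<bar> <= t^2 * D" using *[of 0] by (simp add: prob_space)
 show "\<bar>expectation (%s. sin (t * W s))\<bar> <= t^2 * D" using *[of "- (pi / 2)"] by (simp add: cos_diff)
qed

end

subsection \<open>The covariance kernel in scaled time\<close>

text \<open>Multiplication by \<open>2 * sin (th / 2)\<close> makes the sum telescope. The free
  phase \<open>c\<close> covers the derivatives, which only shift the phase.\<close>

lemma sum_cos_le:
 assumes "sin (th / 2) ~= 0"
 shows "\<bar>\<Sum>k=1..m. cos (real k * th + c)\<bar> <= 1 / \<bar>sin (th / 2)\<bar>"
proof -
 have tel: "2 * sin (th / 2) * (\<Sum>k=1..m. cos (real k * th + c)) = sin (real m * th + th / 2 + c) - sin (th / 2 + c)" for m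
 proof (induction m)
  case (Suc m)
  have pr: "2 * sin y * cos x = sin (x + y) - sin (x - y)" for x y :: real by (simp add: sin_add sin_diff)
  have ar: "real (Suc m) * th + c + th / 2 = real (Suc m) * th + th / 2 + c"
   "real (Suc m) * th + c - th / 2 = real m * th + th / 2 + c" by (simp_all add: algebra_simps)
  have "2 * sin (th / 2) * cos (real (Suc m) * th + c)
    = sin (real (Suc m) * th + th / 2 + c) - sin (real m * th + th / 2 + c)" unfolding pr ar ..
  then show ?case using Suc by (simp add: distrib_left)
 qed simp
 have "\<bar>2 * sin (th / 2) * (\<Sum>k=1..m. cos (real k * th + c))\<bar> <= 2" unfolding tel using sin_le_one sin_ge_minus_one
  by (intro order_trans[OF abs_triangle_ineq4]) (simp add: abs_le_iff add_mono order_trans[OF add_mono[OF abs_sin_le_one abs_sin_le_one]])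
 then have "2 * (\<bar>sin (th / 2)\<bar> * \<bar>\<Sum>k=1..m. cos (real k * th + c)\<bar>) <= 2" by (simp add: abs_mult)
 then show ?thesis using assms by (simp add: field_simps)
qed

text \<open>Summation by parts: the boundary term and the total variation of the nondecreasing
  weights contribute \<open>g n * P\<close> each.\<close>

lemma abel_bound:
 fixes g z :: "nat => real"
 assumes S: "!!m. \<bar>\<Sum>k=1..m. z k\<bar> <= P" and g: "!!k. 0 <= g k" "!!k. g k <= g (Suc k)"
 shows "\<bar>\<Sum>k=1..n. g k * z k\<bar> <= 2 * g n * P"
proof -
 define T where "T m = (\<Sum>k=1..m. z k)" for m
 have P: "P >= 0" using S[of 0] by simp
 have eq: "(\<Sum>k=1..n. g k * z k) = g n * T n - (\<Sum>k<n. (g (Suc k) - g k) * T k)" for n by (induction n) (simp_all add: T_def algebra_simps)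
 have "\<bar>\<Sum>k<n. (g (Suc k) - g k) * T k\<bar> <= (\<Sum>k<n. (g (Suc k) - g k) * P)"
  by (rule order_trans[OF sum_abs]) (use g S in \<open>auto simp: abs_mult T_def intro!: sum_mono mult_mono\<close>)
 also have "\<dots> = (g n - g 0) * P" by (simp add: sum_distrib_right[symmetric] sum_lessThan_telescope)
 also have "\<dots> <= g n * P" using g P by (intro mult_right_mono) auto
 finally have 1: "\<bar>\<Sum>k<n. (g (Suc k) - g k) * T k\<bar> <= g n * P" .
 have 2: "\<bar>g n * T n\<bar> <= g n * P" using g S by (auto simp: abs_mult T_def intro!: mult_mono)
 have "\<bar>\<Sum>k=1..n. g k * z k\<bar> <= \<bar>g n * T n\<bar> + \<bar>\<Sum>k<n. (g (Suc k) - g k) * T k\<bar>" unfolding eq by (rule abs_triangle_ineq4)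
 then show ?thesis using 1 2 by linarith
qed

text \<open>Jordan's inequality with half its constant, which is all that is used; beyond 1
  monotonicity of the sine replaces \<open>half_le_sin\<close>.\<close>

lemma sin_ge_two_over_pi:
 fixes x :: real assumes "0 <= x" "x <= pi / 2" shows "x / pi <= sin x"
proof (cases "x <= 1")
 case True
 have "x / pi <= x / 2" using assms pi_gt3 by (intro divide_left_mono) auto
 then show ?thesis using half_le_sin[of x] True assms by linarith
next
 case False
 have "x / pi <= 1 / 2" using assms by (simp add: field_simps)
 also have "1 / 2 <= sin (1::real)" using half_le_sin[of 1] by simp
 also have "sin 1 <= sin x" using False assms by (intro sin_monotone_2pi_le) auto
 finally show ?thesis .
qed

lemma harm_le_ln: "n >= 1 ==> (harm n :: real) <= 1 + ln n"
proof (induction n rule: dec_induct)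
 case base
 show ?case by (simp add: harm_expand)
next
 case (step n)
 have "ln (real n / real (Suc n)) <= real n / real (Suc n) - 1" using step.hyps by (intro ln_le_minus_one) simp
 also have "\<dots> = - inverse (real (Suc n))" by (simp add: field_simps)
 finally have "inverse (real (Suc n)) <= ln (Suc n) - ln n" using step.hyps by (simp add: ln_div)
 then show ?case using step by (simp add: harm_Suc)
qed

text \<open>\<open>Inl k\<close> indexes the coefficient of \<open>u k\<close> and
  \<open>Inr k\<close> that of \<open>v k\<close>; \<open>kk\<close> recovers the frequency
  index.\<close>

definition J :: "nat => (nat + nat) set" where "J n = {1..n} <+> {1..n}"

definition kk :: "nat + nat => nat" where "kk = case_sum id id"

text \<open>The \<open>a\<close>-th derivative of \<open>cos (k * y / 2)\<close> or
  \<open>sin (k * y / 2)\<close>, with differentiation written as a phase shift by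
  \<open>pi / 2\<close>.\<close>

definition \<tau> :: "nat => nat + nat => real => real" where
 "\<tau> a i y = (case i of
   Inl k => (k / 2) ^ a * cos (k / 2 * y + a * (pi / 2))
  | Inr k => (k / 2) ^ a * sin (k / 2 * y + a * (pi / 2)))"

text \<open>The power \<open>n ^ a\<close> comes from the time scale \<open>t = n * y\<close>, the
  factor \<open>sqrt n\<close> from the normalization of the random sum.\<close>

definition Tm :: "nat => nat => real => nat + nat => real" where
 "Tm n a t i = \<tau> a i (t / n) / (real n ^ a * sqrt n)"

text \<open>Up to constants, the average of \<open>1 / k\<close> over the frequencies: the size of
  the Gram error caused by eigenfunction errors of order \<open>1 / k\<close>.\<close>

definition et :: "nat => real" where "et n = (1 + ln n) / n"

lemma finite_J [simp]: "finite (J n)" by (simp add: J_def)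

lemma J_kk: "i \<in> J n ==> 1 <= kk i \<and> kk i <= n" by (auto simp: J_def kk_def)

lemma sum_J: "(\<Sum>i\<in>J n. f i) = (\<Sum>k=1..n. f (Inl k) + f (Inr k))" unfolding J_def by (subst sum.Plus) (auto simp: sum.distrib)

lemma sum_inverse_kk: "n >= 1 ==> (\<Sum>i\<in>J n. 1 / kk i) / n <= 2 * et n"
proof -
 assume n: "n >= 1"
 have "(\<Sum>i\<in>J n. 1 / kk i) = 2 * harm n" unfolding sum_J by (simp add: kk_def harm_def sum_distrib_left inverse_eq_divide)
 then show ?thesis using harm_le_ln[OF n] n by (simp add: et_def field_simps)
qed

lemma et_nonneg: "n >= 1 ==> 0 <= et n" by (simp add: et_def)

lemma et_tendsto: "et \<longlonglongrightarrow> 0" "(%n. n * (et n)^2) \<longlonglongrightarrow> 0" unfolding et_def[abs_def] by real_asymp+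

lemma ip_Tm:
 assumes n: "n >= 1"
 shows "ip (J n) (Tm n a s) (Tm n b t) =
  (\<Sum>k=1..n. (real k / (2 * n)) ^ (a + b) * cos (real k * ((s - t) / (2 * n)) + (real a - real b) * (pi / 2))) / n"
proof -
 have "Tm n a s (Inl k) * Tm n b t (Inl k) + Tm n a s (Inr k) * Tm n b t (Inr k)
  = (real k / (2 * n)) ^ (a + b) * cos (real k * ((s - t) / (2 * n)) + (real a - real b) * (pi / 2)) / n" for k
 proof -
  define x y where "x = k / 2 * (s / n) + a * (pi / 2)" and "y = k / 2 * (t / n) + b * (pi / 2)"
  have xy: "x - y = k * ((s - t) / (2 * n)) + (real a - real b) * (pi / 2)" using n by (simp add: x_def y_def field_simps)
  have "Tm n a s (Inl k) * Tm n b t (Inl k) + Tm n a s (Inr k) * Tm n b t (Inr k)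
   = ((k / 2) ^ a * (k / 2) ^ b * (cos x * cos y + sin x * sin y)) / ((real n ^ a * sqrt n) * (real n ^ b * sqrt n))"
  proof -
   have T: "Tm n a s (Inl k) = (k / 2) ^ a * cos x / (real n ^ a * sqrt n)" "Tm n a s (Inr k) = (k / 2) ^ a * sin x / (real n ^ a * sqrt n)"
    "Tm n b t (Inl k) = (k / 2) ^ b * cos y / (real n ^ b * sqrt n)" "Tm n b t (Inr k) = (k / 2) ^ b * sin y / (real n ^ b * sqrt n)"
    by (simp_all add: Tm_def \<tau>_def x_def y_def)
   show ?thesis unfolding T times_divide_times_eq by (simp only: add_divide_distrib[symmetric] distrib_left mult_ac)
  qed
  also have "cos x * cos y + sin x * sin y = cos (x - y)" by (simp add: cos_diff)
  also have "(k / 2) ^ a * (k / 2) ^ b * cos (x - y) / ((real n ^ a * sqrt n) * (real n ^ b * sqrt n))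
   = ((k / 2) ^ (a + b) / real n ^ (a + b)) * cos (x - y) / n"
  proof -
   have "(real n ^ a * sqrt n) * (real n ^ b * sqrt n) = real n ^ (a + b) * n" by (simp add: power_add mult_ac)
   then show ?thesis by (simp add: power_add)
  qed
  also have "(k / 2) ^ (a + b) / real n ^ (a + b) = (k / (2 * n)) ^ (a + b)" by (simp add: power_divide power_mult_distrib)
  finally show ?thesis unfolding xy .
 qed
 then show ?thesis unfolding ip_def sum_J by (simp add: sum_divide_distrib)
qed

text \<open>Abel summation against the Dirichlet kernel bound. The range
  \<open>\<bar>s - t\<bar> <= 2 * pi * n\<close> keeps \<open>th / 2\<close> within
  \<open>pi / 2\<close> of zero, so the sine there is comparable to its argument and there is no
  recurrence at the far end. The constant is \<open>8 * 4 * 2\<close>, from \<open>pi < 4\<close>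
  and \<open>1 + \<bar>s - t\<bar> <= 2 * \<bar>s - t\<bar>\<close>.\<close>

lemma ip_Tm_le:
 assumes n: "n >= 1" and d: "\<bar>s - t\<bar> <= 2 * pi * n"
 shows "\<bar>ip (J n) (Tm n a s) (Tm n b t)\<bar> <= 64 / (1 + \<bar>s - t\<bar>)"
proof -
 define g :: "nat => real" where "g k = (real k / (2 * n)) ^ (a + b)" for k
 have g: "0 <= g k" "g k <= g (Suc k)" for k unfolding g_def by (auto intro!: power_mono divide_right_mono)
 have gn: "g k <= 1" if "k <= n" for k unfolding g_def using that n by (intro power_le_one) (auto simp: field_simps)
 define c where "c = (real a - real b) * (pi / 2)"
 define th where "th = (s - t) / (2 * n)"
 have e: "ip (J n) (Tm n a s) (Tm n b t) = (\<Sum>k=1..n. g k * cos (real k * th + c)) / n" unfolding ip_Tm[OF n] g_def c_def th_def ..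
 show ?thesis
 proof (cases "\<bar>s - t\<bar> <= 1")
  case True
  have "\<bar>\<Sum>k=1..n. g k * cos (real k * th + c)\<bar> <= (\<Sum>k=1..n. 1 * 1)"
   using g gn by (intro order_trans[OF sum_abs] sum_mono) (auto simp: abs_mult intro!: mult_le_one)
  then have "\<bar>ip (J n) (Tm n a s) (Tm n b t)\<bar> <= 1" unfolding e using n by (simp add: field_simps)
  also have "1 <= 64 / (1 + \<bar>s - t\<bar>)" using True by (simp add: field_simps)
  finally show ?thesis .
 next
  case False
  have th: "\<bar>th\<bar> <= pi" "\<bar>th\<bar> = \<bar>s - t\<bar> / (2 * n)" using d n by (auto simp: th_def abs_divide field_simps)
  have "\<bar>sin x\<bar> = \<bar>sin \<bar>x\<bar>\<bar>" for x :: real by (cases "x >= 0") auto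
  then have "sin \<bar>th / 2\<bar> <= \<bar>sin (th / 2)\<bar>" by (metis abs_ge_self)
  moreover have "\<bar>th / 2\<bar> / pi <= sin \<bar>th / 2\<bar>" using th(1) by (intro sin_ge_two_over_pi) auto
  ultimately have s: "\<bar>th / 2\<bar> / pi <= \<bar>sin (th / 2)\<bar>" by linarith
  have "\<bar>th\<bar> > 0" using False n th(2) by auto
  then have "0 < \<bar>th / 2\<bar> / pi" by simp
  then have s0: "\<bar>sin (th / 2)\<bar> > 0" using s by linarith
  have "\<bar>\<Sum>k=1..n. g k * cos (real k * th + c)\<bar> <= 2 * g n * (1 / \<bar>sin (th / 2)\<bar>)"
   by (intro abel_bound g sum_cos_le) (use s0 in auto)
  also have "\<dots> <= 2 * 1 * (1 / (\<bar>th / 2\<bar> / pi))"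
   using gn[of n] s \<open>\<bar>th\<bar> > 0\<close> s0 g by (intro mult_mono divide_left_mono) auto
  also have "\<dots> = 8 * pi * n / \<bar>s - t\<bar>" using False n by (simp add: th_def abs_divide field_simps)
  finally have "\<bar>ip (J n) (Tm n a s) (Tm n b t)\<bar> <= 8 * pi * n / \<bar>s - t\<bar> / n"
   unfolding e abs_divide abs_of_nat by (intro divide_right_mono) auto
  also have "\<dots> = 8 * pi / \<bar>s - t\<bar>" using n by simp
  also have "\<dots> <= 64 / (1 + \<bar>s - t\<bar>)"
  proof -
   have "(8 * pi) * (1 + \<bar>s - t\<bar>) <= (8 * 4) * (2 * \<bar>s - t\<bar>)" using False pi_less_4 by (intro mult_mono) auto
   then show ?thesis using False by (simp add: field_simps)
  qed
  finally show ?thesis .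
 qed
qed

lemma Tm_bound:
 assumes "i \<in> J n" shows "\<bar>Tm n a t i\<bar> <= 1 / sqrt n"
proof -
 have n: "n >= 1" using J_kk[OF assms] by simp
 have "\<bar>\<tau> a i y\<bar> <= (kk i / 2) ^ a" for y by (cases i) (auto simp: \<tau>_def kk_def abs_mult intro!: mult_left_le)
 moreover have "(kk i / 2) ^ a <= real n ^ a" using J_kk[OF assms] by (intro power_mono) auto
 ultimately have "\<bar>\<tau> a i (t / n)\<bar> <= real n ^ a" by (rule order_trans)
 then show ?thesis using n by (simp add: Tm_def abs_divide abs_mult field_simps)
qed

lemma \<tau>_deriv: "(\<tau> a i has_real_derivative \<tau> (Suc a) i y) (at y within A)"
proof (cases i)
 case (Inl k)
 have "cos (k / 2 * y + Suc a * (pi / 2)) = - sin (k / 2 * y + a * (pi / 2))" by (simp add: algebra_simps cos_add sin_add add_divide_distrib)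
 then show ?thesis unfolding \<tau>_def[abs_def] Inl sum.case by (auto intro!: derivative_eq_intros)
next
 case (Inr k)
 have "sin (k / 2 * y + Suc a * (pi / 2)) = cos (k / 2 * y + a * (pi / 2))" by (simp add: algebra_simps cos_add sin_add add_divide_distrib)
 then show ?thesis unfolding \<tau>_def[abs_def] Inr sum.case by (auto intro!: derivative_eq_intros)
qed

lemma Tm_deriv:
 assumes n: "n >= 1" shows "((%t. Tm n a t i) has_real_derivative Tm n (Suc a) t i) (at t within A)"
proof -
 have "((%t. \<tau> a i (t / n)) has_real_derivative \<tau> (Suc a) i (t / n) * (1 / n)) (at t within A)"
  by (rule DERIV_subset[OF DERIV_chain2[OF \<tau>_deriv] subset_UNIV]) (use n in \<open>auto intro!: derivative_eq_intros\<close>)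
 from DERIV_cdivide[OF this, of "real n ^ a * sqrt n"] show ?thesis unfolding Tm_def[abs_def] using n by (simp add: field_simps)
qed

text \<open>A Riemann sum for the integral of \<open>x ^ p\<close> over \<open>[0, 1]\<close>.
  Division by \<open>2 ^ p\<close> gives the spectral moments, hence the limits 1/12 and
  1/80.\<close>

definition mom :: "nat => nat => real" where "mom p n = (\<Sum>k=1..n. (real k / n) ^ p) / n"

lemma mom_tendsto: "mom 2 \<longlonglongrightarrow> 1 / 3" "mom 4 \<longlonglongrightarrow> 1 / 5"
proof -
 have s2: "(\<Sum>k=1..n. real k ^ 2) = real n * (n + 1) * (2 * n + 1) / 6" for n by (induction n) (simp_all add: field_simps power2_eq_square)
 have s4: "(\<Sum>k=1..n. real k ^ 4) = real n * (n + 1) * (2 * n + 1) * (3 * real n ^ 2 + 3 * n - 1) / 30" for n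
  by (induction n) (simp_all add: field_simps power2_eq_square power4_eq_xxxx)
 have m: "mom p = (%n. (\<Sum>k=1..n. real k ^ p) / real n ^ p / n)" for p by (simp add: mom_def fun_eq_iff power_divide sum_divide_distrib)
 have "mom 2 = (%n. real n * (n + 1) * (2 * n + 1) / 6 / real n ^ 2 / n)" by (simp only: m s2)
 also have "\<dots> \<longlonglongrightarrow> 1 / 3" by real_asymp
 finally show "mom 2 \<longlonglongrightarrow> 1 / 3" .
 have "mom 4 = (%n. real n * (n + 1) * (2 * n + 1) * (3 * real n ^ 2 + 3 * n - 1) / 30 / real n ^ 4 / n)" by (simp only: m s4)
 also have "\<dots> \<longlonglongrightarrow> 1 / 5" by real_asymp
 finally show "mom 4 \<longlonglongrightarrow> 1 / 5" .
qed

lemma ip_Tm_diag: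
 assumes n: "n >= 1"
 shows "ip (J n) (Tm n 0 t) (Tm n 0 t) = 1" "ip (J n) (Tm n 0 t) (Tm n 1 t) = 0"
  "ip (J n) (Tm n 1 t) (Tm n 1 t) = mom 2 n / 4" "ip (J n) (Tm n 0 t) (Tm n 2 t) = - mom 2 n / 4"
  "ip (J n) (Tm n 1 t) (Tm n 2 t) = 0" "ip (J n) (Tm n 2 t) (Tm n 2 t) = mom 4 n / 16"
proof -
 have m: "(\<Sum>k=1..n. (real k / (2 * n)) ^ p) / n = mom p n / 2 ^ p" for p
  unfolding mom_def sum_divide_distrib by (intro sum.cong refl) (simp add: power_divide power_mult_distrib)
 have e: "ip (J n) (Tm n a t) (Tm n b t) = mom (a + b) n / 2 ^ (a + b) * cos ((real a - real b) * (pi / 2))" for a b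
  unfolding ip_Tm[OF n] m[symmetric] by (simp add: sum_distrib_right sum_divide_distrib)
 have m0: "mom 0 n = 1" using n by (simp add: mom_def)
 show "ip (J n) (Tm n 0 t) (Tm n 0 t) = 1" "ip (J n) (Tm n 0 t) (Tm n 1 t) = 0"
  "ip (J n) (Tm n 1 t) (Tm n 1 t) = mom 2 n / 4" "ip (J n) (Tm n 0 t) (Tm n 2 t) = - mom 2 n / 4"
  "ip (J n) (Tm n 1 t) (Tm n 2 t) = 0" "ip (J n) (Tm n 2 t) (Tm n 2 t) = mom 4 n / 16"
  using e[of 0 0] e[of 0 1] e[of 1 1] e[of 0 2] e[of 1 2] e[of 2 2] by (simp_all add: m0 numeral_2_eq_2[symmetric])
qed

subsection \<open>Orthonormalization of the values on a cell\<close>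

lemma ip_normalize:
 fixes J :: "'i set"
 assumes "ip J u u >= ka^2" "ka > 0"
 obtains c where "c > 0" "c <= 1 / ka" "c^2 * ip J u u = 1"
proof -
 have pos: "ip J u u > 0" using assms by (meson less_le_trans zero_less_power)
 have "ka <= sqrt (ip J u u)" by (rule real_le_rsqrt) (rule assms(1))
 then have "1 / sqrt (ip J u u) <= 1 / ka" using assms(2) pos by (intro divide_left_mono) auto
 moreover have "(1 / sqrt (ip J u u))^2 * ip J u u = 1" using pos by (simp add: power_divide)
 moreover have "1 / sqrt (ip J u u) > 0" using pos by simp
 ultimately show ?thesis using that by blast
qed

text \<open>The numbers are the limiting Gram matrix of value, first and second derivative. The
  smallest residual variance is that of the second derivative given the value,
  \<open>1/80 - 1/144 = 1/180\<close>; with the tolerances it stays above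
  \<open>(6/100) ^ 2\<close>, which leads to the factor 20 in the last clause.\<close>

lemma gram_schmidt3:
 fixes J :: "'i set"
 assumes uu: "\<bar>ip J u u - 1\<bar> <= 1 / 1000" and uv: "\<bar>ip J u v\<bar> <= 1 / 1000"
  and vv: "\<bar>ip J v v - 1 / 12\<bar> <= 1 / 1000" and uw: "\<bar>ip J u w + 1 / 12\<bar> <= 1 / 1000"
  and vw: "\<bar>ip J v w\<bar> <= 1 / 1000" and ww: "\<bar>ip J w w - 1 / 80\<bar> <= 1 / 1000"
 shows "\<exists>e :: nat => 'i => real. (\<forall>a<3. \<forall>b<3. ip J (e a) (e b) = (if a = b then 1 else 0)) \<and>
  (\<forall>x\<in>{u, v, w}. \<exists>\<alpha>. \<forall>i. x i = (\<Sum>a<3. \<alpha> a * e a i)) \<and>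
  (\<forall>x r. \<bar>ip J u x\<bar> <= r --> \<bar>ip J v x\<bar> <= r --> \<bar>ip J w x\<bar> <= r --> (\<forall>a<3. \<bar>ip J (e a) x\<bar> <= 20 * r))"
proof -
 have "999/1000 <= ip J u u" using uu by linarith
 then have "(99/100)^2 <= ip J u u" by (simp add: power2_eq_square)
 then obtain c where c: "c > 0" "c <= 1 / (99/100)" "c^2 * ip J u u = 1" by (rule ip_normalize) simp
 define e0 where "e0 = (%i. c * u i)"
 have e00: "ip J e0 e0 = 1" using c by (simp add: e0_def ip_simps power2_eq_square mult.assoc)
 have u_e0: "u i = (1 / c) * e0 i" for i using c by (simp add: e0_def)
 define p where "p = ip J e0 v"
 have uu': "999/1000 <= ip J u u" using uu by linarith
 have "\<bar>p\<bar> = c * \<bar>ip J u v\<bar>" using c by (simp add: p_def e0_def ip_simps abs_mult)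
 also have "\<dots> <= (1 / (99/100)) * (1 / 1000)" using c uv by (intro mult_mono) auto
 finally have p: "\<bar>p\<bar> <= 11/10000" by simp
 have p2: "p^2 <= (11/10000)^2" using power_mono[OF p abs_ge_zero, of 2] by simp
 define v' where "v' = (%i. 1 * v i + (- p) * e0 i)"
 have e0v': "ip J e0 v' = 0" unfolding v'_def ip_lin_right by (simp add: e00 p_def)
 have v'v': "ip J v' v' = ip J v v - p^2"
 proof -
  have "ip J v' x = 1 * ip J v x + (- p) * ip J e0 x" for x unfolding v'_def by (rule ip_lin_left)
  then have "ip J v' v' = ip J v v' - p * ip J e0 v'" by simp
  also have "ip J v v' = ip J v v - p * ip J v e0" unfolding v'_def ip_lin_right by simp
  also have "ip J v e0 = p" by (simp add: p_def ip_commute)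
  finally show ?thesis by (simp add: e0v' power2_eq_square)
 qed
 have "1/12 - 1/1000 - (11/10000)^2 <= ip J v' v'" unfolding v'v' using vv p2 by linarith
 then have "(28/100)^2 <= ip J v' v'" by (rule order_trans[rotated]) (simp add: power2_eq_square)
 then obtain d where d: "d > 0" "d <= 1 / (28/100)" "d^2 * ip J v' v' = 1" by (rule ip_normalize) simp
 define e1 where "e1 = (%i. d * v' i)"
 have e11: "ip J e1 e1 = 1" using d by (simp add: e1_def ip_simps power2_eq_square mult.assoc)
 have e01: "ip J e0 e1 = 0" by (simp add: e1_def ip_simps e0v')
 have v_e: "v i = p * e0 i + (1 / d) * e1 i" for i using d by (simp add: e1_def v'_def)
 define q0 where "q0 = ip J e0 w"
 define q1 where "q1 = ip J e1 w"
 have uw': "\<bar>ip J u w\<bar> <= 8434 / 100000" using uw by linarith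
 have "\<bar>q0\<bar> = c * \<bar>ip J u w\<bar>" using c by (simp add: q0_def e0_def ip_simps abs_mult)
 also have "\<dots> <= (1 / (99/100)) * (85 / 1000)" using c uw' by (intro mult_mono) auto
 finally have q0: "\<bar>q0\<bar> <= 86/1000" by simp
 have q02: "q0^2 <= 714 / 100000"
 proof -
  have "q0^2 = c^2 * (ip J u w)^2" by (simp add: q0_def e0_def ip_simps power_mult_distrib)
  moreover have sq: "(ip J u w)^2 <= (8434 / 100000)^2" using power_mono[of "\<bar>ip J u w\<bar>" "8434/100000" 2] uw' by simp
  moreover have "c^2 * (999/1000) <= c^2 * ip J u u" using uu' by (intro mult_left_mono) auto
  then have c2: "c^2 <= 1000/999" using c by simp
  have "c^2 * (ip J u w)^2 <= (1000/999) * (8434 / 100000)^2" by (rule mult_mono[OF c2 sq]) auto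
  ultimately have "q0^2 <= (1000/999) * (8434 / 100000)^2" by simp
  then show ?thesis by (simp add: power2_eq_square)
 qed
 have "q1 = d * (ip J v w - p * q0)" by (simp add: q1_def e1_def v'_def ip_simps q0_def)
 then have "\<bar>q1\<bar> = d * \<bar>ip J v w - p * q0\<bar>" using d by (simp add: abs_mult)
 also have "\<dots> <= (1 / (28/100)) * (1 / 1000 + (11/10000) * (86/1000))"
 proof (intro mult_mono)
  have "\<bar>p * q0\<bar> <= (11/10000) * (86/1000)" unfolding abs_mult by (intro mult_mono p q0) auto
  then show "\<bar>ip J v w - p * q0\<bar> <= 1 / 1000 + (11/10000) * (86/1000)" using vw by linarith
 qed (use d in auto)
 finally have q1: "\<bar>q1\<bar> <= 4/1000" by simp
 have q12: "q1^2 <= (4/1000)^2" using power_mono[OF q1 abs_ge_zero, of 2] by simp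
 define w' where "w' = (%i. 1 * (1 * w i + (- q0) * e0 i) + (- q1) * e1 i)"
 have e0w': "ip J e0 w' = 0" and e1w': "ip J e1 w' = 0"
  unfolding w'_def ip_lin_right using e01 ip_commute[of J e1 e0] by (simp_all add: e00 e11 q0_def q1_def)
 have w'w': "ip J w' w' = ip J w w - q0^2 - q1^2"
 proof -
  have "ip J w' x = 1 * (1 * ip J w x + (- q0) * ip J e0 x) + (- q1) * ip J e1 x" for x unfolding w'_def ip_lin_left ..
  then have "ip J w' w' = ip J w w' - q0 * ip J e0 w' - q1 * ip J e1 w'" by simp
  also have "ip J w w' = ip J w w - q0 * ip J w e0 - q1 * ip J w e1" unfolding w'_def ip_lin_right by simp
  also have "ip J w e0 = q0" by (simp add: q0_def ip_commute)
  also have "ip J w e1 = q1" by (simp add: q1_def ip_commute)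
  finally show ?thesis by (simp add: e0w' e1w' power2_eq_square)
 qed
 have "1/80 - 1/1000 - 714/100000 - (4/1000)^2 <= ip J w' w'" unfolding w'w' using ww q02 q12 by linarith
 then have "(6/100)^2 <= ip J w' w'" by (rule order_trans[rotated]) (simp add: power2_eq_square)
 then obtain f where f: "f > 0" "f <= 1 / (6/100)" "f^2 * ip J w' w' = 1" by (rule ip_normalize) simp
 define e2 where "e2 = (%i. f * w' i)"
 have e22: "ip J e2 e2 = 1" using f by (simp add: e2_def ip_simps power2_eq_square mult.assoc)
 have e02: "ip J e0 e2 = 0" "ip J e1 e2 = 0" by (simp_all add: e2_def ip_simps e0w' e1w')
 have w_e: "w i = q0 * e0 i + q1 * e1 i + (1 / f) * e2 i" for i using f by (simp add: e2_def w'_def)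
 define e where "e a = (if a = 0 then e0 else if a = 1 then e1 else e2)" for a :: nat
 have lt3: "a < 3 \<longleftrightarrow> a = 0 \<or> a = 1 \<or> a = 2" for a :: nat by auto
 have s3: "(\<Sum>a<3. h a) = h 0 + h 1 + h 2" for h :: "nat => real" by (simp add: eval_nat_numeral)
 have orth: "\<forall>a<3. \<forall>b<3. ip J (e a) (e b) = (if a = b then 1 else 0)"
  unfolding lt3 using e01 e02 ip_commute[of J e1 e0] ip_commute[of J e2 e0] ip_commute[of J e2 e1] by (auto simp: e_def e00 e11 e22)
 have span: "\<forall>x\<in>{u, v, w}. \<exists>\<alpha>. \<forall>i. x i = (\<Sum>a<3. \<alpha> a * e a i)"
 proof -
  have "\<exists>\<alpha>. \<forall>i. u i = (\<Sum>a<3. \<alpha> a * e a i)"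
   unfolding s3 by (rule exI[of _ "%a. if a = 0 then 1 / c else 0"]) (simp add: e_def u_e0)
  moreover have "\<exists>\<alpha>. \<forall>i. v i = (\<Sum>a<3. \<alpha> a * e a i)"
   unfolding s3 by (rule exI[of _ "%a. if a = 0 then p else if a = 1 then 1 / d else 0"]) (simp add: e_def v_e)
  moreover have "\<exists>\<alpha>. \<forall>i. w i = (\<Sum>a<3. \<alpha> a * e a i)"
   unfolding s3 by (rule exI[of _ "%a. if a = 0 then q0 else if a = 1 then q1 else 1 / f"]) (simp add: e_def w_e)
  ultimately show ?thesis by simp
 qed
 have bnd: "\<bar>ip J (e a) x\<bar> <= 20 * r" if a: "a < 3" and x: "\<bar>ip J u x\<bar> <= r" "\<bar>ip J v x\<bar> <= r" "\<bar>ip J w x\<bar> <= r" for a x r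
 proof -
  have r: "r >= 0" using x by linarith
  have "\<bar>ip J e0 x\<bar> = c * \<bar>ip J u x\<bar>" using c by (simp add: e0_def ip_simps abs_mult)
  also have "\<dots> <= (1 / (99/100)) * r" using c x by (intro mult_mono) auto
  also have "\<dots> <= 102/100 * r" using r by simp
  finally have b0: "\<bar>ip J e0 x\<bar> <= 102/100 * r" .
  have "\<bar>ip J v' x\<bar> = \<bar>ip J v x - p * ip J e0 x\<bar>" unfolding v'_def ip_lin_left by simp
  also have "\<dots> <= \<bar>ip J v x\<bar> + \<bar>p\<bar> * \<bar>ip J e0 x\<bar>" unfolding abs_mult[symmetric] by (rule abs_triangle_ineq4)
  also have "\<dots> <= r + (11/10000) * (102/100 * r)" using x b0 p by (intro add_mono mult_mono) auto
  finally have bv: "\<bar>ip J v' x\<bar> <= 101/100 * r" using r by simp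
  have "\<bar>ip J e1 x\<bar> = d * \<bar>ip J v' x\<bar>" using d by (simp add: e1_def ip_simps abs_mult)
  also have "\<dots> <= (1 / (28/100)) * (101/100 * r)" using d bv by (intro mult_mono) auto
  finally have b1: "\<bar>ip J e1 x\<bar> <= 4 * r" using r by simp
  have "\<bar>ip J w' x\<bar> = \<bar>ip J w x - q0 * ip J e0 x - q1 * ip J e1 x\<bar>" unfolding w'_def ip_lin_left by simp
  also have "\<dots> <= \<bar>ip J w x\<bar> + \<bar>q0\<bar> * \<bar>ip J e0 x\<bar> + \<bar>q1\<bar> * \<bar>ip J e1 x\<bar>"
   unfolding abs_mult[symmetric] by linarith
  also have "\<dots> <= r + (86/1000) * (102/100 * r) + (4/1000) * (4 * r)" using x b0 b1 q0 q1 by (intro add_mono mult_mono) auto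
  finally have bw: "\<bar>ip J w' x\<bar> <= 111/100 * r" using r by simp
  have "\<bar>ip J e2 x\<bar> = f * \<bar>ip J w' x\<bar>" using f by (simp add: e2_def ip_simps abs_mult)
  also have "\<dots> <= (1 / (6/100)) * (111/100 * r)" using f bw by (intro mult_mono) auto
  finally have b2: "\<bar>ip J e2 x\<bar> <= 20 * r" using r by simp
  show ?thesis using a b0 b1 b2 r unfolding lt3 by (auto simp: e_def)
 qed
 show ?thesis using orth span bnd by blast
qed

text \<open>The constant \<open>C\<close> makes \<open>h\<close> vanish at both ends of
  \<open>[0, de]\<close>. Rolle's theorem for \<open>h\<close>, followed by the mean value theorem
  for \<open>f'\<close>, works with mere existence of the second derivative.\<close>

lemma second_difference:
 fixes f :: "real => real"
 assumes de: "de > 0" and c: "continuous_on {t - de..t + de} f"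
  and d1: "!!x. t - de < x ==> x < t + de ==> (f has_real_derivative f' x) (at x)"
  and d2: "!!x. t - de < x ==> x < t + de ==> (f' has_real_derivative f'' x) (at x)"
 shows "\<exists>z. t - de < z \<and> z < t + de \<and> f (t + de) + f (t - de) - 2 * f t = de^2 * f'' z"
proof -
 define C where "C = (f (t + de) + f (t - de) - 2 * f t) / de^2"
 define h where "h s = f (t + s) + f (t - s) - C * s^2" for s
 have "\<exists>z>0. z < de \<and> (%v. v * (f' (t + z) - f' (t - z) - 2 * C * z)) = (%v. 0)"
 proof (rule Rolle_deriv[of 0 de h])
  show "h 0 = h de" using de by (simp add: h_def C_def)
  show "continuous_on {0..de} h" unfolding h_def by (intro continuous_intros continuous_on_compose2[OF c]) auto
  show "(h has_derivative (%v. v * (f' (t + z) - f' (t - z) - 2 * C * z))) (at z)" if "0 < z" "z < de" for z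
  proof -
   have "((%s. f (t + s)) has_real_derivative f' (t + z) * 1) (at z)"
    by (rule DERIV_chain2[OF d1]) (use that in \<open>auto intro!: derivative_eq_intros\<close>)
   moreover have "((%s. f (t - s)) has_real_derivative f' (t - z) * (- 1)) (at z)"
    by (rule DERIV_chain2[OF d1]) (use that in \<open>auto intro!: derivative_eq_intros\<close>)
   ultimately have "(h has_real_derivative (f' (t + z) - f' (t - z) - 2 * C * z)) (at z)" unfolding h_def by (auto intro!: derivative_eq_intros)
   then show ?thesis by (simp add: has_field_derivative_def mult_commute_abs)
  qed
 qed (use de in auto)
 then obtain z where z: "0 < z" "z < de" "f' (t + z) - f' (t - z) = 2 * C * z" by (auto simp: fun_eq_iff dest: spec[of _ 1])
 obtain y where y: "t - z < y" "y < t + z" "f' (t + z) - f' (t - z) = (t + z - (t - z)) * f'' y" using MVT2[of "t - z" "t + z" f' f''] z d2 by auto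
 have "C = f'' y" using y(3) z by simp
 moreover have "f (t + de) + f (t - de) - 2 * f t = de^2 * C" using de by (simp add: C_def)
 ultimately show ?thesis using y(1,2) z de by (intro exI[of _ y]) auto
qed

text \<open>The interface between the differential equation and the probabilistic part:
  eigenfunctions in the variable \<open>y\<close> with two derivatives, each within one power of
  \<open>k\<close> below its main size from the trigonometric model. \<open>system_data\<close>
  provides these facts.\<close>

locale sl_data =
 fixes \<phi> :: "nat => nat + nat => real => real" and K :: real
 assumes K0: "K >= 0"
  and der: "!!i a y. 1 <= kk i ==> a < 2 ==> y \<in> ivl ==> (\<phi> a i has_real_derivative \<phi> (Suc a) i y) (at y within ivl)"
  and err: "!!i a y. 1 <= kk i ==> a <= 2 ==> y \<in> ivl ==> \<bar>\<phi> a i y - \<tau> a i y\<bar> <= K * kk i ^ a / kk i"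
begin

text \<open>Coefficient vector of the \<open>a\<close>-th derivative of the normalized random sum in the scaled time \<open>t = n y\<close>;
 \<open>Tm n a t\<close> is its trigonometric approximation.\<close>

definition V :: "nat => nat => real => nat + nat => real" where
 "V n a t i = \<phi> a i (t / n) / (real n ^ a * sqrt n)"

abbreviation dom :: "nat => real set" where "dom n \<equiv> {0..2 * pi * n}"

lemma V_err:
 assumes "i \<in> J n" "a <= 2" "t \<in> dom n"
 shows "\<bar>V n a t i - Tm n a t i\<bar> <= K / (kk i * sqrt n)"
proof -
 have k: "1 <= kk i" "kk i <= n" using J_kk[OF assms(1)] by auto
 then have n: "n >= 1" by simp
 have y: "t / n \<in> ivl" using assms(3) n by (auto simp: field_simps)
 have "\<bar>V n a t i - Tm n a t i\<bar> = \<bar>\<phi> a i (t / n) - \<tau> a i (t / n)\<bar> / (real n ^ a * sqrt n)"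
  using n by (simp add: V_def Tm_def diff_divide_distrib[symmetric] abs_divide abs_mult)
 also have "\<dots> <= (K * kk i ^ a / kk i) / (real n ^ a * sqrt n)" by (intro divide_right_mono err k y assms) simp
 also have "\<dots> <= (K * real n ^ a / kk i) / (real n ^ a * sqrt n)"
  using k K0 by (intro divide_right_mono mult_left_mono) (auto intro!: power_mono)
 also have "\<dots> = K / (kk i * sqrt n)" using n by (simp add: field_simps)
 finally show ?thesis .
qed

lemma V_bound:
 assumes "i \<in> J n" "a <= 2" "t \<in> dom n"
 shows "\<bar>V n a t i\<bar> <= (1 + K) / sqrt n"
proof -
 have k: "1 <= kk i" "kk i <= n" using J_kk[OF assms(1)] by auto
 have "K / (kk i * sqrt n) <= K / (1 * sqrt n)" using k K0 by (intro divide_left_mono mult_right_mono) auto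
 then have "\<bar>V n a t i\<bar> <= 1 / sqrt n + K / sqrt n" using V_err[OF assms] Tm_bound[OF assms(1), of a t] by simp
 then show ?thesis by (simp add: add_divide_distrib)
qed

lemma V_deriv:
 assumes "i \<in> J n" "a < 2" "t \<in> dom n"
 shows "((%t. V n a t i) has_real_derivative V n (Suc a) t i) (at t within dom n)"
proof -
 have k: "1 <= kk i" "kk i <= n" using J_kk[OF assms(1)] by auto
 then have n: "n >= 1" by simp
 have im: "(%t. t / n) ` dom n \<subseteq> ivl" using n by (auto simp: field_simps)
 have y: "t / n \<in> ivl" using assms(3) im by blast
 have "((%t. \<phi> a i (t / n)) has_real_derivative \<phi> (Suc a) i (t / n) * (1 / n)) (at t within dom n)"
 proof -
  have dt: "((%t. t / n) has_real_derivative 1 / n) (at t within dom n)" using n by (auto intro!: derivative_eq_intros)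
  show ?thesis using DERIV_image_chain[OF DERIV_subset[OF der[OF k(1) assms(2) y] im] dt] by (simp add: o_def)
 qed
 from DERIV_cdivide[OF this, of "real n ^ a * sqrt n"] show ?thesis unfolding V_def[abs_def] using n by (simp add: field_simps)
qed

definition "C1 = 2 * K * (2 + K)"

lemma C1_nonneg: "C1 >= 0" using K0 by (simp add: C1_def)

text \<open>The terms with index \<open>k\<close> are off by order \<open>1 / (k * n)\<close>, so a
  harmonic sum appears; this is where the logarithm enters.\<close>

lemma ip_V_err:
 assumes n: "n >= 1" and ab: "a <= 2" "b <= 2" and st: "s \<in> dom n" "t \<in> dom n"
 shows "\<bar>ip (J n) (V n a s) (V n b t) - ip (J n) (Tm n a s) (Tm n b t)\<bar> <= C1 * et n"
proof -
 have "ip (J n) (V n a s) (V n b t) - ip (J n) (Tm n a s) (Tm n b t)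
  = (\<Sum>i\<in>J n. (V n a s i - Tm n a s i) * V n b t i + Tm n a s i * (V n b t i - Tm n b t i))"
  (is "?l = ?r") by (simp add: ip_def sum_subtractf[symmetric] algebra_simps)
 moreover have "\<bar>?r\<bar> <= (\<Sum>i\<in>J n. K * (2 + K) * (1 / kk i) / n)"
 proof (rule order_trans[OF sum_abs sum_mono])
  fix i assume i: "i \<in> J n"
  have "\<bar>(V n a s i - Tm n a s i) * V n b t i + Tm n a s i * (V n b t i - Tm n b t i)\<bar>
   <= \<bar>V n a s i - Tm n a s i\<bar> * \<bar>V n b t i\<bar> + \<bar>Tm n a s i\<bar> * \<bar>V n b t i - Tm n b t i\<bar>"
   unfolding abs_mult[symmetric] by (rule abs_triangle_ineq)
  also have "\<dots> <= (K / (kk i * sqrt n)) * ((1 + K) / sqrt n) + (1 / sqrt n) * (K / (kk i * sqrt n))"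
   using K0 by (intro add_mono mult_mono V_err V_bound Tm_bound i ab st) auto
  also have "\<dots> = K * (2 + K) * (1 / kk i) / n" using n J_kk[OF i] by (simp add: field_simps)
  finally show "\<bar>(V n a s i - Tm n a s i) * V n b t i + Tm n a s i * (V n b t i - Tm n b t i)\<bar> <= K * (2 + K) * (1 / kk i) / n" .
 qed
 ultimately have "\<bar>?l\<bar> <= (\<Sum>i\<in>J n. K * (2 + K) * (1 / kk i) / n)" by simp
 also have "\<dots> = K * (2 + K) * ((\<Sum>i\<in>J n. 1 / kk i) / n)" by (simp add: sum_distrib_left sum_divide_distrib)
 also have "\<dots> <= K * (2 + K) * (2 * et n)" using K0 by (intro mult_left_mono sum_inverse_kk n) auto
 finally show ?thesis by (simp add: C1_def mult_ac)
qed

lemma VT_err: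
 assumes n: "n >= 1" and a: "a <= 2" and t: "t \<in> dom n"
 shows "L2_set (%i. V n a t i - Tm n a t i) (J n) <= sqrt (2 * K^2 * et n)" unfolding L2_set_def
proof (rule real_sqrt_le_mono)
 have "(\<Sum>i\<in>J n. (V n a t i - Tm n a t i)^2) <= (\<Sum>i\<in>J n. K^2 * (1 / kk i) / n)"
 proof (rule sum_mono)
  fix i assume i: "i \<in> J n"
  have "(V n a t i - Tm n a t i)^2 <= (K / (kk i * sqrt n))^2" using power_mono[OF V_err[OF i a t] abs_ge_zero, of 2] by simp
  also have "\<dots> = K^2 * (1 / (real (kk i))^2) / n" by (simp add: power_divide power_mult_distrib)
  also have "\<dots> <= K^2 * (1 / kk i) / n"
   using J_kk[OF i] by (intro divide_right_mono mult_left_mono divide_left_mono) (auto simp: power2_eq_square)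
  finally show "(V n a t i - Tm n a t i)^2 <= K^2 * (1 / kk i) / n" .
 qed
 also have "\<dots> = K^2 * ((\<Sum>i\<in>J n. 1 / kk i) / n)" by (simp add: sum_distrib_left sum_divide_distrib)
 also have "\<dots> <= K^2 * (2 * et n)" by (intro mult_left_mono sum_inverse_kk n) auto
 finally show "(\<Sum>i\<in>J n. (V n a t i - Tm n a t i)^2) <= 2 * K^2 * et n" by simp
qed

lemma ip_V_le:
 assumes n: "n >= 1" and ab: "a <= 2" "b <= 2" and st: "s \<in> dom n" "t \<in> dom n"
 shows "\<bar>ip (J n) (V n a s) (V n b t)\<bar> <= 64 / (1 + \<bar>s - t\<bar>) + C1 * et n"
 using ip_V_err[OF assms] ip_Tm_le[OF n, of s t a b] st by (auto simp: abs_le_iff)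

lemma L2_bound:
 assumes n: "n >= 1" and "!!i. i \<in> J n ==> \<bar>x i\<bar> <= c / sqrt n" "c >= 0"
 shows "L2_set x (J n) <= 2 * c"
proof -
 have "(\<Sum>i\<in>J n. (x i)^2) <= (\<Sum>i\<in>J n. c^2 / n)"
 proof (rule sum_mono)
  fix i assume "i \<in> J n"
  then show "(x i)^2 <= c^2 / n" using power_mono[OF assms(2) abs_ge_zero, of i 2] by (simp add: power_divide)
 qed
 also have "\<dots> = 2 * c^2" unfolding sum_J using n by simp
 also have "\<dots> <= (2 * c)^2" by (simp add: power_mult_distrib)
 finally show ?thesis unfolding L2_set_def using assms(3) by (intro real_le_lsqrt) auto
qed

lemma L2_Tm: "n >= 1 ==> L2_set (Tm n a t) (J n) <= 2" using L2_bound[of n "Tm n a t" 1] Tm_bound by simp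

lemma L2_Tm_diff:
 assumes n: "n >= 1" shows "L2_set (%i. Tm n a s i - Tm n a t i) (J n) <= 2 * \<bar>s - t\<bar>"
proof (rule L2_bound[OF n])
 fix i assume i: "i \<in> J n"
 have "norm (Tm n a s i - Tm n a t i) <= 1 / sqrt n * norm (s - t)"
  by (rule field_differentiable_bound[where S=UNIV, OF _ Tm_deriv[OF n]]) (use Tm_bound[OF i] in auto)
 then show "\<bar>Tm n a s i - Tm n a t i\<bar> <= \<bar>s - t\<bar> / sqrt n" by simp
qed simp

lemma ip_V_deriv:
 assumes "a < 2" "t \<in> dom n"
 shows "((%t. ip (J n) (V n a t) v) has_real_derivative ip (J n) (V n (Suc a) t) v) (at t within dom n)"
 unfolding ip_def by (intro DERIV_sum DERIV_cmult_right V_deriv assms)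

text \<open>Together with the value at \<open>t\<close>, the divided differences \<open>d2\<close>
  and \<open>d3\<close> span the same space as the three point values, but their Gram matrix stays
  nondegenerate as the mesh tends to zero.\<close>

definition d2 :: "nat => real => real => nat + nat => real" where
 "d2 n de t i = (V n 0 (t + de) i - V n 0 (t - de) i) / (2 * de)"

definition d3 :: "nat => real => real => nat + nat => real" where
 "d3 n de t i = (V n 0 (t + de) i + V n 0 (t - de) i - 2 * V n 0 t i) / de^2"

text \<open>The intermediate point depends on the vector \<open>v\<close> that is paired with the
  quotient; no single point serves for the vector itself.\<close>

lemma difference_quotients:
 assumes de: "de > 0" and dom: "t - de \<in> dom n" "t + de \<in> dom n"
 shows "\<exists>z\<in>{t - de..t + de}. ip (J n) (d2 n de t) v = ip (J n) (V n 1 z) v"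
  and "\<exists>z\<in>{t - de..t + de}. ip (J n) (d3 n de t) v = ip (J n) (V n 2 z) v"
proof -
 have D: "((%t. ip (J n) (V n a t) v) has_real_derivative ip (J n) (V n (Suc a) x) v) (at x)"
  if "a < 2" "t - de < x" "x < t + de" for a x using ip_V_deriv[OF that(1), of x n v] that dom by (simp add: at_within_Icc_at)
 have C: "continuous_on {t - de..t + de} (%t. ip (J n) (V n a t) v)" if "a < 2" for a
  by (rule continuous_on_subset[where s="dom n"], rule DERIV_continuous_on, rule ip_V_deriv[OF that]) (use dom in auto)
 have "\<exists>l z. t - de < z \<and> z < t + de \<and> ((%t. ip (J n) (V n 0 t) v) has_real_derivative l) (at z) \<and>
   ip (J n) (V n 0 (t + de)) v - ip (J n) (V n 0 (t - de)) v = (t + de - (t - de)) * l"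
  by (rule MVT) (use de C D[of 0] in \<open>auto simp: real_differentiable_def\<close>)
 then obtain l z where z: "t - de < z" "z < t + de" "((%t. ip (J n) (V n 0 t) v) has_real_derivative l) (at z)"
  "ip (J n) (V n 0 (t + de)) v - ip (J n) (V n 0 (t - de)) v = (t + de - (t - de)) * l" by blast
 have "l = ip (J n) (V n 1 z) v" using DERIV_unique[OF z(3) D[of 0, OF _ z(1,2)]] by simp
 moreover have "ip (J n) (d2 n de t) v = (ip (J n) (V n 0 (t + de)) v - ip (J n) (V n 0 (t - de)) v) / (2 * de)"
  unfolding ip_def d2_def by (simp add: sum_subtractf[symmetric] sum_divide_distrib algebra_simps)
 ultimately show "\<exists>z\<in>{t - de..t + de}. ip (J n) (d2 n de t) v = ip (J n) (V n 1 z) v" using z de by (intro bexI[of _ z]) auto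
 obtain z where z: "t - de < z" "z < t + de"
  "ip (J n) (V n 0 (t + de)) v + ip (J n) (V n 0 (t - de)) v - 2 * ip (J n) (V n 0 t) v = de^2 * ip (J n) (V n 2 z) v"
  using second_difference[OF de C[of 0] D[of 0] D[of "Suc 0"]] by (auto simp: numeral_2_eq_2)
 moreover have "ip (J n) (d3 n de t) v = (ip (J n) (V n 0 (t + de)) v + ip (J n) (V n 0 (t - de)) v - 2 * ip (J n) (V n 0 t) v) / de^2"
  unfolding ip_def d3_def by (simp add: sum_subtractf[symmetric] sum.distrib[symmetric] sum_distrib_left sum_divide_distrib algebra_simps)
 ultimately show "\<exists>z\<in>{t - de..t + de}. ip (J n) (d3 n de t) v = ip (J n) (V n 2 z) v" using de by (intro bexI[of _ z]) auto
qed

text \<open>The thresholds leave a total Gram error of \<open>1/1000\<close>, the tolerance of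
  \<open>gram_schmidt3\<close>.\<close>

definition good :: "nat => bool" where
 "good n \<longleftrightarrow> n >= 1 \<and> sqrt (2 * K^2 * et n) <= 1 / 20000 \<and> \<bar>mom 2 n / 4 - 1 / 12\<bar> <= 1 / 2000 \<and> \<bar>mom 4 n / 16 - 1 / 80\<bar> <= 1 / 2000"

lemma eventually_good: "eventually good sequentially"
proof -
 have 1: "(%n. sqrt (2 * K^2 * et n)) \<longlonglongrightarrow> 0" by (rule tendsto_eq_intros et_tendsto(1) refl)+ simp
 have 2: "(%n. \<bar>mom 2 n / 4 - 1 / 12\<bar>) \<longlonglongrightarrow> 0"
  using tendsto_rabs[OF tendsto_diff[OF tendsto_divide[OF mom_tendsto(1) tendsto_const[of 4]] tendsto_const[of "1/12"]]] by simp
 have 3: "(%n. \<bar>mom 4 n / 16 - 1 / 80\<bar>) \<longlonglongrightarrow> 0"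
  using tendsto_rabs[OF tendsto_diff[OF tendsto_divide[OF mom_tendsto(2) tendsto_const[of 16]] tendsto_const[of "1/80"]]] by simp
 have "eventually (%n. sqrt (2 * K^2 * et n) < 1 / 20000) sequentially"
  "eventually (%n. \<bar>mom 2 n / 4 - 1 / 12\<bar> < 1 / 2000) sequentially"
  "eventually (%n. \<bar>mom 4 n / 16 - 1 / 80\<bar> < 1 / 2000) sequentially"
  by (intro order_tendstoD(2)[OF 1] order_tendstoD(2)[OF 2] order_tendstoD(2)[OF 3]; simp)+
 then show ?thesis using eventually_ge_at_top[of 1] unfolding good_def[abs_def] by eventually_elim simp
qed

lemma near_Tm:
 assumes n: "good n" and de: "de <= 1 / 40000" and a: "a <= 2" and z: "z \<in> dom n" "\<bar>z - t\<bar> <= de"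
 shows "L2_set (%i. V n a z i - Tm n a t i) (J n) <= 1 / 10000"
proof -
 have n1: "n >= 1" using n by (simp add: good_def)
 have "L2_set (%i. V n a z i - Tm n a t i) (J n)
  <= L2_set (%i. V n a z i - Tm n a z i) (J n) + L2_set (%i. Tm n a z i - Tm n a t i) (J n)" by (rule L2_set_triangle_diff)
 \<comment> \<open>The trigonometric model is Lipschitz with constant 2, so a displacement of
   \<open>1/40000\<close> costs another \<open>1/20000\<close>.\<close>
 also have "\<dots> <= 1 / 20000 + 2 * \<bar>z - t\<bar>" using VT_err[OF n1 a z(1)] n L2_Tm_diff[OF n1] by (intro add_mono) (auto simp: good_def)
 finally show ?thesis using z de by simp
qed

lemma ip_near:
 assumes n: "n >= 1" and x: "L2_set (%i. x i - Tm n a t i) (J n) <= 1 / 10000"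
  and y: "L2_set (%i. y i - Tm n b t i) (J n) <= 1 / 10000"
 shows "\<bar>ip (J n) x y - ip (J n) (Tm n a t) (Tm n b t)\<bar> <= 1 / 2000"
proof -
 have Ly: "L2_set y (J n) <= 3" using L2_set_triangle_ineq[of "%i. y i - Tm n b t i" "Tm n b t" "J n"] y L2_Tm[OF n, of b t] by simp
 have "ip (J n) x y - ip (J n) (Tm n a t) (Tm n b t)
  = ip (J n) (%i. x i - Tm n a t i) y + ip (J n) (Tm n a t) (%i. y i - Tm n b t i)" (is "?l = ?r") unfolding ip_simps by simp
 moreover have "\<bar>?r\<bar> <= 1 / 10000 * 3 + 2 * (1 / 10000)"
  by (intro order_trans[OF abs_triangle_ineq] add_mono order_trans[OF ip_Cauchy] mult_mono x y Ly L2_Tm n) auto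
 ultimately show ?thesis by simp
qed

text \<open>All three vectors lie within \<open>1/10000\<close> of the model vectors at
  \<open>t\<close>; for the quotients this follows by duality from
  \<open>difference_quotients\<close>. An inner product then moves by at most \<open>1/2000\<close>,
  and the moments contribute at most as much again.\<close>

lemma cell_gram:
 assumes n: "good n" and de: "de > 0" "de <= 1 / 40000" and dom: "t - de \<in> dom n" "t + de \<in> dom n"
 shows "\<bar>ip (J n) (V n 0 t) (V n 0 t) - 1\<bar> <= 1 / 1000" "\<bar>ip (J n) (V n 0 t) (d2 n de t)\<bar> <= 1 / 1000"
  "\<bar>ip (J n) (d2 n de t) (d2 n de t) - 1 / 12\<bar> <= 1 / 1000" "\<bar>ip (J n) (V n 0 t) (d3 n de t) + 1 / 12\<bar> <= 1 / 1000"
  "\<bar>ip (J n) (d2 n de t) (d3 n de t)\<bar> <= 1 / 1000" "\<bar>ip (J n) (d3 n de t) (d3 n de t) - 1 / 80\<bar> <= 1 / 1000"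
  "L2_set (%i. d2 n de t i - Tm n 1 t i) (J n) <= 1 / 10000"
proof -
 have n1: "n >= 1" using n by (simp add: good_def)
 have t: "t \<in> dom n" using dom de by auto
 have w1: "L2_set (%i. V n 0 t i - Tm n 0 t i) (J n) <= 1 / 10000" by (rule near_Tm[OF n de(2) _ t]) (use de in auto)
 have dual: "L2_set (%i. x i - Tm n a t i) (J n) <= 1 / 10000"
  if x: "!!v. \<exists>z\<in>{t - de..t + de}. ip (J n) x v = ip (J n) (V n a z) v" and a: "a <= 2" for x a
 proof (rule L2_set_le_of_dual)
  let ?v = "%i. x i - Tm n a t i"
  obtain z where z: "z \<in> {t - de..t + de}" "ip (J n) x ?v = ip (J n) (V n a z) ?v" using x by blast
  have "ip (J n) ?v ?v = ip (J n) x ?v - ip (J n) (Tm n a t) ?v" by (rule ip_diff_left)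
  also have "\<dots> = ip (J n) (%i. V n a z i - Tm n a t i) ?v" unfolding z(2) ip_diff_left ..
  finally have e: "ip (J n) ?v ?v = ip (J n) (%i. V n a z i - Tm n a t i) ?v" .
  have "z \<in> dom n" "\<bar>z - t\<bar> <= de" using z(1) dom by auto
  then have "L2_set (%i. V n a z i - Tm n a t i) (J n) <= 1 / 10000" by (rule near_Tm[OF n de(2) a])
  then show "\<bar>ip (J n) ?v ?v\<bar> <= 1 / 10000 * L2_set ?v (J n)" unfolding e by (intro order_trans[OF ip_Cauchy] mult_right_mono) auto
 qed simp
 have w2: "L2_set (%i. d2 n de t i - Tm n 1 t i) (J n) <= 1 / 10000" by (rule dual[OF difference_quotients(1)[OF de(1) dom]]) simp
 have w3: "L2_set (%i. d3 n de t i - Tm n 2 t i) (J n) <= 1 / 10000" by (rule dual[OF difference_quotients(2)[OF de(1) dom]]) simp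
 note g = ip_Tm_diag[OF n1, of t]
 have m2: "\<bar>mom 2 n / 4 - 1 / 12\<bar> <= 1 / 2000" and m4: "\<bar>mom 4 n / 16 - 1 / 80\<bar> <= 1 / 2000" using n by (auto simp: good_def)
 show "\<bar>ip (J n) (V n 0 t) (V n 0 t) - 1\<bar> <= 1 / 1000" using ip_near[OF n1 w1 w1] unfolding g by linarith
 show "\<bar>ip (J n) (V n 0 t) (d2 n de t)\<bar> <= 1 / 1000" using ip_near[OF n1 w1 w2] unfolding g by linarith
 show "\<bar>ip (J n) (d2 n de t) (d2 n de t) - 1 / 12\<bar> <= 1 / 1000" using ip_near[OF n1 w2 w2] m2 unfolding g by linarith
 show "\<bar>ip (J n) (V n 0 t) (d3 n de t) + 1 / 12\<bar> <= 1 / 1000" using ip_near[OF n1 w1 w3] m2 unfolding g by linarith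
 show "\<bar>ip (J n) (d2 n de t) (d3 n de t)\<bar> <= 1 / 1000" using ip_near[OF n1 w2 w3] unfolding g by linarith
 show "\<bar>ip (J n) (d3 n de t) (d3 n de t) - 1 / 80\<bar> <= 1 / 1000" using ip_near[OF n1 w3 w3] m4 unfolding g by linarith
 show "L2_set (%i. d2 n de t i - Tm n 1 t i) (J n) <= 1 / 10000" by (rule w2)
qed

lemma cell_frame:
 assumes n: "good n" and de: "de > 0" "de <= 1 / 40000" and dom: "t - de \<in> dom n" "t + de \<in> dom n"
 shows "\<exists>e :: nat => nat + nat => real. (\<forall>a<3. \<forall>b<3. ip (J n) (e a) (e b) = (if a = b then 1 else 0)) \<and>
  (\<forall>x\<in>{V n 0 t, d2 n de t, d3 n de t}. \<exists>\<alpha>. \<forall>i. x i = (\<Sum>a<3. \<alpha> a * e a i)) \<and>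
  (\<forall>v r. (\<forall>z\<in>{t - de..t + de}. \<forall>a\<le>2. \<bar>ip (J n) (V n a z) v\<bar> <= r) --> (\<forall>a<3. \<bar>ip (J n) (e a) v\<bar> <= 20 * r))"
proof -
 have "\<exists>e :: nat => nat + nat => real. (\<forall>a<3. \<forall>b<3. ip (J n) (e a) (e b) = (if a = b then 1 else 0)) \<and>
  (\<forall>x\<in>{V n 0 t, d2 n de t, d3 n de t}. \<exists>\<alpha>. \<forall>i. x i = (\<Sum>a<3. \<alpha> a * e a i)) \<and>
  (\<forall>x r. \<bar>ip (J n) (V n 0 t) x\<bar> <= r --> \<bar>ip (J n) (d2 n de t) x\<bar> <= r --> \<bar>ip (J n) (d3 n de t) x\<bar> <= r -->
   (\<forall>a<3. \<bar>ip (J n) (e a) x\<bar> <= 20 * r))" by (rule gram_schmidt3) (rule cell_gram[OF assms])+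
 then obtain e :: "nat => nat + nat => real" where e: "\<forall>a<3. \<forall>b<3. ip (J n) (e a) (e b) = (if a = b then 1 else 0)"
  "\<forall>x\<in>{V n 0 t, d2 n de t, d3 n de t}. \<exists>\<alpha>. \<forall>i. x i = (\<Sum>a<3. \<alpha> a * e a i)"
  "!!x r. \<bar>ip (J n) (V n 0 t) x\<bar> <= r ==> \<bar>ip (J n) (d2 n de t) x\<bar> <= r ==> \<bar>ip (J n) (d3 n de t) x\<bar> <= r ==>
   (\<forall>a<3. \<bar>ip (J n) (e a) x\<bar> <= 20 * r)" by blast
 have "\<forall>a<3. \<bar>ip (J n) (e a) v\<bar> <= 20 * r" if v: "\<forall>z\<in>{t - de..t + de}. \<forall>a\<le>2. \<bar>ip (J n) (V n a z) v\<bar> <= r" for v r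
 proof (rule e(3))
  show "\<bar>ip (J n) (V n 0 t) v\<bar> <= r" using v de by auto
  show "\<bar>ip (J n) (d2 n de t) v\<bar> <= r" using difference_quotients(1)[OF de(1) dom, of v] v by auto
  show "\<bar>ip (J n) (d3 n de t) v\<bar> <= r" using difference_quotients(2)[OF de(1) dom, of v] v by auto
 qed
 then show ?thesis using e(1,2) by blast
qed

end

subsection \<open>Variance of sums of local functionals\<close>

definition ndist :: "nat => nat => nat" where "ndist i j = (if j <= i then i - j else j - i)"

lemma of_nat_ndist: "real (ndist i j) = \<bar>real i - real j\<bar>" by (simp add: ndist_def)

text \<open>Every distance from \<open>i\<close> is attained at most twice, once on each
  side.\<close>

lemma sum_ndist_le:
 fixes g :: "nat => real"
 assumes i: "i < c" and g: "!!k. 0 <= g k"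
 shows "(\<Sum>j<c. g (ndist i j)) <= 2 * (\<Sum>k<c. g k)"
proof -
 have "{..<c} = {..i} \<union> {i<..<c}" using i by auto
 then have "(\<Sum>j<c. g (ndist i j)) = (\<Sum>j\<le>i. g (ndist i j)) + (\<Sum>j\<in>{i<..<c}. g (ndist i j))"
  by (simp add: sum.union_disjoint ivl_disj_int)
 also have "(\<Sum>j\<le>i. g (ndist i j)) = (\<Sum>k\<le>i. g k)"
  by (rule sum.reindex_bij_witness[of _ "%k. i - k" "%j. i - j"]) (auto simp: ndist_def)
 also have "\<dots> <= (\<Sum>k<c. g k)" using i by (intro sum_mono2 g) auto
 also have "(\<Sum>j\<in>{i<..<c}. g (ndist i j)) = (\<Sum>k\<in>{0<..<c - i}. g k)"
  by (rule sum.reindex_bij_witness[of _ "%k. i + k" "%j. j - i"]) (auto simp: ndist_def)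
 also have "\<dots> <= (\<Sum>k<c. g k)" using i by (intro sum_mono2 g) auto
 finally show ?thesis by simp
qed

text \<open>Each term beyond the first is at most a difference of consecutive reciprocals divided by
  \<open>x\<close>, and these telescope.\<close>

lemma sum_inverse_sq_le:
 fixes x :: real assumes x: "x > 0"
 shows "(\<Sum>k<c. 1 / (1 + x * real k)^2) <= 1 + 1 / x"
proof -
 have "(\<Sum>k<c. 1 / (1 + x * real (Suc k))^2) <= (1 - 1 / (1 + x * real c)) / x" for c
 proof (induction c)
  case (Suc c)
  have p: "1 + x * real c > 0" "1 + x * real (Suc c) > 0" using x by (auto intro: add_pos_nonneg)
  have "1 / (1 + x * real (Suc c))^2 <= 1 / ((1 + x * real c) * (1 + x * real (Suc c)))"
   unfolding power2_eq_square using x p by (intro divide_left_mono mult_right_mono mult_pos_pos) auto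
  also have "\<dots> = (1 / (1 + x * real c) - 1 / (1 + x * real (Suc c))) / x"
  proof -
   have fr: "1 / (a * b) = (1 / a - 1 / b) / (b - a)" if "0 < a" "a < b" for a b :: real using that by (simp add: divide_simps)
   show ?thesis using fr[of "1 + x * real c" "1 + x * real (Suc c)"] p x by (simp add: algebra_simps)
  qed
  finally show ?case using Suc by (simp add: diff_divide_distrib)
 qed simp
 also have "(1 - 1 / (1 + x * real c)) / x <= 1 / x" for c using x by (intro divide_right_mono) auto
 finally have *: "(\<Sum>k<c. 1 / (1 + x * real (Suc k))^2) <= 1 / x" for c .
 show ?thesis
 proof (cases c)
  case (Suc m)
  then show ?thesis unfolding Suc sum.lessThan_Suc_shift using *[of m] by simp
 qed (use x in simp)
qed

lemma n_et_sq_le: "n >= 1 ==> real n * (et n)^2 <= 4"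
proof -
 assume n: "n >= 1"
 have "ln (sqrt n) <= sqrt n - 1" using n by (intro ln_le_minus_one) simp
 then have "1 + ln n <= 2 * sqrt n" using n by (simp add: ln_sqrt)
 then have "(1 + ln n)^2 <= (2 * sqrt n)^2" using n by (intro power_mono) auto
 then have "(1 + ln n)^2 <= 4 * n" by (simp add: power_mult_distrib)
 moreover have "real n * (et n)^2 = (1 + ln n)^2 / n" using n by (simp add: et_def power_divide power2_eq_square)
 moreover have "(1 + ln n)^2 / n <= 4 * n / n" using calculation(1) by (intro divide_right_mono) auto
 ultimately show ?thesis using n by simp
qed

locale sl_process = sl_data \<phi> K + prob_space M
 for \<phi> :: "nat => nat + nat => real => real" and K :: real and M :: "'s measure" +
 fixes \<xi> :: "nat + nat => 's => real"
 assumes std_xi: "!!i. i \<in> {1..} <+> {1..} ==> distributed M lborel (\<xi> i) std_normal_density"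
  and indep_xi: "indep_vars (%_. borel) \<xi> ({1..} <+> {1..})"
begin

sublocale gv: gauss_vec M "J n" \<xi> for n
proof
 show "i \<in> J n ==> distributed M lborel (\<xi> i) std_normal_density" for i by (rule std_xi) (auto simp: J_def)
 show "indep_vars (%_. borel) \<xi> (J n)" by (rule indep_vars_subset[OF indep_xi]) (auto simp: J_def)
qed simp

text \<open>Bounded limits of cosine polynomials in the three values at \<open>t - de\<close>, \<open>t\<close> and \<open>t + de\<close>, expressed in
 an arbitrary orthonormal frame spanning them.\<close>

definition loc :: "nat => real => real => ('s => real) => bool" where
 "loc n de t f \<longleftrightarrow> (\<forall>e. gv.ortho3 n e --> gv.in_span n e (V n 0 (t - de)) --> gv.in_span n e (V n 0 t) -->
  gv.in_span n e (V n 0 (t + de)) --> gv.limtrig n e f)"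

lemma cell_frame_spans:
 assumes n: "good n" and de: "de > 0" "de <= 1 / 40000" and dom: "t - de \<in> dom n" "t + de \<in> dom n"
 obtains e where "gv.ortho3 n e" "gv.in_span n e (V n 0 (t - de))" "gv.in_span n e (V n 0 t)" "gv.in_span n e (V n 0 (t + de))"
  "!!v r a. (!!z a. z \<in> {t - de..t + de} ==> a <= 2 ==> \<bar>ip (J n) (V n a z) v\<bar> <= r) ==> a < 3 ==> \<bar>ip (J n) (e a) v\<bar> <= 20 * r"
proof -
 obtain e :: "nat => nat + nat => real" where e: "\<forall>a<3. \<forall>b<3. ip (J n) (e a) (e b) = (if a = b then 1 else 0)"
  "\<forall>x\<in>{V n 0 t, d2 n de t, d3 n de t}. \<exists>\<alpha>. \<forall>i. x i = (\<Sum>a<3. \<alpha> a * e a i)"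
  "\<forall>v r. (\<forall>z\<in>{t - de..t + de}. \<forall>a\<le>2. \<bar>ip (J n) (V n a z) v\<bar> <= r) --> (\<forall>a<3. \<bar>ip (J n) (e a) v\<bar> <= 20 * r)"
  using cell_frame[OF assms] by blast
 have o: "gv.ortho3 n e" using e(1) by (simp add: gv.ortho3_def)
 have s: "gv.in_span n e (V n 0 t)" "gv.in_span n e (d2 n de t)" "gv.in_span n e (d3 n de t)" using e(2) unfolding gv.in_span_def by auto
 have "V n 0 (t + de) = (%i. 1 * (1 * V n 0 t i + de * d2 n de t i) + (de^2 / 2) * d3 n de t i)"
  using de by (simp add: fun_eq_iff d2_def d3_def field_simps)
 then have sp: "gv.in_span n e (V n 0 (t + de))" by (simp only: gv.in_span_lin s)
 have "V n 0 (t - de) = (%i. 1 * (1 * V n 0 t i + (- de) * d2 n de t i) + (de^2 / 2) * d3 n de t i)"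
  using de by (simp add: fun_eq_iff d2_def d3_def field_simps)
 then have sm: "gv.in_span n e (V n 0 (t - de))" by (simp only: gv.in_span_lin s)
 show ?thesis by (rule that[OF o sm s(1) sp]) (use e(3) in blast)
qed

text \<open>Each frame costs a factor 20 per entry and the cross Gram matrix has nine entries,
  whence \<open>9 * 400^2 = 1440000\<close>. Moving from points of the cells to their centres at
  most doubles the reciprocal distance, so 64 becomes 128, and \<open>2 * 128^2 = 32768\<close>
  after squaring the two-term bound.\<close>

lemma loc_cv_le:
 assumes n: "good n" and de: "de > 0" "de <= 1 / 40000"
  and dom: "t - de \<in> dom n" "t + de \<in> dom n" "t' - de \<in> dom n" "t' + de \<in> dom n"
  and f: "loc n de t f" and g: "loc n de t' g"
  and A: "expectation (%s. (f s)^2) <= A" "expectation (%s. (g s)^2) <= A"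
 shows "\<bar>gv.cv f g\<bar> <= (1440000 * (32768 + 2 * C1^2)) * (1 / (1 + \<bar>t - t'\<bar>)^2 + (et n)^2) * A"
proof -
 have n1: "n >= 1" using n by (simp add: good_def)
 obtain e where e: "gv.ortho3 n e" "gv.in_span n e (V n 0 (t - de))" "gv.in_span n e (V n 0 t)" "gv.in_span n e (V n 0 (t + de))"
  "!!v r a. (!!z a. z \<in> {t - de..t + de} ==> a <= 2 ==> \<bar>ip (J n) (V n a z) v\<bar> <= r) ==> a < 3 ==> \<bar>ip (J n) (e a) v\<bar> <= 20 * r"
  using cell_frame_spans[OF n de dom(1,2)] by metis
 obtain e' where e': "gv.ortho3 n e'" "gv.in_span n e' (V n 0 (t' - de))" "gv.in_span n e' (V n 0 t')" "gv.in_span n e' (V n 0 (t' + de))"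
  "!!v r a. (!!z a. z \<in> {t' - de..t' + de} ==> a <= 2 ==> \<bar>ip (J n) (V n a z) v\<bar> <= r) ==> a < 3 ==> \<bar>ip (J n) (e' a) v\<bar> <= 20 * r"
  using cell_frame_spans[OF n de dom(3,4)] by metis
 define x where "x = 128 / (1 + \<bar>t - t'\<bar>) + C1 * et n"
 have VV: "\<bar>ip (J n) (V n a z) (V n b z')\<bar> <= x"
  if "a <= 2" "b <= 2" "z \<in> {t - de..t + de}" "z' \<in> {t' - de..t' + de}" for a b z z'
 proof -
  have "z \<in> dom n" "z' \<in> dom n" using that dom by auto
  then have "\<bar>ip (J n) (V n a z) (V n b z')\<bar> <= 64 / (1 + \<bar>z - z'\<bar>) + C1 * et n" by (intro ip_V_le n1 that)
  moreover have "1 + \<bar>t - t'\<bar> <= 2 * (1 + \<bar>z - z'\<bar>)"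
   proof -
   have "t - de <= z" "z <= t + de" "t' - de <= z'" "z' <= t' + de" using that by auto
   then have "\<bar>t - t'\<bar> <= \<bar>z - z'\<bar> + 2 * de" by linarith
   moreover have "1 + p <= 2 * (1 + q)" if "p <= q + 2 * de" "0 <= q" for p q using that de by argo
   ultimately show ?thesis by simp
  qed
  then have "64 / (1 + \<bar>z - z'\<bar>) <= 64 / ((1 + \<bar>t - t'\<bar>) / 2)" by (intro divide_left_mono) auto
  ultimately show ?thesis by (simp add: x_def)
 qed
 have Ve: "\<bar>ip (J n) (V n a z) (e' b)\<bar> <= 20 * x" if "a <= 2" "z \<in> {t - de..t + de}" "b < 3" for a b z
  unfolding ip_commute[of "J n" "V n a z"] by (rule e'(5)[OF _ that(3)]) (use VV that in \<open>simp add: ip_commute[of "J n" _ "V n a z"]\<close>)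
 have ee: "\<bar>ip (J n) (e a) (e' b)\<bar> <= 400 * x" if "a < 3" "b < 3" for a b using e(5)[of "e' b" "20 * x" a] Ve that by simp
 have "(\<Sum>a<3. \<Sum>b<3. (ip (J n) (e a) (e' b))^2) <= (\<Sum>a<3::nat. \<Sum>b<3::nat. (400 * x)^2)"
 proof (intro sum_mono)
  fix a b :: nat assume "a \<in> {..<3}" "b \<in> {..<3}"
  then show "(ip (J n) (e a) (e' b))^2 <= (400 * x)^2" using power_mono[OF ee abs_ge_zero, of a b 2] by simp
 qed
 also have "\<dots> = 1440000 * x^2" by (simp add: power_mult_distrib)
 also have "x^2 <= (32768 + 2 * C1^2) * (1 / (1 + \<bar>t - t'\<bar>)^2 + (et n)^2)"
 proof -
  have "x^2 <= 2 * (128 / (1 + \<bar>t - t'\<bar>))^2 + 2 * (C1 * et n)^2"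
   unfolding x_def using sum_squares_bound[of "128 / (1 + \<bar>t - t'\<bar>)" "C1 * et n"] by (simp add: power2_sum)
  also have "\<dots> = 32768 * (1 / (1 + \<bar>t - t'\<bar>)^2) + 2 * C1^2 * (et n)^2" by (simp add: power_divide power_mult_distrib)
  also have "\<dots> <= (32768 + 2 * C1^2) * (1 / (1 + \<bar>t - t'\<bar>)^2) + (32768 + 2 * C1^2) * (et n)^2"
   by (intro add_mono mult_right_mono) auto
  finally show ?thesis by (simp add: distrib_left)
 qed
 finally have r: "(\<Sum>a<3. \<Sum>b<3. (ip (J n) (e a) (e' b))^2) <= 1440000 * ((32768 + 2 * C1^2) * (1 / (1 + \<bar>t - t'\<bar>)^2 + (et n)^2))"
  by simp
 have "gv.limtrig n e f" "gv.limtrig n e' g" using f g e e' unfolding loc_def by auto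
 from gv.limtrig_cv_le[OF this e(1) e'(1) r A] show ?thesis by (simp only: mult.assoc)
qed

definition "CV = 64 * (1440000 * (32768 + 2 * C1^2))"

lemma loc_meas:
 assumes "good n" "de > 0" "de <= 1 / 40000" "t - de \<in> dom n" "t + de \<in> dom n" "loc n de t f"
 shows "f \<in> borel_measurable M" "\<exists>B. \<forall>s. \<bar>f s\<bar> <= B"
proof -
 obtain e where "gv.ortho3 n e" "gv.in_span n e (V n 0 (t - de))" "gv.in_span n e (V n 0 t)" "gv.in_span n e (V n 0 (t + de))"
  using cell_frame_spans[OF assms(1-5)] by metis
 then have "gv.limtrig n e f" using assms(6) unfolding loc_def by blast
 then show "f \<in> borel_measurable M" "\<exists>B. \<forall>s. \<bar>f s\<bar> <= B" by (rule gv.limtrig_meas, rule gv.limtrig_bounded)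
qed

text \<open>This is half a cell width: \<open>c\<close> cells fill \<open>dom n\<close>, their ends
  are the points \<open>pt\<close> with even index and their midpoints those with odd index.\<close>

definition mesh :: "nat => nat => real" where "mesh n c = pi * n / c"

definition pt :: "nat => nat => nat => real" where "pt n c j = real j * mesh n c"

lemma pt_dom: "c >= 1 ==> j <= 2 * c ==> pt n c j \<in> dom n"
proof -
 assume c: "c >= 1" "j <= 2 * c"
 have "real j * (pi * n / c) <= real (2 * c) * (pi * n / c)" using c by (intro mult_right_mono) auto
 then show ?thesis using c by (simp add: pt_def mesh_def)
qed

text \<open>There are \<open>pi * n / h\<close> cells, and the squared inverse distances from one
  cell sum to order \<open>1 / h\<close>. The model error contributes the number of pairs times
  \<open>et n ^ 2\<close>, which is of order \<open>n / h^2\<close> since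
  \<open>n * (et n)^2\<close> is bounded.\<close>

lemma cell_sum_variance:
 assumes n: "good n" and c: "c >= 1" and de: "mesh n c <= 1 / 40000"
  and f: "!!i. i < c ==> loc n (mesh n c) (pt n c (2 * i + 1)) (f i)"
  and A: "!!i. i < c ==> expectation (%s. (f i s)^2) <= A" and A0: "A >= 0"
 shows "gv.cv (%s. \<Sum>i<c. f i s) (%s. \<Sum>i<c. f i s) <= CV * A * n / (mesh n c)^2"
proof -
 define de where "de = mesh n c"
 have n1: "n >= 1" using n by (simp add: good_def)
 have de0: "de > 0" using n1 c by (simp add: de_def mesh_def)
 have de1: "de <= 1 / 40000" using de by (simp add: de_def)
 have cd: "real c = pi * n / de" using c n1 by (simp add: de_def mesh_def)
 define B where "B = 1440000 * (32768 + 2 * C1^2)"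
 have B: "B >= 0" by (simp add: B_def)
 have d: "pt n c (2 * i + 1) - de \<in> dom n" "pt n c (2 * i + 1) + de \<in> dom n" if "i < c" for i
 proof -
  have e: "pt n c (2 * i + 1) - de = pt n c (2 * i)" "pt n c (2 * i + 1) + de = pt n c (2 * i + 2)" by (simp_all add: pt_def de_def algebra_simps)
  show "pt n c (2 * i + 1) - de \<in> dom n" "pt n c (2 * i + 1) + de \<in> dom n" unfolding e using that c by (intro pt_dom; simp)+
 qed
 have m: "f i \<in> borel_measurable M" "\<exists>B. \<forall>s. \<bar>f i s\<bar> <= B" if "i < c" for i
  using loc_meas[OF n de0 de1 d[OF that] f[OF that, folded de_def]] by auto
 obtain b where b: "!!i s. i < c ==> \<bar>f i s\<bar> <= b i" using m(2) by metis
 have bb: "\<bar>f i s\<bar> <= (\<Sum>i<c. \<bar>b i\<bar>)" if "i \<in> {..<c}" for i s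
 proof -
  have "\<bar>f i s\<bar> <= \<bar>b i\<bar>" using b[of i s] that by simp
  also have "\<dots> <= (\<Sum>i<c. \<bar>b i\<bar>)" using that by (intro member_le_sum) auto
  finally show ?thesis .
 qed
 define g where "g k = 1 / (1 + 2 * de * real k)^2" for k :: nat
 have g0: "g k >= 0" for k by (simp add: g_def)
 have "gv.cv (%s. \<Sum>i<c. f i s) (%s. \<Sum>i<c. f i s) = (\<Sum>i<c. \<Sum>j<c. gv.cv (f i) (f j))"
  using gv.cv_sum_sum[of "{..<c}" f "\<Sum>i<c. \<bar>b i\<bar>" "%_. 1"] m(1) bb by simp
 also have "\<dots> <= (\<Sum>i<c. \<Sum>j<c. B * (g (ndist i j) + (et n)^2) * A)"
 proof (intro sum_mono)
  fix i j assume ij: "i \<in> {..<c}" "j \<in> {..<c}"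
  have "\<bar>gv.cv (f i) (f j)\<bar> <= B * (1 / (1 + \<bar>pt n c (2 * i + 1) - pt n c (2 * j + 1)\<bar>)^2 + (et n)^2) * A"
   unfolding B_def using ij by (intro loc_cv_le[OF n de0 de1] d f[folded de_def] A; simp)
  also have "\<bar>pt n c (2 * i + 1) - pt n c (2 * j + 1)\<bar> = 2 * de * real (ndist i j)"
  proof -
   have "pt n c (2 * i + 1) - pt n c (2 * j + 1) = (2 * de) * (real i - real j)" by (simp add: pt_def de_def algebra_simps)
   then show ?thesis unfolding of_nat_ndist using de0 by (simp add: abs_mult)
  qed
  finally show "gv.cv (f i) (f j) <= B * (g (ndist i j) + (et n)^2) * A" by (simp add: g_def)
 qed
 also have "\<dots> = B * A * (\<Sum>i<c. (\<Sum>j<c. g (ndist i j)) + c * (et n)^2)"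
  by (simp add: sum_distrib_left sum_distrib_right sum.distrib algebra_simps)
 also have "\<dots> <= B * A * (\<Sum>i<c. 2 * (1 + 1 / (2 * de)) + c * (et n)^2)"
 proof (intro mult_left_mono sum_mono add_right_mono)
  fix i assume "i \<in> {..<c}"
  then have "(\<Sum>j<c. g (ndist i j)) <= 2 * (\<Sum>k<c. g k)" using g0 by (intro sum_ndist_le) auto
  also have "(\<Sum>k<c. g k) <= 1 + 1 / (2 * de)" unfolding g_def using de0 by (intro sum_inverse_sq_le) simp
  finally show "(\<Sum>j<c. g (ndist i j)) <= 2 * (1 + 1 / (2 * de))" by simp
 qed (use B A0 in auto)
 also have "\<dots> = B * A * (real c * (2 + 1 / de) + (real c)^2 * (et n)^2)" by (simp add: power2_eq_square algebra_simps)
 also have "\<dots> <= B * A * (64 * n / de^2)"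
 proof (intro mult_left_mono)
  have "2 + 1 / de <= 2 / de" using de0 de1 by (simp add: field_simps)
  then have "real c * (2 + 1 / de) <= real c * (2 / de)" by (intro mult_left_mono) auto
  also have "\<dots> = 2 * pi * (n / de^2)" unfolding cd by (simp add: power2_eq_square)
  also have "\<dots> <= (2 * 32 / 10) * (n / de^2)" using pi_approx by (intro mult_right_mono) auto
  finally have 1: "real c * (2 + 1 / de) <= (2 * 32 / 10) * (n / de^2)" .
  have "(real c)^2 * (et n)^2 = pi^2 * (n * (et n)^2) * (n / de^2)" unfolding cd by (simp add: power2_eq_square)
  also have "\<dots> <= ((32/10)^2 * 4) * (n / de^2)" using pi_approx n_et_sq_le[OF n1] by (intro mult_right_mono mult_mono power_mono) auto
  finally have 2: "(real c)^2 * (et n)^2 <= ((32/10)^2 * 4) * (n / de^2)" .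
  have "real c * (2 + 1 / de) + (real c)^2 * (et n)^2 <= (2 * 32 / 10 + (32/10)^2 * 4) * (n / de^2)"
   using add_mono[OF 1 2] by (simp only: distrib_right)
  also have "\<dots> <= 64 * (n / de^2)" by (intro mult_right_mono) (auto simp: power2_eq_square)
  finally show "real c * (2 + 1 / de) + (real c)^2 * (et n)^2 <= 64 * n / de^2" by simp
 qed (use B A0 in auto)
 finally show ?thesis by (simp add: CV_def B_def de_def mult_ac)
qed

end

subsection \<open>Dyadic refinement of sign change counts\<close>

text \<open>As \<open>sgn b\<close> has square 1, the expression is
  \<open>(1 - sgn a * sgn b) * (1 - sgn b * sgn c) / 2\<close>. It is nonzero only if neither
  neighbour has the sign of \<open>b\<close>, and then nothing cancels in
  \<open>a + c - 2 * b\<close>.\<close>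

lemma sgn_pattern:
 fixes a b c :: real
 assumes "b ~= 0"
 shows "0 <= (1 - sgn a * sgn b - sgn b * sgn c + sgn a * sgn c) / 2"
  and "(1 - sgn a * sgn b - sgn b * sgn c + sgn a * sgn c) / 2 <= 2"
  and "(1 - sgn a * sgn b - sgn b * sgn c + sgn a * sgn c) / 2 ~= 0 ==>
   \<bar>b\<bar> <= \<bar>a + c - 2 * b\<bar> \<and> \<bar>c - a\<bar> <= \<bar>a + c - 2 * b\<bar>"
 using assms by (auto simp: sgn_if split: if_splits)

lemma ip_quad_lower:
 fixes I :: "'i set"
 assumes g: "999/1000 <= ip I u u" "\<bar>ip I u v\<bar> <= 1/1000" "82/1000 <= ip I v v"
 shows "1/20 * (p^2 + q^2) <= ip I (%i. p * u i + q * v i) (%i. p * u i + q * v i)"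
proof -
 have "2 * (p * q * ip I u v) >= - (1/1000 * p^2) - 1/1000 * q^2"
 proof -
  have "\<bar>2 * (p * q * ip I u v)\<bar> = (2 * \<bar>p * q\<bar>) * \<bar>ip I u v\<bar>" by (simp add: abs_mult)
  also have "\<dots> <= (p^2 + q^2) * (1/1000)"
   using sum_squares_bound[of "\<bar>p\<bar>" "\<bar>q\<bar>"] g(2) by (intro mult_mono) (auto simp: abs_mult mult.assoc)
  finally show ?thesis by (simp add: abs_le_iff)
 qed
 moreover have "p^2 * (999/1000) <= p^2 * ip I u u" by (intro mult_left_mono g) auto
 moreover have "q^2 * (82/1000) <= q^2 * ip I v v" by (intro mult_left_mono g) auto
 moreover have "ip I (%i. p * u i + q * v i) (%i. p * u i + q * v i)
  = p^2 * ip I u u + 2 * (p * q * ip I u v) + q^2 * ip I v v"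
  by (simp add: ip_lin_left ip_lin_right ip_commute[of _ v u] power2_eq_square algebra_simps)
 ultimately show ?thesis unfolding distrib_left using zero_le_power2[of p] zero_le_power2[of q] by linarith
qed

section \<open>Standard deviations and their monotone limits\<close>

context gauss_vec
begin

lemma AE_Z_nonzero:
 assumes "ip J u u > 0" shows "AE s in M. Z u s ~= 0"
proof -
 have L: "L2_set u J ~= 0" using assms by (auto simp: ip_self)
 have "AE x in lborel. x ~= (0::real)" by (rule AE_lborel_singleton)
 then have "AE x in SN. L2_set u J * x ~= 0" using L by (subst AE_density) (auto elim!: eventually_mono)
 then have "AE y in distr SN borel (%x. L2_set u J * x). y ~= 0" by (subst AE_distr_iff) auto
 then have "AE y in distr M borel (Z u). y ~= 0" by (simp only: distr_Z)
 then show ?thesis by (subst (asm) AE_distr_iff) auto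
qed

definition sd :: "('s => real) => real" where "sd f = sqrt (cv f f)"

lemma cv_commute: "cv f g = cv g f" by (simp add: cv_def mult.commute)

lemma sq_integrable_add:
 fixes f g :: "'s => real"
 assumes [measurable]: "f \<in> borel_measurable M" "g \<in> borel_measurable M"
  and i2: "integrable M (%s. (f s)^2)" "integrable M (%s. (g s)^2)"
 shows "integrable M (%s. (f s + g s)^2)" unfolding power2_sum mult.assoc using expectation_Cauchy(2)[of f g] i2 by simp

lemma sd_triangle:
 fixes f g :: "'s => real"
 assumes [measurable]: "f \<in> borel_measurable M" "g \<in> borel_measurable M"
  and i2: "integrable M (%s. (f s)^2)" "integrable M (%s. (g s)^2)"
 shows "sd (%s. f s + g s) <= sd f + sd g"
proof -
 have i: "integrable M f" "integrable M g"
  by (rule square_integrable_imp_integrable[OF assms(1) i2(1)], rule square_integrable_imp_integrable[OF assms(2) i2(2)])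
 have ifg: "integrable M (%s. f s * g s)" "integrable M (%s. g s * f s)" "integrable M (%s. f s * f s)" "integrable M (%s. g s * g s)"
  by (rule expectation_Cauchy(2); use i2 in simp)+
 have "cv (%s. f s + g s) (%s. f s + g s) = cv f f + 2 * cv f g + cv g g"
 proof -
  have "(%s. (f s + g s) * (f s + g s)) = (%s. f s * f s + 2 * (f s * g s) + g s * g s)" by (auto simp: algebra_simps)
  then have e1: "expectation (%s. (f s + g s) * (f s + g s))
   = expectation (%s. f s * f s) + 2 * expectation (%s. f s * g s) + expectation (%s. g s * g s)" using ifg by simp
  have e2: "expectation (%s. f s + g s) = expectation f + expectation g" using i by simp
  show ?thesis unfolding cv_def e1 e2 by (simp add: algebra_simps)
 qed
 also have "\<dots> <= cv f f + 2 * (sd f * sd g) + cv g g" using cv_Cauchy[OF assms] by (simp add: sd_def abs_le_iff)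
 also have "\<dots> = (sd f + sd g)^2" using cv_self[OF i2(1)] cv_self[OF i2(2)] by (simp add: sd_def power2_sum)
 finally have "sd (%s. f s + g s) <= \<bar>sd f + sd g\<bar>" unfolding sd_def using real_sqrt_le_mono by fastforce
 moreover have "sd f >= 0" "sd g >= 0" using cv_self[OF i2(1)] cv_self[OF i2(2)] by (simp_all add: sd_def)
 ultimately show ?thesis by simp
qed

text \<open>Standard deviations do not see constants, so the bound on expectations is added to bound
  the second moments. Monotone convergence makes \<open>Y\<close> square integrable; afterwards
  multiples of \<open>Y\<close> and \<open>Y^2\<close> dominate.\<close>

lemma sd_limit_increasing:
 fixes X :: "nat => 's => real"
 assumes [measurable]: "!!j. X j \<in> borel_measurable M" "Y \<in> borel_measurable M"
  and i2: "!!j. integrable M (%s. (X j s)^2)" and nn: "!!j. AE s in M. 0 <= X j s"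
  and mono: "!!j. AE s in M. X j s <= X (Suc j) s" and lim: "AE s in M. (%j. X j s) \<longlonglongrightarrow> Y s"
  and B: "!!j. sd (%s. X j s - X 0 s) <= B" and E: "!!j. expectation (X j) <= B'"
 shows "integrable M (%s. (Y s)^2)" "sd (%s. Y s - X 0 s) <= B"
proof -
 have mono': "AE s in M. \<forall>j. X j s <= X (Suc j) s" and nn': "AE s in M. \<forall>j. 0 <= X j s" using mono nn by (auto simp: AE_all_countable)
 have i: "integrable M (X j)" for j by (rule square_integrable_imp_integrable[OF _ i2]) simp
 have E0: "0 <= expectation (X j)" for j by (rule integral_nonneg_AE[OF nn])
 have dm: "(%s. X j s - X 0 s) \<in> borel_measurable M" and di2: "integrable M (%s. (X j s - X 0 s)^2)" for j
  using sq_integrable_add[of "X j" "%s. - X 0 s"] i2 by auto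
 define C where "C = (sd (X 0) + B)^2 + B'^2"
 have sd0: "sd (X j) >= 0" for j using cv_self[OF i2[of j]] by (simp add: sd_def)
 have bound: "expectation (%s. (X j s)^2) <= C" for j
 proof -
  have "sd (X j) <= sd (X 0) + sd (%s. X j s - X 0 s)" using sd_triangle[of "X 0" "%s. X j s - X 0 s"] i2 dm di2 by simp
  then have "sd (X j) <= sd (X 0) + B" using B[of j] by linarith
  then have "(sd (X j))^2 <= (sd (X 0) + B)^2" using sd0 by (intro power_mono)
  moreover have "(sd (X j))^2 = cv (X j) (X j)" using cv_self[OF i2[of j]] by (simp add: sd_def)
  moreover have "(expectation (X j))^2 <= B'^2" using E E0 by (intro power_mono)
  ultimately show ?thesis unfolding C_def by (simp add: cv_def power2_eq_square)
 qed
 have mono2: "AE s in M. mono (%j. (X j s)^2)" using mono' nn' by eventually_elim (auto intro!: incseq_SucI power_mono)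
 have bdd: "Bseq (%j. expectation (%s. (X j s)^2))" by (rule BseqI'[where K=C]) (use bound in simp)
 have inc: "incseq (%j. expectation (%s. (X j s)^2))"
 proof (rule incseq_SucI, rule integral_mono_AE[OF i2 i2])
  show "AE s in M. (X j s)^2 <= (X (Suc j) s)^2" for j using mono' nn' by eventually_elim (auto intro!: power_mono)
 qed
 have "convergent (%j. expectation (%s. (X j s)^2))" by (rule Bseq_mono_convergent[OF bdd]) (use inc in \<open>auto simp: incseq_def\<close>)
 then obtain l where l: "(%j. expectation (%s. (X j s)^2)) \<longlonglongrightarrow> l" by (auto simp: convergent_def)
 have lim2: "AE s in M. (%j. (X j s)^2) \<longlonglongrightarrow> (Y s)^2" using lim by eventually_elim (auto intro!: tendsto_power)
 show Y2: "integrable M (%s. (Y s)^2)" by (rule integrable_monotone_convergence[OF i2 mono2 lim2 l]) simp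
 have Y: "integrable M Y" by (rule square_integrable_imp_integrable[OF _ Y2]) simp
 have le: "AE s in M. \<forall>j. 0 <= X j s \<and> X j s <= Y s" using mono' nn' lim
 proof eventually_elim
  case (elim s)
  have "incseq (%j. X j s)" using elim by (auto intro: incseq_SucI)
  then show ?case using elim incseq_le by blast
 qed
 have 1: "(%j. expectation (%s. X j s - X 0 s)) \<longlonglongrightarrow> expectation (%s. Y s - X 0 s)"
 proof (rule integral_dominated_convergence[where w="%s. 2 * Y s"])
  show "AE s in M. (%j. X j s - X 0 s) \<longlonglongrightarrow> Y s - X 0 s" using lim by eventually_elim (auto intro!: tendsto_intros)
  show "AE s in M. norm (X j s - X 0 s) <= 2 * Y s" for j using le by eventually_elim (smt (verit) real_norm_def)
 qed (use Y in auto)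
 have 2: "(%j. expectation (%s. (X j s - X 0 s) * (X j s - X 0 s))) \<longlonglongrightarrow> expectation (%s. (Y s - X 0 s) * (Y s - X 0 s))"
 proof (rule integral_dominated_convergence[where w="%s. 4 * (Y s)^2"])
  show "AE s in M. (%j. (X j s - X 0 s) * (X j s - X 0 s)) \<longlonglongrightarrow> (Y s - X 0 s) * (Y s - X 0 s)"
   using lim by eventually_elim (auto intro!: tendsto_intros)
  show "AE s in M. norm ((X j s - X 0 s) * (X j s - X 0 s)) <= 4 * (Y s)^2" for j using le
  proof eventually_elim
   case (elim s)
   then have "\<bar>X j s - X 0 s\<bar> <= 2 * Y s" by (smt (verit))
   then have "\<bar>X j s - X 0 s\<bar> * \<bar>X j s - X 0 s\<bar> <= (2 * Y s) * (2 * Y s)" by (intro mult_mono) auto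
   then show ?case by (simp add: abs_mult power2_eq_square)
  qed
 qed (use Y2 in auto)
 have "(%j. sd (%s. X j s - X 0 s)) \<longlonglongrightarrow> sd (%s. Y s - X 0 s)" unfolding sd_def cv_def by (intro tendsto_intros 1 2)
 then show "sd (%s. Y s - X 0 s) <= B" by (rule LIMSEQ_le_const2) (use B in blast)
qed

end

section \<open>One refinement step of the sign change count\<close>

context sl_process
begin

definition fz :: "nat => real => 's => real" where "fz n t s = gv.Z n (V n 0 t) s"

lemma fz_meas [measurable]: "fz n t \<in> borel_measurable M" unfolding fz_def[abs_def] by (rule gv.Z_meas)

text \<open>The gain in the number of sign changes when the grid point \<open>t\<close> is inserted between \<open>t - de\<close> and \<open>t + de\<close>.\<close>

definition extra :: "nat => real => real => 's => real" where
 "extra n de t s = (1 - sgn (fz n (t - de) s) * sgn (fz n t s) - sgn (fz n t s) * sgn (fz n (t + de) s)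
   + sgn (fz n (t - de) s) * sgn (fz n (t + de) s)) / 2"

lemma extra_meas [measurable]: "extra n de t \<in> borel_measurable M" unfolding extra_def[abs_def] by measurable

lemma loc_sgn: "loc n de t (%s. sgn (fz n (t - de) s) * sgn (fz n (t + de) s))"
 "loc n de t (%s. sgn (fz n (t - de) s) * sgn (fz n t s))" "loc n de t (%s. sgn (fz n t s) * sgn (fz n (t + de) s))"
 unfolding loc_def fz_def by (auto intro: gv.limtrig_sgn_mult)

lemma loc_lin: "loc n de t f ==> loc n de t g ==> loc n de t (%s. p * f s + q * g s)" unfolding loc_def by (auto intro: gv.limtrig_lin)

lemma loc_const: "loc n de t (%s. a)" unfolding loc_def by (auto intro: gv.limtrig_const)

lemma loc_extra: "loc n de t (extra n de t)"
proof -
 have "extra n de t = (%s. 1 * (1 * (1/2) + (-1/2) * (sgn (fz n (t - de) s) * sgn (fz n t s)))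
  + 1 * ((-1/2) * (sgn (fz n t s) * sgn (fz n (t + de) s)) + (1/2) * (sgn (fz n (t - de) s) * sgn (fz n (t + de) s))))"
  by (rule ext) (simp add: extra_def field_simps)
 then show ?thesis by (simp only: loc_lin loc_const loc_sgn)
qed

text \<open>A gain forces value and first difference at the midpoint to be dominated by the second
  difference. Either the second difference quotient exceeds \<open>L\<close>, which the tenth moment
  makes rare, or value and first quotient lie in the box \<open>de^2 * L\<close> by
  \<open>de * L\<close>, to which the small ball estimate applies. The gain is at most 2, whence
  \<open>4 * (60 + 945) = 4020\<close>.\<close>

lemma extra_facts:
 assumes n: "good n" and de: "de > 0" "de <= 1 / 40000" and dom: "t - de \<in> dom n" "t + de \<in> dom n"
 shows "AE s in M. 0 <= extra n de t s" and "expectation (%s. (extra n de t s)^2) <= 4020 * de powr (5/2)"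
  and "expectation (extra n de t) <= 4020 * de powr (5/2)"
proof -
 note g = cell_gram[OF assms]
 have gg: "999/1000 <= ip (J n) (V n 0 t) (V n 0 t)" "\<bar>ip (J n) (V n 0 t) (d2 n de t)\<bar> <= 1/1000"
  "82/1000 <= ip (J n) (d2 n de t) (d2 n de t)" "ip (J n) (d3 n de t) (d3 n de t) <= 1" using g(1,2,3,6) by linarith+
 have nz: "AE s in M. fz n t s ~= 0" unfolding fz_def by (rule gv.AE_Z_nonzero) (use gg in linarith)
 show pos: "AE s in M. 0 <= extra n de t s" using nz by eventually_elim (unfold extra_def, rule sgn_pattern(1))
 \<comment> \<open>The threshold balances the two events: \<open>de^3 * L^2\<close> and
   \<open>L\<close> to the power -10 are both \<open>de powr (5/2)\<close>.\<close>
 define L where "L = de powr (- 1/4)"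
 have L: "L > 0" using de by (simp add: L_def)
 define S1 where "S1 = {s \<in> space M. \<bar>gv.Z n (V n 0 t) s\<bar> <= de^2 * L \<and> \<bar>gv.Z n (d2 n de t) s\<bar> <= de * L}"
 define S2 where "S2 = {s \<in> space M. L ^ 10 <= (gv.Z n (d3 n de t) s) ^ 10}"
 have [measurable]: "S1 \<in> events" "S2 \<in> events" unfolding S1_def S2_def by measurable
 have p1: "prob S1 <= 60 * de powr (5/2)"
 proof -
  have "prob S1 <= 3 * (de^2 * L) * (de * L) / (1/20)" unfolding S1_def
  proof (rule gv.small_ball)
   show "1/20 * (p^2 + q^2) <= ip (J n) (%i. p * V n 0 t i + q * d2 n de t i) (%i. p * V n 0 t i + q * d2 n de t i)" for p q
    by (rule ip_quad_lower) (use gg in auto)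
  qed (use de L in auto)
  also have "\<dots> = 60 * (de ^ 3 * L^2)" by (simp add: power2_eq_square power3_eq_cube)
  also have "de ^ 3 * L^2 = de powr (5/2)"
  proof -
   have "de ^ 3 = de powr 3" using de by simp
   moreover have "L^2 = de powr (- 1/2)" unfolding L_def power2_eq_square powr_add[symmetric] by simp
   ultimately show ?thesis by (simp add: powr_add[symmetric])
  qed
  finally show ?thesis .
 qed
 have p2: "prob S2 <= 945 * de powr (5/2)"
 proof -
  have "prob S2 <= expectation (%s. (gv.Z n (d3 n de t) s) ^ 10) / L ^ 10" unfolding S2_def
   using integral_Markov_inequality_measure[OF gv.integrable_Z_pow10[of n "d3 n de t"], of "space M" "L ^ 10"] L by simp
  also have "\<dots> <= 945 * 1 ^ 5 / L ^ 10"
   unfolding gv.expectation_Z_pow10 using L gg(4) by (intro divide_right_mono mult_left_mono power_mono) auto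
  also have "\<dots> = 945 * de powr (5/2)"
  proof -
   have "L ^ 10 = de powr (- (5/2))" unfolding L_def using de by (simp add: powr_power)
   then show ?thesis by (simp add: powr_minus field_simps)
  qed
  finally show ?thesis .
 qed
 have bd: "\<bar>extra n de t s\<bar> <= 2" for s unfolding extra_def by (auto simp: sgn_if)
 have key: "AE s in M. (extra n de t s ~= 0 --> s \<in> S1 \<union> S2) \<and> extra n de t s <= 2" using nz AE_space
 proof eventually_elim
  case (elim s)
  have "s \<in> S1 \<union> S2" if e: "extra n de t s ~= 0"
  proof -
   let ?a = "fz n (t - de) s" and ?b = "fz n t s" and ?c = "fz n (t + de) s"
   have "\<bar>?b\<bar> <= \<bar>?a + ?c - 2 * ?b\<bar> \<and> \<bar>?c - ?a\<bar> <= \<bar>?a + ?c - 2 * ?b\<bar>"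
    by (rule sgn_pattern(3)) (use elim e in \<open>auto simp: extra_def\<close>)
   moreover have "?a + ?c - 2 * ?b = de^2 * gv.Z n (d3 n de t) s"
   proof -
    have "d3 n de t = (%i. (1 / de^2) * (1 * (1 * V n 0 (t + de) i + 1 * V n 0 (t - de) i) + (- 2) * V n 0 t i))" by (simp add: fun_eq_iff d3_def)
    then have "gv.Z n (d3 n de t) s = (1 / de^2) * (1 * (1 * ?c + 1 * ?a) + (- 2) * ?b)" by (simp only: gv.Z_lin gv.Z_scale fz_def)
    then show ?thesis using de by simp
   qed
   moreover have "?c - ?a = 2 * de * gv.Z n (d2 n de t) s"
   proof -
    have "d2 n de t = (%i. (1 / (2 * de)) * (1 * V n 0 (t + de) i + (- 1) * V n 0 (t - de) i))" by (simp add: fun_eq_iff d2_def)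
    then have "gv.Z n (d2 n de t) s = (1 / (2 * de)) * (1 * ?c + (- 1) * ?a)" by (simp only: gv.Z_lin gv.Z_scale fz_def)
    then show ?thesis using de by simp
   qed
   ultimately have b: "\<bar>?b\<bar> <= de^2 * \<bar>gv.Z n (d3 n de t) s\<bar>" "2 * de * \<bar>gv.Z n (d2 n de t) s\<bar> <= de^2 * \<bar>gv.Z n (d3 n de t) s\<bar>"
    using de by (simp_all add: abs_mult)
   show ?thesis
   proof (cases "\<bar>gv.Z n (d3 n de t) s\<bar> <= L")
    case True
    then have l: "de^2 * \<bar>gv.Z n (d3 n de t) s\<bar> <= de^2 * L" by (intro mult_left_mono) auto
    have "2 * de * \<bar>gv.Z n (d2 n de t) s\<bar> <= de * (de * L)" using b(2) l by (simp add: power2_eq_square mult.assoc)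
    then have "2 * \<bar>gv.Z n (d2 n de t) s\<bar> <= de * L" using de by (simp add: mult.assoc mult.left_commute)
    then have "\<bar>gv.Z n (d2 n de t) s\<bar> <= de * L" by simp
    moreover have "\<bar>?b\<bar> <= de^2 * L" using b(1) l by linarith
    ultimately show ?thesis using elim by (simp add: S1_def fz_def)
   next
    case False
    then have "L ^ 10 <= \<bar>gv.Z n (d3 n de t) s\<bar> ^ 10" using L by (intro power_mono) auto
    then have "s \<in> S2" using elim by (simp add: S2_def power_even_abs)
    then show ?thesis ..
   qed
  qed
  then show ?case using bd[of s] by (simp add: abs_le_iff)
 qed
 have P: "prob (S1 \<union> S2) <= 1005 * de powr (5/2)" using measure_Un_le[of S1 M S2] p1 p2 by simp
 have iS: "integrable M (%s. 4 * indicator (S1 \<union> S2) s :: real)"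
  by (intro integrable_mult_right integrable_real_indicator) (auto simp: emeasure_eq_measure)
 have i1: "integrable M (extra n de t)" by (rule gv.integrable_bounded[OF _ bd]) simp
 have i2: "integrable M (%s. (extra n de t s)^2)" by (rule gv.integrable_sq_bounded[OF _ bd]) simp
 have E: "expectation (%s. 4 * indicator (S1 \<union> S2) s :: real) <= 4020 * de powr (5/2)" using P by simp
 have "expectation (%s. (extra n de t s)^2) <= expectation (%s. 4 * indicator (S1 \<union> S2) s :: real)"
 proof (rule integral_mono_AE[OF i2 iS])
  show "AE s in M. (extra n de t s)^2 <= 4 * indicator (S1 \<union> S2) s" using key pos
  proof eventually_elim
   case (elim s)
   then have "(extra n de t s)^2 <= 2^2" by (intro power_mono) auto
   then show ?case using elim by (cases "extra n de t s = 0") auto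
  qed
 qed
 then show "expectation (%s. (extra n de t s)^2) <= 4020 * de powr (5/2)" using E by linarith
 have "expectation (extra n de t) <= expectation (%s. 4 * indicator (S1 \<union> S2) s :: real)"
 proof (rule integral_mono_AE[OF i1 iS])
  show "AE s in M. extra n de t s <= 4 * indicator (S1 \<union> S2) s" using key by eventually_elim (force simp: indicator_def)
 qed
 then show "expectation (extra n de t) <= 4020 * de powr (5/2)" using E by linarith
qed

end

subsection \<open>Simple zeros and sign changes\<close>

lemma eventually_nonzero_near_simple_zero:
 fixes f :: "real => real"
 assumes D: "(f has_real_derivative d) (at x within S)" and s: "f x = 0 ==> d ~= 0"
 shows "eventually (%y. f y ~= 0) (at x within S)"
proof (cases "f x = 0")
 case True
 have "((%y. (f y - f x) / (y - x)) \<longlongrightarrow> d) (at x within S)" using D by (simp add: has_field_derivative_iff)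
 from tendsto_imp_eventually_ne[OF this s[OF True]] show ?thesis by eventually_elim (use True in auto)
next
 case False
 have "(f \<longlongrightarrow> f x) (at x within S)" using DERIV_continuous[OF D] by (simp add: continuous_within)
 from tendsto_imp_eventually_ne[OF this False] show ?thesis .
qed

text \<open>Infinitely many zeros would accumulate in the compact interval, but near each point the
  function is nonzero except possibly at the point itself.\<close>

lemma simple_zeros_finite:
 fixes f :: "real => real"
 assumes D: "!!t. t \<in> {a..b} ==> (f has_real_derivative f' t) (at t within {a..b})"
  and s: "!!t. t \<in> {a..b} ==> f t = 0 ==> f' t ~= 0"
 shows "finite {t \<in> {a..b}. f t = 0}"
proof (rule ccontr)
 assume "infinite {t \<in> {a..b}. f t = 0}"
 then obtain x where x: "x \<in> {a..b}" "x islimpt {t \<in> {a..b}. f t = 0}"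
  using compact_Icc[of a b] unfolding compact_eq_Bolzano_Weierstrass by (metis (no_types, lifting) mem_Collect_eq subsetI)
 have "eventually (%y. f y ~= 0) (at x within {a..b})" by (rule eventually_nonzero_near_simple_zero[OF D[OF x(1)]]) (rule s[OF x(1)])
 then obtain d where d: "d > 0" "!!y. y \<in> {a..b} ==> y ~= x ==> dist y x < d ==> f y ~= 0" unfolding eventually_at by auto
 then show False using x(2) unfolding islimpt_approachable by auto
qed

lemma sign_near_simple_zero:
 fixes f :: "real => real"
 assumes D: "(f has_real_derivative d) (at z within S)" and "f z = 0" "d ~= 0"
 shows "\<exists>et>0. \<forall>y\<in>S. \<bar>y - z\<bar> < et --> y ~= z --> sgn (f y) = sgn (y - z) * sgn d"
proof -
 have "((%y. sgn ((f y - f z) / (y - z))) \<longlongrightarrow> sgn d) (at z within S)"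
  using D by (intro tendsto_sgn assms) (simp add: has_field_derivative_iff)
 then have "eventually (%y. dist (sgn ((f y - f z) / (y - z))) (sgn d) < 1) (at z within S)" by (rule tendstoD) simp
 then obtain et where et: "et > 0" "!!y. y \<in> S ==> y ~= z ==> dist y z < et ==> dist (sgn ((f y - f z) / (y - z))) (sgn d) < 1"
  unfolding eventually_at by auto
 show ?thesis
 proof (intro exI[of _ et] conjI ballI impI)
  fix y assume y: "y \<in> S" "\<bar>y - z\<bar> < et" "y ~= z"
  have "\<bar>sgn (f y / (y - z)) - sgn d\<bar> < 1" using et(2)[of y] y assms by (simp add: dist_real_def)
  then have "sgn (f y / (y - z)) = sgn d" using assms(3) by (auto simp: sgn_if split: if_splits)
  then have e: "sgn (f y) / sgn (y - z) = sgn d" by (simp only: sgn_divide)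
  show "sgn (f y) = sgn (y - z) * sgn d" using y(3) by (cases "y < z") (simp_all flip: e)
 qed (rule et)
qed

text \<open>The local sign hypothesis forbids two zeros in one cell and forces a sign change in the
  cell of each zero; the intermediate value theorem gives the converse. Hence the cell index is a
  bijection from zeros to cells with a sign change.\<close>

lemma sign_changes_eq_card_zeros:
 fixes f :: "real => real"
 assumes h: "h > 0" and b: "b = real c * h" and cont: "continuous_on {0..b} f"
  and nz: "!!i. i <= c ==> f (real i * h) ~= 0"
  and loc: "!!z y. z \<in> {0..b} ==> f z = 0 ==> y \<in> {0..b} ==> \<bar>y - z\<bar> < 2 * h ==> y ~= z ==> sgn (f y) = sgn (y - z) * d z \<and> d z ~= 0"
 shows "(\<Sum>i<c. (1 - sgn (f (real i * h)) * sgn (f (real (Suc i) * h))) / 2) = real (card {t \<in> {0..b}. f t = 0})"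
proof -
 let ?Z = "{t \<in> {0..b}. f t = 0}"
 define C where "C = {i. i < c \<and> sgn (f (real i * h)) * sgn (f (real (Suc i) * h)) < 0}"
 define I where "I z = nat \<lfloor>z / h\<rfloor>" for z
 have fin: "finite C" by (simp add: C_def)
 have I: "I z < c \<and> real (I z) * h < z \<and> z < real (Suc (I z)) * h" if z: "z \<in> ?Z" for z
 proof -
  have z0: "0 <= z" "z <= b" "f z = 0" using z by auto
  have fl: "real (I z) = real_of_int \<lfloor>z / h\<rfloor>" using z0 h by (simp add: I_def)
  have le: "real (I z) <= z / h" "z / h < real (I z) + 1" unfolding fl by linarith+
  have le': "real (I z) * h <= z" "z < real (Suc (I z)) * h" using le h by (simp_all add: field_simps)
  have "z ~= b" using nz[of c] z0 b by auto
  then have "real (I z) * h < real c * h" using le'(1) z0 b by linarith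
  then have "I z < c" using h by simp
  moreover have "real (I z) * h ~= z" using nz[of "I z"] z0 \<open>I z < c\<close> by auto
  ultimately show ?thesis using le' by auto
 qed
 have dom: "real i * h \<in> {0..b}" if "i <= c" for i using that h b by (auto intro: mult_right_mono)
 have "bij_betw I ?Z C"
 proof (rule bij_betw_imageI)
  show "inj_on I ?Z"
  proof (rule inj_onI, rule ccontr)
   fix z z' assume z: "z \<in> ?Z" "z' \<in> ?Z" "I z = I z'" "z ~= z'"
   have "\<bar>z' - z\<bar> < 2 * h"
   proof -
    have "real (I z) * h < z" "z < real (I z) * h + h" "real (I z) * h < z'" "z' < real (I z) * h + h"
     using I[OF z(1)] I[OF z(2)] z(3) by (simp_all add: algebra_simps)
    then show ?thesis using h by linarith
   qed
   then show False using loc[of z z'] z by (auto simp: sgn_if split: if_splits)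
  qed
  show "I ` ?Z = C"
  proof (intro equalityI subsetI)
   fix i assume "i \<in> I ` ?Z"
   then obtain z where z: "z \<in> ?Z" "i = I z" by blast
   have i: "i < c" "real i * h < z" "z < real (Suc i) * h" using I[OF z(1)] z(2) by auto
   have st: "real (Suc i) * h = real i * h + h" by (simp add: algebra_simps)
   have "sgn (f (real i * h)) = sgn (real i * h - z) * d z \<and> d z ~= 0" by (rule loc) (use z i dom[of i] h st in auto)
   moreover have "sgn (f (real (Suc i) * h)) = sgn (real (Suc i) * h - z) * d z" by (rule loc[THEN conjunct1]) (use z i dom[of "Suc i"] h st in auto)
   ultimately have "sgn (f (real i * h)) * sgn (f (real (Suc i) * h)) = - (d z * d z) \<and> d z ~= 0" using i by simp
   then show "i \<in> C" using i by (auto simp: C_def) (metis mult_eq_0_iff not_real_square_gt_zero)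
  next
   fix i assume i: "i \<in> C"
   then have ic: "i < c" and neg: "sgn (f (real i * h)) * sgn (f (real (Suc i) * h)) < 0" by (auto simp: C_def)
   have le: "real i * h <= real (Suc i) * h" using h by (intro mult_right_mono) auto
   have "\<exists>z. real i * h <= z \<and> z <= real (Suc i) * h \<and> f z = 0"
   proof (cases "f (real i * h) < 0")
    case True
    then have "f (real (Suc i) * h) > 0" using neg by (simp add: sgn_if split: if_splits)
    then show ?thesis using True le dom[of i] dom[of "Suc i"] ic by (intro IVT' continuous_on_subset[OF cont]) auto
   next
    case False
    then have "f (real (Suc i) * h) < 0" "f (real i * h) > 0" using neg by (auto simp: sgn_if split: if_splits)
    then show ?thesis using le dom[of i] dom[of "Suc i"] ic by (intro IVT2' continuous_on_subset[OF cont]) auto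
   qed
   then obtain z where z: "real i * h <= z" "z <= real (Suc i) * h" "f z = 0" by blast
   have zZ: "z \<in> ?Z" using z dom[of i] dom[of "Suc i"] ic by auto
   have "z ~= real (Suc i) * h" using nz[of "Suc i"] ic z(3) by auto
   then have "z / h < real i + 1" "real i <= z / h" using z h by (auto simp: field_simps)
   then have "\<lfloor>z / h\<rfloor> = int i" by (simp add: floor_unique)
   then have "I z = i" by (simp add: I_def)
   then show "i \<in> I ` ?Z" using zZ by blast
  qed
 qed
 then have "card ?Z = card C" by (rule bij_betw_same_card)
 have "(\<Sum>i<c. (1 - sgn (f (real i * h)) * sgn (f (real (Suc i) * h))) / 2) = (\<Sum>i<c. if i \<in> C then 1 else 0)"
 proof (intro sum.cong refl)
  fix i assume "i \<in> {..<c}"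
  then have "f (real i * h) ~= 0" "f (real (Suc i) * h) ~= 0" "i < c" using nz[of i] nz[of "Suc i"] by auto
  then show "(1 - sgn (f (real i * h)) * sgn (f (real (Suc i) * h))) / 2 = (if i \<in> C then 1 else 0)" by (auto simp: C_def sgn_if split: if_splits)
 qed
 also have "\<dots> = real (card C)" by (subst sum.If_cases) (auto simp: C_def intro!: arg_cong[where f=card])
 finally show ?thesis using \<open>card ?Z = card C\<close> by simp
qed

text \<open>Finitely many simple zeros have a common radius in which the sign is that of the linear
  part. Once two cell widths fit into it, the count is exact, so the sequence is eventually
  constant.\<close>

lemma sign_changes_tendsto_card_zeros:
 fixes f :: "real => real"
 assumes b: "b > 0" and c: "c >= 1"
  and D: "!!t. t \<in> {0..b} ==> (f has_real_derivative f' t) (at t within {0..b})"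
  and s: "!!t. t \<in> {0..b} ==> f t = 0 ==> f' t ~= 0"
  and nz: "!!i j. i <= c * 2 ^ j ==> f (real i * (b / (c * 2 ^ j))) ~= 0"
 shows "(%j. \<Sum>i<c * 2 ^ j. (1 - sgn (f (real i * (b / (c * 2 ^ j)))) * sgn (f (real (Suc i) * (b / (c * 2 ^ j))))) / 2)
  \<longlonglongrightarrow> real (card {t \<in> {0..b}. f t = 0})"
proof -
 let ?Z = "{t \<in> {0..b}. f t = 0}"
 have fin: "finite ?Z" by (rule simple_zeros_finite[OF D s])
 have "\<forall>z\<in>?Z. \<exists>et>0. \<forall>y\<in>{0..b}. \<bar>y - z\<bar> < et --> y ~= z --> sgn (f y) = sgn (y - z) * sgn (f' z)"
  using sign_near_simple_zero[OF D] s by auto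
 from bchoice[OF this] obtain et where "\<forall>z\<in>?Z. et z > 0 \<and>
   (\<forall>y\<in>{0..b}. \<bar>y - z\<bar> < et z --> y ~= z --> sgn (f y) = sgn (y - z) * sgn (f' z))" ..
 then have et: "!!z. z \<in> ?Z ==> et z > 0"
  "!!z y. z \<in> ?Z ==> y \<in> {0..b} ==> \<bar>y - z\<bar> < et z ==> y ~= z ==> sgn (f y) = sgn (y - z) * sgn (f' z)" by blast+
 define m where "m = Min (insert 1 (et ` ?Z))"
 have m: "m > 0" "!!z. z \<in> ?Z ==> m <= et z" unfolding m_def using fin et(1) by auto
 have "(%j. 2 * (b / (c * 2 ^ j))) \<longlonglongrightarrow> 0"
 proof -
  have "(%j. 2 * b / c * (1/2) ^ j) \<longlonglongrightarrow> 2 * b / c * 0" by (intro tendsto_mult tendsto_const LIMSEQ_power_zero) simp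
  moreover have "(%j. 2 * (b / (c * 2 ^ j))) = (%j. 2 * b / c * (1/2) ^ j)" by (rule ext) (simp add: power_divide)
  ultimately show ?thesis by simp
 qed
 then have "eventually (%j. 2 * (b / (c * 2 ^ j)) < m) sequentially" using m(1) by (rule order_tendstoD)
 then have "eventually (%j. (\<Sum>i<c * 2 ^ j. (1 - sgn (f (real i * (b / (c * 2 ^ j)))) * sgn (f (real (Suc i) * (b / (c * 2 ^ j))))) / 2)
   = real (card ?Z)) sequentially"
 proof eventually_elim
  case (elim j)
  show ?case
  proof (rule sign_changes_eq_card_zeros[where d="%z. sgn (f' z)"])
   show "0 < b / (c * 2 ^ j)" using b c by simp
   show "b = real (c * 2 ^ j) * (b / (c * 2 ^ j))" using c by simp
   show "continuous_on {0..b} f" by (rule DERIV_continuous_on[OF D])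
   show "i <= c * 2 ^ j ==> f (real i * (b / (c * 2 ^ j))) ~= 0" for i by (rule nz)
   fix z y assume *: "z \<in> {0..b}" "f z = 0" "y \<in> {0..b}" "\<bar>y - z\<bar> < 2 * (b / (c * 2 ^ j))" "y ~= z"
   then have "\<bar>y - z\<bar> < et z" using elim m(2)[of z] by auto
   then show "sgn (f y) = sgn (y - z) * sgn (f' z) \<and> sgn (f' z) ~= 0" using et(2)[of z y] * s[of z] by (auto simp: sgn_zero_iff)
  qed
 qed
 then show ?thesis by (rule tendsto_eventually)
qed

section \<open>Almost sure simplicity of the zeros\<close>

context sl_process
begin

lemma ip_V_point:
 assumes n: "good n" and t: "t \<in> dom n"
 shows "999/1000 <= ip (J n) (V n 0 t) (V n 0 t)" "\<bar>ip (J n) (V n 0 t) (V n 1 t)\<bar> <= 1/1000"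
  "82/1000 <= ip (J n) (V n 1 t) (V n 1 t)"
proof -
 have n1: "n >= 1" using n by (simp add: good_def)
 have w: "L2_set (%i. V n a t i - Tm n a t i) (J n) <= 1 / 10000" if "a <= 2" for a by (rule near_Tm[OF n _ that t, of "1/40000"]) auto
 have w0: "L2_set (%i. V n 0 t i - Tm n 0 t i) (J n) <= 1 / 10000" by (rule w) simp
 have w1: "L2_set (%i. V n 1 t i - Tm n 1 t i) (J n) <= 1 / 10000" by (rule w) simp
 have m2: "\<bar>mom 2 n / 4 - 1 / 12\<bar> <= 1 / 2000" using n by (simp add: good_def)
 note g = ip_Tm_diag[OF n1, of t]
 show "999/1000 <= ip (J n) (V n 0 t) (V n 0 t)" using ip_near[OF n1 w0 w0] unfolding g by linarith
 show "\<bar>ip (J n) (V n 0 t) (V n 1 t)\<bar> <= 1/1000" using ip_near[OF n1 w0 w1] unfolding g by linarith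
 show "82/1000 <= ip (J n) (V n 1 t) (V n 1 t)" using ip_near[OF n1 w1 w1] m2 unfolding g by linarith
qed

lemma fz_deriv:
 assumes "t \<in> dom n" "a < 2"
 shows "((%t. gv.Z n (V n a t) s) has_real_derivative gv.Z n (V n (Suc a) t) s) (at t within dom n)"
 unfolding gv.Z_def by (intro DERIV_sum DERIV_cmult_right V_deriv assms)

text \<open>Bulinskaya's argument: a double zero makes value and derivative simultaneously small at the
 nearest grid point.\<close>

lemma AE_simple_zeros:
 assumes n: "good n"
 shows "AE s in M. \<forall>t\<in>dom n. fz n t s = 0 --> gv.Z n (V n 1 t) s ~= 0"
proof -
 have n1: "n >= 1" using n by (simp add: good_def)
 \<comment> \<open>A random Lipschitz constant for the derivative, finite at every sample point;
   integer values \<open>L\<close> above it reduce the exceptional set to a countable union.\<close>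
 define R where "R s = (\<Sum>i\<in>J n. (1 + K) * \<bar>\<xi> i s\<bar>)" for s
 have R: "\<bar>gv.Z n (V n 2 t) s\<bar> <= R s" if "t \<in> dom n" for t s unfolding gv.Z_def R_def
 proof (rule order_trans[OF sum_abs sum_mono])
  fix i assume i: "i \<in> J n"
  have "\<bar>V n 2 t i\<bar> <= (1 + K) / sqrt n" by (rule V_bound[OF i _ that]) simp
  also have "\<dots> <= (1 + K) / 1" using n1 K0 by (intro divide_left_mono) auto
  finally show "\<bar>V n 2 t i * \<xi> i s\<bar> <= (1 + K) * \<bar>\<xi> i s\<bar>" by (simp add: abs_mult mult_right_mono)
 qed
 define h where "h c = 2 * pi * n / c" for c :: nat
 define U where "U L c = (\<Union>i\<le>c. {s \<in> space M. \<bar>gv.Z n (V n 0 (i * h c)) s\<bar> <= L * (h c)^2 \<and> \<bar>gv.Z n (V n 1 (i * h c)) s\<bar> <= L * h c})"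
  for L c :: nat
 have Um: "U L c \<in> events" for L c unfolding U_def by (intro sets.finite_UN) auto
 have hd: "real i * h c \<in> dom n" if "i <= c" "c >= 1" for i c
 proof -
  have "real i * h c <= real c * h c" using that by (intro mult_right_mono) (auto simp: h_def)
  then show ?thesis using that by (simp add: h_def)
 qed
 \<comment> \<open>About \<open>c\<close> grid points with small ball probability of order
   \<open>h^3\<close> each: the total is of order \<open>1 / c^2\<close> and vanishes in the
   limit.\<close>
 have P: "prob (U L c) <= 60 * (real c + 1) * (real L)^2 * (h c) ^ 3" if c: "c >= 1" and L: "L >= 1" for L c
 proof -
  have h0: "h c > 0" using c n1 by (simp add: h_def)
  have "prob (U L c) <= (\<Sum>i\<le>c. prob {s \<in> space M. \<bar>gv.Z n (V n 0 (i * h c)) s\<bar> <= L * (h c)^2 \<and> \<bar>gv.Z n (V n 1 (i * h c)) s\<bar> <= L * h c})"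
   unfolding U_def by (rule finite_measure_subadditive_finite) auto
  also have "\<dots> <= (\<Sum>i\<le>c. 3 * (L * (h c)^2) * (L * h c) / (1/20))"
  proof (intro sum_mono gv.small_ball)
   fix i p q assume "i \<in> {..c}"
   then have "real i * h c \<in> dom n" using hd c by auto
   from ip_V_point[OF n this]
   show "1/20 * (p^2 + q^2) <= ip (J n) (%k. p * V n 0 (i * h c) k + q * V n 1 (i * h c) k) (%k. p * V n 0 (i * h c) k + q * V n 1 (i * h c) k)"
    by (rule ip_quad_lower)
  qed (use h0 L in auto)
  also have "\<dots> = 60 * (real c + 1) * (real L)^2 * (h c) ^ 3" by (simp add: power2_eq_square power3_eq_cube)
  finally show ?thesis .
 qed
 have null: "(\<Inter>c\<in>{1..}. U L c) \<in> null_sets M" if L: "L >= 1" for L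
 proof -
  have m: "(\<Inter>c\<in>{1..}. U L c) \<in> events" by (intro sets.countable_INT) (auto intro: Um)
  have "prob (\<Inter>c\<in>{1..}. U L c) <= 0"
  proof (rule LIMSEQ_le_const)
   show "(%c. 60 * (real c + 1) * (real L)^2 * (h c) ^ 3) \<longlonglongrightarrow> 0"
   proof -
    have "(%c. (60 * (real L)^2 * (2 * pi * n) ^ 3) * ((real c + 1) / real c ^ 3)) \<longlonglongrightarrow> (60 * (real L)^2 * (2 * pi * n) ^ 3) * 0"
     by (intro tendsto_mult tendsto_const) real_asymp
    moreover have "(%c. (60 * (real L)^2 * (2 * pi * n) ^ 3) * ((real c + 1) / real c ^ 3))
      = (%c. 60 * (real c + 1) * (real L)^2 * (h c) ^ 3)"
     by (rule ext) (simp add: h_def power_divide mult_ac del: distrib_left_numeral distrib_right_numeral)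
    ultimately show ?thesis by simp
   qed
   show "\<exists>N. \<forall>c\<ge>N. prob (\<Inter>c\<in>{1..}. U L c) <= 60 * (real c + 1) * (real L)^2 * (h c) ^ 3"
   proof (intro exI[of _ 1] allI impI)
    fix c :: nat assume c: "1 <= c"
    have "prob (\<Inter>c\<in>{1..}. U L c) <= prob (U L c)" using c by (intro finite_measure_mono Um) auto
    then show "prob (\<Inter>c\<in>{1..}. U L c) <= 60 * (real c + 1) * (real L)^2 * (h c) ^ 3" using P[OF c L] by linarith
   qed
  qed
  then have "prob (\<Inter>c\<in>{1..}. U L c) = 0" by (simp add: measure_le_0_iff)
  then show ?thesis using m by (simp add: null_sets_def emeasure_eq_measure)
 qed
 have "AE s in M. \<forall>L\<in>{1..}. s \<notin> (\<Inter>c\<in>{1..}. U L c)"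
 proof (subst AE_ball_countable)
  show "\<forall>L\<in>{1..}. AE s in M. s \<notin> (\<Inter>c\<in>{1..}. U L c)" by (intro ballI AE_not_in null) simp
 qed simp
 then show ?thesis using AE_space
 proof eventually_elim
  case (elim s)
  show ?case
  proof (intro ballI impI notI)
   fix t assume t: "t \<in> dom n" and z: "fz n t s = 0" "gv.Z n (V n 1 t) s = 0"
   obtain L :: nat where L: "R s <= L" "L >= 1" using real_arch_simple[of "max 1 (R s)"] by (metis max.bounded_iff of_nat_1 of_nat_le_iff)
   have R0: "0 <= R s" using R[OF t, of s] by linarith
   have b1: "\<bar>gv.Z n (V n 1 y) s\<bar> <= L * \<bar>y - t\<bar>" if y: "y \<in> dom n" for y
   proof -
    have "norm (gv.Z n (V n 1 y) s - gv.Z n (V n 1 t) s) <= L * norm (y - t)"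
    proof (rule field_differentiable_bound[where S="dom n"])
     show "((%t. gv.Z n (V n 1 t) s) has_real_derivative gv.Z n (V n 2 x) s) (at x within dom n)" if "x \<in> dom n" for x
      using fz_deriv[OF that, of 1] by (simp add: numeral_2_eq_2)
     show "norm (gv.Z n (V n 2 x) s) <= L" if "x \<in> dom n" for x using R[OF that, of s] L by simp
    qed (use y t in auto)
    then show ?thesis using z by simp
   qed
   have b0: "\<bar>fz n y s\<bar> <= L * (y - t)^2" if y: "y \<in> dom n" for y
   proof -
    have sub: "closed_segment t y \<subseteq> dom n" using y t by (auto simp: closed_segment_eq_real_ivl split: if_splits)
    have "norm (fz n y s - fz n t s) <= (L * \<bar>y - t\<bar>) * norm (y - t)" unfolding fz_def
    proof (rule field_differentiable_bound[where S="closed_segment t y"])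
     fix x assume x: "x \<in> closed_segment t y"
     show "((%t. gv.Z n (V n 0 t) s) has_real_derivative gv.Z n (V n 1 x) s) (at x within closed_segment t y)"
      using DERIV_subset[OF fz_deriv[of x n 0] sub] x sub by auto
     have "\<bar>x - t\<bar> <= \<bar>y - t\<bar>" using x by (auto simp: closed_segment_eq_real_ivl split: if_splits)
     then have "L * \<bar>x - t\<bar> <= L * \<bar>y - t\<bar>" by (intro mult_left_mono) auto
     moreover have "\<bar>gv.Z n (V n 1 x) s\<bar> <= L * \<bar>x - t\<bar>" by (rule b1) (use x sub in blast)
     ultimately show "norm (gv.Z n (V n 1 x) s) <= L * \<bar>y - t\<bar>" by simp
    qed auto
    then show ?thesis using z by (simp add: power2_eq_square abs_mult_self_eq mult.assoc)
   qed
   have "s \<in> U L c" if c: "c >= 1" for c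
   proof -
    have h0: "h c > 0" using c n1 by (simp add: h_def)
    define i where "i = nat \<lfloor>t / h c\<rfloor>"
    have fl: "real i = real_of_int \<lfloor>t / h c\<rfloor>" using t h0 by (simp add: i_def)
    have le: "real i <= t / h c" "t / h c < real i + 1" unfolding fl by linarith+
    have le': "real i * h c <= t" "t < real i * h c + h c" using le h0 by (simp_all add: field_simps)
    have "t <= real c * h c" using t c by (simp add: h_def)
    then have "real i * h c <= real c * h c" using le' by linarith
    then have ic: "i <= c" using h0 by simp
    have y: "real i * h c \<in> dom n" by (rule hd[OF ic c])
    have d: "\<bar>real i * h c - t\<bar> <= h c" using le' by linarith
    have "(real i * h c - t)^2 <= (h c)^2" using power_mono[OF d abs_ge_zero, of 2] by simp
    then have "\<bar>gv.Z n (V n 0 (i * h c)) s\<bar> <= L * (h c)^2"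
     using b0[OF y] unfolding fz_def by (meson mult_left_mono of_nat_0_le_iff order_trans)
    moreover have "\<bar>gv.Z n (V n 1 (i * h c)) s\<bar> <= L * h c" using b1[OF y] d by (meson mult_left_mono of_nat_0_le_iff order_trans)
    ultimately show ?thesis using ic elim(2) unfolding U_def by auto
   qed
   then show False using elim(1) L(2) by auto
  qed
 qed
qed

end

subsection \<open>Measurability of the number of zeros\<close>

text \<open>By compactness a continuous function has a zero exactly if its absolute value gets below
  every \<open>1 / (k + 1)\<close>, and by continuity this can be tested on a countable dense
  set.\<close>

lemma zero_in_interval_measurable:
 fixes g :: "real => 's => real"
 assumes m: "!!t. t \<in> {p..q} ==> g t \<in> borel_measurable M"
  and c: "!!s. s \<in> space M ==> continuous_on {p..q} (%t. g t s)"
 shows "{s \<in> space M. \<exists>t\<in>{p..q}. g t s = 0} \<in> sets M"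
proof -
 obtain D where D: "countable D" and Dsub: "D \<subseteq> {p..q}" and cl: "{p..q} \<subseteq> closure D" using separable[of "{p..q}"] by metis
 have eq: "{s \<in> space M. \<exists>t\<in>{p..q}. g t s = 0} = (\<Inter>k::nat. \<Union>x\<in>D. {s \<in> space M. \<bar>g x s\<bar> < 1 / Suc k})"
 proof (intro equalityI subsetI)
  fix s assume "s \<in> {s \<in> space M. \<exists>t\<in>{p..q}. g t s = 0}"
  then obtain t where s: "s \<in> space M" and t: "t \<in> {p..q}" "g t s = 0" by auto
  have "\<exists>x\<in>D. \<bar>g x s\<bar> < 1 / Suc k" for k
  proof -
   obtain d where d: "d > 0" "!!y. y \<in> {p..q} ==> dist y t < d ==> dist (g y s) (g t s) < 1 / Suc k"
    using c[OF s] t(1) unfolding continuous_on_iff by (metis of_nat_0_less_iff zero_less_Suc zero_less_divide_1_iff)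
   obtain x where "x \<in> D" "dist x t < d" using cl t(1) d(1) closure_approachable[of t D] by blast
   then show ?thesis using d(2)[of x] Dsub t by (auto simp: dist_real_def intro!: bexI[of _ x])
  qed
  then show "s \<in> (\<Inter>k::nat. \<Union>x\<in>D. {s \<in> space M. \<bar>g x s\<bar> < 1 / Suc k})" using s by auto
 next
  fix s assume s: "s \<in> (\<Inter>k::nat. \<Union>x\<in>D. {s \<in> space M. \<bar>g x s\<bar> < 1 / Suc k})"
  then have sp: "s \<in> space M" and x: "\<exists>x\<in>D. \<bar>g x s\<bar> < 1 / Suc k" for k :: nat by auto
  have "{p..q} ~= {}" using x[of 0] Dsub by blast
  from continuous_attains_inf[OF compact_Icc this continuous_on_rabs[OF c[OF sp]]]
  obtain t where t: "t \<in> {p..q}" "!!y. y \<in> {p..q} ==> \<bar>g t s\<bar> <= \<bar>g y s\<bar>" by blast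
  have "g t s = 0"
  proof (rule ccontr)
   assume "g t s ~= 0"
   then obtain k :: nat where "1 / Suc k < \<bar>g t s\<bar>" using reals_Archimedean[of "\<bar>g t s\<bar>"] by (auto simp: inverse_eq_divide)
   moreover obtain y where "y \<in> D" "\<bar>g y s\<bar> < 1 / Suc k" using x[of k] by blast
   ultimately show False using t(2)[of y] Dsub by auto
  qed
  then show "s \<in> {s \<in> space M. \<exists>t\<in>{p..q}. g t s = 0}" using sp t by auto
 qed
 have gm: "{s \<in> space M. \<bar>g x s\<bar> < 1 / Suc k} \<in> sets M" if "x \<in> D" for x and k :: nat
 proof -
  have [measurable]: "g x \<in> borel_measurable M" using m that Dsub by auto
  show ?thesis by measurable
 qed
 show ?thesis unfolding eq by (intro sets.countable_INT) (auto intro!: sets.countable_UN' D gm simp del: of_nat_Suc)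
qed

text \<open>Having at least \<open>k\<close> zeros means that some \<open>k\<close> disjoint
  rational intervals each contain one, a countable union over finite families of intervals.\<close>

lemma card_zeros_measurable:
 fixes g :: "real => 's => real"
 assumes m: "!!t. t \<in> {0..b} ==> g t \<in> borel_measurable M"
  and c: "!!s. s \<in> space M ==> continuous_on {0..b} (%t. g t s)"
 shows "(%s. real (card {t \<in> {0..b}. g t s = 0})) \<in> borel_measurable M"
proof -
 define Z where "Z s = {t \<in> {0..b}. g t s = 0}" for s
 define I where "I pq = {max 0 (fst pq)..min b (snd pq)}" for pq :: "real \<times> real"
 define E where "E pq = {s \<in> space M. \<exists>t\<in>I pq. g t s = 0}" for pq
 have E: "E pq \<in> sets M" for pq
 proof -
  have sub: "I pq \<subseteq> {0..b}" by (auto simp: I_def)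
  show ?thesis unfolding E_def I_def by (rule zero_in_interval_measurable)
    (use sub in \<open>auto simp: I_def intro!: m intro: continuous_on_subset[OF c]\<close>)
 qed
 define FF where "FF k = {F. finite F \<and> F \<subseteq> \<rat> \<times> \<rat> \<and> card F = k \<and> disjoint_family_on I F}" for k
 define P where "P k s \<longleftrightarrow> (\<exists>T. T \<subseteq> Z s \<and> finite T \<and> card T = k)" for k s
 have cFF: "countable (FF k)" for k
 proof (rule countable_subset)
  show "FF k \<subseteq> {F. finite F \<and> F \<subseteq> \<rat> \<times> \<rat>}" by (auto simp: FF_def)
  show "countable {F. finite F \<and> F \<subseteq> (\<rat> \<times> \<rat> :: (real \<times> real) set)}"
   by (intro countable_Collect_finite_subset countable_SIGMA countable_rat)
 qed
 have PE: "P k s \<longleftrightarrow> (\<exists>F\<in>FF k. \<forall>pq\<in>F. s \<in> E pq)" if s: "s \<in> space M" for k s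
 proof
  assume "P k s"
  then obtain T where T: "T \<subseteq> Z s" "finite T" "card T = k" unfolding P_def by blast
  \<comment> \<open>Windows of radius \<open>d / 3\<close> around the chosen zeros, with
    \<open>d\<close> at most their minimal separation, are disjoint.\<close>
  define d where "d = Min (insert 1 ((%(x, y). \<bar>x - y\<bar>) ` ((T \<times> T) - Id)))"
  have d: "d > 0" unfolding d_def using T(2) by (subst Min_gr_iff) auto
  have dd: "d <= \<bar>x - y\<bar>" if "x \<in> T" "y \<in> T" "x ~= y" for x y
  proof -
   have "(%(x, y). \<bar>x - y\<bar>) (x, y) \<in> (%(x, y). \<bar>x - y\<bar>) ` ((T \<times> T) - Id)" using that by (intro imageI) auto
   then show ?thesis unfolding d_def using T(2) by (intro Min_le) auto
  qed
  have "\<forall>x. \<exists>p. p \<in> \<rat> \<and> x - d / 3 < p \<and> p < x" using Rats_dense_in_real[of "x - d / 3" x for x] d by (metis diff_gt_0_iff_gt diff_less_eq less_add_same_cancel1 zero_less_divide_iff zero_less_numeral)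
  then obtain p where p: "!!x. p x \<in> \<rat> \<and> x - d / 3 < p x \<and> p x < x" by metis
  have "\<forall>x. \<exists>q. q \<in> \<rat> \<and> x < q \<and> q < x + d / 3" using Rats_dense_in_real[of x "x + d / 3" for x] d by (metis less_add_same_cancel1 zero_less_divide_iff zero_less_numeral)
  then obtain q where q: "!!x. q x \<in> \<rat> \<and> x < q x \<and> q x < x + d / 3" by metis
  define h where "h x = (p x, q x)" for x
  have sep: "I (h x) \<inter> I (h y) = {}" if "x \<in> T" "y \<in> T" "x ~= y" for x y
  proof -
   have "d <= \<bar>x - y\<bar>" by (rule dd[OF that])
   then have "q x < p y \<or> q y < p x" using p[of x] p[of y] q[of x] q[of y] d by linarith
   then show ?thesis by (auto simp: I_def h_def)
  qed
  have mem: "x \<in> I (h x)" if "x \<in> T" for x using that T(1) p[of x] q[of x] by (auto simp: I_def h_def Z_def)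
  have inj: "inj_on h T" using sep mem by (intro inj_onI) (metis IntI empty_iff)
  have "h ` T \<in> FF k"
  proof -
   have "h ` T \<subseteq> \<rat> \<times> \<rat>" using p q by (auto simp: h_def)
   moreover have "card (h ` T) = k" using card_image[OF inj] T(3) by simp
   moreover have "disjoint_family_on I (h ` T)" unfolding disjoint_family_on_def using sep by auto
   ultimately show ?thesis using T(2) by (simp add: FF_def)
  qed
  moreover have "\<forall>pq\<in>h ` T. s \<in> E pq" using mem T(1) s by (auto simp: E_def Z_def)
  ultimately show "\<exists>F\<in>FF k. \<forall>pq\<in>F. s \<in> E pq" by blast
 next
  assume "\<exists>F\<in>FF k. \<forall>pq\<in>F. s \<in> E pq"
  then obtain F where F: "finite F" "card F = k" "disjoint_family_on I F" "!!pq. pq \<in> F ==> s \<in> E pq" by (auto simp: FF_def)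
  have "\<forall>pq\<in>F. \<exists>t. t \<in> I pq \<and> g t s = 0" using F(4) by (auto simp: E_def)
  from bchoice[OF this] obtain z where z: "\<forall>pq\<in>F. z pq \<in> I pq \<and> g (z pq) s = 0" ..
  have "inj_on z F"
  proof (rule inj_onI, rule ccontr)
   fix x y assume xy: "x \<in> F" "y \<in> F" "z x = z y" "x ~= y"
   then have "I x \<inter> I y = {}" using F(3) by (auto simp: disjoint_family_on_def)
   then show False using z xy by (metis IntI empty_iff)
  qed
  then have "card (z ` F) = k" using F by (simp add: card_image)
  moreover have "z ` F \<subseteq> Z s" using z by (auto simp: Z_def I_def)
  ultimately show "P k s" unfolding P_def using F(1) by blast
 qed
 have Pm: "{s \<in> space M. P k s} \<in> sets M" for k
 proof -
  have eq: "{s \<in> space M. P k s} = (\<Union>F\<in>FF k. {s \<in> space M. \<forall>pq\<in>F. s \<in> E pq})" using PE by auto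
  have "{s \<in> space M. \<forall>pq\<in>F. s \<in> E pq} \<in> sets M" if "F \<in> FF k" for F
  proof (rule sets.sets_Collect_finite_All)
   show "{s \<in> space M. s \<in> E pq} \<in> sets M" for pq
   proof -
    have "{s \<in> space M. s \<in> E pq} = E pq" by (auto simp: E_def)
    then show ?thesis using E by simp
   qed
  qed (use that in \<open>simp add: FF_def\<close>)
  then show ?thesis unfolding eq by (intro sets.countable_UN') (auto intro: cFF)
 qed
 have PZ: "P k s \<longleftrightarrow> infinite (Z s) \<or> k <= card (Z s)" for k s
 proof (cases "finite (Z s)")
  case True
  then show ?thesis unfolding P_def by (auto intro: card_mono dest: obtain_subset_with_card_n)
 next
  case False
  then show ?thesis unfolding P_def using infinite_arbitrarily_large[OF False, of k] by auto
 qed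
 have "(%s. card (Z s)) \<in> measurable M (count_space UNIV)"
 proof (rule iffD2[OF measurable_count_space_eq2_countable], intro conjI ballI)
  fix k :: nat
  \<comment> \<open>The value 0 also collects the infinite zero sets, on which \<open>card\<close>
    is 0.\<close>
  have "(%s. card (Z s)) -` {k} \<inter> space M =
   (if k = 0 then (\<Inter>j. {s \<in> space M. P j s}) \<union> (space M - {s \<in> space M. P 1 s})
    else {s \<in> space M. P k s} - {s \<in> space M. P (Suc k) s})"
  proof (cases "k = 0")
   case True
   have "card (Z s) = 0 \<longleftrightarrow> (\<forall>j. P j s) \<or> \<not> P 1 s" for s
    unfolding PZ by (metis card.infinite le_zero_eq not_less_eq_eq One_nat_def Suc_n_not_le_n)
   then show ?thesis using True by auto
  next
   case False
   then have "card (Z s) = k \<longleftrightarrow> P k s \<and> \<not> P (Suc k) s" for s unfolding PZ by (cases "finite (Z s)") auto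
   then show ?thesis using False by auto
  qed
  also have "\<dots> \<in> sets M" using Pm by (auto intro!: sets.countable_INT' sets.Diff)
  finally show "(%s. card (Z s)) -` {k} \<inter> space M \<in> sets M" .
 qed auto
 then show ?thesis unfolding Z_def by (rule measurable_compose) simp
qed

subsection \<open>Approximation of the number of zeros by sign changes\<close>

context sl_process
begin

definition sgnc :: "nat => nat => 's => real" where
 "sgnc n c s = (\<Sum>i<c. (1 - sgn (fz n (pt n c (2 * i)) s) * sgn (fz n (pt n c (2 * i + 2)) s)) / 2)"

definition Nz :: "nat => 's => real" where "Nz n s = real (card {t \<in> dom n. fz n t s = 0})"

lemma sgnc_meas [measurable]: "sgnc n c \<in> borel_measurable M" unfolding sgnc_def[abs_def] by measurable

lemma Nz_meas [measurable]: "Nz n \<in> borel_measurable M" unfolding Nz_def[abs_def]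
proof (rule card_zeros_measurable)
 show "continuous_on (dom n) (%t. fz n t s)" for s unfolding fz_def by (rule DERIV_continuous_on[OF fz_deriv]) simp_all
qed (rule fz_meas)

lemma sgnc_bounds: "0 <= sgnc n c s" "sgnc n c s <= c"
proof -
 have "0 <= (1 - sgn x * sgn y) / 2" "(1 - sgn x * sgn y) / 2 <= 1" for x y :: real by (auto simp: sgn_if)
 then show "0 <= sgnc n c s" "sgnc n c s <= c" unfolding sgnc_def
  using sum_bounded_above[of "{..<c}" "%i. (1 - sgn (fz n (pt n c (2 * i)) s) * sgn (fz n (pt n c (2 * i + 2)) s)) / 2" 1] by (auto intro: sum_nonneg)
qed

lemma pt_cell: "pt n c (2 * i + 1) - mesh n c = pt n c (2 * i)" "pt n c (2 * i + 1) + mesh n c = pt n c (2 * i + 2)"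
 by (simp_all add: pt_def algebra_simps)

lemma sgnc_refine: "sgnc n (2 * c) s - sgnc n c s = (\<Sum>i<c. extra n (mesh n c) (pt n c (2 * i + 1)) s)"
proof -
 have pt2: "pt n (2 * c) (2 * j) = pt n c j" for j by (simp add: pt_def mesh_def)
 have pt2': "pt n (2 * c) (2 * j + 2) = pt n c (j + 1)" for j using pt2[of "j + 1"] by simp
 define g where "g j = (1 - sgn (fz n (pt n c j) s) * sgn (fz n (pt n c (j + 1)) s)) / 2" for j
 have e: "sgnc n (2 * c) s = (\<Sum>j<2 * c. g j)" unfolding sgnc_def pt2 pt2' g_def ..
 have "(\<Sum>j<2 * c. g j) = (\<Sum>i<c. g (2 * i) + g (2 * i + 1))" by (induction c) auto
 then show ?thesis unfolding e unfolding sgnc_def extra_def pt_cell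
  by (simp only: sum_subtractf[symmetric], intro sum.cong refl) (simp add: g_def field_simps)
qed

text \<open>The factor 7 is \<open>1 / (1 - 6/7)\<close>, the sum of the geometric series over the
  dyadic steps.\<close>

definition "CZ = 7 * sqrt (CV * 4020)"

lemma CV_nonneg: "CV >= 0" by (simp add: CV_def)

lemma AE_grid_nonzero:
 assumes n: "good n" and c: "c >= 1"
 shows "AE s in M. \<forall>j\<in>{..2 * c}. fz n (pt n c j) s ~= 0"
proof (subst AE_ball_countable)
 show "\<forall>j\<in>{..2 * c}. AE s in M. fz n (pt n c j) s ~= 0"
 proof
  fix j assume "j \<in> {..2 * c}"
  then have "pt n c j \<in> dom n" using c by (intro pt_dom) auto
  from ip_V_point(1)[OF n this] show "AE s in M. fz n (pt n c j) s ~= 0" unfolding fz_def by (intro gv.AE_Z_nonzero) simp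
 qed
qed simp

text \<open>With \<open>h\<close> the mesh, second moments of order \<open>h powr (5/2)\<close> and
  the factor \<open>n / h^2\<close> of \<open>cell_sum_variance\<close> give a variance of order
  \<open>n * h powr (1/2)\<close>. For the mean the weaker bound \<open>h powr 2\<close> per cell is
  enough, since \<open>c * h = pi * n\<close>.\<close>

lemma sgnc_refine_bounds:
 assumes n: "good n" and c: "c >= 1" and de: "mesh n c <= 1 / 40000"
 shows "AE s in M. sgnc n c s <= sgnc n (2 * c) s"
  and "gv.sd (%s. sgnc n (2 * c) s - sgnc n c s) <= sqrt (CV * 4020 * n) * mesh n c powr (1/4)"
  and "expectation (sgnc n (2 * c)) <= expectation (sgnc n c) + 4020 * pi * n * mesh n c"
proof -
 define h where "h = mesh n c"
 have n1: "n >= 1" using n by (simp add: good_def)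
 have h: "h > 0" "h <= 1 / 40000" using n1 c de by (simp_all add: h_def mesh_def)
 have d: "pt n c (2 * i + 1) - h \<in> dom n" "pt n c (2 * i + 1) + h \<in> dom n" if "i < c" for i
  unfolding h_def pt_cell using that c by (intro pt_dom; simp)+
 note e = extra_facts[OF n h d]
 have "AE s in M. \<forall>i\<in>{..<c}. 0 <= extra n h (pt n c (2 * i + 1)) s" by (subst AE_ball_countable, simp) (intro ballI e(1), simp_all)
 then show "AE s in M. sgnc n c s <= sgnc n (2 * c) s"
 proof eventually_elim
  case (elim s)
  then have "0 <= (\<Sum>i<c. extra n (mesh n c) (pt n c (2 * i + 1)) s)" unfolding h_def by (intro sum_nonneg) auto
  then show ?case unfolding sgnc_refine[symmetric] by simp
 qed
 have "gv.cv (%s. \<Sum>i<c. extra n h (pt n c (2 * i + 1)) s) (%s. \<Sum>i<c. extra n h (pt n c (2 * i + 1)) s)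
   <= CV * (4020 * h powr (5/2)) * n / (mesh n c)^2"
  by (rule cell_sum_variance[OF n c de]) (use h e in \<open>auto simp: h_def intro: loc_extra\<close>)
 also have "\<dots> = (CV * 4020 * n) * h powr (1/2)"
 proof -
  have "h powr (5/2) = h powr (1/2) * h^2" using h by (simp add: powr_add[symmetric] flip: powr_numeral)
  then show ?thesis using h by (simp add: h_def field_simps)
 qed
 also have "h powr (1/2) = (h powr (1/4))^2" by (simp add: power2_eq_square powr_add[symmetric])
 finally show "gv.sd (%s. sgnc n (2 * c) s - sgnc n c s) <= sqrt (CV * 4020 * n) * mesh n c powr (1/4)"
  unfolding sgnc_refine gv.sd_def h_def[symmetric] by (intro real_le_lsqrt) (use CV_nonneg in \<open>simp_all add: power_mult_distrib\<close>)
 have i: "integrable M (extra n h t)" for t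
 proof (rule gv.integrable_bounded)
  show "\<bar>extra n h t s\<bar> <= 2" for s by (auto simp: extra_def sgn_if)
 qed measurable
 have isg: "integrable M (sgnc n c')" for c' by (rule gv.integrable_bounded[of _ "c'"]) (use sgnc_bounds in \<open>auto simp: abs_le_iff intro: order_trans[of _ 0]\<close>)
 have "expectation (sgnc n (2 * c)) - expectation (sgnc n c) = (\<Sum>i<c. expectation (extra n h (pt n c (2 * i + 1))))"
 proof -
  have "expectation (%s. sgnc n (2 * c) s - sgnc n c s) = (\<Sum>i<c. expectation (extra n h (pt n c (2 * i + 1))))"
   unfolding sgnc_refine h_def[symmetric] by (rule Bochner_Integration.integral_sum) (rule i)
  then show ?thesis using Bochner_Integration.integral_diff[OF isg[of "2 * c"] isg[of c]] by simp
 qed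
 also have "\<dots> <= (\<Sum>i<c. 4020 * h powr (5/2))" by (intro sum_mono e(3)) auto
 also have "\<dots> <= (\<Sum>i<c. 4020 * h powr 2)" using h by (intro sum_mono mult_left_mono powr_mono') auto
 also have "\<dots> = 4020 * pi * n * h" using h c n1 by (simp add: h_def mesh_def power2_eq_square)
 finally show "expectation (sgnc n (2 * c)) <= expectation (sgnc n c) + 4020 * pi * n * mesh n c" by (simp add: h_def)
qed

lemma geometric_chain_le:
 fixes x :: "nat => real" and r B :: real
 assumes "0 <= r" "r < 1" "x 0 <= a" "!!j. x (Suc j) <= x j + B * r ^ j" "B >= 0"
 shows "x j <= a + B / (1 - r)"
proof -
 have "x j <= a + B * ((1 - r ^ j) / (1 - r))"
 proof (induction j)
  case (Suc j)
  have "(1 - r ^ Suc j) / (1 - r) = (1 - r ^ j) / (1 - r) + r ^ j" using assms(2) by (simp add: field_simps)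
  then show ?case using Suc assms(4)[of j] by (simp add: distrib_left)
 qed (use assms in simp)
 also have "\<dots> <= a + B * (1 / (1 - r))" using assms by (intro add_left_mono mult_left_mono divide_right_mono) auto
 finally show ?thesis by simp
qed

text \<open>Each halving of the mesh multiplies its fourth root by at most \<open>6/7\<close>, so
  the errors of all refinements sum to a multiple of the first one. Almost surely zeros are simple
  and no grid point is a zero, so the counts increase to the number of zeros.\<close>

lemma zeros_sgnc:
 assumes n: "good n" and c: "c >= 1" and de: "mesh n c <= 1 / 40000"
 shows "integrable M (%s. (Nz n s)^2)" "gv.sd (%s. Nz n s - sgnc n c s) <= CZ * sqrt n * mesh n c powr (1/4)"
proof -
 define h where "h = mesh n c"
 have n1: "n >= 1" using n by (simp add: good_def)
 have h: "h > 0" "h <= 1 / 40000" using n1 c de by (simp_all add: h_def mesh_def)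
 define cc where "cc j = c * 2 ^ j" for j :: nat
 have cc: "cc j >= 1" "mesh n (cc j) = h / 2 ^ j" "cc (Suc j) = 2 * cc j" "cc 0 = c" for j using c by (simp_all add: cc_def h_def mesh_def)
 have hj: "mesh n (cc j) <= 1 / 40000" for j
 proof -
  have "h / 2 ^ j <= h / 1" using h by (intro divide_left_mono) auto
  also have "h / 1 <= 1 / 40000" using h by simp
  finally show ?thesis by (simp only: cc)
 qed
 note R = sgnc_refine_bounds[OF n cc(1) hj, unfolded cc(3)[symmetric]]
 have i2: "integrable M (%s. (sgnc n c' s)^2)" for c'
  by (rule gv.integrable_sq_bounded[of _ "c'"]) (use sgnc_bounds in \<open>auto simp: abs_le_iff intro: order_trans[of _ 0]\<close>)
 have B: "gv.sd (%s. sgnc n (cc j) s - sgnc n (cc 0) s) <= 0 + sqrt (CV * 4020 * n) * h powr (1/4) / (1 - 6/7)" for j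
 proof (rule geometric_chain_le[where x="%j. gv.sd (%s. sgnc n (cc j) s - sgnc n (cc 0) s)"])
  show "gv.sd (%s. sgnc n (cc 0) s - sgnc n (cc 0) s) <= 0" by (simp add: gv.sd_def gv.cv_def)
  fix j
  have d2: "integrable M (%s. (sgnc n a s - sgnc n b s)^2)" for a b using gv.sq_integrable_add[of "sgnc n a" "%s. - sgnc n b s"] i2 by simp
  have "gv.sd (%s. sgnc n (cc (Suc j)) s - sgnc n (cc 0) s)
   <= gv.sd (%s. sgnc n (cc j) s - sgnc n (cc 0) s) + gv.sd (%s. sgnc n (cc (Suc j)) s - sgnc n (cc j) s)"
   using gv.sd_triangle[of "%s. sgnc n (cc j) s - sgnc n (cc 0) s" "%s. sgnc n (cc (Suc j)) s - sgnc n (cc j) s"] d2 by simp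
  moreover have "mesh n (cc j) powr (1/4) <= h powr (1/4) * (6/7) ^ j"
  proof -
   \<comment> \<open>Equivalent to \<open>(7/6) ^ 4 <= 2\<close>.\<close>
   have q: "(2::real) powr (1/4) >= 7/6"
   proof -
    have "(7/6::real) = ((7/6) powr 4) powr (1/4)" by (simp only: powr_powr) simp
    also have "\<dots> <= 2 powr (1/4)" by (intro powr_mono2) (simp_all add: power4_eq_xxxx)
    finally show ?thesis .
   qed
   have "((2::real) ^ j) powr (1/4) = (2 powr (1/4)) ^ j" for j :: nat by (induction j) (simp_all add: powr_mult)
   then have "mesh n (cc j) powr (1/4) = h powr (1/4) / (2 powr (1/4)) ^ j" using h by (simp add: cc powr_divide)
   also have "\<dots> <= h powr (1/4) / (7/6) ^ j" using q by (intro divide_left_mono power_mono) auto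
   finally show ?thesis by (simp add: power_divide)
  qed
  then have "sqrt (CV * 4020 * n) * mesh n (cc j) powr (1/4) <= sqrt (CV * 4020 * n) * (h powr (1/4) * (6/7) ^ j)"
   using CV_nonneg by (intro mult_left_mono) auto
  ultimately show "gv.sd (%s. sgnc n (cc (Suc j)) s - sgnc n (cc 0) s) <= gv.sd (%s. sgnc n (cc j) s - sgnc n (cc 0) s)
    + sqrt (CV * 4020 * n) * h powr (1/4) * (6/7) ^ j" using R(2)[of j] by simp
 qed (use CV_nonneg in auto)
 have E: "expectation (sgnc n (cc j)) <= expectation (sgnc n c) + (4020 * pi * n * h) / (1 - 1/2)" for j
 proof (rule geometric_chain_le[where x="%j. expectation (sgnc n (cc j))"])
  show "expectation (sgnc n (cc (Suc j))) <= expectation (sgnc n (cc j)) + 4020 * pi * n * h * (1/2) ^ j" for j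
   using R(3)[of j] by (simp add: cc power_divide)
 qed (use h in \<open>simp_all add: cc\<close>)
 have nz: "AE s in M. \<forall>j. \<forall>i\<in>{..2 * cc j}. fz n (pt n (cc j) i) s ~= 0"
  unfolding AE_all_countable by (intro allI AE_grid_nonzero n cc)
 have lim: "AE s in M. (%j. sgnc n (cc j) s) \<longlonglongrightarrow> Nz n s" using nz AE_simple_zeros[OF n]
 proof eventually_elim
  case (elim s)
  have p: "real i * (2 * pi * n / (c * 2 ^ j)) = pt n (cc j) (2 * i)" for i j by (simp add: pt_def mesh_def cc_def)
  have "(%j. \<Sum>i<c * 2 ^ j. (1 - sgn (fz n (real i * (2 * pi * n / (c * 2 ^ j))) s) * sgn (fz n (real (Suc i) * (2 * pi * n / (c * 2 ^ j))) s)) / 2)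
    \<longlonglongrightarrow> real (card {t \<in> {0..2 * pi * n}. fz n t s = 0})"
  proof (rule sign_changes_tendsto_card_zeros)
   show "((%t. fz n t s) has_real_derivative gv.Z n (V n 1 t) s) (at t within dom n)" if "t \<in> dom n" for t
    unfolding fz_def using fz_deriv[OF that, of 0] by simp
   show "fz n (real i * (2 * pi * n / (c * 2 ^ j))) s ~= 0" if "i <= c * 2 ^ j" for i j unfolding p using elim(1) that by (auto simp: cc_def)
  qed (use elim(2) n1 c in auto)
  then show ?case unfolding p sgnc_def Nz_def by (simp add: cc_def)
 qed
 have mono: "AE s in M. sgnc n (cc j) s <= sgnc n (cc (Suc j)) s" for j by (rule R(1))
 note L = gv.sd_limit_increasing[OF sgnc_meas Nz_meas i2 _ mono lim B E]
 show "integrable M (%s. (Nz n s)^2)" by (rule L(1)) (simp add: sgnc_bounds)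
 have "gv.sd (%s. Nz n s - sgnc n (cc 0) s) <= 0 + sqrt (CV * 4020 * n) * h powr (1/4) / (1 - 6/7)" by (rule L(2)) (simp add: sgnc_bounds)
 then show "gv.sd (%s. Nz n s - sgnc n c s) <= CZ * sqrt n * mesh n c powr (1/4)" by (simp add: cc CZ_def real_sqrt_mult h_def)
qed

end

subsection \<open>Trigonometric approximation of sign changes\<close>

definition sgn_err :: "nat => real" where
 "sgn_err m = (\<integral>x. (sgn x - sgn_approx m x)^2 \<partial>SN)"

lemma sgn_approx_meas [measurable]: "sgn_approx m \<in> borel_measurable borel"
proof -
 obtain n :: nat and c p where "sgn_approx m = (%x. \<Sum>j<n. c j * sin (p j * x))"
  using sgn_approx_sinpoly[of m] unfolding sinpoly_def by (elim exE) (rule that)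
 then show ?thesis by simp
qed

lemma sgn_diff_sq_le: "\<bar>S\<bar> <= 1 ==> \<bar>(sgn x - S)^2\<bar> <= (4::real)"
proof -
 assume "\<bar>S\<bar> <= 1"
 then have "\<bar>sgn x - S\<bar> <= 2" by (auto simp: sgn_if abs_le_iff)
 then have "\<bar>sgn x - S\<bar>^2 <= 2^2" by (intro power_mono) auto
 then show ?thesis by simp
qed

lemma sgn_err_tendsto: "sgn_err \<longlonglongrightarrow> 0"
proof -
 interpret S: prob_space SN by (rule real_dist_normal_dist[THEN real_distribution.axioms(1)])
 have "(%m. \<integral>x. (sgn x - sgn_approx m x)^2 \<partial>SN) \<longlonglongrightarrow> (\<integral>x. 0 \<partial>SN)"
 proof (rule integral_dominated_convergence[where w="%_. 4"])
  show "AE x in SN. (%m. (sgn x - sgn_approx m x)^2) \<longlonglongrightarrow> 0"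
  proof (intro AE_I2)
   fix x :: real
   have "(%m. (sgn x - sgn_approx m x)^2) \<longlonglongrightarrow> (sgn x - sgn x)^2" by (intro tendsto_intros sgn_approx_tendsto)
   then show "(%m. (sgn x - sgn_approx m x)^2) \<longlonglongrightarrow> 0" by simp
  qed
 qed (use sgn_diff_sq_le[OF sgn_approx_le_1] in auto)
 then show ?thesis by (simp add: sgn_err_def[abs_def])
qed

lemma sinpoly_mult_cos_sum:
 assumes "sinpoly S"
 shows "\<exists>(L :: (nat \<times> nat \<times> real) set) d p q. finite L \<and>
  (\<forall>x y. S x * S y = (\<Sum>l\<in>L. d l * cos (p l * x + q l * y)))"
proof -
 obtain n :: nat and c p where S: "S = (%x. \<Sum>j<n. c j * sin (p j * x))" using assms unfolding sinpoly_def by (elim exE) (rule that)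
 \<comment> \<open>The third index component is a sign: 1 selects the cosine of the difference and
   -1 that of the sum in the product of two sines.\<close>
 define d where "d = (%(j :: nat, k :: nat, e :: real). c j * c k * e / 2)"
 define P where "P = (%(j :: nat, k :: nat, e :: real). p j)"
 define Q where "Q = (%(j :: nat, k :: nat, e :: real). - (e * p k))"
 have "S x * S y = (\<Sum>l\<in>{..<n} \<times> {..<n} \<times> {1, -1}. d l * cos (P l * x + Q l * y))" for x y
 proof -
  have "S x * S y = (\<Sum>j<n. \<Sum>k<n. c j * c k * (sin (p j * x) * sin (p k * y)))" by (simp add: S sum_product mult_ac)
  also have "\<dots> = (\<Sum>j<n. \<Sum>k<n. \<Sum>e\<in>{1, -1}. c j * c k * e / 2 * cos (p j * x + (- (e * p k)) * y))"
   by (intro sum.cong refl) (simp add: sin_times_sin field_simps)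
  also have "\<dots> = (\<Sum>l\<in>{..<n} \<times> {..<n} \<times> {1, -1}. d l * cos (P l * x + Q l * y))"
   by (simp only: sum.cartesian_product d_def P_def Q_def split_def fst_conv snd_conv)
  finally show ?thesis .
 qed
 then show ?thesis by (intro exI[of _ "{..<n} \<times> {..<n} \<times> {1, -1}"] exI conjI allI) auto
qed

context sl_process
begin

text \<open>Normalization to unit variance leaves the signs unchanged and makes the error of the
  sign approximation independent of the position.\<close>

definition U :: "nat => real => nat + nat => real" where
 "U n t i = V n 0 t i / L2_set (V n 0 t) (J n)"

definition sgnt :: "nat => nat => nat => 's => real" where
 "sgnt m n c s = (\<Sum>i<c. (1 - sgn_approx m (gv.Z n (U n (pt n c (2 * i))) s)
   * sgn_approx m (gv.Z n (U n (pt n c (2 * i + 2))) s)) / 2)"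

lemma L2_V_lower: "good n ==> t \<in> dom n ==> 1/2 <= L2_set (V n 0 t) (J n)"
proof (rule power2_le_imp_le)
 assume "good n" "t \<in> dom n"
 from ip_V_point(1)[OF this] have "999/1000 <= (L2_set (V n 0 t) (J n))^2" by (simp only: ip_self)
 moreover have "(1/2)^2 <= (999/1000 :: real)" by (simp add: power2_eq_square)
 ultimately show "(1/2)^2 <= (L2_set (V n 0 t) (J n))^2" by linarith
qed simp

lemma U_unit: "good n ==> t \<in> dom n ==> L2_set (U n t) (J n) = 1"
proof -
 assume "good n" "t \<in> dom n"
 then have L: "1/2 <= L2_set (V n 0 t) (J n)" by (rule L2_V_lower)
 have "U n t = (%i. 1 / L2_set (V n 0 t) (J n) * V n 0 t i)" by (rule ext) (simp add: U_def)
 then have "L2_set (U n t) (J n) = \<bar>1 / L2_set (V n 0 t) (J n)\<bar> * L2_set (V n 0 t) (J n)" by (simp only: L2_set_scale)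
 then show ?thesis using L by simp
qed

lemma Z_U: "gv.Z n (U n t) s = fz n t s / L2_set (V n 0 t) (J n)" by (simp add: gv.Z_def fz_def U_def sum_divide_distrib)

lemma sgn_Z_U: "good n ==> t \<in> dom n ==> sgn (gv.Z n (U n t) s) = sgn (fz n t s)" using L2_V_lower[of n t] by (simp add: Z_U sgn_divide)

lemma in_span_U: "gv.in_span n e (V n 0 t) ==> gv.in_span n e (U n t)"
proof -
 assume *: "gv.in_span n e (V n 0 t)"
 have "U n t = (%i. 1 / L2_set (V n 0 t) (J n) * V n 0 t i + 0 * V n 0 t i)" by (rule ext) (simp add: U_def)
 then show ?thesis by (simp only: gv.in_span_lin[OF * *])
qed

lemma ip_U: "ip (J n) (U n s) (U n t) = ip (J n) (V n 0 s) (V n 0 t) / (L2_set (V n 0 s) (J n) * L2_set (V n 0 t) (J n))"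
 by (simp add: ip_def U_def sum_divide_distrib)

lemma ip_U_le:
 assumes n: "good n" and d: "s \<in> dom n" "t \<in> dom n"
 shows "\<bar>ip (J n) (U n s) (U n t)\<bar> <= 4 * (64 / (1 + \<bar>s - t\<bar>) + C1 * et n)"
proof -
 have n1: "n >= 1" using n by (simp add: good_def)
 have "1/2 * (1/2) <= L2_set (V n 0 s) (J n) * L2_set (V n 0 t) (J n)" using L2_V_lower[OF n] d by (intro mult_mono) auto
 then have "\<bar>ip (J n) (V n 0 s) (V n 0 t)\<bar> / \<bar>L2_set (V n 0 s) (J n) * L2_set (V n 0 t) (J n)\<bar>
  <= (64 / (1 + \<bar>s - t\<bar>) + C1 * et n) / (1/4)" using ip_V_le[OF n1 _ _ d, of 0 0] C1_nonneg et_nonneg[OF n1] by (intro frac_le) auto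
 then show ?thesis unfolding ip_U abs_divide by simp
qed

lemma sgn_approx_Z_err:
 assumes "good n" "t \<in> dom n"
 shows "expectation (%s. (sgn (fz n t s) - sgn_approx m (gv.Z n (U n t) s))^2) = sgn_err m"
proof -
 have "expectation (%s. (sgn (gv.Z n (U n t) s) - sgn_approx m (gv.Z n (U n t) s))^2) = sgn_err m"
  by (subst gv.expectation_Z) (simp_all add: U_unit[OF assms] sgn_err_def)
 then show ?thesis by (simp only: sgn_Z_U[OF assms])
qed

lemma sgnt_meas [measurable]: "sgnt m n c \<in> borel_measurable M" unfolding sgnt_def[abs_def] by measurable

lemma sgnt_bounds: "\<bar>sgnt m n c s\<bar> <= c"
proof -
 have "\<bar>(1 - x * y) / 2\<bar> <= 1" if "\<bar>x\<bar> <= 1" "\<bar>y\<bar> <= 1" for x y :: real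
  using mult_mono[OF that] by (auto simp: abs_mult[symmetric] abs_le_iff)
 then have "\<bar>sgnt m n c s\<bar> <= (\<Sum>i<c. 1)" unfolding sgnt_def by (intro order_trans[OF sum_abs] sum_mono) (simp add: sgn_approx_le_1)
 then show ?thesis by simp
qed

lemma loc_sgn_approx:
 "loc n de t (%s. sgn_approx m (gv.Z n (U n (t - de)) s) * sgn_approx m (gv.Z n (U n (t + de)) s))" unfolding loc_def
proof (intro allI impI)
 fix e assume e: "gv.in_span n e (V n 0 (t - de))" "gv.in_span n e (V n 0 (t + de))"
 show "gv.limtrig n e (%s. sgn_approx m (gv.Z n (U n (t - de)) s) * sgn_approx m (gv.Z n (U n (t + de)) s))"
 proof (rule gv.limtrig_trig[OF gv.trig_sinpoly_mult[OF sgn_approx_sinpoly sgn_approx_sinpoly]])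
  show "\<bar>sgn_approx m (gv.Z n (U n (t - de)) s) * sgn_approx m (gv.Z n (U n (t + de)) s)\<bar> <= 1" for s
   using mult_mono[OF sgn_approx_le_1 sgn_approx_le_1] by (simp add: abs_mult)
 qed (intro in_span_U e)+
qed

text \<open>The cellwise differences are again local functionals with second moment at most
  \<open>sgn_err m\<close>, so \<open>cell_sum_variance\<close> applies. The error is small only
  relative to the mesh, which therefore has to be fixed before \<open>m\<close>.\<close>

lemma sgnc_sgnt:
 assumes n: "good n" and c: "c >= 1" and de: "mesh n c <= 1 / 40000"
 shows "gv.sd (%s. sgnc n c s - sgnt m n c s) <= sqrt (CV * sgn_err m * n) / mesh n c"
proof -
 define S where "S t s = sgn_approx m (gv.Z n (U n t) s)" for t s
 define g where "g t s = sgn (fz n t s)" for t s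
 have [measurable]: "S t \<in> borel_measurable M" "g t \<in> borel_measurable M" for t unfolding S_def[abs_def] g_def[abs_def] by measurable
 have S1: "\<bar>S t s\<bar> <= 1" and g1: "\<bar>g t s\<bar> <= 1" for t s by (auto simp: S_def sgn_approx_le_1 g_def sgn_if)
 have ig: "integrable M (%s. (g t s - S t s)^2)" for t
 proof (rule gv.integrable_bounded[of _ 4])
  show "\<bar>(g t s - S t s)^2\<bar> <= 4" for s unfolding g_def by (rule sgn_diff_sq_le[OF S1])
 qed measurable
 define f where "f i s = (1/2) * (S (pt n c (2 * i)) s * S (pt n c (2 * i + 2)) s) + (-1/2) * (g (pt n c (2 * i)) s * g (pt n c (2 * i + 2)) s)" for i s
 have eq: "sgnc n c s - sgnt m n c s = (\<Sum>i<c. f i s)" for s unfolding sgnc_def sgnt_def sum_subtractf[symmetric] f_def S_def g_def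
  by (intro sum.cong refl) (simp add: field_simps)
 have "gv.cv (%s. \<Sum>i<c. f i s) (%s. \<Sum>i<c. f i s) <= CV * sgn_err m * n / (mesh n c)^2"
 proof (rule cell_sum_variance[OF n c de])
  fix i assume i: "i < c"
  have d: "pt n c (2 * i) \<in> dom n" "pt n c (2 * i + 2) \<in> dom n" using i c by (intro pt_dom; simp)+
  have "loc n (mesh n c) (pt n c (2 * i + 1)) (%s. S (pt n c (2 * i)) s * S (pt n c (2 * i + 2)) s)"
   using loc_sgn_approx[of n "mesh n c" "pt n c (2 * i + 1)" m] unfolding pt_cell S_def .
  from loc_lin[OF this loc_sgn(1)[of n "mesh n c" "pt n c (2 * i + 1)", unfolded pt_cell], of "1/2" "-1/2"]
  show "loc n (mesh n c) (pt n c (2 * i + 1)) (f i)" by (simp only: f_def[abs_def] g_def)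
  have "expectation (%s. (f i s)^2) <= expectation (%s. 1/2 * (g (pt n c (2 * i)) s - S (pt n c (2 * i)) s)^2
    + 1/2 * (g (pt n c (2 * i + 2)) s - S (pt n c (2 * i + 2)) s)^2)"
  proof (rule integral_mono)
   show "(f i s)^2 <= 1/2 * (g (pt n c (2 * i)) s - S (pt n c (2 * i)) s)^2
    + 1/2 * (g (pt n c (2 * i + 2)) s - S (pt n c (2 * i + 2)) s)^2" for s
   proof -
    have "\<bar>a * b - a' * b'\<bar> <= \<bar>a - a'\<bar> + \<bar>b - b'\<bar>" if "\<bar>b\<bar> <= 1" "\<bar>a'\<bar> <= 1" for a b a' b' :: real
    proof -
     have e: "a * b - a' * b' = (a - a') * b + a' * (b - b')" by (simp add: algebra_simps)
     have "\<bar>(a - a') * b\<bar> <= \<bar>a - a'\<bar> * 1" "\<bar>a' * (b - b')\<bar> <= 1 * \<bar>b - b'\<bar>"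
      unfolding abs_mult using that by (intro mult_mono; simp)+
     then show ?thesis unfolding e by (intro order_trans[OF abs_triangle_ineq] add_mono) simp_all
    qed
    from this[OF g1 S1, of "g (pt n c (2 * i)) s" "pt n c (2 * i + 2)" s "pt n c (2 * i)" s "S (pt n c (2 * i + 2)) s"]
    have "\<bar>2 * f i s\<bar> <= \<bar>g (pt n c (2 * i)) s - S (pt n c (2 * i)) s\<bar> + \<bar>g (pt n c (2 * i + 2)) s - S (pt n c (2 * i + 2)) s\<bar>"
     (is "_ <= \<bar>?a\<bar> + \<bar>?b\<bar>") by (simp add: f_def abs_minus_commute)
    from power_mono[OF this abs_ge_zero, of 2] have "4 * (f i s)^2 <= (\<bar>?a\<bar> + \<bar>?b\<bar>)^2" by (simp add: power_mult_distrib)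
    also have "\<dots> <= 2 * ?a^2 + 2 * ?b^2" using sum_squares_bound[of "\<bar>?a\<bar>" "\<bar>?b\<bar>"] by (simp add: power2_sum)
    finally show ?thesis by simp
   qed
   have "\<bar>f i s\<bar> <= 1" for s using mult_mono[OF S1[of "pt n c (2 * i)" s] S1[of "pt n c (2 * i + 2)" s]]
     mult_mono[OF g1[of "pt n c (2 * i)" s] g1[of "pt n c (2 * i + 2)" s]] unfolding f_def by (simp add: abs_mult[symmetric])
   then show "integrable M (%s. (f i s)^2)" by (intro gv.integrable_sq_bounded[of _ 1]) (auto simp: f_def[abs_def])
  qed (intro Bochner_Integration.integrable_add integrable_mult_right ig)
  also have "\<dots> = 1/2 * expectation (%s. (g (pt n c (2 * i)) s - S (pt n c (2 * i)) s)^2)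
    + 1/2 * expectation (%s. (g (pt n c (2 * i + 2)) s - S (pt n c (2 * i + 2)) s)^2)"
   using Bochner_Integration.integral_add[OF integrable_mult_right[OF ig, of "1/2"] integrable_mult_right[OF ig, of "1/2"],
    of "pt n c (2 * i)" "pt n c (2 * i + 2)"] by simp
  also have "\<dots> = sgn_err m" unfolding g_def S_def sgn_approx_Z_err[OF n d(1)] sgn_approx_Z_err[OF n d(2)] by simp
  finally show "expectation (%s. (f i s)^2) <= sgn_err m" .
 qed (simp add: sgn_err_def)
 from real_sqrt_le_mono[OF this]
 show ?thesis unfolding eq gv.sd_def real_sqrt_divide by (simp add: mesh_def)
qed

end

subsection \<open>Limits of the Gram matrix and of the variance\<close>

definition sinc :: "real => real" where "sinc x = (if x = 0 then 1 else sin x / x)"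

text \<open>Taylor's formula shows that \<open>h * cos (k * h)\<close> differs from the increment of
  the sine by at most \<open>h^2\<close>, so the sum telescopes up to
  \<open>n * h^2\<close>.\<close>

lemma average_cos_tendsto: "(%n. (\<Sum>k=1..n. cos (real k * (x / n))) / n) \<longlonglongrightarrow> sinc x"
proof (cases "x = 0")
 case True
 have "eventually (%n. 1 = (\<Sum>k=1..n. cos (real k * (x / n))) / n) sequentially"
  using eventually_ge_at_top[of 1] by eventually_elim (simp add: True)
 then show ?thesis by (rule Lim_transform_eventually[rotated]) (simp add: sinc_def True)
next
 case False
 have tel: "\<bar>sin (real n * h) - h * (\<Sum>k=1..n. cos (real k * h))\<bar> <= n * h^2" for n h
 proof (induction n)
  case (Suc n)
  have "\<bar>sin (real n * h) - sin (real (Suc n) * h) + h * cos (real (Suc n) * h)\<bar> <= h^2"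
   using sin_taylor2[of "real (Suc n) * h" "- h"] by (simp add: algebra_simps)
  with Suc have "\<bar>(sin (real n * h) - h * (\<Sum>k=1..n. cos (real k * h)))
    - (sin (real n * h) - sin (real (Suc n) * h) + h * cos (real (Suc n) * h))\<bar> <= n * h^2 + h^2" by linarith
  then show ?case by (simp add: algebra_simps)
 qed simp
 have "(%n. (sin x - x * ((\<Sum>k=1..n. cos (real k * (x / n))) / n))) \<longlonglongrightarrow> 0"
 proof (rule Lim_null_comparison)
  show "eventually (%n. norm (sin x - x * ((\<Sum>k=1..n. cos (real k * (x / n))) / n)) <= x^2 * (1 / n)) sequentially"
   using eventually_ge_at_top[of 1]
  proof eventually_elim
   case (elim n)
   then show ?case using tel[of n "x / n"] by (simp add: power2_eq_square)
  qed
  show "(%n. x^2 * (1 / real n)) \<longlonglongrightarrow> 0" using tendsto_mult[OF tendsto_const[of "x^2"] lim_1_over_n] by simp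
 qed
 from tendsto_divide[OF tendsto_diff[OF tendsto_const[of "sin x"] this] tendsto_const[of x]]
 show ?thesis using False by (simp add: sinc_def)
qed

text \<open>The exponent \<open>- 3/2\<close> trades the logarithm for a power that is still
  summable.\<close>

lemma et_sq_le: "n >= 1 ==> (et n)^2 <= 16 * real n powr (- 3/2)"
proof -
 assume n: "n >= 1"
 have "ln (real n powr (1/4)) <= real n powr (1/4) - 1" using n by (intro ln_le_minus_one) simp
 then have l: "1 + ln n <= 4 * real n powr (1/4)" using n by (simp add: ln_powr)
 have "et n <= 4 * real n powr (1/4) / real n powr 1" unfolding et_def using n l by (simp add: divide_right_mono)
 also have "\<dots> = 4 * real n powr (1/4 - 1)" by (simp only: powr_diff times_divide_eq_right)
 also have "\<dots> = 4 * real n powr (- 3/4)" by simp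
 finally have "(et n)^2 <= (4 * real n powr (- 3/4))^2" using et_nonneg[OF n] by (intro power_mono)
 also have "\<dots> = 16 * real n powr (- 3/2)" by (simp add: power2_eq_square powr_add[symmetric])
 finally show ?thesis .
qed

lemma sum_sum_symmetric:
 fixes F :: "nat => nat => real"
 assumes sym: "!!i j. F i j = F j i"
 shows "(\<Sum>i<c. \<Sum>j<c. F i j) = (\<Sum>k<c. (if k = 0 then 1 else 2) * (\<Sum>i<c - k. F i (i + k)))"
proof (induction c)
 case (Suc c)
 have "(\<Sum>k<Suc c. (if k = 0 then 1 else 2) * (\<Sum>i<Suc c - k. F i (i + k)))
  = (\<Sum>k<Suc c. (if k = 0 then 1 else 2) * (\<Sum>i<c - k. F i (i + k)) + (if k = 0 then 1 else 2) * F (c - k) c)"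
 proof (intro sum.cong refl)
  fix k assume "k \<in> {..<Suc c}"
  then have "Suc c - k = Suc (c - k)" "c - k + k = c" by auto
  then show "(if k = 0 then 1 else 2) * (\<Sum>i<Suc c - k. F i (i + k))
   = (if k = 0 then 1 else 2) * (\<Sum>i<c - k. F i (i + k)) + (if k = 0 then 1 else 2) * F (c - k) c" by (simp add: distrib_left)
 qed
 also have "\<dots> = (\<Sum>i<c. \<Sum>j<c. F i j) + (\<Sum>k<Suc c. (if k = 0 then 1 else 2) * F (c - k) c)" by (simp add: sum.distrib Suc)
 also have "(\<Sum>k<Suc c. (if k = 0 then 1 else 2) * F (c - k) c) = F c c + (\<Sum>i<c. 2 * F i c)"
 proof -
  have "(\<Sum>k<c. 2 * F (c - Suc k) c) = (\<Sum>i<c. 2 * F i c)" by (rule sum.reindex_bij_witness[of _ "%i. c - Suc i" "%k. c - Suc k"]) auto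
  then show ?thesis unfolding sum.lessThan_Suc_shift by simp
 qed
 finally have e: "(\<Sum>k<Suc c. (if k = 0 then 1 else 2) * (\<Sum>i<Suc c - k. F i (i + k)))
  = (\<Sum>i<c. \<Sum>j<c. F i j) + (F c c + 2 * (\<Sum>i<c. F i c))" by (simp only: sum_distrib_left)
 have "(\<Sum>j<c. F c j) = (\<Sum>j<c. F j c)" by (intro sum.cong refl sym)
 then show ?case unfolding e by (simp add: sum.distrib)
qed simp

text \<open>The double sum is arranged by diagonals, and Tannery's theorem exchanges the limit with
  the sum over the lag \<open>k\<close>, dominated by a multiple of
  \<open>(k + 1) powr (- 3/2)\<close>.\<close>

lemma stationary_double_sum:
 fixes F :: "nat => nat => nat => real" and ka :: nat
 assumes ka: "ka >= 1" and sym: "!!n i j. F n i j = F n j i" and b0: "b >= 0"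
  and bound: "eventually (%n. \<forall>i k. i + k < ka * n --> \<bar>F n i (i + k)\<bar> <= b * real (Suc k) powr (- 3/2)) sequentially"
  and lim: "!!i k. eventually (%n. i n + k < ka * n) sequentially ==> (%n. F n (i n) (i n + k)) \<longlonglongrightarrow> G k"
 shows "convergent (%n. (\<Sum>i<ka * n. \<Sum>j<ka * n. F n i j) / n)"
proof -
 define w where "w k = (if k = 0 then 1 else 2 :: real)" for k :: nat
 define a where "a k n = (if k < ka * n then w k * (\<Sum>i<ka * n - k. F n i (i + k)) / n else 0)" for k n
 have w: "0 <= w k" "w k <= 2" for k by (auto simp: w_def)
 have ev: "eventually (%n. 0 + k < ka * n) sequentially" for k using eventually_gt_at_top[of k]
 proof eventually_elim
  case (elim n)
  have "k < 1 * n" using elim by simp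
  also have "1 * n <= ka * n" using ka by (rule mult_le_mono1)
  finally show ?case by simp
 qed
 have unif: "eventually (%n. \<forall>i. i + k < ka * n --> \<bar>F n i (i + k) - G k\<bar> < ep) sequentially" if ep: "ep > 0" for k ep
 proof -
  \<comment> \<open>Convergence along every index sequence implies uniform convergence: a violating
    index is selected whenever one exists, and the hypothesis is applied to the selected
    sequence.\<close>
  define i where "i n = (if \<exists>i. i + k < ka * n \<and> \<not> \<bar>F n i (i + k) - G k\<bar> < ep
   then SOME i. i + k < ka * n \<and> \<not> \<bar>F n i (i + k) - G k\<bar> < ep else 0)" for n
  have i: "i n + k < ka * n \<and> \<not> \<bar>F n (i n) (i n + k) - G k\<bar> < ep"
   if "\<exists>i. i + k < ka * n \<and> \<not> \<bar>F n i (i + k) - G k\<bar> < ep" for n using someI_ex[OF that] that by (simp add: i_def)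
  have "eventually (%n. i n + k < ka * n) sequentially" using ev[of k]
  proof eventually_elim
   case (elim n)
   then show ?case using i[of n] by (cases "\<exists>i. i + k < ka * n \<and> \<not> \<bar>F n i (i + k) - G k\<bar> < ep") (auto simp: i_def)
  qed
  from tendstoD[OF lim[OF this] ep] show ?thesis by eventually_elim (use i in \<open>auto simp: dist_real_def\<close>)
 qed
 have "eventually (%n. summable (%k. norm (a k n))) sequentially \<and> summable (%k. norm (w k * (ka * G k))) \<and>
   (%n. suminf (%k. a k n)) \<longlonglongrightarrow> suminf (%k. w k * (ka * G k))"
 proof (rule tannerys_theorem)
  show "(%n. a k n) \<longlonglongrightarrow> w k * (ka * G k)" for k
  proof -
   have 1: "(%n. w k * ((ka * real n - k) / n * G k)) \<longlonglongrightarrow> w k * (ka * G k)"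
   proof (intro tendsto_mult tendsto_const)
    have "(%n. ka - k * (1 / real n)) \<longlonglongrightarrow> real ka - real k * 0" by (intro tendsto_intros lim_1_over_n)
    moreover have "eventually (%n. ka - k * (1 / real n) = (ka * real n - k) / n) sequentially"
     using eventually_ge_at_top[of 1] by eventually_elim (simp add: field_simps)
    ultimately show "(%n. (ka * real n - k) / n) \<longlonglongrightarrow> ka" by (simp add: Lim_transform_eventually)
   qed
   have "(%n. a k n - w k * ((ka * real n - k) / n * G k)) \<longlonglongrightarrow> 0"
   proof (rule tendstoI)
    fix ep :: real assume ep: "ep > 0"
    define ep' where "ep' = ep / (3 * ka)"
    have e': "ep' > 0" using ep ka by (simp add: ep'_def)
    show "eventually (%n. dist (a k n - w k * ((ka * real n - k) / n * G k)) 0 < ep) sequentially"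
     using unif[OF e', of k] ev[of k] eventually_ge_at_top[of 1]
    proof eventually_elim
     case (elim n)
     have rl: "real (ka * n - k) = ka * real n - k" using elim(2) by (simp add: of_nat_diff)
     have "a k n - w k * ((ka * real n - k) / n * G k) = w k * ((\<Sum>i<ka * n - k. F n i (i + k) - G k) / n)"
     proof -
      have e: "(\<Sum>i<ka * n - k. F n i (i + k) - G k) = (\<Sum>i<ka * n - k. F n i (i + k)) - (ka * real n - k) * G k"
       by (simp add: sum_subtractf rl)
      show ?thesis unfolding e a_def using elim(2,3) by (simp add: field_simps)
     qed
     then have "\<bar>a k n - w k * ((ka * real n - k) / n * G k)\<bar> = w k * (\<bar>\<Sum>i<ka * n - k. F n i (i + k) - G k\<bar> / n)"
      using w by (simp add: abs_mult)
     also have "\<dots> <= 2 * (ka * real n * ep' / n)"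
     proof (intro mult_mono divide_right_mono)
      have "\<bar>\<Sum>i<ka * n - k. F n i (i + k) - G k\<bar> <= (\<Sum>i<ka * n - k. ep')"
       by (intro order_trans[OF sum_abs] sum_mono) (use elim(1) less_imp_le in \<open>auto simp: less_diff_conv\<close>)
      also have "\<dots> <= ka * real n * ep'" using e' by (simp add: rl)
      finally show "\<bar>\<Sum>i<ka * n - k. F n i (i + k) - G k\<bar> <= ka * real n * ep'" .
     qed (use w in auto)
     also have "\<dots> = 2 * ep / 3" using elim(3) ka by (simp add: ep'_def)
     finally show ?case using ep by simp
    qed
   qed
   from tendsto_add[OF this 1] show ?thesis by simp
  qed
  show "eventually (%(k, n). norm (a k n) <= 2 * (ka * b) * real (Suc k) powr (- 3/2)) (at_top \<times>\<^sub>F sequentially)" unfolding split_def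
  proof (rule eventually_compose_filterlim[OF _ filterlim_snd, where P="%n. \<forall>k. norm (a k n) <= 2 * (ka * b) * real (Suc k) powr (- 3/2)", THEN eventually_mono])
   show "eventually (%n. \<forall>k. norm (a k n) <= 2 * (ka * b) * real (Suc k) powr (- 3/2)) sequentially" using bound eventually_ge_at_top[of 1]
   proof eventually_elim
    case (elim n)
    show ?case
    proof
     fix k
     show "norm (a k n) <= 2 * (ka * b) * real (Suc k) powr (- 3/2)"
     proof (cases "k < ka * n")
      case True
      let ?x = "b * real (Suc k) powr (- 3/2)"
      have "\<bar>\<Sum>i<ka * n - k. F n i (i + k)\<bar> <= (\<Sum>i<ka * n - k. ?x)"
       by (intro order_trans[OF sum_abs] sum_mono) (use elim(1) in \<open>auto simp: less_diff_conv\<close>)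
      also have "\<dots> = real (ka * n - k) * ?x" by simp
      also have "\<dots> <= real (ka * n) * ?x" using b0 by (intro mult_right_mono) (simp_all del: of_nat_mult)
      finally have "w k * \<bar>\<Sum>i<ka * n - k. F n i (i + k)\<bar> <= 2 * (real (ka * n) * ?x)" using w b0 by (intro mult_mono) auto
      then have "w k * \<bar>\<Sum>i<ka * n - k. F n i (i + k)\<bar> / n <= 2 * (real (ka * n) * ?x) / n" by (intro divide_right_mono) auto
      then show ?thesis using True w elim(2) by (simp add: a_def abs_mult)
     qed (use b0 in \<open>simp add: a_def\<close>)
    qed
   qed
  qed simp
  have "summable (%k. real (Suc k) powr (- 3/2))" by (subst summable_Suc_iff) (simp add: summable_real_powr_iff)
  then show "summable (%k. 2 * (ka * b) * real (Suc k) powr (- 3/2))" by (rule summable_mult)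
 qed simp
 then have "convergent (%n. suminf (%k. a k n))" unfolding convergent_def by blast
 moreover have "suminf (%k. a k n) = (\<Sum>i<ka * n. \<Sum>j<ka * n. F n i j) / n" for n
 proof -
  have "suminf (%k. a k n) = (\<Sum>k<ka * n. a k n)" by (rule suminf_finite) (auto simp: a_def)
  also have "\<dots> = (\<Sum>i<ka * n. \<Sum>j<ka * n. F n i j) / n"
   unfolding sum_sum_symmetric[of "F n", OF sym] sum_divide_distrib by (simp add: a_def w_def)
  finally show ?thesis .
 qed
 ultimately show ?thesis by simp
qed

context sl_process
begin

lemma ip_V_tendsto:
 assumes d: "eventually (%n. s n \<in> dom n \<and> t n \<in> dom n \<and> s n - t n = de) sequentially"
 shows "(%n. ip (J n) (V n 0 (s n)) (V n 0 (t n))) \<longlonglongrightarrow> sinc (de / 2)"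
proof -
 have "(%n. ip (J n) (V n 0 (s n)) (V n 0 (t n)) - (\<Sum>k=1..n. cos (real k * (de / 2 / n))) / n) \<longlonglongrightarrow> 0"
 proof (rule Lim_null_comparison)
  show "eventually (%n. norm (ip (J n) (V n 0 (s n)) (V n 0 (t n)) - (\<Sum>k=1..n. cos (real k * (de / 2 / n))) / n) <= C1 * et n) sequentially"
   using d eventually_ge_at_top[of 1]
  proof eventually_elim
   case (elim n)
   then have "ip (J n) (Tm n 0 (s n)) (Tm n 0 (t n)) = (\<Sum>k=1..n. cos (real k * (de / 2 / n))) / n" using ip_Tm[of n 0 "s n" 0 "t n"] by simp
   then show ?case using ip_V_err[of n 0 0 "s n" "t n"] elim by simp
  qed
  show "(%n. C1 * et n) \<longlonglongrightarrow> 0" using tendsto_mult[OF tendsto_const[of C1] et_tendsto(1)] by simp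
 qed
 from tendsto_add[OF this average_cos_tendsto[of "de / 2"]] show ?thesis by simp
qed

lemma ip_U_tendsto:
 assumes d: "eventually (%n. s n \<in> dom n \<and> t n \<in> dom n \<and> s n - t n = de) sequentially"
 shows "(%n. ip (J n) (U n (s n)) (U n (t n))) \<longlonglongrightarrow> sinc (de / 2)"
proof -
 have L: "(%n. L2_set (V n 0 (r n)) (J n)) \<longlonglongrightarrow> 1" if "eventually (%n. r n \<in> dom n) sequentially" for r
 proof -
  have "(%n. ip (J n) (V n 0 (r n)) (V n 0 (r n))) \<longlonglongrightarrow> sinc (0 / 2)" by (rule ip_V_tendsto) (use that in eventually_elim, auto)
  from tendsto_real_sqrt[OF this] show ?thesis by (simp add: L2_set_sqrt_ip sinc_def)
 qed
 have "(%n. ip (J n) (V n 0 (s n)) (V n 0 (t n)) / (L2_set (V n 0 (s n)) (J n) * L2_set (V n 0 (t n)) (J n))) \<longlonglongrightarrow> sinc (de / 2) / (1 * 1)"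
  by (intro tendsto_divide tendsto_mult ip_V_tendsto d L; (rule eventually_mono[OF d])?; simp)
 then show ?thesis by (simp add: ip_U)
qed

end

subsection \<open>Central limit theorem for the trigonometric approximation\<close>

context sl_process
begin

definition ug :: "nat => nat => nat => nat + nat => real" where
 "ug n ka j = U n (real j * (2 * pi / ka))"

lemma pt_grid: "n >= 1 ==> ka >= 1 ==> pt n (ka * n) (2 * j) = real j * (2 * pi / ka)"
 "n >= 1 ==> mesh n (ka * n) = pi / ka" by (simp_all add: pt_def mesh_def)

lemma grid_dom: "ka >= 1 ==> j <= ka * n ==> real j * (2 * pi / ka) \<in> dom n"
proof -
 assume *: "ka >= 1" "j <= ka * n"
 have "real j * (2 * pi / ka) <= real (ka * n) * (2 * pi / ka)" using *(2) by (intro mult_right_mono) (simp_all del: of_nat_mult)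
 then show ?thesis using * by (simp add: mult_ac)
qed

lemma ug_tendsto:
 assumes ka: "ka >= 1" and i: "eventually (%n. i n + a <= ka * n \<and> i n + b <= ka * n) sequentially"
 shows "(%n. ip (J n) (ug n ka (i n + a)) (ug n ka (i n + b))) \<longlonglongrightarrow> sinc ((real a - real b) * (2 * pi / ka) / 2)"
 unfolding ug_def
proof (rule ip_U_tendsto)
 show "eventually (%n. real (i n + a) * (2 * pi / ka) \<in> dom n \<and> real (i n + b) * (2 * pi / ka) \<in> dom n \<and>
  real (i n + a) * (2 * pi / ka) - real (i n + b) * (2 * pi / ka) = (real a - real b) * (2 * pi / ka)) sequentially"
  using i by eventually_elim (intro conjI grid_dom ka, simp_all add: algebra_simps add_divide_distrib diff_divide_distrib)
qed

text \<open>Inverse distances on a grid of fixed spacing sum to a harmonic number, and the model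
  error adds \<open>n * et n\<close>; both are logarithmic in \<open>n\<close>.\<close>

lemma ug_row:
 assumes n: "good n" and ka: "ka >= 1" and j: "j <= ka * n"
 shows "(\<Sum>k<Suc (ka * n). \<bar>ip (J n) (ug n ka j) (ug n ka k)\<bar>) <= 512 * ka * (1 + ln (ka * n + 1)) + 8 * ka * C1 * (1 + ln n)"
proof -
 have n1: "n >= 1" using n by (simp add: good_def)
 define g where "g k = 1 / (1 + (2 * pi / ka) * real k)" for k
 have g0: "g k >= 0" for k by (simp add: g_def)
 have g: "g k <= ka * (1 / real (Suc k))" for k
 proof -
  have "2 * pi * real k >= 1 * real k" using pi_gt3 by (intro mult_right_mono) auto
  then have "real (Suc k) <= ka * (1 + (2 * pi / ka) * real k)" using ka by (simp add: distrib_left)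
  moreover have "1 + (2 * pi / ka) * real k > 0" by (intro add_pos_nonneg) auto
  ultimately show ?thesis by (simp add: g_def divide_simps mult.commute del: of_nat_Suc)
 qed
 have "(\<Sum>k<Suc (ka * n). \<bar>ip (J n) (ug n ka j) (ug n ka k)\<bar>) <= (\<Sum>k<Suc (ka * n). 256 * g (ndist j k) + 4 * C1 * et n)"
 proof (rule sum_mono)
  fix k assume "k \<in> {..<Suc (ka * n)}"
  then have "\<bar>ip (J n) (ug n ka j) (ug n ka k)\<bar> <= 4 * (64 / (1 + \<bar>real j * (2 * pi / ka) - real k * (2 * pi / ka)\<bar>) + C1 * et n)"
   unfolding ug_def using ka j by (intro ip_U_le n grid_dom) auto
  also have "\<bar>real j * (2 * pi / ka) - real k * (2 * pi / ka)\<bar> = (2 * pi / ka) * real (ndist j k)"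
   unfolding of_nat_ndist left_diff_distrib[symmetric] abs_mult by simp
  finally show "\<bar>ip (J n) (ug n ka j) (ug n ka k)\<bar> <= 256 * g (ndist j k) + 4 * C1 * et n" by (simp add: g_def)
 qed
 also have "\<dots> = 256 * (\<Sum>k<Suc (ka * n). g (ndist j k)) + real (Suc (ka * n)) * (4 * C1 * et n)"
  by (simp add: sum.distrib sum_distrib_left del: sum.lessThan_Suc)
 also have "\<dots> <= 256 * (2 * (ka * (1 + ln (ka * n + 1)))) + (2 * ka * n) * (4 * C1 * et n)"
 proof (intro add_mono mult_left_mono mult_right_mono)
  have "(\<Sum>k<Suc (ka * n). g (ndist j k)) <= 2 * (\<Sum>k<Suc (ka * n). g k)" by (rule sum_ndist_le) (use j g0 in auto)
  also have "(\<Sum>k<Suc (ka * n). g k) <= (\<Sum>k<Suc (ka * n). ka * (1 / real (Suc k)))" by (intro sum_mono g)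
  also have "\<dots> = ka * harm (Suc (ka * n))"
  proof -
   have "(\<Sum>k<Suc (ka * n). 1 / real (Suc k)) = (\<Sum>k=1..Suc (ka * n). inverse (real k))"
    by (rule sum.reindex_bij_witness[of _ "%k. k - 1" Suc]) (auto simp: divide_inverse)
   then show ?thesis by (simp only: sum_distrib_left[symmetric] harm_def)
  qed
  also have "harm (Suc (ka * n)) <= 1 + ln (ka * n + 1)" using harm_le_ln[of "Suc (ka * n)"] by (simp add: add.commute)
  finally show "(\<Sum>k<Suc (ka * n). g (ndist j k)) <= 2 * (ka * (1 + ln (ka * n + 1)))" by (simp add: mult_left_mono)
  have "1 <= ka * n" using ka n1 by simp
  then have "Suc (ka * n) <= 2 * ka * n" by simp
  then show "real (Suc (ka * n)) <= real (2 * ka * n)" by (simp only: of_nat_le_iff)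
 qed (use C1_nonneg et_nonneg[OF n1] in auto)
 also have "(2 * ka * n) * (4 * C1 * et n) = 8 * ka * C1 * (1 + ln n)" using n1 by (simp add: et_def)
 finally show ?thesis by (simp add: mult.assoc add.commute)
qed

text \<open>The Stein error: \<open>n\<close> terms with row sums of order \<open>log n\<close> and
  coefficients of order \<open>1 / sqrt n\<close>.\<close>

lemma log_cube_tendsto:
 "(%n. sqrt ((a * (1 + ln (ka * n + 1)) + b * (1 + ln n)) ^ 3 / n)) \<longlonglongrightarrow> 0" if "ka >= 1" for ka :: nat
proof -
 have k: "real ka > 0" using that by simp
 have 1: "(%n. (1 + ln (ka * real n + 1)) / real n powr (1/3)) \<longlonglongrightarrow> 0" using k by real_asymp
 have 2: "(%n. (1 + ln (real n)) / real n powr (1/3)) \<longlonglongrightarrow> 0" by real_asymp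
 have "(%n. (a * ((1 + ln (ka * real n + 1)) / real n powr (1/3)) + b * ((1 + ln (real n)) / real n powr (1/3))) ^ 3) \<longlonglongrightarrow> (a * 0 + b * 0) ^ 3"
  by (intro tendsto_intros 1 2)
 moreover have "(a * ((1 + ln (ka * real n + 1)) / real n powr (1/3)) + b * ((1 + ln (real n)) / real n powr (1/3))) ^ 3
   = (a * (1 + ln (ka * n + 1)) + b * (1 + ln n)) ^ 3 / n" if "n >= 1" for n :: nat
 proof -
  have "(real n powr (1/3)) ^ 3 = n" using that by (simp add: powr_powr flip: powr_realpow)
  then show ?thesis by (simp add: power_divide add.commute flip: add_divide_distrib)
 qed
 ultimately have "(%n. (a * (1 + ln (ka * n + 1)) + b * (1 + ln n)) ^ 3 / n) \<longlonglongrightarrow> 0"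
  by (subst (asm) tendsto_cong[OF eventually_mono[OF eventually_ge_at_top[of 1]]]) auto
 from tendsto_real_sqrt[OF this] show ?thesis by simp
qed

text \<open>On a grid of fixed spacing the approximate count is a constant plus a sum of cosines of
  functionals of two neighbouring grid values. Asymptotic normality is
  \<open>trig_stat_char\<close>; the variance converges because the Gram entries do and the
  covariances have a summable bound in the lag.\<close>

lemma sgnt_limits:
 fixes m ka :: nat and t :: real
 assumes ka: "ka >= 1" "pi / ka <= 1 / 40000"
 defines "Y \<equiv> %n. sgnt m n (ka * n)"
 defines "W \<equiv> %n s. (Y n s - expectation (Y n)) / sqrt n"
 shows "convergent (%n. gv.cv (Y n) (Y n) / n)"
  and "(%n. expectation (%s. cos (t * W n s)) - exp (- (gv.cv (Y n) (Y n) / n * t^2) / 2)) \<longlonglongrightarrow> 0"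
  and "(%n. expectation (%s. sin (t * W n s))) \<longlonglongrightarrow> 0"
proof -
 obtain L :: "(nat \<times> nat \<times> real) set" and d p q where L: "finite L"
  and rep: "!!x y. sgn_approx m x * sgn_approx m y = (\<Sum>l\<in>L. d l * cos (p l * x + q l * y))"
  using sinpoly_mult_cos_sum[OF sgn_approx_sinpoly[of m]] by blast
 define P where "P = (\<Sum>l\<in>L. \<bar>p l\<bar> + \<bar>q l\<bar>)"
 define D where "D = (\<Sum>l\<in>L. \<bar>d l\<bar>)"
 have PD: "\<bar>p l\<bar> <= P" "\<bar>q l\<bar> <= P" "\<bar>d l\<bar> <= D" if "l \<in> L" for l
 proof -
  have "\<bar>p l\<bar> + \<bar>q l\<bar> <= P" unfolding P_def using that L by (intro member_le_sum) auto
  then show "\<bar>p l\<bar> <= P" "\<bar>q l\<bar> <= P" by auto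
  show "\<bar>d l\<bar> <= D" unfolding D_def using that L by (intro member_le_sum) auto
 qed
 have P0: "P >= 0" and D0: "D >= 0" by (auto simp: P_def D_def intro!: sum_nonneg)
 \<comment> \<open>The index pairs a cell with a frequency pair from the cosine representation of
   the sign product.\<close>
 define th where "th n il = (%x. p (snd il) * ug n ka (fst il) x + q (snd il) * ug n ka (Suc (fst il)) x)" for n and il :: "nat \<times> nat \<times> nat \<times> real"
 define A where "A n = {..<ka * n} \<times> L" for n
 define cf where "cf n il = (- (d (snd il) / 2)) / sqrt n" for n :: nat and il :: "nat \<times> nat \<times> nat \<times> real"
 define f where "f n i s = (\<Sum>l\<in>L. - (d l / 2) * cos (gv.Z n (th n (i, l)) s))" for n i s
 have fm [measurable]: "f n i \<in> borel_measurable M" for n i unfolding f_def[abs_def] by measurable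
 have f_eq: "f n i s = - (sgn_approx m (gv.Z n (ug n ka i) s) * sgn_approx m (gv.Z n (ug n ka (Suc i)) s)) / 2" for n i s
  by (simp only: rep f_def th_def fst_conv snd_conv gv.Z_lin sum_negf[symmetric] sum_divide_distrib)
   (intro sum.cong refl, simp)
 have f1: "\<bar>f n i s\<bar> <= 1" for n i s
 proof -
  have "\<bar>sgn_approx m x * sgn_approx m y\<bar> <= 1 * 1" for x y unfolding abs_mult by (intro mult_mono sgn_approx_le_1) auto
  then have "\<bar>sgn_approx m x * sgn_approx m y\<bar> / 2 <= 1" for x y by (rule order_trans[OF divide_right_mono[of _ "1 * 1"]]) auto
  then show ?thesis unfolding f_eq by simp
 qed
 have if': "integrable M (f n i)" for n i by (rule gv.integrable_bounded[OF fm f1])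
 have Y_eq: "Y n s = ka * n / 2 + (\<Sum>i<ka * n. f n i s)" if n: "n >= 1" for n s
 proof -
  have g: "U n (pt n (ka * n) (2 * i)) = ug n ka i" for i unfolding ug_def pt_grid(1)[OF n ka(1)] ..
  have g': "U n (pt n (ka * n) (2 * i + 2)) = ug n ka (Suc i)" for i using g[of "Suc i"] by simp
  have "Y n s = (\<Sum>i<ka * n. 1 / 2 + f n i s)" unfolding Y_def sgnt_def g g' f_eq by (intro sum.cong refl) (simp add: diff_divide_distrib)
  then show ?thesis by (simp add: sum.distrib)
 qed
 have Em: "expectation (Y n) = ka * n / 2 + (\<Sum>i<ka * n. expectation (f n i))" if n: "n >= 1" for n
  unfolding Y_eq[OF n] using if' by (simp add: prob_space)
 have cvY: "gv.cv (Y n) (Y n) = gv.cv (%s. \<Sum>i<ka * n. f n i s) (%s. \<Sum>i<ka * n. f n i s)" (is ?a)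
  and WV: "expectation (%s. (W n s)^2) = gv.cv (Y n) (Y n) / n" (is ?b) if n: "n >= 1" for n
 proof -
  have b: "\<bar>\<Sum>i<ka * n. f n i s\<bar> <= (\<Sum>i<ka * n. 1)" for s by (intro order_trans[OF sum_abs] sum_mono f1)
  have i2: "integrable M (%s. (Y n s)^2)" "integrable M (%s. (\<Sum>i<ka * n. f n i s)^2)"
   using gv.integrable_sq_bounded[OF _ sgnt_bounds] gv.integrable_sq_bounded[OF _ b] by (auto simp: Y_def)
  show ?a
  proof -
   have "gv.cv (Y n) (Y n) = variance (Y n)" by (rule gv.cv_self[OF i2(1)]) (simp add: Y_def)
   moreover have "gv.cv (%s. \<Sum>i<ka * n. f n i s) (%s. \<Sum>i<ka * n. f n i s) = variance (%s. \<Sum>i<ka * n. f n i s)"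
    by (rule gv.cv_self[OF i2(2)]) measurable
   moreover have "Y n s - expectation (Y n) = (\<Sum>i<ka * n. f n i s) - expectation (%s. \<Sum>i<ka * n. f n i s)" for s
    unfolding Y_eq[OF n] Em[OF n] by (simp add: if')
   ultimately show ?thesis by simp
  qed
  show ?b using gv.cv_self[OF i2(1)] n by (simp add: W_def power_divide Y_def)
 qed
 have stat: "gv.trig_stat n (A n) (cf n) (th n) s = W n s" if n: "n >= 1" for n s
 proof -
  have "expectation (f n i) = (\<Sum>l\<in>L. - (d l / 2) * exp (- ip (J n) (th n (i, l)) (th n (i, l)) / 2))" for i
   unfolding f_def by (simp add: gv.expectation_cos)
  then have "(f n i s - expectation (f n i)) / sqrt n
   = (\<Sum>l\<in>L. cf n (i, l) * (cos (gv.Z n (th n (i, l)) s) - exp (- ip (J n) (th n (i, l)) (th n (i, l)) / 2)))" for i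
   unfolding f_def by (simp only: sum_subtractf[symmetric] sum_divide_distrib cf_def snd_conv)
    (intro sum.cong refl, simp add: right_diff_distrib diff_divide_distrib)
  moreover have "W n s = (\<Sum>i<ka * n. (f n i s - expectation (f n i)) / sqrt n)"
   unfolding W_def Y_eq[OF n] Em[OF n] by (simp add: sum_subtractf flip: sum_divide_distrib)
  ultimately have "W n s = (\<Sum>i<ka * n. \<Sum>l\<in>L. cf n (i, l) * (cos (gv.Z n (th n (i, l)) s) - exp (- ip (J n) (th n (i, l)) (th n (i, l)) / 2)))"
   by (simp only:)
  then show ?thesis unfolding gv.trig_stat_def A_def by (simp only: sum.cartesian_product split_def prod.collapse)
 qed
 \<comment> \<open>Each inner product of two vectors \<open>th\<close> is a combination of four such
   grid entries, hence the factor 4 in \<open>a\<close> and \<open>b\<close> below.\<close>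
 define r where "r n i j = ip (J n) (ug n ka i) (ug n ka j)" for n i j
 have ipth: "ip (J n) (th n (i, l)) (th n (j, l')) = p l * p l' * r n i j + p l * q l' * r n i (Suc j)
   + q l * p l' * r n (Suc i) j + q l * q l' * r n (Suc i) (Suc j)" for n i j l l'
  unfolding th_def r_def by (simp add: ip_lin_left ip_lin_right algebra_simps)
 define a where "a = 4 * real (card L) * P^2 * (512 * real ka)"
 define b where "b = 4 * real (card L) * P^2 * (8 * real ka * C1)"
 define La where "La n = a * (1 + ln (real ka * real n + 1)) + b * (1 + ln (real n))" for n :: nat
 define ep where "ep n = 2 * D^2 * sqrt (ka * card L) * sqrt (La n ^ 3 / n)" for n :: nat
 have rows: "(\<Sum>k\<in>A n. \<bar>ip (J n) (th n il) (th n k)\<bar>) <= La n" if n: "good n" and il: "il \<in> A n" for n il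
 proof -
  obtain i l where [simp]: "il = (i, l)" and i: "i < ka * n" and l: "l \<in> L" using il by (auto simp: A_def)
  let ?\<rho> = "512 * real ka * (1 + ln (real ka * real n + 1)) + 8 * real ka * C1 * (1 + ln (real n))"
  have pr: "\<bar>x * y * z\<bar> <= P^2 * \<bar>z\<bar>" if "\<bar>x\<bar> <= P" "\<bar>y\<bar> <= P" for x y z
   using that P0 unfolding abs_mult power2_eq_square by (intro mult_mono mult_right_mono) auto
  have R: "(\<Sum>j<ka * n. \<bar>r n i' j\<bar>) <= ?\<rho>" "(\<Sum>j<ka * n. \<bar>r n i' (Suc j)\<bar>) <= ?\<rho>" if "i' <= ka * n" for i'
   using ug_row[OF n ka(1) that] sum.lessThan_Suc[of "%j. \<bar>r n i' j\<bar>" "ka * n"] sum.lessThan_Suc_shift[of "%j. \<bar>r n i' j\<bar>" "ka * n"]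
    abs_ge_zero[of "r n i' (ka * n)"] abs_ge_zero[of "r n i' 0"] unfolding r_def by linarith+
  have "(\<Sum>k\<in>A n. \<bar>ip (J n) (th n il) (th n k)\<bar>) = (\<Sum>j<ka * n. \<Sum>l'\<in>L. \<bar>ip (J n) (th n (i, l)) (th n (j, l'))\<bar>)"
   unfolding A_def by (simp add: sum.cartesian_product)
  also have "\<dots> <= (\<Sum>j<ka * n. \<Sum>l'\<in>L. P^2 * (\<bar>r n i j\<bar> + \<bar>r n i (Suc j)\<bar> + \<bar>r n (Suc i) j\<bar> + \<bar>r n (Suc i) (Suc j)\<bar>))"
  proof (intro sum_mono)
   fix j l' assume "l' \<in> L"
   note b = PD(1,2)[OF l] PD(1,2)[OF this]
   show "\<bar>ip (J n) (th n (i, l)) (th n (j, l'))\<bar> <= P^2 * (\<bar>r n i j\<bar> + \<bar>r n i (Suc j)\<bar> + \<bar>r n (Suc i) j\<bar> + \<bar>r n (Suc i) (Suc j)\<bar>)"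
    unfolding ipth distrib_left by (intro order_trans[OF abs_triangle_ineq] add_mono pr b)
  qed
  also have "\<dots> = card L * P^2 * ((\<Sum>j<ka * n. \<bar>r n i j\<bar>) + (\<Sum>j<ka * n. \<bar>r n i (Suc j)\<bar>)
    + (\<Sum>j<ka * n. \<bar>r n (Suc i) j\<bar>) + (\<Sum>j<ka * n. \<bar>r n (Suc i) (Suc j)\<bar>))"
   by (simp add: sum_distrib_left sum.distrib distrib_left mult.assoc)
  also have "\<dots> <= card L * P^2 * (?\<rho> + ?\<rho> + ?\<rho> + ?\<rho>)" using i by (intro mult_left_mono add_mono R) auto
  finally show ?thesis by (simp add: La_def a_def b_def algebra_simps)
 qed
 have char: "\<bar>expectation (%s. cos (t * W n s)) - exp (- (gv.cv (Y n) (Y n) / n * t^2) / 2)\<bar> <= t^2 * ep n"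
   "\<bar>expectation (%s. sin (t * W n s))\<bar> <= t^2 * ep n" if n: "good n" for n
 proof -
  have n1: "n >= 1" using n by (simp add: good_def)
  have c: "\<bar>cf n il\<bar> <= D / sqrt n" if "il \<in> A n" for il
  proof -
   have "\<bar>d (snd il)\<bar> / 2 <= D" using PD(3)[of "snd il"] that by (auto simp: A_def)
   from divide_right_mono[OF this, of "sqrt n"] show ?thesis unfolding cf_def by simp
  qed
  have "2 * (D / sqrt n)^2 * sqrt (card (A n) * La n ^ 3) = ep n"
  proof -
   have "sqrt (card (A n) * La n ^ 3) = sqrt (ka * card L) * sqrt (real n * real n * (La n ^ 3 / n))"
    using n1 by (simp add: A_def card_cartesian_product real_sqrt_mult)
   also have "\<dots> = sqrt (ka * card L) * (n * sqrt (La n ^ 3 / n))" by (simp only: real_sqrt_mult real_sqrt_mult_self abs_of_nat)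
   finally show ?thesis using n1 by (simp add: ep_def power_divide)
  qed
  moreover have "finite (A n)" using L by (simp add: A_def)
  ultimately show "\<bar>expectation (%s. cos (t * W n s)) - exp (- (gv.cv (Y n) (Y n) / n * t^2) / 2)\<bar> <= t^2 * ep n"
   "\<bar>expectation (%s. sin (t * W n s))\<bar> <= t^2 * ep n"
   using gv.trig_stat_char[of "A n" n "th n" "La n" "cf n" "D / sqrt n" t] rows[OF n] c D0 by (simp_all add: stat[OF n1] WV[OF n1])
 qed
 have ep: "(%n. t^2 * ep n) \<longlonglongrightarrow> 0"
  using tendsto_mult[OF tendsto_const[of "t^2"] tendsto_mult[OF tendsto_const[of "2 * D^2 * sqrt (ka * card L)"] log_cube_tendsto[OF ka(1), of a b]]]
  by (simp add: ep_def La_def add.commute)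
 show "(%n. expectation (%s. cos (t * W n s)) - exp (- (gv.cv (Y n) (Y n) / n * t^2) / 2)) \<longlonglongrightarrow> 0"
  "(%n. expectation (%s. sin (t * W n s))) \<longlonglongrightarrow> 0"
  by (rule Lim_null_comparison[OF eventually_mono[OF eventually_good] ep]; use char in simp)+
 define B where "B = 1440000 * (32768 + 2 * C1^2)"
 define R where "R x = sinc (x * (2 * pi / ka) / 2)" for x
 define N where "N l = p l * p l * R 0 + p l * q l * R (- 1) + q l * p l * R 1 + q l * q l * R 0" for l
 define H where "H k l l' = p l * p l' * R (- real k) + p l * q l' * R (- 1 - real k) + q l * p l' * R (1 - real k) + q l * q l' * R (- real k)"
  for k l l'
 have cvf: "gv.cv (f n i) (f n j) = (\<Sum>l\<in>L. \<Sum>l'\<in>L. (- (d l / 2) * exp (- ip (J n) (th n (i, l)) (th n (i, l)) / 2)) *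
   (- (d l' / 2) * exp (- ip (J n) (th n (j, l')) (th n (j, l')) / 2)) * (cosh (ip (J n) (th n (i, l)) (th n (j, l'))) - 1))" for n i j
  by (rule gv.cv_cos_sum) (simp_all add: f_def fun_eq_iff)
 have "convergent (%n. (\<Sum>i<ka * n. \<Sum>j<ka * n. gv.cv (f n i) (f n j)) / n)"
 proof (rule stationary_double_sum)
  show "gv.cv (f n i) (f n j) = gv.cv (f n j) (f n i)" for n i j by (rule gv.cv_commute)
  show "B * (ka^2 + 16 * ka powr (3/2)) >= 0" by (simp add: B_def)
  show "eventually (%n. \<forall>i k. i + k < ka * n --> \<bar>gv.cv (f n i) (f n (i + k))\<bar>
    <= B * (ka^2 + 16 * ka powr (3/2)) * real (Suc k) powr (- 3/2)) sequentially" using eventually_good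
  proof (eventually_elim, intro allI impI)
   fix n i k assume n: "good n" and ik: "i + k < ka * n"
   have n1: "n >= 1" using n by (simp add: good_def)
   have h: "mesh n (ka * n) = pi / ka" by (rule pt_grid(2)[OF n1])
   have c1: "ka * n >= 1" using n1 ka(1) by simp
   have lf: "loc n (pi / ka) (pt n (ka * n) (2 * j + 1)) (f n j)"
    and dm: "pt n (ka * n) (2 * j + 1) - pi / ka \<in> dom n" "pt n (ka * n) (2 * j + 1) + pi / ka \<in> dom n" if "j < ka * n" for j
   proof -
    have e: "pt n (ka * n) (2 * j + 1) - pi / ka = real j * (2 * pi / ka)" "pt n (ka * n) (2 * j + 1) + pi / ka = real (Suc j) * (2 * pi / ka)"
     using pt_cell[of n "ka * n" j] pt_grid(1)[OF n1 ka(1), of j] pt_grid(1)[OF n1 ka(1), of "Suc j"] unfolding h by simp_all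
    show "pt n (ka * n) (2 * j + 1) - pi / ka \<in> dom n" "pt n (ka * n) (2 * j + 1) + pi / ka \<in> dom n"
     unfolding e using that ka(1) by (intro grid_dom; simp)+
    have "f n j = (%s. (- 1/2) * (sgn_approx m (gv.Z n (ug n ka j) s) * sgn_approx m (gv.Z n (ug n ka (Suc j)) s)) + 0 * 0)"
     by (rule ext) (simp add: f_eq)
    then show "loc n (pi / ka) (pt n (ka * n) (2 * j + 1)) (f n j)"
     using loc_lin[OF loc_sgn_approx[of n "pi / ka" "pt n (ka * n) (2 * j + 1)" m] loc_const, of "-1/2" 0 0] unfolding e ug_def by (simp only:)
   qed
   have E1: "expectation (%s. (f n j s)^2) <= 1" for j
   proof -
    have "(f n j s)^2 <= 1" for s using power_mono[OF f1 abs_ge_zero, of n j s 2] by simp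
    then have "expectation (%s. (f n j s)^2) <= expectation (%s. 1)" by (intro integral_mono gv.integrable_sq_bounded[OF fm f1]) auto
    then show ?thesis by (simp add: prob_space)
   qed
   have ds: "\<bar>pt n (ka * n) (2 * i + 1) - pt n (ka * n) (2 * (i + k) + 1)\<bar> = real k * (2 * pi / ka)"
    unfolding pt_def left_diff_distrib[symmetric] h abs_mult by simp
   have "\<bar>gv.cv (f n i) (f n (i + k))\<bar> <= B * (1 / (1 + real k * (2 * pi / ka))^2 + (et n)^2) * 1"
    unfolding B_def ds[symmetric] by (rule loc_cv_le[OF n _ ka(2) dm dm lf lf E1 E1]) (use ik ka(1) in auto)
   also have "\<dots> <= B * ((ka^2 + 16 * ka powr (3/2)) * real (Suc k) powr (- 3/2))"
   proof -
    have pk: "2 * pi * real k >= 1 * real k" using pi_gt3 by (intro mult_right_mono) auto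
    have "real (Suc k) / ka <= 1 + real k * (2 * pi / ka)"
    proof -
     have "real (Suc k) / ka = 1 / ka + 1 * real k / ka" by (simp add: add_divide_distrib)
     also have "\<dots> <= 1 + 2 * pi * real k / ka" using ka(1) by (intro add_mono divide_right_mono pk) auto
     finally show ?thesis by (simp add: mult.commute)
    qed
    then have "1 / (1 + real k * (2 * pi / ka))^2 <= 1 / (real (Suc k) / ka)^2"
     using ka(1) by (intro divide_left_mono power_mono mult_pos_pos zero_less_power) (auto intro: add_pos_nonneg)
    also have "\<dots> = ka^2 * real (Suc k) powr (- 2)" by (simp add: power_divide powr_minus field_simps del: of_nat_Suc)
    also have "\<dots> <= ka^2 * real (Suc k) powr (- 3/2)" by (intro mult_left_mono powr_mono) auto
    finally have 1: "1 / (1 + real k * (2 * pi / ka))^2 <= ka^2 * real (Suc k) powr (- 3/2)" .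
    have "Suc k <= ka * n" using ik by simp
    \<comment> \<open>The lag satisfies \<open>k < ka * n\<close>, so the bound
      \<open>n powr (- 3/2)\<close> for the squared model error turns into a summable bound in
      \<open>k\<close>.\<close>
    then have "real (Suc k) <= real ka * real n" by (metis of_nat_le_iff of_nat_mult)
    then have "(real ka * real n) powr (- 3/2) <= real (Suc k) powr (- 3/2)" by (intro powr_mono2') auto
    then have "ka powr (3/2) * (real ka * real n) powr (- 3/2) <= ka powr (3/2) * real (Suc k) powr (- 3/2)" by (intro mult_left_mono) auto
    moreover have "ka powr (3/2) * (real ka * real n) powr (- 3/2) = real n powr (- 3/2)"
     using ka(1) by (simp add: powr_mult powr_add[symmetric] flip: mult.assoc)
    ultimately have 2: "(et n)^2 <= 16 * ka powr (3/2) * real (Suc k) powr (- 3/2)" using et_sq_le[OF n1] by linarith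
    have "1 / (1 + real k * (2 * pi / ka))^2 + (et n)^2 <= (ka^2 + 16 * ka powr (3/2)) * real (Suc k) powr (- 3/2)"
     using add_mono[OF 1 2] by (simp only: distrib_right of_nat_power)
    from mult_left_mono[OF this, of B] show ?thesis by (simp add: B_def)
   qed
   finally show "\<bar>gv.cv (f n i) (f n (i + k))\<bar> <= B * (ka^2 + 16 * ka powr (3/2)) * real (Suc k) powr (- 3/2)" by (simp add: mult.assoc)
  qed
  fix i :: "nat => nat" and k :: nat assume i: "eventually (%n. i n + k < ka * n) sequentially"
  have r: "(%n. r n (i n + a) (i n + b)) \<longlonglongrightarrow> R (real a - real b)" if "a <= Suc k" "b <= Suc k" for a b unfolding r_def R_def
   by (rule ug_tendsto[OF ka(1)], rule eventually_mono[OF i]) (use that in auto)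
  have r0: "(%n. r n (i n) (i n)) \<longlonglongrightarrow> R 0" "(%n. r n (i n) (Suc (i n))) \<longlonglongrightarrow> R (- 1)"
   "(%n. r n (Suc (i n)) (i n)) \<longlonglongrightarrow> R 1" "(%n. r n (Suc (i n)) (Suc (i n))) \<longlonglongrightarrow> R 0"
   using r[of 0 0] r[of 0 1] r[of 1 0] r[of 1 1] by simp_all
  have r1: "(%n. r n (i n + k) (i n + k)) \<longlonglongrightarrow> R 0" "(%n. r n (i n + k) (Suc (i n + k))) \<longlonglongrightarrow> R (- 1)"
   "(%n. r n (Suc (i n + k)) (i n + k)) \<longlonglongrightarrow> R 1" "(%n. r n (Suc (i n + k)) (Suc (i n + k))) \<longlonglongrightarrow> R 0"
   using r[of k k] r[of k "Suc k"] r[of "Suc k" k] r[of "Suc k" "Suc k"] by simp_all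
  have r2: "(%n. r n (i n) (i n + k)) \<longlonglongrightarrow> R (- real k)" "(%n. r n (i n) (Suc (i n + k))) \<longlonglongrightarrow> R (- 1 - real k)"
   "(%n. r n (Suc (i n)) (i n + k)) \<longlonglongrightarrow> R (1 - real k)" "(%n. r n (Suc (i n)) (Suc (i n + k))) \<longlonglongrightarrow> R (- real k)"
   using r[of 0 k] r[of 0 "Suc k"] r[of 1 k] r[of 1 "Suc k"] by (simp_all add: algebra_simps)
  show "(%n. gv.cv (f n (i n)) (f n (i n + k))) \<longlonglongrightarrow> (\<Sum>l\<in>L. \<Sum>l'\<in>L. (- (d l / 2) * exp (- N l / 2)) * (- (d l' / 2) * exp (- N l' / 2)) * (cosh (H k l l') - 1))"
   unfolding cvf ipth N_def H_def by (intro tendsto_intros r0 r1 r2) simp_all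
 qed (rule ka(1))
 moreover have "eventually (%n. (\<Sum>i<ka * n. \<Sum>j<ka * n. gv.cv (f n i) (f n j)) / n = gv.cv (Y n) (Y n) / n) sequentially"
  using eventually_ge_at_top[of 1]
 proof eventually_elim
  case (elim n)
  then show ?case unfolding cvY[OF elim] using gv.cv_sum_sum[of "{..<ka * n}" "f n" 1 "%_. 1"] f1 by simp
 qed
 ultimately show "convergent (%n. gv.cv (Y n) (Y n) / n)" by (simp only: convergent_cong)
qed

end

subsection \<open>Second chaos component of a sign product in the plane\<close>



interpretation SN: prob_space SN by (rule real_dist_normal_dist[THEN real_distribution.axioms(1)])
interpretation SN2: pair_prob_space SN SN ..

lemma SN_integral: "g \<in> borel_measurable borel ==> (\<integral>x. g x \<partial>SN) = (\<integral>x. std_normal_density x * g x \<partial>lborel)" for g :: "real => real"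
 by (subst integral_density) auto

lemma SN_sq: "integrable SN (%x. x^2)" "(\<integral>x. x^2 \<partial>SN) = 1"
 using std_normal_distribution_even_moments[of 1] by (simp_all add: numeral_eq_Suc)

lemma SN_ind: "integrable SN (indicat_real {l..r})" by (rule SN.integrable_const_bound[where B=1]) auto

lemma SN_const: "measure SN UNIV = 1" using SN.prob_space by simp

lemma SN_interval:
 assumes "l <= r" shows "(\<integral>x. indicat_real {l..r} x \<partial>SN) = (\<integral>x. std_normal_density x * indicat_real {l..r} x \<partial>lborel)"
 by (rule SN_integral) measurable

lemma SN_interval_lower:
 assumes lr: "l <= r" and c: "!!x. x \<in> {l..r} ==> c <= std_normal_density x"
 shows "c * (r - l) <= (\<integral>x. indicat_real {l..r} x \<partial>SN)"
proof -
 have "c * (r - l) = (\<integral>x. c * indicat_real {l..r} x \<partial>lborel)" using lr by simp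
 also have "\<dots> <= (\<integral>x. std_normal_density x * indicat_real {l..r} x \<partial>lborel)"
 proof (rule integral_mono)
  show "integrable lborel (%x. std_normal_density x * indicat_real {l..r} x)"
   by (rule integrable_real_mult_indicator) (auto intro: integrable_std_normal_moment[of 0, simplified])
  show "c * indicat_real {l..r} x <= std_normal_density x * indicat_real {l..r} x" for x using c by (auto simp: indicator_def)
 qed (use lr in simp)
 finally show ?thesis unfolding SN_interval[OF lr] .
qed

text \<open>The constant lies just below the maximum \<open>1 / sqrt (2 * pi)\<close> of the
  density.\<close>

lemma std_normal_density_lower:
 assumes "\<bar>x\<bar> <= R" shows "398/1000 * exp (- R\<^sup>2 / 2) <= std_normal_density x"
proof -
 have "sqrt (2 * pi) <= 251/100" using pi_less_4 pi_approx by (intro real_le_lsqrt) (auto simp: power2_eq_square)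
 then have "398/1000 <= 1 / sqrt (2 * pi)" using pi_gt3 by (simp add: field_simps)
 moreover have "exp (- R\<^sup>2 / 2) <= exp (- x\<^sup>2 / 2)" using power_mono[OF assms abs_ge_zero, of 2] by simp
 ultimately show ?thesis unfolding std_normal_density_def by (intro mult_mono) auto
qed

lemma std_normal_density_quad_le: "std_normal_density x * (x^2 + 1) <= 8/10"
proof -
 have "1 + x^2 / 2 <= exp (x^2 / 2)" by (rule exp_ge_add_one_self)
 then have "x^2 + 1 <= 2 * exp (x^2 / 2)" by linarith
 from mult_right_mono[OF this, of "exp (- x\<^sup>2 / 2)"]
 have "(x^2 + 1) * exp (- x\<^sup>2 / 2) <= 2 * exp (x^2 / 2) * exp (- x\<^sup>2 / 2)" by simp
 also have "\<dots> = 2" by (simp add: exp_minus)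
 finally have e: "(x^2 + 1) * exp (- x\<^sup>2 / 2) <= 2" .
 have "sqrt (2 * pi) >= 5/2" using pi_approx by (intro real_le_rsqrt) (auto simp: power2_eq_square)
 then have "1 / sqrt (2 * pi) <= 4/10" by (simp add: field_simps)
 from mult_mono[OF this e] show ?thesis by (simp add: std_normal_density_def mult_ac)
qed

text \<open>Pairs are \<open>(y, x)\<close>: \<open>x\<close> is the coordinate of the large
  component with coefficient \<open>a\<close>, and \<open>y\<close> that of the small one with
  coefficient \<open>b\<close>. Off the boundary lines this is the indicator of a sign
  change.\<close>

definition sgn_diff :: "real => real => real \<times> real => real" where
 "sgn_diff a b yx = (1 - sgn (a * snd yx + b * fst yx) * sgn (a * snd yx - b * fst yx)) / 2"

lemma sgn_diff_meas [measurable]: "sgn_diff a b \<in> borel_measurable (borel \<Otimes>\<^sub>M borel)" unfolding sgn_diff_def[abs_def] by measurable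

lemma sgn_diff_bounds: "0 <= sgn_diff a b yx" "sgn_diff a b yx <= 1" by (auto simp: sgn_diff_def sgn_if)

text \<open>The two linear forms multiply to \<open>a^2 * x^2 - b^2 * y^2\<close>, so the signs
  differ exactly in a thin double cone around the \<open>y\<close> axis.\<close>

lemma sgn_diff_cases:
 assumes "a > 0" "b > 0"
 shows "sgn_diff a b (y, x) = (if \<bar>x\<bar> < b / a * \<bar>y\<bar> then 1 else if \<bar>x\<bar> = b / a * \<bar>y\<bar> then 1/2 else 0)"
proof -
 have e: "(a * x + b * y) * (a * x - b * y) = (a * \<bar>x\<bar> + b * \<bar>y\<bar>) * (a * \<bar>x\<bar> - b * \<bar>y\<bar>)"
  by (simp add: algebra_simps flip: power2_eq_square)
 have "sgn (a * x + b * y) * sgn (a * x - b * y) = sgn (a * \<bar>x\<bar> + b * \<bar>y\<bar>) * sgn (a * \<bar>x\<bar> - b * \<bar>y\<bar>)"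
  unfolding sgn_mult[symmetric] e ..
 moreover have "\<bar>x\<bar> < b / a * \<bar>y\<bar> \<longleftrightarrow> a * \<bar>x\<bar> < b * \<bar>y\<bar>" "\<bar>x\<bar> = b / a * \<bar>y\<bar> \<longleftrightarrow> a * \<bar>x\<bar> = b * \<bar>y\<bar>"
  using assms by (auto simp: field_simps)
 moreover have "a * \<bar>x\<bar> + b * \<bar>y\<bar> >= 0" using assms by simp
 moreover have "a * \<bar>x\<bar> + b * \<bar>y\<bar> = 0 ==> a * \<bar>x\<bar> = b * \<bar>y\<bar>" using assms by (simp add: add_nonneg_eq_0_iff)
 ultimately show ?thesis by (auto simp: sgn_diff_def sgn_if)
qed

lemma sgn_diff_quad_integrable:
 "integrable (SN \<Otimes>\<^sub>M SN) (%yx. sgn_diff a b yx * ((fst yx)^2 - 1))" "integrable (SN \<Otimes>\<^sub>M SN) (%yx. sgn_diff a b yx * ((snd yx)^2 + 1))"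
proof -
 have q: "integrable SN (%x. x^2 + 1)" using SN_sq(1) by simp
 have 1: "integrable (SN \<Otimes>\<^sub>M SN) (%yx. (fst yx)^2 + 1)" using q by (intro SN2.Fubini_integrable) (auto intro!: always_eventually)
 have 2: "integrable (SN \<Otimes>\<^sub>M SN) (%yx. (snd yx)^2 + 1)" using q by (intro SN2.Fubini_integrable) (auto intro!: always_eventually)
 have le: "\<bar>sgn_diff a b yx * z\<bar> <= \<bar>z\<bar>" for yx z
  using mult_right_mono[OF sgn_diff_bounds(2), of "\<bar>z\<bar>" a b yx] by (simp add: abs_mult sgn_diff_bounds(1))
 show "integrable (SN \<Otimes>\<^sub>M SN) (%yx. sgn_diff a b yx * ((fst yx)^2 - 1))"
 proof (rule Bochner_Integration.integrable_bound[OF 1], measurable, intro always_eventually allI)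
  fix yx :: "real \<times> real"
  have "\<bar>(fst yx)^2 - 1\<bar> <= (fst yx)^2 + 1" using zero_le_power2[of "fst yx"] by (simp add: abs_le_iff)
  then show "norm (sgn_diff a b yx * ((fst yx)^2 - 1)) <= norm ((fst yx)^2 + 1)" using le[of yx "(fst yx)^2 - 1"] by simp
 qed
 show "integrable (SN \<Otimes>\<^sub>M SN) (%yx. sgn_diff a b yx * ((snd yx)^2 + 1))"
 proof (rule Bochner_Integration.integrable_bound[OF 2], measurable, intro always_eventually allI)
  show "norm (sgn_diff a b yx * ((snd yx)^2 + 1)) <= norm ((snd yx)^2 + 1)" for yx using le[of yx "(snd yx)^2 + 1"] by simp
 qed
qed

text \<open>For fixed \<open>y\<close> the cone is an interval of length
  \<open>2 * (b / a) * \<bar>y\<bar>\<close>, and the density times \<open>x^2 + 1\<close> is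
  bounded by \<open>8/10\<close>.\<close>

lemma sgn_diff_upper:
 assumes a: "a > 0" and b: "b > 0"
 shows "(\<integral>yx. sgn_diff a b yx * ((snd yx)^2 + 1) \<partial>(SN \<Otimes>\<^sub>M SN)) <= 2 * (b / a)"
proof -
 define be where "be = b / a"
 have be: "be > 0" using a b by (simp add: be_def)
 have inner: "(\<integral>x. sgn_diff a b (y, x) * (x^2 + 1) \<partial>SN) <= 8/10 * be * (y^2 + 1)" for y
 proof -
  have "(\<integral>x. sgn_diff a b (y, x) * (x^2 + 1) \<partial>SN) = (\<integral>x. std_normal_density x * (sgn_diff a b (y, x) * (x^2 + 1)) \<partial>lborel)"
   by (rule SN_integral) measurable
  also have "\<dots> <= (\<integral>x. 8/10 * indicat_real {- (be * \<bar>y\<bar>)..be * \<bar>y\<bar>} x \<partial>lborel)"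
  proof (rule integral_mono')
   show "integrable lborel (%x. 8/10 * indicat_real {- (be * \<bar>y\<bar>)..be * \<bar>y\<bar>} x)" using be by simp
   fix x
   show "std_normal_density x * (sgn_diff a b (y, x) * (x^2 + 1)) <= 8/10 * indicat_real {- (be * \<bar>y\<bar>)..be * \<bar>y\<bar>} x"
   proof (cases "\<bar>x\<bar> <= be * \<bar>y\<bar>")
    case True
    have "sgn_diff a b (y, x) * (std_normal_density x * (x^2 + 1)) <= 1 * (8/10)" by (intro mult_mono std_normal_density_quad_le sgn_diff_bounds) auto
    then show ?thesis using True by (auto simp: indicator_def mult_ac abs_le_iff)
   qed (use sgn_diff_cases[OF a b] in \<open>auto simp: be_def indicator_def\<close>)
   show "0 <= 8/10 * indicat_real {- (be * \<bar>y\<bar>)..be * \<bar>y\<bar>} x" by simp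
  qed
  also have "\<dots> = 8/10 * be * (2 * \<bar>y\<bar>)" using be by simp
  also have "2 * \<bar>y\<bar> <= y^2 + 1" using sum_squares_bound[of "\<bar>y\<bar>" 1] by simp
  finally show ?thesis using be by (simp add: mult_left_mono)
 qed
 have "(\<integral>yx. sgn_diff a b yx * ((snd yx)^2 + 1) \<partial>(SN \<Otimes>\<^sub>M SN)) = (\<integral>y. (\<integral>x. sgn_diff a b (y, x) * (x^2 + 1) \<partial>SN) \<partial>SN)"
  using SN2.integral_fst'[OF sgn_diff_quad_integrable(2)[of a b]] by simp
 also have "\<dots> <= (\<integral>y. 8/10 * be * (y^2 + 1) \<partial>SN)"
  using SN2.integrable_fst'[OF sgn_diff_quad_integrable(2)[of a b]] SN_sq(1) by (intro integral_mono inner) auto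
 also have "\<dots> = 8/10 * be * 2" using SN_sq by (simp add: SN_const)
 finally show ?thesis using be by (simp add: be_def)
qed

text \<open>The conditional probability \<open>h y\<close> of a sign change grows with
  \<open>\<bar>y\<bar>\<close>, and \<open>y^2 - 1\<close> has mean zero, so the integral is a
  positive association. It is quantified by the growth of \<open>h\<close> between 1 and
  \<open>3/2\<close>.\<close>

lemma sgn_diff_lower:
 assumes a: "a > 0" and b: "b > 0" and ab: "b / a <= 1/100"
 shows "b / a / 50 <= (\<integral>yx. sgn_diff a b yx * ((fst yx)^2 - 1) \<partial>(SN \<Otimes>\<^sub>M SN))"
proof -
 define be where "be = b / a"
 have be: "be > 0" "be <= 1/100" using a b ab by (simp_all add: be_def)
 define h where "h y = (\<integral>x. sgn_diff a b (y, x) \<partial>SN)" for y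
 have i: "integrable SN (%x. sgn_diff a b (y, x))" for y by (rule SN.integrable_const_bound[where B=1]) (use sgn_diff_bounds in auto)
 have mono: "h y <= h z" if "\<bar>y\<bar> <= \<bar>z\<bar>" for y z unfolding h_def
 proof (rule integral_mono[OF i i])
  fix x
  have "be * \<bar>y\<bar> <= be * \<bar>z\<bar>" using that be by simp
  then show "sgn_diff a b (y, x) <= sgn_diff a b (z, x)" unfolding sgn_diff_cases[OF a b] be_def[symmetric] by auto
 qed
 \<comment> \<open>Two intervals of length \<open>be / 2\<close> near the origin, where the density
   exceeds \<open>397/1000\<close>.\<close>
 have gap: "h (3/2) - h 1 >= 397/1000 * be"
 proof -
  have d: "397/1000 <= std_normal_density x" if "\<bar>x\<bar> <= 3/2 * be" for x
  proof -
   have "\<bar>x\<bar> <= 15/1000" using that be by simp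
   from std_normal_density_lower[OF this]
   have "398/1000 * exp (- (15/1000)\<^sup>2 / 2) <= std_normal_density x" .
   moreover have "1 + (- (15/1000)\<^sup>2 / 2) <= exp (- (15/1000)\<^sup>2 / 2 :: real)" by (rule exp_ge_add_one_self)
   ultimately show ?thesis by (simp add: power2_eq_square)
  qed
  let ?l = "{- (3/2 * be)..- be}" and ?r = "{be..3/2 * be}"
  have "397/1000 * (3/2 * be - be) + 397/1000 * (- be - (- (3/2 * be))) <= (\<integral>x. indicat_real ?r x \<partial>SN) + (\<integral>x. indicat_real ?l x \<partial>SN)"
   using be by (intro add_mono SN_interval_lower d) auto
  also have "\<dots> = (\<integral>x. indicat_real ?r x + indicat_real ?l x \<partial>SN)"
   by (rule Bochner_Integration.integral_add[symmetric]) (rule SN_ind)+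
  also have "\<dots> <= (\<integral>x. sgn_diff a b (3/2, x) - sgn_diff a b (1, x) \<partial>SN)"
  proof (rule integral_mono_AE)
   have n: "AE x in SN. x ~= c" for c :: real using AE_lborel_singleton[of c] by (subst AE_density) (auto elim!: eventually_mono)
   show "AE x in SN. indicat_real ?r x + indicat_real ?l x <= sgn_diff a b (3/2, x) - sgn_diff a b (1, x)"
    using n[of be] n[of "- be"] n[of "3/2 * be"] n[of "- (3/2 * be)"]
    by eventually_elim (use be in \<open>auto simp: sgn_diff_cases[OF a b] be_def[symmetric] indicator_def abs_if split: if_splits\<close>)
  qed (intro Bochner_Integration.integrable_add Bochner_Integration.integrable_diff SN_ind i)+
  also have "\<dots> = h (3/2) - h 1" using i by (simp add: h_def)
  finally show ?thesis by simp
 qed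
 have fst_eq: "(\<integral>yx. sgn_diff a b yx * ((fst yx)^2 - 1) \<partial>(SN \<Otimes>\<^sub>M SN)) = (\<integral>y. h y * (y^2 - 1) \<partial>SN)"
  using SN2.integral_fst'[OF sgn_diff_quad_integrable(1)[of a b]] by (simp add: h_def)
 have hi: "integrable SN (%y. h y * (y^2 - 1))" using SN2.integrable_fst'[OF sgn_diff_quad_integrable(1)[of a b]] by (simp add: h_def)
 \<comment> \<open>The factor \<open>5/4\<close> is \<open>(3/2)^2 - 1\<close>. Times the mass
   \<open>44/1000\<close> of the set where \<open>\<bar>y\<bar>\<close> lies between
   \<open>3/2\<close> and 2, this exceeds \<open>be / 50\<close>.\<close>
 define g where "g = 5/4 * (397/1000 * be)"
 let ?L = "{- 2..- (3/2) :: real}" and ?R = "{3/2..2 :: real}"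
 have d: "44/1000 <= std_normal_density x" if "\<bar>x\<bar> <= 2" for x
 proof -
  have "exp (2::real) <= 9" using power_mono[OF exp_le, of 2] by (simp add: exp_of_nat_mult[of 2 1, simplified, symmetric])
  then have "398/1000 * (1/9) <= 398/1000 * exp (- 2 :: real)" by (simp add: exp_minus field_simps)
  then show ?thesis using std_normal_density_lower[OF that] by simp
 qed
 have "44/1000 * (2 - 3/2) + 44/1000 * (- (3/2) - (- 2)) <= (\<integral>y. indicat_real ?R y \<partial>SN) + (\<integral>y. indicat_real ?L y \<partial>SN)"
 proof (intro add_mono SN_interval_lower)
  fix x :: real assume "x \<in> ?R"
  then show "44/1000 <= std_normal_density x" by (intro d) auto
 next
  fix x :: real assume "x \<in> ?L"
  then show "44/1000 <= std_normal_density x" by (intro d) auto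
 qed auto
 then have "g * (44/1000) <= g * ((\<integral>y. indicat_real ?R y \<partial>SN) + (\<integral>y. indicat_real ?L y \<partial>SN))"
  using be by (intro mult_left_mono) (auto simp: g_def)
 also have "\<dots> = (\<integral>y. g * (indicat_real ?R y + indicat_real ?L y) \<partial>SN)" using SN_ind by simp
 \<comment> \<open>Subtracting \<open>h 1 * (y^2 - 1)\<close> does not change the integral and makes
   the integrand nonnegative.\<close>
 also have "\<dots> <= (\<integral>y. h y * (y^2 - 1) - h 1 * (y^2 - 1) \<partial>SN)"
 proof (rule integral_mono)
  show "g * (indicat_real ?R y + indicat_real ?L y) <= h y * (y^2 - 1) - h 1 * (y^2 - 1)" for y
  proof (cases "\<bar>y\<bar> < 3/2")
   case True
   have "0 <= (h y - h 1) * (y^2 - 1)"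
   proof (cases "\<bar>y\<bar> <= 1")
    case True
    then have "h y <= h 1" "y^2 <= 1" using mono[of y 1] by (auto simp: abs_square_le_1)
    then show ?thesis by (simp add: mult_nonpos_nonpos)
   next
    case False
    then have "h 1 <= h y" "1 <= y^2" using mono[of 1 y] abs_square_le_1[of y] by auto
    then show ?thesis by simp
   qed
   then show ?thesis using True by (auto simp: indicator_def left_diff_distrib)
  next
   case False
   then have "h (3/2) <= h y" by (intro mono) auto
   then have 1: "397/1000 * be <= h y - h 1" using gap by linarith
   have "(3/2)^2 <= \<bar>y\<bar>^2" using False by (intro power_mono) auto
   then have 2: "5/4 <= y^2 - 1" by (simp add: power2_eq_square)
   have "g <= (y^2 - 1) * (h y - h 1)" unfolding g_def using be 1 2 by (intro mult_mono) auto
   moreover have "g * (indicat_real ?R y + indicat_real ?L y) <= g" using be by (auto simp: g_def indicator_def)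
   ultimately show ?thesis by (simp add: algebra_simps)
  qed
 qed (use hi SN_sq Bochner_Integration.integrable_add[OF SN_ind SN_ind] in auto)
 also have "\<dots> = (\<integral>y. h y * (y^2 - 1) \<partial>SN)" using hi SN_sq by (simp add: SN_const)
 finally show ?thesis unfolding fst_eq using be by (simp add: g_def be_def[symmetric])
qed

subsection \<open>Correlation of sign products with quadratic forms\<close>

lemma quad_limit:
 "(%m. 2 * (1 - exp (- (W * (1 / real m)^2) / 2) * cosh (r * (1 / real m))) / (1 / real m)^2) \<longlonglongrightarrow> W - r * r"
 unfolding cosh_field_def by real_asymp

lemma one_minus_cos_quotient:
 "(%m. 2 * (1 - cos (z * (1 / real m))) / (1 / real m)^2) \<longlonglongrightarrow> z * z"
 "\<bar>2 * (1 - cos (z * ep)) / ep^2\<bar> <= z^2"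
proof -
 show "(%m. 2 * (1 - cos (z * (1 / real m))) / (1 / real m)^2) \<longlonglongrightarrow> z * z" by real_asymp
 have "2 * (1 - cos y) <= y^2" for y :: real
 proof -
  have "cos y = 1 - 2 * (sin (y / 2))^2" using cos_double_sin[of "y / 2"] by simp
  moreover have "(sin (y / 2))^2 <= (y / 2)^2" using power_mono[OF abs_sin_x_le_abs_x abs_ge_zero, of "y / 2" 2] by (simp add: power_divide)
  ultimately show ?thesis by (simp add: power_divide)
 qed
 from this[of "z * ep"] show "\<bar>2 * (1 - cos (z * ep)) / ep^2\<bar> <= z^2" by (cases "ep = 0") (simp_all add: divide_simps power_mult_distrib)
qed

lemma sgn_approx_rep:
 "\<exists>(L :: nat => (nat \<times> nat \<times> real) set) d p q. \<forall>m. finite (L m) \<and>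
  (\<forall>x y. sgn_approx m x * sgn_approx m y = (\<Sum>l\<in>L m. d m l * cos (p m l * x + q m l * y)))"
proof -
 have "\<forall>m. \<exists>(L :: (nat \<times> nat \<times> real) set) d p q. finite L \<and>
  (\<forall>x y. sgn_approx m x * sgn_approx m y = (\<Sum>l\<in>L. d l * cos (p l * x + q l * y)))"
  by (intro allI sinpoly_mult_cos_sum sgn_approx_sinpoly)
 then show ?thesis by (simp only: choice_iff)
qed

section \<open>Projection of sign products onto squares of Gaussian functionals\<close>

context gauss_vec
begin

text \<open>The square of \<open>Z w\<close> is the dominated limit of
  \<open>2 * (1 - cos (ep * Z w)) / ep^2\<close>, so the formula for products of cosines
  suffices.\<close>

lemma expectation_cos_Z_sq:
 "expectation (%s. cos (Z th s) * ((Z w s)^2 - ip J w w)) = - (exp (- ip J th th / 2) * (ip J th w)^2)"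
proof -
 define X where "X m s = cos (Z th s) * (2 * (1 - cos (Z w s * (1 / real m))) / (1 / real m)^2)" for m :: nat and s
 have "(%m. expectation (X m)) \<longlonglongrightarrow> expectation (%s. cos (Z th s) * (Z w s)^2)"
 proof (rule integral_dominated_convergence[where w="%s. (Z w s)^2"])
  show "AE s in M. (%m. X m s) \<longlonglongrightarrow> cos (Z th s) * (Z w s)^2" unfolding X_def power2_eq_square[of "Z w _"]
   by (intro always_eventually allI tendsto_mult tendsto_const one_minus_cos_quotient)
  show "AE s in M. norm (X m s) <= (Z w s)^2" for m
  proof (intro always_eventually allI)
   fix s
   have "\<bar>cos (Z th s)\<bar> * \<bar>2 * (1 - cos (Z w s * (1 / real m))) / (1 / real m)^2\<bar> <= 1 * (Z w s)^2"
    by (intro mult_mono one_minus_cos_quotient(2) abs_cos_le_one) auto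
   then show "norm (X m s) <= (Z w s)^2" by (simp add: X_def abs_mult)
  qed
 qed (use integrable_Z_sq in \<open>auto simp: X_def[abs_def]\<close>)
 moreover have "expectation (X m) = exp (- ip J th th / 2) *
  (2 * (1 - exp (- (ip J w w * (1 / real m)^2) / 2) * cosh (ip J th w * (1 / real m))) / (1 / real m)^2)" for m
 proof -
  let ?e = "1 / real m"
  have "X m s = 2 / ?e^2 * (cos (Z th s) - cos (Z th s) * cos (Z (%i. ?e * w i) s))" for s
  proof -
   have "x * (2 * (1 - c) / y) = 2 / y * (x - x * c)" for x c y :: real by (cases "y = 0") (simp_all add: field_simps)
   then show ?thesis unfolding X_def Z_scale mult.commute[of "Z w s"] .
  qed
  moreover have "integrable M (%s. cos (Z th s) * cos (Z (%i. ?e * w i) s))"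
   by (rule integrable_bounded[of _ 1]) (auto simp: abs_mult intro!: mult_le_one)
  ultimately have "expectation (X m) = 2 / ?e^2 * (exp (- ip J th th / 2) - exp (- (ip J th th + ip J (%i. ?e * w i) (%i. ?e * w i)) / 2) * cosh (ip J th (%i. ?e * w i)))"
  proof -
   assume X: "!!s. X m s = 2 / ?e^2 * (cos (Z th s) - cos (Z th s) * cos (Z (%i. ?e * w i) s))"
    and i: "integrable M (%s. cos (Z th s) * cos (Z (%i. ?e * w i) s))"
   have "expectation (X m) = 2 / ?e^2 * expectation (%s. cos (Z th s) - cos (Z th s) * cos (Z (%i. ?e * w i) s))"
    unfolding integral_mult_right_zero[symmetric] by (intro Bochner_Integration.integral_cong refl X)
   then show ?thesis unfolding Bochner_Integration.integral_diff[OF integrable_cos i] expectation_cos expectation_cos_cos .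
  qed
  also have "ip J (%i. ?e * w i) (%i. ?e * w i) = ip J w w * ?e^2" unfolding ip_scale_left ip_scale_right by (simp only: power2_eq_square mult_ac)
  also have "ip J th (%i. ?e * w i) = ip J th w * ?e" unfolding ip_scale_right by (simp only: mult_ac)
  also have "exp (- (ip J th th + ip J w w * ?e^2) / 2) = exp (- ip J th th / 2) * exp (- (ip J w w * ?e^2) / 2)"
   by (simp only: exp_add[symmetric]) (simp add: add_divide_distrib diff_divide_distrib)
  finally have "expectation (X m) = 2 / ?e^2 * (exp (- ip J th th / 2) - exp (- ip J th th / 2) * exp (- (ip J w w * ?e^2) / 2) * cosh (ip J th w * ?e))" .
  moreover have "2 / y * (A - A * B * C) = A * (2 * (1 - B * C) / y)" for A B C y :: real by (cases "y = 0") (simp_all add: field_simps)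
  ultimately show ?thesis by (simp only:)
 qed
 ultimately have "(%m. exp (- ip J th th / 2) * (2 * (1 - exp (- (ip J w w * (1 / real m)^2) / 2) * cosh (ip J th w * (1 / real m))) / (1 / real m)^2))
  \<longlonglongrightarrow> expectation (%s. cos (Z th s) * (Z w s)^2)" by simp
 from LIMSEQ_unique[OF this tendsto_mult[OF tendsto_const quad_limit]]
 have e: "expectation (%s. cos (Z th s) * (Z w s)^2) = exp (- ip J th th / 2) * (ip J w w - ip J th w * ip J th w)" .
 have "integrable M (%s. cos (Z th s) * (Z w s)^2)" by (rule Bochner_Integration.integrable_bound[OF integrable_Z_sq[of w]], measurable)
   (auto simp: abs_mult intro!: mult_left_le_one_le)
 then have "expectation (%s. cos (Z th s) * ((Z w s)^2 - ip J w w)) = expectation (%s. cos (Z th s) * (Z w s)^2) - exp (- ip J th th / 2) * ip J w w"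
  by (simp add: right_diff_distrib expectation_cos)
 then show ?thesis unfolding e by (simp add: power2_eq_square algebra_simps)
qed

text \<open>The coefficient of the sign product along the second order Hermite polynomial of
  \<open>Z w\<close>.\<close>

definition T :: "('i => real) => ('i => real) => ('i => real) => real" where
 "T u v w = expectation (%s. sgn (Z u s) * sgn (Z v s) * ((Z w s)^2 - ip J w w))"

lemma integrable_bounded_mult:
 fixes f :: "'s => real"
 assumes "f \<in> borel_measurable M" "!!s. \<bar>f s\<bar> <= 1" "integrable M g"
 shows "integrable M (%s. f s * g s)"
 by (rule Bochner_Integration.integrable_bound[OF assms(3)]) (use assms in \<open>auto simp: abs_mult intro!: mult_left_le_one_le\<close>)

lemma integrable_Z_sq_centered: "integrable M (%s. (Z w s)^2 - c)" using integrable_Z_sq by simp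

text \<open>The approximating sums depend on the family only through inner products of
  \<open>u\<close>, \<open>v\<close> and \<open>w\<close>. This allows a transfer to another
  Gaussian family and shows that the limit is quadratic in the pairings with
  \<open>w\<close>.\<close>

lemma T_tendsto:
 assumes fin: "!!m. finite (L m)"
  and rep: "!!m x y. sgn_approx m x * sgn_approx m y = (\<Sum>l\<in>L m. d m l * cos (p m l * x + q m l * y))"
 shows "(%m. - (\<Sum>l\<in>L m. d m l * (exp (- ((p m l)^2 * ip J u u + 2 * p m l * q m l * ip J u v + (q m l)^2 * ip J v v) / 2)
   * (p m l * ip J u w + q m l * ip J v w)^2))) \<longlonglongrightarrow> T u v w"
proof -
 have 1: "\<bar>sgn_approx m x * sgn_approx m y\<bar> <= 1" for m x y using mult_mono[OF sgn_approx_le_1 sgn_approx_le_1] by (simp add: abs_mult)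
 have "(%m. expectation (%s. sgn_approx m (Z u s) * sgn_approx m (Z v s) * ((Z w s)^2 - ip J w w))) \<longlonglongrightarrow> T u v w" unfolding T_def
 proof (rule integral_dominated_convergence[where w="%s. \<bar>(Z w s)^2 - ip J w w\<bar>"])
  show "AE s in M. (%m. sgn_approx m (Z u s) * sgn_approx m (Z v s) * ((Z w s)^2 - ip J w w)) \<longlonglongrightarrow> sgn (Z u s) * sgn (Z v s) * ((Z w s)^2 - ip J w w)"
   by (intro always_eventually allI tendsto_mult tendsto_const sgn_approx_tendsto)
  show "AE s in M. norm (sgn_approx m (Z u s) * sgn_approx m (Z v s) * ((Z w s)^2 - ip J w w)) <= \<bar>(Z w s)^2 - ip J w w\<bar>" for m
   using mult_right_mono[OF 1, of "\<bar>(Z w _)^2 - ip J w w\<bar>"] by (intro always_eventually allI) (simp add: abs_mult)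
 qed (use integrable_Z_sq_centered in auto)
 moreover have "expectation (%s. sgn_approx m (Z u s) * sgn_approx m (Z v s) * ((Z w s)^2 - ip J w w)) =
  - (\<Sum>l\<in>L m. d m l * (exp (- ((p m l)^2 * ip J u u + 2 * p m l * q m l * ip J u v + (q m l)^2 * ip J v v) / 2)
   * (p m l * ip J u w + q m l * ip J v w)^2))" for m
 proof -
  let ?th = "%l i. p m l * u i + q m l * v i"
  have "expectation (%s. sgn_approx m (Z u s) * sgn_approx m (Z v s) * ((Z w s)^2 - ip J w w))
   = expectation (%s. \<Sum>l\<in>L m. d m l * (cos (Z (?th l) s) * ((Z w s)^2 - ip J w w)))" by (simp only: rep Z_lin sum_distrib_right mult.assoc)
  also have "\<dots> = (\<Sum>l\<in>L m. d m l * - (exp (- ip J (?th l) (?th l) / 2) * (ip J (?th l) w)^2))"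
  proof (subst Bochner_Integration.integral_sum)
   show "integrable M (%s. d m l * (cos (Z (?th l) s) * ((Z w s)^2 - ip J w w)))" for l
    by (intro integrable_mult_right integrable_bounded_mult integrable_Z_sq_centered) auto
  qed (simp add: expectation_cos_Z_sq)
  also have "\<dots> = - (\<Sum>l\<in>L m. d m l * (exp (- ((p m l)^2 * ip J u u + 2 * p m l * q m l * ip J u v + (q m l)^2 * ip J v v) / 2)
   * (p m l * ip J u w + q m l * ip J v w)^2))"
  proof -
   have "ip J (?th l) (?th l) = (p m l)^2 * ip J u u + 2 * p m l * q m l * ip J u v + (q m l)^2 * ip J v v" for l
    unfolding ip_lin_left ip_lin_right ip_commute[of _ v u] by (simp add: power2_eq_square algebra_simps)
   then show ?thesis unfolding sum_negf[symmetric] by (simp add: ip_lin_left)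
  qed
  finally show ?thesis .
 qed
 ultimately show ?thesis by simp
qed

lemma T_commute: "T u v w = T v u w" by (simp add: T_def mult.commute)

end

text \<open>Both coefficients are limits of the same sequence, because the sums in
  \<open>T_tendsto\<close> contain only these inner products.\<close>

lemma T_transfer:
 fixes I :: "'i set" and I' :: "'j set"
 assumes "gauss_vec M I \<xi>" "gauss_vec M' I' \<xi>'"
  and "ip I u u = ip I' u' u'" "ip I u v = ip I' u' v'" "ip I v v = ip I' v' v'" "ip I u w = ip I' u' w'" "ip I v w = ip I' v' w'"
 shows "gauss_vec.T M I \<xi> u v w = gauss_vec.T M' I' \<xi>' u' v' w'"
proof -
 obtain L :: "nat => (nat \<times> nat \<times> real) set" and d p q where r: "!!m. finite (L m)"
  "!!m x y. sgn_approx m x * sgn_approx m y = (\<Sum>l\<in>L m. d m l * cos (p m l * x + q m l * y))" using sgn_approx_rep by blast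
 show ?thesis by (rule LIMSEQ_unique[OF gauss_vec.T_tendsto[OF assms(1) r] gauss_vec.T_tendsto[OF assms(2) r, of u' v' w', folded assms(3-7)]])
qed

lemma gauss_plane: "gauss_vec (SN \<Otimes>\<^sub>M SN) UNIV (case_bool fst snd)"
proof -
 have f: "distr (SN \<Otimes>\<^sub>M SN) SN fst = SN" by (rule SN.distr_pair_fst)
 have s: "distr (SN \<Otimes>\<^sub>M SN) SN snd = SN"
 proof -
  have "distr (SN \<Otimes>\<^sub>M SN) SN snd = distr (distr (SN \<Otimes>\<^sub>M SN) (SN \<Otimes>\<^sub>M SN) (%(x, y). (y, x))) SN snd"
   by (subst SN2.distr_pair_swap[symmetric]) simp
  also have "\<dots> = distr (SN \<Otimes>\<^sub>M SN) SN fst" by (subst distr_distr) (auto simp: o_def split_def)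
  finally show ?thesis using f by simp
 qed
 have b: "distr (SN \<Otimes>\<^sub>M SN) borel fst = SN" "distr (SN \<Otimes>\<^sub>M SN) borel snd = SN"
  "distr (SN \<Otimes>\<^sub>M SN) lborel fst = SN" "distr (SN \<Otimes>\<^sub>M SN) lborel snd = SN"
  by (subst f[symmetric] s[symmetric], intro distr_cong; simp)+
 show ?thesis
 proof
  show "distributed (SN \<Otimes>\<^sub>M SN) lborel (case_bool fst snd i) std_normal_density" for i using b by (cases i) (auto simp: distributed_def)
  have "distr (SN \<Otimes>\<^sub>M SN) (borel \<Otimes>\<^sub>M borel) (%x. (fst x, snd x)) = SN \<Otimes>\<^sub>M SN"
   using distr_id[of "SN \<Otimes>\<^sub>M SN"] by (simp add: id_def cong: distr_cong)
  then have "SN2.indep_var borel fst borel snd" unfolding SN2.indep_var_distribution_eq b by simp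
  moreover have "case_bool borel borel = (%_. borel :: real measure)" by (rule ext) (simp split: bool.split)
  ultimately show "SN2.indep_vars (%_. borel) (case_bool fst snd) UNIV" by (simp add: SN2.indep_var_def)
 qed simp
qed

text \<open>The pair \<open>u\<close>, \<open>v\<close> is modelled in the plane with
  \<open>P\<close> as second and \<open>Q\<close> as first coordinate. The sign product is
  \<open>1 - 2 * sgn_diff\<close>, and the constant 1 is orthogonal to centred squares; this doubles
  the bounds of \<open>sgn_diff_upper\<close> and \<open>sgn_diff_lower\<close>.\<close>

lemma T_plane:
 fixes I :: "'i set"
 assumes g: "gauss_vec M I \<xi>" and o: "ip I P P = 1" "ip I Q Q = 1" "ip I P Q = 0" and ab: "a > 0" "b > 0" "b / a <= 1/100"
  and u: "u = (%i. a * P i + b * Q i)" and v: "v = (%i. a * P i + (- b) * Q i)"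
 shows "- (4 * (b / a)) <= gauss_vec.T M I \<xi> u v P" "gauss_vec.T M I \<xi> u v P <= 4 * (b / a)" "gauss_vec.T M I \<xi> u v Q <= - (b / a / 25)"
proof -
 interpret P2: gauss_vec "SN \<Otimes>\<^sub>M SN" UNIV "case_bool fst snd" by (rule gauss_plane)
 define u' where "u' = case_bool b a"
 define v' where "v' = case_bool (- b) a"
 define P' where "P' = case_bool 0 (1::real)"
 define Q' where "Q' = case_bool 1 (0::real)"
 have Z: "P2.Z w yx = w True * fst yx + w False * snd yx" for w yx unfolding P2.Z_def by (simp add: UNIV_bool)
 have ip': "ip UNIV w z = w True * z True + w False * z False" for w z :: "bool => real" by (simp add: ip_def UNIV_bool)
 have gram: "ip I u u = a * a + b * b" "ip I u v = a * a - b * b" "ip I v v = a * a + b * b"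
  "ip I u P = a" "ip I v P = a" "ip I u Q = b" "ip I v Q = - b" unfolding u v ip_lin_left ip_lin_right ip_commute[of I Q P] o by simp_all
 have T1: "gauss_vec.T M I \<xi> u v P = P2.T u' v' P'" "gauss_vec.T M I \<xi> u v Q = P2.T u' v' Q'"
  by (rule T_transfer[OF g gauss_plane]; simp add: ip' gram u'_def v'_def P'_def Q'_def)+
 have s: "sgn (P2.Z u' yx) * sgn (P2.Z v' yx) = 1 - 2 * sgn_diff a b yx" for yx
  by (simp add: sgn_diff_def Z u'_def v'_def add.commute diff_divide_distrib)
 have m: "fst \<in> borel_measurable (SN \<Otimes>\<^sub>M SN)" "snd \<in> borel_measurable (SN \<Otimes>\<^sub>M SN)" by simp_all
 note i = sgn_diff_quad_integrable[of a b]
 have q: "integrable (SN \<Otimes>\<^sub>M SN) (%yx. (fst yx)^2 - 1)" "(\<integral>yx. (fst yx)^2 - 1 \<partial>(SN \<Otimes>\<^sub>M SN)) = 0"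
  "integrable (SN \<Otimes>\<^sub>M SN) (%yx. (snd yx)^2 - 1)" "(\<integral>yx. (snd yx)^2 - 1 \<partial>(SN \<Otimes>\<^sub>M SN)) = 0"
  using P2.integrable_Z_sq[of Q'] P2.integrable_Z_sq[of P'] P2.expectation_Z_sq[of Q'] P2.expectation_Z_sq[of P'] SN2.prob_space
  by (simp_all add: Z Q'_def P'_def ip')
 have "P2.T u' v' Q' = (\<integral>yx. ((fst yx)^2 - 1) - 2 * (sgn_diff a b yx * ((fst yx)^2 - 1)) \<partial>(SN \<Otimes>\<^sub>M SN))"
  unfolding P2.T_def s by (rule Bochner_Integration.integral_cong) (simp_all add: Z Q'_def ip' algebra_simps)
 then have Q: "P2.T u' v' Q' = - 2 * (\<integral>yx. sgn_diff a b yx * ((fst yx)^2 - 1) \<partial>(SN \<Otimes>\<^sub>M SN))" using q i by simp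
 then show "gauss_vec.T M I \<xi> u v Q <= - (b / a / 25)" using sgn_diff_lower[OF ab] unfolding T1 by simp
 define g where "g yx = sgn_diff a b yx * ((snd yx)^2 - 1)" for yx
 have le: "\<bar>g yx\<bar> <= sgn_diff a b yx * ((snd yx)^2 + 1)" for yx
  unfolding g_def abs_mult using sgn_diff_bounds[of a b yx] zero_le_power2[of "snd yx"] by (intro mult_mono) (auto simp: abs_le_iff)
 have gi: "integrable (SN \<Otimes>\<^sub>M SN) g"
  by (rule Bochner_Integration.integrable_bound[OF i(2)]) (use le abs_ge_self order_trans in \<open>fastforce simp: g_def[abs_def]\<close>)+
 have "P2.T u' v' P' = (\<integral>yx. ((snd yx)^2 - 1) - 2 * g yx \<partial>(SN \<Otimes>\<^sub>M SN))"
  unfolding P2.T_def s by (rule Bochner_Integration.integral_cong) (simp_all add: Z P'_def ip' g_def algebra_simps)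
 then have P: "P2.T u' v' P' = - 2 * (\<integral>yx. g yx \<partial>(SN \<Otimes>\<^sub>M SN))" using q gi by simp
 have "\<bar>\<integral>yx. g yx \<partial>(SN \<Otimes>\<^sub>M SN)\<bar> <= (\<integral>yx. \<bar>g yx\<bar> \<partial>(SN \<Otimes>\<^sub>M SN))" by (rule integral_abs_bound)
 also have "\<dots> <= (\<integral>yx. sgn_diff a b yx * ((snd yx)^2 + 1) \<partial>(SN \<Otimes>\<^sub>M SN))" using gi i(2) le by (intro integral_mono) auto
 also have "\<dots> <= 2 * (b / a)" by (rule sgn_diff_upper[OF ab(1,2)])
 finally show "- (4 * (b / a)) <= gauss_vec.T M I \<xi> u v P" "gauss_vec.T M I \<xi> u v P <= 4 * (b / a)" unfolding T1 P by (auto simp: abs_le_iff)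
qed

subsection \<open>Lower bound for the variance of the number of sign changes\<close>

definition qf :: "'i set => ('i => real) => ('i => real) => real" where "qf I q x = (\<Sum>i\<in>I. q i * (x i)^2)"

lemma qf_diff_le:
 fixes I :: "'i set"
 assumes "!!i. i \<in> I ==> \<bar>q i\<bar> <= 1"
 shows "\<bar>qf I q x - qf I q y\<bar> <= L2_set (%i. x i - y i) I * (L2_set x I + L2_set y I)"
proof -
 have "\<bar>qf I q x - qf I q y\<bar> = \<bar>\<Sum>i\<in>I. q i * ((x i - y i) * (x i + y i))\<bar>"
  by (simp add: qf_def sum_subtractf[symmetric] power2_eq_square algebra_simps)
 also have "\<dots> <= (\<Sum>i\<in>I. \<bar>x i - y i\<bar> * \<bar>x i + y i\<bar>)"
 proof (rule order_trans[OF sum_abs sum_mono])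
  fix i assume "i \<in> I"
  from mult_right_mono[OF assms[OF this], of "\<bar>(x i - y i) * (x i + y i)\<bar>"]
  show "\<bar>q i * ((x i - y i) * (x i + y i))\<bar> <= \<bar>x i - y i\<bar> * \<bar>x i + y i\<bar>" by (simp add: abs_mult)
 qed
 also have "\<dots> <= L2_set (%i. x i - y i) I * L2_set (%i. x i + y i) I" by (rule L2_set_mult_ineq)
 also have "\<dots> <= L2_set (%i. x i - y i) I * (L2_set x I + L2_set y I)" by (intro mult_left_mono L2_set_triangle_ineq L2_set_nonneg)
 finally show ?thesis .
qed

lemma qf_scale: "qf I q (%i. c * x i) = c^2 * qf I q x" by (simp add: qf_def power_mult_distrib sum_distrib_left mult_ac)

context gauss_vec
begin

text \<open>Each square is centred by its mean 1; this is the test variable for the lower variance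
  bound.\<close>

definition Qf :: "('i => real) => 's => real" where "Qf q s = (\<Sum>k\<in>J. q k * ((\<xi> k s)^2 - 1))"

definition uv :: "'i => 'i => real" where "uv k i = (if i = k then 1 else 0)"

lemma uv: "k \<in> J ==> Z (uv k) s = \<xi> k s" "k \<in> J ==> ip J u (uv k) = u k" "k \<in> J ==> ip J (uv k) u = u k"
proof -
 have e: "uv k i * y = (if i = k then y else 0)" "y * uv k i = (if i = k then y else 0)" for i y by (simp_all add: uv_def)
 show "k \<in> J ==> Z (uv k) s = \<xi> k s" "k \<in> J ==> ip J u (uv k) = u k" "k \<in> J ==> ip J (uv k) u = u k"
  using fin by (simp_all add: Z_def ip_def e)
qed

lemma Qf_eq: "Qf q s = (\<Sum>k\<in>J. q k * ((Z (uv k) s)^2 - ip J (uv k) (uv k)))"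
 unfolding Qf_def by (intro sum.cong refl) (simp add: uv(1), simp add: uv(2), simp add: uv_def)

lemma Qf_meas [measurable]: "Qf q \<in> borel_measurable M" unfolding Qf_eq[abs_def] by measurable

lemma sgn_meas_bound: "(%s. sgn (Z u s) * sgn (Z v s)) \<in> borel_measurable M" "\<bar>sgn (Z u s) * sgn (Z v s)\<bar> <= 1"
 by (measurable, simp add: sgn_if)

text \<open>The coefficient \<open>T\<close> is quadratic in the pairings of \<open>w\<close> with
  \<open>u\<close> and \<open>v\<close>, hence only the components of the form along
  \<open>P\<close> and \<open>Q\<close> count. The mixed term vanishes by symmetry.\<close>

lemma expectation_sgn_Qf:
 assumes o: "ip J P P = 1" "ip J Q Q = 1" "ip J P Q = 0"
  and u: "u = (%i. a * P i + b * Q i)" and v: "v = (%i. a * P i + (- b) * Q i)"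
 shows "expectation (%s. sgn (Z u s) * sgn (Z v s) * Qf q s) = qf J q P * T u v P + qf J q Q * T u v Q"
proof -
 note iT = integrable_bounded_mult[OF sgn_meas_bound integrable_Z_sq_centered]
 define PM where "PM e = (%i. 1 * P i + e * Q i)" for e
 have gram: "ip J u u = a * a + b * b" "ip J u v = a * a - b * b" "ip J v u = a * a - b * b" "ip J v v = a * a + b * b"
  "ip J u P = a" "ip J v P = a" "ip J u Q = b" "ip J v Q = - b" "ip J u (PM e) = a + e * b" "ip J v (PM e) = a - e * b" for e
  unfolding u v PM_def ip_lin_left ip_lin_right ip_commute[of J Q P] o by (simp_all add: algebra_simps)
 \<comment> \<open>Reversing \<open>Q\<close> exchanges \<open>u\<close> and \<open>v\<close>, which
   leaves the sign product unchanged; polarization then removes the mixed coefficient.\<close>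
 have "T u v (PM 1) = T v u (PM (- 1))" by (rule T_transfer[OF gauss_vec_axioms gauss_vec_axioms]) (simp_all add: gram)
 then have sw: "T u v (PM 1) = T u v (PM (- 1))" by (simp add: T_commute)
 have "T u v (PM 1) + T u v (PM (- 1)) = 2 * T u v P + 2 * T u v Q"
 proof -
  have n: "ip J (PM e) (PM e) = 1 + e * e" for e unfolding PM_def ip_lin_left ip_lin_right ip_commute[of J Q P] o by simp
  have "T u v (PM 1) + T u v (PM (- 1)) = expectation (%s. sgn (Z u s) * sgn (Z v s) * ((Z (PM 1) s)^2 - ip J (PM 1) (PM 1))
    + sgn (Z u s) * sgn (Z v s) * ((Z (PM (- 1)) s)^2 - ip J (PM (- 1)) (PM (- 1))))"
   unfolding T_def by (rule Bochner_Integration.integral_add[symmetric]) (rule iT)+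
  also have "\<dots> = expectation (%s. 2 * (sgn (Z u s) * sgn (Z v s) * ((Z P s)^2 - ip J P P)) + 2 * (sgn (Z u s) * sgn (Z v s) * ((Z Q s)^2 - ip J Q Q)))"
   by (rule Bochner_Integration.integral_cong[OF refl], unfold n o, unfold PM_def Z_lin) (simp add: power2_eq_square algebra_simps)
  also have "\<dots> = 2 * T u v P + 2 * T u v Q"
   unfolding T_def using Bochner_Integration.integral_add[OF integrable_mult_right[OF iT, of 2] integrable_mult_right[OF iT, of 2]] by simp
  finally show ?thesis .
 qed
 with sw have cross: "T u v (PM 1) - T u v P - T u v Q = 0" by simp
 have "expectation (%s. sgn (Z u s) * sgn (Z v s) * Qf q s) = expectation (%s. \<Sum>k\<in>J. q k * (sgn (Z u s) * sgn (Z v s) * ((Z (uv k) s)^2 - ip J (uv k) (uv k))))"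
  unfolding Qf_eq by (simp add: sum_distrib_left mult_ac)
 also have "\<dots> = (\<Sum>k\<in>J. q k * T u v (uv k))"
  unfolding T_def by (subst Bochner_Integration.integral_sum) (auto intro!: integrable_mult_right iT simp del: ip_self_nonneg)
 finally have E: "expectation (%s. sgn (Z u s) * sgn (Z v s) * Qf q s) = (\<Sum>k\<in>J. q k * T u v (uv k))" .
 obtain L :: "nat => (nat \<times> nat \<times> real) set" and d p r where rep: "!!m. finite (L m)"
  "!!m x y. sgn_approx m x * sgn_approx m y = (\<Sum>l\<in>L m. d m l * cos (p m l * x + r m l * y))" using sgn_approx_rep by blast
 define e where "e m l = d m l * exp (- ((p m l)^2 * ip J u u + 2 * p m l * r m l * ip J u v + (r m l)^2 * ip J v v) / 2)" for m l
 have lim: "(%m. - (\<Sum>l\<in>L m. e m l * (p m l * ip J u w + r m l * ip J v w)^2)) \<longlonglongrightarrow> T u v w" for w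
  using T_tendsto[OF rep, of u v w] by (simp add: e_def mult.assoc)
 \<comment> \<open>The mixed coefficient of the quadratic form; it multiplies a quantity that tends
   to zero.\<close>
 define D where "D = (\<Sum>k\<in>J. q k * (P k * Q k))"
 have "(\<Sum>k\<in>J. q k * - (\<Sum>l\<in>L m. e m l * (p m l * ip J u (uv k) + r m l * ip J v (uv k))^2))
  = qf J q P * - (\<Sum>l\<in>L m. e m l * (p m l * ip J u P + r m l * ip J v P)^2)
   + qf J q Q * - (\<Sum>l\<in>L m. e m l * (p m l * ip J u Q + r m l * ip J v Q)^2)
   + D * (- (\<Sum>l\<in>L m. e m l * (p m l * ip J u (PM 1) + r m l * ip J v (PM 1))^2)
    - - (\<Sum>l\<in>L m. e m l * (p m l * ip J u P + r m l * ip J v P)^2) - - (\<Sum>l\<in>L m. e m l * (p m l * ip J u Q + r m l * ip J v Q)^2))"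
  (is "?l = ?r") for m
 proof -
  define x where "x l = a * (p m l + r m l)" for l
  define y where "y l = b * (p m l - r m l)" for l
  have g: "p m l * ip J u P + r m l * ip J v P = x l" "p m l * ip J u Q + r m l * ip J v Q = y l"
   "p m l * ip J u (PM 1) + r m l * ip J v (PM 1) = x l + y l" for l unfolding gram by (simp_all add: x_def y_def algebra_simps)
  have gk: "p m l * ip J u (uv k) + r m l * ip J v (uv k) = x l * P k + y l * Q k" if "k \<in> J" for k l
   unfolding uv(2)[OF that] by (simp add: u v x_def y_def algebra_simps)
  have "?l = (\<Sum>k\<in>J. q k * - (\<Sum>l\<in>L m. e m l * (x l * P k + y l * Q k)^2))" by (simp add: gk)
  also have "\<dots> = - (\<Sum>l\<in>L m. \<Sum>k\<in>J. q k * (e m l * (x l * P k + y l * Q k)^2))"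
   by (subst sum.swap) (simp add: sum_negf sum_distrib_left)
  also have "\<dots> = - (\<Sum>l\<in>L m. qf J q P * (e m l * (x l)^2) + qf J q Q * (e m l * (y l)^2) + D * (2 * (e m l * (x l * y l))))"
   by (intro arg_cong[where f=uminus] sum.cong refl, simp only: qf_def D_def sum_distrib_right sum.distrib[symmetric],
     intro sum.cong refl) (simp add: power2_eq_square algebra_simps)
  also have "\<dots> = ?r" unfolding g by (simp add: sum.distrib sum_distrib_left power2_sum algebra_simps sum_subtractf)
  finally show ?thesis .
 qed
 then have "(%m. \<Sum>k\<in>J. q k * - (\<Sum>l\<in>L m. e m l * (p m l * ip J u (uv k) + r m l * ip J v (uv k))^2))
  \<longlonglongrightarrow> qf J q P * T u v P + qf J q Q * T u v Q + D * (T u v (PM 1) - T u v P - T u v Q)"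
  by (simp only:) (intro tendsto_add tendsto_diff tendsto_mult tendsto_const lim)
 moreover have "(%m. \<Sum>k\<in>J. q k * - (\<Sum>l\<in>L m. e m l * (p m l * ip J u (uv k) + r m l * ip J v (uv k))^2)) \<longlonglongrightarrow> (\<Sum>k\<in>J. q k * T u v (uv k))"
  by (intro tendsto_sum tendsto_mult tendsto_const lim)
 ultimately show ?thesis unfolding E cross using LIMSEQ_unique by fastforce
qed

lemma expectation_Z_pow4: "expectation (%s. (Z w s) ^ 4) = 3 * (ip J w w)^2" "integrable M (%s. (Z w s) ^ 4)"
 using std_normal_distribution_even_moments[of 2]
 by (simp_all add: expectation_Z[of "%x. x ^ 4"] integrable_Z_iff[of "%x. x ^ 4"] power_mult_distrib ip_self
   fact_numeral flip: power_mult)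

text \<open>Polarization expresses the product of squares by fourth powers of single functionals,
  whose moments are known.\<close>

lemma expectation_Z_sq_sq:
 "integrable M (%s. ((Z u s)^2 - ip J u u) * ((Z v s)^2 - ip J v v))"
 "expectation (%s. ((Z u s)^2 - ip J u u) * ((Z v s)^2 - ip J v v)) = 2 * (ip J u v)^2"
proof -
 let ?p = "%i. u i + v i" and ?m = "%i. u i - v i"
 let ?F = "%s. ((Z ?p s) ^ 4 + (Z ?m s) ^ 4 - 2 * (Z u s) ^ 4 - 2 * (Z v s) ^ 4) / 12 - ip J v v * (Z u s)^2 - ip J u u * (Z v s)^2 + ip J u u * ip J v v"
 have e: "((Z u s)^2 - ip J u u) * ((Z v s)^2 - ip J v v) = ?F s" for s
  unfolding Z_add Z_diff by (simp add: power4_eq_xxxx power2_eq_square algebra_simps)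
 note i = expectation_Z_pow4(2) integrable_Z_sq
 show "integrable M (%s. ((Z u s)^2 - ip J u u) * ((Z v s)^2 - ip J v v))" unfolding e using i by simp
 have "expectation ?F = (3 * (ip J ?p ?p)^2 + 3 * (ip J ?m ?m)^2 - 2 * (3 * (ip J u u)^2) - 2 * (3 * (ip J v v)^2)) / 12
   - ip J v v * ip J u u - ip J u u * ip J v v + ip J u u * ip J v v" using i by (simp add: expectation_Z_pow4(1) expectation_Z_sq prob_space)
 also have "\<dots> = 2 * (ip J u v)^2"
  unfolding ip_add_left ip_add_right ip_diff_left ip_diff_right ip_commute[of J v u] by (simp add: power2_eq_square algebra_simps)
 finally show "expectation (%s. ((Z u s)^2 - ip J u u) * ((Z v s)^2 - ip J v v)) = 2 * (ip J u v)^2" unfolding e .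
qed

lemma Qf_moments: "integrable M (%s. (Qf q s)^2)" "expectation (%s. (Qf q s)^2) = 2 * (\<Sum>k\<in>J. (q k)^2)" "expectation (Qf q) = 0"
proof -
 have e: "(Qf q s)^2 = (\<Sum>k\<in>J. \<Sum>l\<in>J. q k * q l * (((Z (uv k) s)^2 - ip J (uv k) (uv k)) * ((Z (uv l) s)^2 - ip J (uv l) (uv l))))" for s
  unfolding Qf_eq power2_eq_square[of "sum _ _"] sum_product by (intro sum.cong refl) (simp only: mult_ac)
 show "integrable M (%s. (Qf q s)^2)" unfolding e by (intro Bochner_Integration.integrable_sum integrable_mult_right expectation_Z_sq_sq)
 have "expectation (%s. (Qf q s)^2) = (\<Sum>k\<in>J. \<Sum>l\<in>J. q k * q l * (2 * (ip J (uv k) (uv l))^2))"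
  unfolding e using expectation_Z_sq_sq by simp
 also have "\<dots> = (\<Sum>k\<in>J. \<Sum>l\<in>J. if l = k then 2 * (q k)^2 else 0)"
  by (intro sum.cong refl) (auto simp: uv(2), auto simp: uv_def power2_eq_square)
 also have "\<dots> = 2 * (\<Sum>k\<in>J. (q k)^2)" using fin by (simp add: sum_distrib_left)
 finally show "expectation (%s. (Qf q s)^2) = 2 * (\<Sum>k\<in>J. (q k)^2)" .
 show "expectation (Qf q) = 0" unfolding Qf_eq using integrable_Z_sq by (simp add: expectation_Z_sq prob_space)
qed

end

section \<open>The test quadratic form evaluated on one cell\<close>

context sl_process
begin

text \<open>Subtracting the mean makes the form vanish on the value direction of the trigonometric
  model. On the derivative direction it is a quarter of the variance of \<open>(k / n)^2\<close>
  over the frequencies, which is positive.\<close>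

definition qn :: "nat => nat + nat => real" where "qn n i = (real (kk i) / n)^2 - mom 2 n"

lemma mom2_bounds: "n >= 1 ==> 0 <= mom 2 n" "n >= 1 ==> mom 2 n <= 1"
proof -
 assume n: "n >= 1"
 show "0 <= mom 2 n" by (simp add: mom_def sum_nonneg)
 have "(\<Sum>k=1..n. (real k / n)^2) <= (\<Sum>k=1..n. 1)" by (intro sum_mono power_le_one) (use n in auto)
 then show "mom 2 n <= 1" using n by (simp add: mom_def)
qed

lemma qn_bound: "i \<in> J n ==> \<bar>qn n i\<bar> <= 1"
proof -
 assume "i \<in> J n"
 then have k: "1 <= kk i" "kk i <= n" using J_kk by auto
 then have n: "n >= 1" by simp
 have "(real (kk i) / n)^2 <= 1" using k by (intro power_le_one) auto
 then show ?thesis using mom2_bounds[OF n] unfolding qn_def by (simp add: abs_le_iff) (smt (verit) zero_le_power2)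
qed

lemma qf_Tm:
 assumes n: "n >= 1"
 shows "qf (J n) (qn n) (Tm n 0 t) = 0" "qf (J n) (qn n) (Tm n 1 t) = mom 4 n / 4 - (mom 2 n)^2 / 4"
proof -
 have sq: "(Tm n a t (Inl k))^2 + (Tm n a t (Inr k))^2 = (real k / (2 * n)) ^ (2 * a) / n" for a k
 proof -
  have aux: "(x * c / y)^2 + (x * s / y)^2 = x^2 * (c^2 + s^2) / y^2" for x c s y :: real
   by (simp add: power_divide power_mult_distrib add_divide_distrib distrib_left)
  have "(Tm n a t (Inl k))^2 + (Tm n a t (Inr k))^2 = ((real k / 2) ^ a)^2 * 1 / (real n ^ a * sqrt n)^2"
   by (simp only: Tm_def \<tau>_def sum.case aux sin_cos_squared_add2)
  also have "\<dots> = (real k / 2) ^ (2 * a) / (real n ^ (2 * a) * n)" using n by (simp add: power_mult_distrib power_mult[symmetric] mult.commute)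
  also have "\<dots> = (real k / (2 * n)) ^ (2 * a) / n" by (simp add: power_divide power_mult_distrib)
  finally show ?thesis .
 qed
 have "qf (J n) (qn n) (Tm n a t) = (\<Sum>k=1..n. ((real k / n)^2 - mom 2 n) * ((real k / (2 * n)) ^ (2 * a) / n))" for a
  unfolding qf_def sum_J sq[symmetric] by (intro sum.cong refl) (simp add: qn_def kk_def distrib_left)
 note e = this
 have m: "(\<Sum>k=1..n. (real k / n)^2 / n) = mom 2 n" "(\<Sum>k=1..n. (real k / n) ^ 4 / n) = mom 4 n" by (simp_all add: mom_def sum_divide_distrib)
 show "qf (J n) (qn n) (Tm n 0 t) = 0" unfolding e using m(1) n by (simp add: diff_divide_distrib sum_subtractf)
 have "qf (J n) (qn n) (Tm n 1 t) = (\<Sum>k=1..n. (real k / n) ^ 4 / n / 4 - mom 2 n / 4 * ((real k / n)^2 / n))"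
  unfolding e by (intro sum.cong refl) (simp add: power_divide power_mult_distrib field_simps power4_eq_xxxx power2_eq_square)
 also have "\<dots> = mom 4 n / 4 - mom 2 n / 4 * mom 2 n"
  by (simp only: sum_subtractf sum_divide_distrib[symmetric] sum_distrib_left[symmetric] mom_def)
 finally show "qf (J n) (qn n) (Tm n 1 t) = mom 4 n / 4 - (mom 2 n)^2 / 4" by (simp add: power2_eq_square)
qed

lemma unit_close:
 fixes I :: "'i set"
 assumes "L2_set T I = 1" "L2_set (%i. x i - T i) I <= ep" "L2_set x I > 0"
 shows "L2_set (%i. x i / L2_set x I - T i) I <= 2 * ep"
proof -
 let ?r = "L2_set x I"
 have d: "\<bar>?r - 1\<bar> <= ep" using L2_set_triangle_ineq[of "%i. x i - T i" T I] L2_set_triangle_ineq[of "%i. T i - x i" x I] assms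
  by (simp add: L2_set_diff_commute[of T x] abs_le_iff)
 have "L2_set (%i. x i / ?r - T i) I <= L2_set (%i. x i / ?r - x i) I + L2_set (%i. x i - T i) I" by (rule L2_set_triangle_diff)
 also have "L2_set (%i. x i / ?r - x i) I = L2_set (%i. (1 / ?r - 1) * x i) I" by (simp add: left_diff_distrib)
 also have "\<dots> = \<bar>(1 / ?r - 1) * ?r\<bar>" unfolding L2_set_scale abs_mult using assms(3) by simp
 also have "(1 / ?r - 1) * ?r = 1 - ?r" using assms(3) by (simp add: left_diff_distrib)
 finally show ?thesis using d assms(2) by simp
qed

text \<open>The unit vectors at the cell ends are \<open>a * P + b * Q\<close> and
  \<open>a * P - b * Q\<close>, with \<open>P\<close> close to the value direction, \<open>Q\<close>
  close to the normalized derivative direction, and \<open>b / a\<close> comparable to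
  \<open>de\<close>. The form is nearly zero on \<open>P\<close> and at least \<open>1/5\<close> on
  \<open>Q\<close>, while \<open>T\<close> is negative along \<open>Q\<close>.\<close>

lemma cell_Qf:
 assumes n: "good n" and de: "de > 0" "de <= 1 / 40000" and dom: "t - de \<in> dom n" "t + de \<in> dom n"
 shows "expectation (%s. sgn (fz n (t - de) s) * sgn (fz n (t + de) s) * gv.Qf n (qn n) s) <= - (de / 1000)"
proof -
 have n1: "n >= 1" using n by (simp add: good_def)
 have t: "t \<in> dom n" using dom de by auto
 let ?N = "%x. L2_set x (J n)"
 note tri = L2_set_triangle_ineq L2_set_triangle_diff
 have mm: "\<bar>mom 2 n / 4 - 1 / 12\<bar> <= 1 / 2000" "\<bar>mom 4 n / 16 - 1 / 80\<bar> <= 1 / 2000" using n by (simp_all add: good_def)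
 have T0: "?N (Tm n 0 t) = 1" using ip_Tm_diag(1)[OF n1, of t] by (simp add: L2_set_sqrt_ip)
 have T1: "(?N (Tm n 1 t))^2 = mom 2 n / 4" using ip_Tm_diag(3)[OF n1, of t] by (simp add: ip_self)
 have T1b: "28/100 <= ?N (Tm n 1 t)" "?N (Tm n 1 t) <= 29/100"
 proof -
  have "(28/100)^2 <= (?N (Tm n 1 t))^2" "(?N (Tm n 1 t))^2 <= (29/100)^2" unfolding T1 unfolding power2_eq_square using mm(1) by linarith+
  then show "28/100 <= ?N (Tm n 1 t)" "?N (Tm n 1 t) <= 29/100" by (auto intro: power2_le_imp_le)
 qed
 define vp where "vp = V n 0 (t + de)" define vm where "vm = V n 0 (t - de)"
 define up where "up = U n (t + de)" define um where "um = U n (t - de)"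
 have w: "?N (%i. vp i - Tm n 0 t i) <= 1/10000" "?N (%i. vm i - Tm n 0 t i) <= 1/10000"
  unfolding vp_def vm_def using near_Tm[OF n de(2) _ dom(2), of 0 t] near_Tm[OF n de(2) _ dom(1), of 0 t] de by auto
 have vn: "1/2 <= ?N vp" "1/2 <= ?N vm" unfolding vp_def vm_def using L2_V_lower[OF n] dom by auto
 have vp1: "?N vp <= 10001/10000" using tri(1)[of "%i. vp i - Tm n 0 t i" "Tm n 0 t" "J n"] w T0 by simp
 have u: "up = (%i. vp i / ?N vp)" "um = (%i. vm i / ?N vm)" by (auto simp: up_def um_def vp_def vm_def U_def)
 have un: "?N up = 1" "?N um = 1" unfolding up_def um_def using U_unit[OF n] dom by auto
 have uT: "?N (%i. up i - Tm n 0 t i) <= 2 * (1/10000)" "?N (%i. um i - Tm n 0 t i) <= 2 * (1/10000)"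
  unfolding u using vn by (intro unit_close T0 w; simp)+
 \<comment> \<open>Half sum and half difference of vectors of equal norm are orthogonal.\<close>
 define av where "av = (%i. 1/2 * (up i + um i))" define df where "df = (%i. 1/2 * (up i - um i))"
 define a where "a = ?N av" define b where "b = ?N df"
 have avT: "?N (%i. av i - Tm n 0 t i) <= 2/10000"
 proof -
  have "(%i. av i - Tm n 0 t i) = (%i. 1/2 * ((up i - Tm n 0 t i) + (um i - Tm n 0 t i)))" by (simp add: av_def fun_eq_iff)
  then have "?N (%i. av i - Tm n 0 t i) = 1/2 * ?N (%i. (up i - Tm n 0 t i) + (um i - Tm n 0 t i))" by (simp only: L2_set_scale abs_of_pos)
  then show ?thesis using tri(1)[of "%i. up i - Tm n 0 t i" "%i. um i - Tm n 0 t i" "J n"] uT by linarith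
 qed
 have a1: "a <= 1" using tri(1)[of up um "J n"] un unfolding a_def av_def L2_set_scale by simp
 have a9: "9/10 <= a"
 proof -
  have "?N (Tm n 0 t) <= ?N (%i. Tm n 0 t i - av i) + ?N av" using tri(1)[of "%i. Tm n 0 t i - av i" av "J n"] by simp
  then show ?thesis using avT T0 by (simp add: a_def L2_set_diff_commute[of "Tm n 0 t" av])
 qed
 \<comment> \<open>The difference of the unit vectors, rescaled to approximate the derivative vector
   of the model.\<close>
 define y where "y = (%i. ?N vp / de * df i)"
 have yT: "?N (%i. y i - Tm n 1 t i) <= 11/10000"
 proof -
  \<comment> \<open>This is the defect from the different normalizations at the two ends. It is
    small because value and derivative are nearly orthogonal, so the norms at the ends almost
    agree.\<close>
  define c where "c = (?N vm - ?N vp) / (2 * de)"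
  have ye: "y i = d2 n de t i + c * um i" for i
  proof -
   have "?N vp * up i = vp i" "?N vm * um i = vm i" using vn by (simp_all add: u)
   then show ?thesis using de by (simp add: y_def df_def d2_def c_def flip: vp_def vm_def) (simp add: field_simps)
  qed
  note g = cell_gram(7)[OF n de dom]
  have "\<bar>ip (J n) (d2 n de t) vp - 0\<bar> <= 1/2000" "\<bar>ip (J n) (d2 n de t) vm - 0\<bar> <= 1/2000"
   using ip_near[OF n1 g w(1)] ip_near[OF n1 g w(2)] unfolding ip_commute[of "J n" "Tm n 1 t" "Tm n 0 t"] ip_Tm_diag(2)[OF n1] by simp_all
  then have i: "\<bar>ip (J n) (d2 n de t) (%i. vp i + vm i)\<bar> <= 1/1000" unfolding ip_add_right by linarith
  have "(?N vm - ?N vp) * (?N vm + ?N vp) = (?N vm)^2 - (?N vp)^2" by (simp add: power2_eq_square algebra_simps)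
  also have "\<dots> = - (2 * de) * ip (J n) (d2 n de t) (%i. vp i + vm i)"
  proof -
   have "(%i. 2 * de * d2 n de t i) = (%i. vp i - vm i)" using de by (simp add: d2_def vp_def vm_def fun_eq_iff)
   then have "2 * de * ip (J n) (d2 n de t) (%i. vp i + vm i) = ip (J n) (%i. vp i - vm i) (%i. vp i + vm i)" by (simp flip: ip_scale_left)
   also have "\<dots> = (?N vp)^2 - (?N vm)^2" unfolding ip_diff_left ip_add_right ip_commute[of _ vm vp] ip_self[symmetric] by simp
   finally show ?thesis by simp
  qed
  finally have e: "c * (?N vm + ?N vp) = - ip (J n) (d2 n de t) (%i. vp i + vm i)" using de by (simp add: c_def field_simps)
  have "\<bar>c\<bar> * 1 <= \<bar>c\<bar> * (?N vm + ?N vp)" using vn by (intro mult_left_mono) auto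
  also have "\<dots> = \<bar>c * (?N vm + ?N vp)\<bar>" using vn by (simp add: abs_mult)
  finally have c: "\<bar>c\<bar> <= 1/1000" using i unfolding e by simp
  have "?N (%i. y i - Tm n 1 t i) <= ?N (%i. y i - d2 n de t i) + ?N (%i. d2 n de t i - Tm n 1 t i)" by (rule tri(2))
  also have "(%i. y i - d2 n de t i) = (%i. c * um i)" by (simp add: ye)
  finally show ?thesis using c g un by (simp add: L2_set_scale)
 qed
 have yb: "278/1000 <= ?N y" "?N y <= 2912/10000"
  using tri(1)[of "%i. y i - Tm n 1 t i" "Tm n 1 t" "J n"] tri(1)[of "%i. Tm n 1 t i - y i" y "J n"] yT T1b
   L2_set_diff_commute[of "Tm n 1 t" y "J n"] by simp_all
 have Ny: "?N y = ?N vp / de * b" unfolding y_def L2_set_scale b_def using vn de by simp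
 have b: "de / 4 <= b" "b <= de"
 proof -
  have "de * ?N y = ?N vp * b" unfolding Ny using de by simp
  moreover have "de * (278/1000) <= de * ?N y" "de * ?N y <= de * (1/2)" using yb de by (intro mult_left_mono; simp)+
  moreover have "?N vp * b <= 10001/10000 * b" "1/2 * b <= ?N vp * b" using vp1 vn by (intro mult_right_mono; simp add: b_def)+
  ultimately show "de / 4 <= b" "b <= de" by linarith+
 qed
 have b0: "b > 0" and a0: "a > 0" using b de a9 by linarith+
 define P where "P = (%i. av i / a)" define Q where "Q = (%i. 1 / b * df i)"
 have o: "ip (J n) P P = 1" "ip (J n) Q Q = 1" "ip (J n) P Q = 0"
 proof -
  have P': "P = (%i. 1 / a * av i)" by (simp add: P_def)
  show "ip (J n) P P = 1" "ip (J n) Q Q = 1" using a0 b0 unfolding P' Q_def ip_scale_left ip_scale_right ip_self a_def b_def by (simp_all add: power2_eq_square)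
  have "ip (J n) av df = 1/4 * ((?N up)^2 - (?N um)^2)"
   unfolding av_def df_def ip_scale_left ip_scale_right ip_add_left ip_diff_right ip_self[symmetric] ip_commute[of _ um up] by simp
  then show "ip (J n) P Q = 0" unfolding P' Q_def ip_scale_left ip_scale_right by (simp add: un)
 qed
 have ups: "up = (%i. a * P i + b * Q i)" "um = (%i. a * P i + (- b) * Q i)"
  using a0 b0 by (auto simp: P_def Q_def av_def df_def fun_eq_iff field_simps)
 have qP: "\<bar>qf (J n) (qn n) P\<bar> <= 8/10000"
 proof -
  have "?N (%i. P i - Tm n 0 t i) <= 2 * (2/10000)" unfolding P_def a_def using a0 by (intro unit_close T0 avT) (simp add: a_def)
  moreover have "?N P = 1" using o(1) by (simp add: L2_set_sqrt_ip)
  ultimately show ?thesis using qf_diff_le[of "J n" "qn n" P "Tm n 0 t", OF qn_bound] qf_Tm(1)[OF n1, of t] T0 by simp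
 qed
 \<comment> \<open>In the limit the value is \<open>(1/5 - 1/9) / 4\<close> divided by
   \<open>1/12\<close>, that is \<open>4/15\<close>; the tolerances leave
   \<open>1/5\<close>.\<close>
 have qQ: "1/5 <= qf (J n) (qn n) Q"
 proof -
  have "?N (%i. y i - Tm n 1 t i) * (?N y + ?N (Tm n 1 t)) <= 11/10000 * (2912/10000 + 29/100)" using yT yb T1b by (intro mult_mono add_mono) auto
  then have "qf (J n) (qn n) y >= qf (J n) (qn n) (Tm n 1 t) - 11/10000 * (2912/10000 + 29/100)"
   using qf_diff_le[of "J n" "qn n" y "Tm n 1 t", OF qn_bound] by (simp add: abs_le_iff)
  moreover have "mom 2 n <= 1/3 + 1/500" using mm(1) by linarith
  then have "(mom 2 n)^2 <= (1/3 + 1/500)^2" using mom2_bounds[OF n1] by (intro power_mono) auto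
  moreover have "mom 4 n / 4 >= 48/1000" using mm(2) by linarith
  ultimately have "qf (J n) (qn n) y >= 19/1000" unfolding qf_Tm(2)[OF n1] by (simp add: power2_eq_square)
  moreover have "(?N y)^2 <= (2912/10000)^2" using yb by (intro power_mono) auto
  ultimately have "1/5 * (?N y)^2 <= qf (J n) (qn n) y" by (simp add: power2_eq_square)
  moreover have "y = (%i. ?N y * Q i)" unfolding Ny using b0 by (simp add: y_def Q_def fun_eq_iff)
  then have "qf (J n) (qn n) y = (?N y)^2 * qf (J n) (qn n) Q" by (metis qf_scale)
  ultimately have "(?N y)^2 * (1/5) <= (?N y)^2 * qf (J n) (qn n) Q" by simp
  moreover have "(?N y)^2 > 0" using yb by (intro zero_less_power) auto
  ultimately show ?thesis by (simp only: mult_le_cancel_left_pos)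
 qed
 define be where "be = b / a"
 have be: "de / 4 <= be" "be <= 1/100"
 proof -
  have "b / 1 <= b / a" using a1 a0 b0 by (intro divide_left_mono) auto
  then show "de / 4 <= be" using b unfolding be_def by linarith
  have "b / a <= b / (9/10)" using a9 b0 by (intro divide_left_mono) auto
  also have "\<dots> = 10/9 * b" by simp
  finally show "be <= 1/100" using b de unfolding be_def by linarith
 qed
 have gvn: "gauss_vec M (J n) \<xi>" ..
 note TP = T_plane[OF gvn o a0 b0 be(2)[unfolded be_def] ups, folded be_def]
 have "expectation (%s. sgn (gv.Z n up s) * sgn (gv.Z n um s) * gv.Qf n (qn n) s) = qf (J n) (qn n) P * gv.T n up um P + qf (J n) (qn n) Q * gv.T n up um Q"
  by (rule gv.expectation_sgn_Qf[OF o ups])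
 also have "\<dots> <= 8/10000 * (4 * be) + 1/5 * (- (be / 25))"
 proof (rule add_mono)
  have "\<bar>qf (J n) (qn n) P * gv.T n up um P\<bar> <= 8/10000 * (4 * be)"
   unfolding abs_mult using qP TP(1,2) by (intro mult_mono) (auto simp: abs_le_iff)
  then show "qf (J n) (qn n) P * gv.T n up um P <= 8/10000 * (4 * be)" by (simp add: abs_le_iff)
  have "1/5 * (be / 25) <= qf (J n) (qn n) Q * - gv.T n up um Q" using qQ TP(3) be de by (intro mult_mono) auto
  then show "qf (J n) (qn n) Q * gv.T n up um Q <= 1/5 * (- (be / 25))" by simp
 qed
 also have "\<dots> <= - (de / 1000)" using be(1) de by simp
 finally have "expectation (%s. sgn (gv.Z n up s) * sgn (gv.Z n um s) * gv.Qf n (qn n) s) <= - (de / 1000)" .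
 then show ?thesis unfolding up_def um_def sgn_Z_U[OF n dom(1)] sgn_Z_U[OF n dom(2)] by (simp add: mult.commute)
qed

text \<open>Cauchy-Schwarz against \<open>Qf\<close>, whose variance is at most
  \<open>4 * n\<close>, while every cell contributes a covariance of at least
  \<open>h / 2000\<close>. As \<open>c * h = pi * n\<close>, the bound does not depend on the mesh
  and so survives refinement.\<close>

lemma sgnc_lower:
 assumes n: "good n" and c: "c >= 1" and de: "mesh n c <= 1 / 40000"
 shows "sqrt n / 2000 <= gv.sd (sgnc n c)"
proof -
 have n1: "n >= 1" using n by (simp add: good_def)
 define h where "h = mesh n c"
 have h: "h > 0" "h <= 1 / 40000" using n1 c de by (simp_all add: h_def mesh_def)
 let ?Q = "gv.Qf n (qn n)"
 note Qm = gv.Qf_moments[of n "qn n"]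
 have Qi: "integrable M ?Q" by (rule square_integrable_imp_integrable[OF _ Qm(1)]) simp
 have d: "pt n c (2 * i) \<in> dom n" "pt n c (2 * i + 2) \<in> dom n" if "i < c" for i using that c by (intro pt_dom; simp)+
 define g where "g i s = sgn (fz n (pt n c (2 * i)) s) * sgn (fz n (pt n c (2 * i + 2)) s) * ?Q s" for i s
 have gi: "integrable M (g i)" for i unfolding g_def[abs_def] by (rule gv.integrable_bounded_mult[OF _ _ Qi]) (auto simp: sgn_if)
 have cell: "expectation (g i) <= - (h / 1000)" if "i < c" for i
  using cell_Qf[OF n h, of "pt n c (2 * i + 1)"] d[OF that] unfolding g_def[abs_def] h_def pt_cell by simp
 have "sgnc n c s * ?Q s = (\<Sum>i<c. 1/2 * ?Q s - 1/2 * g i s)" for s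
  unfolding sgnc_def sum_distrib_right g_def by (intro sum.cong refl) (simp add: field_simps)
 then have "expectation (%s. sgnc n c s * ?Q s) = (\<Sum>i<c. - 1/2 * expectation (g i))" using Qi gi Qm(3) by simp
 also have "\<dots> >= (\<Sum>i<c. h / 2000)"
 proof (rule sum_mono)
  show "h / 2000 <= - 1/2 * expectation (g i)" if "i \<in> {..<c}" for i using cell[of i] that by simp
 qed
 also have "(\<Sum>i<c. h / 2000) = pi * n / 2000" using c by (simp add: h_def mesh_def)
 finally have E: "pi * n / 2000 <= expectation (%s. sgnc n c s * ?Q s)" by simp
 have i2: "integrable M (%s. (sgnc n c s)^2)"
  by (rule gv.integrable_sq_bounded[of _ "c"]) (use sgnc_bounds in \<open>auto simp: abs_le_iff intro: order_trans[of _ 0]\<close>)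
 have Q2: "gv.cv ?Q ?Q <= 4 * n"
 proof -
  have "gv.cv ?Q ?Q = 2 * (\<Sum>k\<in>J n. (qn n k)^2)" using Qm by (simp add: gv.cv_def power2_eq_square)
  also have "(\<Sum>k\<in>J n. (qn n k)^2) <= (\<Sum>k\<in>J n. 1)" using qn_bound abs_square_le_1 by (intro sum_mono) blast
  also have "(\<Sum>k\<in>J n. 1) = 2 * real n" unfolding sum_J by simp
  finally show ?thesis by simp
 qed
 have "expectation (%s. sgnc n c s * ?Q s) = gv.cv (sgnc n c) ?Q" using Qm(3) by (simp add: gv.cv_def)
 also have "\<dots> <= gv.sd (sgnc n c) * sqrt (gv.cv ?Q ?Q)" using gv.cv_Cauchy[OF sgnc_meas gv.Qf_meas i2 Qm(1)] by (simp add: gv.sd_def)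
 also have "\<dots> <= gv.sd (sgnc n c) * sqrt (4 * n)"
  using Q2 gv.cv_self[OF i2] by (intro mult_left_mono real_sqrt_le_mono) (simp_all add: gv.sd_def)
 also have "sqrt (4 * n) = 2 * sqrt n" by (simp add: real_sqrt_mult)
 finally have "pi * n / 2000 <= gv.sd (sgnc n c) * (2 * sqrt n)" using E by linarith
 moreover have "2 * real n / 2000 <= pi * n / 2000" using pi_gt3 by (intro divide_right_mono mult_right_mono) auto
 ultimately have "(2 * sqrt n) * (sqrt n / 2000) <= (2 * sqrt n) * gv.sd (sgnc n c)" by (simp add: mult.commute)
 then show ?thesis using n1 by (subst (asm) mult_le_cancel_left_pos) auto
qed

end

subsection \<open>Central limit theorem for the number of zeros\<close>

lemma exp_half_sq_lipschitz: "\<bar>exp (- x\<^sup>2 / 2) - exp (- y\<^sup>2 / 2)\<bar> <= \<bar>x - y :: real\<bar>"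
proof -
 have "norm (exp (- x\<^sup>2 / 2) - exp (- y\<^sup>2 / 2)) <= 1 * norm (x - y)"
 proof (rule field_differentiable_bound[where S=UNIV])
  fix z :: real
  show "((%x. exp (- x\<^sup>2 / 2)) has_real_derivative (- z * exp (- z\<^sup>2 / 2))) (at z within UNIV)" by (auto intro!: derivative_eq_intros)
  have "\<bar>z\<bar> <= 1 + z^2 / 2" using sum_squares_bound[of "\<bar>z\<bar>" 1] by simp
  also have "\<dots> <= exp (z^2 / 2)" by (rule exp_ge_add_one_self)
  finally show "norm (- z * exp (- z\<^sup>2 / 2)) <= 1" by (simp add: abs_mult exp_minus field_simps)
 qed auto
 then show ?thesis by simp
qed

text \<open>The comparison sequence may have a different limit \<open>l'\<close>, as long as it is
  close to \<open>l\<close>: the approximating counts have their own variances.\<close>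

lemma tendsto_of_approx:
 fixes x :: "nat => real"
 assumes "!!ep. ep > 0 ==> \<exists>y l'. y \<longlonglongrightarrow> l' \<and> \<bar>l' - l\<bar> <= ep \<and> eventually (%n. \<bar>x n - y n\<bar> <= ep) sequentially"
 shows "x \<longlonglongrightarrow> l"
proof (rule tendstoI)
 fix e :: real assume e: "e > 0"
 obtain y l' where y: "y \<longlonglongrightarrow> l'" "\<bar>l' - l\<bar> <= e / 4" "eventually (%n. \<bar>x n - y n\<bar> <= e / 4) sequentially"
  using assms[of "e / 4"] e by auto
 have "eventually (%n. dist (y n) l' < e / 4) sequentially" using tendstoD[OF y(1), of "e / 4"] e by simp
 then show "eventually (%n. dist (x n) l < e) sequentially" using y(3)
 proof eventually_elim
  case (elim n)
  then have "\<bar>y n - l'\<bar> < e / 4" "\<bar>x n - y n\<bar> <= e / 4" by (simp_all add: dist_real_def)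
  then show ?case using y(2) e unfolding dist_real_def by linarith
 qed
qed

lemma convergent_of_approx:
 fixes x :: "nat => real"
 assumes a: "!!ep. ep > 0 ==> \<exists>y. convergent y \<and> eventually (%n. \<bar>x n - y n\<bar> <= ep) sequentially"
 shows "convergent x"
proof (rule Cauchy_convergent, rule metric_CauchyI)
 fix e :: real assume e: "e > 0"
 obtain y where y: "convergent y" "eventually (%n. \<bar>x n - y n\<bar> <= e / 4) sequentially" using a[of "e / 4"] e by auto
 obtain N1 where N1: "!!m n. m >= N1 ==> n >= N1 ==> dist (y m) (y n) < e / 4"
  using metric_CauchyD[OF convergent_Cauchy[OF y(1)], of "e / 4"] e by auto
 obtain N2 where N2: "!!n. n >= N2 ==> \<bar>x n - y n\<bar> <= e / 4" using y(2) by (auto simp: eventually_sequentially)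
 show "\<exists>M. \<forall>m\<ge>M. \<forall>n\<ge>M. dist (x m) (x n) < e"
 proof (intro exI allI impI)
  fix m n assume "max N1 N2 <= m" "max N1 N2 <= n"
  then have "\<bar>y m - y n\<bar> < e / 4" "\<bar>x m - y m\<bar> <= e / 4" "\<bar>x n - y n\<bar> <= e / 4"
   using N1[of m n] N2[of m] N2[of n] by (auto simp: dist_real_def)
  then show "dist (x m) (x n) < e" using e unfolding dist_real_def by linarith
 qed
qed

section \<open>Characteristic functions and weak convergence\<close>

context prob_space
begin

lemma char_distr:
 assumes [measurable]: "f \<in> borel_measurable M"
 shows "char (distr M borel f) t = of_real (expectation (%s. cos (t * f s))) + \<i> * of_real (expectation (%s. sin (t * f s)))"
proof -
 have i: "integrable M (%s. cos (t * f s))" "integrable M (%s. sin (t * f s))" by (rule integrable_const_bound[where B=1]; simp)+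
 have "char (distr M borel f) t = (CLINT s|M. iexp (t * f s))" unfolding char_def by (subst integral_distr) auto
 also have "\<dots> = (CLINT s|M. of_real (cos (t * f s)) + \<i> * of_real (sin (t * f s)))"
 proof -
  have "iexp x = of_real (cos x) + \<i> * of_real (sin x)" for x by (simp add: cis_conv_exp[symmetric] complex_eq_iff)
  then show ?thesis by (simp only:)
 qed
 also have "\<dots> = of_real (expectation (%s. cos (t * f s))) + \<i> * of_real (expectation (%s. sin (t * f s)))"
  using i by (subst Bochner_Integration.integral_add) (auto intro!: integrable_mult_right integrable_of_real)
 finally show ?thesis .
qed

lemma expectation_lipschitz:
 fixes f g :: "'a => real" and h :: "real => real"
 assumes [measurable]: "f \<in> borel_measurable M" "g \<in> borel_measurable M" "h \<in> borel_measurable borel"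
  and h: "!!x y. \<bar>h x - h y\<bar> <= \<bar>x - y\<bar>" "!!x. \<bar>h x\<bar> <= 1"
  and i: "integrable M (%s. (f s - g s)^2)"
 shows "\<bar>expectation (%s. h (f s)) - expectation (%s. h (g s))\<bar> <= sqrt (expectation (%s. (f s - g s)^2))"
proof -
 have hi: "integrable M (%s. h (f s))" "integrable M (%s. h (g s))" by (rule integrable_const_bound[where B=1]; use h(2) in simp)+
 have d: "integrable M (%s. \<bar>f s - g s\<bar>)" "integrable M (%s. f s - g s)" using square_integrable_imp_integrable[OF _ i] by auto
 have "\<bar>expectation (%s. h (f s)) - expectation (%s. h (g s))\<bar> = \<bar>expectation (%s. h (f s) - h (g s))\<bar>" using hi by simp
 also have "\<dots> <= expectation (%s. \<bar>h (f s) - h (g s)\<bar>)" by (rule integral_abs_bound)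
 also have "\<dots> <= expectation (%s. \<bar>f s - g s\<bar>)" using hi d h(1) by (intro integral_mono) auto
 also have "\<dots> <= sqrt (expectation (%s. (f s - g s)^2))"
 proof (rule real_le_rsqrt)
  have "0 <= variance (%s. \<bar>f s - g s\<bar>)" by (rule integral_nonneg_AE) simp
  then show "(expectation (%s. \<bar>f s - g s\<bar>))^2 <= expectation (%s. (f s - g s)^2)" using i d by (subst (asm) variance_eq) auto
 qed
 finally show ?thesis .
qed

lemma cos_sin_lipschitz: "\<bar>cos x - cos y\<bar> <= \<bar>x - y\<bar>" "\<bar>sin x - sin y\<bar> <= \<bar>x - y :: real\<bar>"
proof -
 have "norm (cos x - cos y) <= 1 * norm (x - y)" "norm (sin x - sin y) <= 1 * norm (x - y)"
  by (rule field_differentiable_bound[where S=UNIV and f'="%z. - sin z"]; simp add: DERIV_cos)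
   (rule field_differentiable_bound[where S=UNIV and f'=cos]; simp add: DERIV_sin)
 then show "\<bar>cos x - cos y\<bar> <= \<bar>x - y\<bar>" "\<bar>sin x - sin y\<bar> <= \<bar>x - y\<bar>" by auto
qed

text \<open>Levy continuity. The normalization by the standard deviation for each \<open>n\<close>
  is replaced by its positive limit \<open>sg\<close>, at a cost controlled by the Lipschitz bound
  for cosine and sine.\<close>

lemma weak_conv_normalized:
 fixes W :: "nat => 'a => real"
 assumes [measurable]: "!!n. W n \<in> borel_measurable M" and i2: "eventually (%n. integrable M (%s. (W n s)^2)) sequentially"
  and sg: "(%n. sqrt (expectation (%s. (W n s)^2))) \<longlonglongrightarrow> sg" "sg > 0"
  and c: "!!t. (%n. expectation (%s. cos (t * W n s))) \<longlonglongrightarrow> exp (- (sg * t)\<^sup>2 / 2)"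
  and s: "!!t. (%n. expectation (%s. sin (t * W n s))) \<longlonglongrightarrow> 0"
 shows "weak_conv_m (%n. distr M borel (%s. W n s / sqrt (expectation (%s. (W n s)^2)))) SN"
proof (rule levy_continuity)
 define r where "r n = sqrt (expectation (%s. (W n s)^2))" for n
 have r: "r \<longlonglongrightarrow> sg" using sg(1) by (simp add: r_def[abs_def])
 show "real_distribution (distr M borel (%s. W n s / sqrt (expectation (%s. (W n s)^2))))" for n by (rule real_distribution_distr) simp
 show "real_distribution SN" by (rule real_dist_normal_dist)
 fix t
 have pos: "eventually (%n. r n > 0) sequentially" using order_tendstoD(1)[OF r sg(2)] .
 have lim: "(%n. expectation (%s. h (t * (W n s / r n)))) \<longlonglongrightarrow> l"
  if h: "!!x y. \<bar>h x - h y\<bar> <= \<bar>x - y\<bar>" "!!x. \<bar>h x\<bar> <= 1" "h \<in> borel_measurable borel"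
   and l: "(%n. expectation (%s. h (t / sg * W n s))) \<longlonglongrightarrow> l" for h :: "real => real" and l
 proof -
  note [measurable] = h(3)
  have "(%n. expectation (%s. h (t * (W n s / r n))) - expectation (%s. h (t / sg * W n s))) \<longlonglongrightarrow> 0"
  proof (rule Lim_null_comparison)
   show "eventually (%n. norm (expectation (%s. h (t * (W n s / r n))) - expectation (%s. h (t / sg * W n s))) <= \<bar>t / r n - t / sg\<bar> * r n) sequentially"
    using i2
   proof eventually_elim
    case (elim n)
    have e: "(t * (W n s / r n) - t / sg * W n s)^2 = (t / r n - t / sg)^2 * (W n s)^2" for s
     by (simp add: power_mult_distrib[symmetric] left_diff_distrib)
    have "\<bar>expectation (%s. h (t * (W n s / r n))) - expectation (%s. h (t / sg * W n s))\<bar>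
     <= sqrt (expectation (%s. (t * (W n s / r n) - t / sg * W n s)^2))"
     by (rule expectation_lipschitz[OF _ _ h(3,1,2)]) (simp_all only: e, use elim in simp_all)
    also have "\<dots> = \<bar>t / r n - t / sg\<bar> * r n" unfolding e by (simp add: real_sqrt_mult r_def)
    finally show ?case by simp
   qed
   have "(%n. \<bar>t / r n - t / sg\<bar> * r n) \<longlonglongrightarrow> \<bar>t / sg - t / sg\<bar> * sg"
    using sg(2) by (intro tendsto_intros r) auto
   then show "(%n. \<bar>t / r n - t / sg\<bar> * r n) \<longlonglongrightarrow> 0" by simp
  qed
  from tendsto_add[OF this l] show ?thesis by simp
 qed
 have C: "(%n. expectation (%s. cos (t * (W n s / r n)))) \<longlonglongrightarrow> exp (- (sg * (t / sg))\<^sup>2 / 2)"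
  by (rule lim[OF _ _ _ c]) (simp_all add: cos_sin_lipschitz)
 have S: "(%n. expectation (%s. sin (t * (W n s / r n)))) \<longlonglongrightarrow> 0" by (rule lim[OF _ _ _ s]) (simp_all add: cos_sin_lipschitz)
 have "(%n. of_real (expectation (%s. cos (t * (W n s / r n)))) + \<i> * of_real (expectation (%s. sin (t * (W n s / r n)))))
  \<longlonglongrightarrow> of_real (exp (- (sg * (t / sg))\<^sup>2 / 2)) + \<i> * of_real 0" by (intro tendsto_intros C S)
 then show "(%n. char (distr M borel (%s. W n s / sqrt (expectation (%s. (W n s)^2)))) t) \<longlonglongrightarrow> char SN t"
  using sg(2) by (simp add: char_distr char_std_normal_distribution r_def exp_of_real[symmetric])
qed

end

section \<open>Passage from the approximating counts to the number of zeros\<close>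

context sl_process
begin

lemma AE_finite_zeros:
 assumes "good n" shows "AE s in M. finite {t \<in> dom n. fz n t s = 0}" using AE_simple_zeros[OF assms]
proof eventually_elim
 case (elim s)
 show ?case
 proof (rule simple_zeros_finite)
  show "((%t. fz n t s) has_real_derivative gv.Z n (V n 1 t) s) (at t within dom n)" if "t \<in> dom n" for t
   unfolding fz_def using fz_deriv[OF that, of 0] by simp
 qed (use elim in blast)
qed

lemma small_mesh:
 assumes "ep > 0"
 shows "\<exists>ka::nat. ka >= 1 \<and> pi / ka <= 1 / 40000 \<and> CZ * (pi / ka) powr (1/4) <= ep"
proof -
 have "(%ka::nat. CZ * (pi / ka) powr (1/4)) \<longlonglongrightarrow> CZ * 0" by (intro tendsto_mult tendsto_const) real_asymp
 then have "eventually (%ka. CZ * (pi / real ka) powr (1/4) < ep) sequentially" using assms by (intro order_tendstoD) auto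
 moreover have "(%ka::nat. pi / ka) \<longlonglongrightarrow> 0" by real_asymp
 then have "eventually (%ka. pi / real ka < 1 / 40000) sequentially" by (intro order_tendstoD) auto
 ultimately have "eventually (%ka. ka >= 1 \<and> pi / real ka <= 1 / 40000 \<and> CZ * (pi / ka) powr (1/4) <= ep) sequentially"
  using eventually_ge_at_top[of 1] by eventually_elim auto
 from eventually_happens[OF this] show ?thesis by auto
qed

text \<open>The grid spacing is fixed first, to make the discretization error small; then the degree
  \<open>m\<close>, because the error of the sign approximation carries the inverse mesh.\<close>

lemma Nz_sgnt:
 assumes e: "ep > 0"
 shows "\<exists>m ka. ka >= 1 \<and> pi / real ka <= 1 / 40000 \<and> (\<forall>n. good n --> gv.sd (%s. Nz n s - sgnt m n (ka * n) s) <= ep * sqrt n)"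
proof -
 obtain ka :: nat where ka: "ka >= 1" "pi / ka <= 1 / 40000" "CZ * (pi / ka) powr (1/4) <= ep / 2" using small_mesh[of "ep / 2"] e by auto
 have "(%m. sqrt (CV * sgn_err m) / (pi / ka)) \<longlonglongrightarrow> sqrt (CV * 0) / (pi / ka)"
  using ka(1) by (intro tendsto_intros sgn_err_tendsto) auto
 from order_tendstoD(2)[OF this, of "ep / 2"] e
 have "eventually (%m. sqrt (CV * sgn_err m) / (pi / ka) < ep / 2) sequentially" by simp
 then obtain m where m: "sqrt (CV * sgn_err m) / (pi / ka) < ep / 2" using eventually_happens by force
 have "gv.sd (%s. Nz n s - sgnt m n (ka * n) s) <= ep * sqrt n" if n: "good n" for n
 proof -
  have n1: "n >= 1" using n by (simp add: good_def)
  have c: "ka * n >= 1" and h: "mesh n (ka * n) = pi / ka" using n1 ka(1) pt_grid(2)[OF n1] by auto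
  note X = zeros_sgnc[OF n c, unfolded h, OF ka(2)] and Y = sgnc_sgnt[OF n c, unfolded h, OF ka(2), of m]
  have i: "integrable M (%s. (sgnc n (ka * n) s)^2)" "integrable M (%s. (sgnt m n (ka * n) s)^2)"
   by (rule gv.integrable_sq_bounded[of _ "real (ka * n)"], use sgnc_bounds sgnt_bounds in \<open>auto simp: abs_le_iff intro: order_trans[of _ 0] simp del: of_nat_mult\<close>)+
  have d: "integrable M (%s. (Nz n s - sgnc n (ka * n) s)^2)" "integrable M (%s. (sgnc n (ka * n) s - sgnt m n (ka * n) s)^2)"
   using gv.sq_integrable_add[OF Nz_meas _ X(1), of "%s. - sgnc n (ka * n) s"] gv.sq_integrable_add[OF sgnc_meas _ i(1), of "%s. - sgnt m n (ka * n) s"] i by auto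
  have "gv.sd (%s. Nz n s - sgnt m n (ka * n) s) <= gv.sd (%s. Nz n s - sgnc n (ka * n) s) + gv.sd (%s. sgnc n (ka * n) s - sgnt m n (ka * n) s)"
   using gv.sd_triangle[OF _ _ d] by simp
  also have "\<dots> <= CZ * sqrt n * (pi / ka) powr (1/4) + sqrt (CV * sgn_err m * n) / (pi / ka)" by (rule add_mono[OF X(2) Y])
  also have "\<dots> = (CZ * (pi / ka) powr (1/4) + sqrt (CV * sgn_err m) / (pi / ka)) * sqrt n"
   by (simp add: real_sqrt_mult algebra_simps add_divide_distrib)
  also have "\<dots> <= (ep / 2 + ep / 2) * sqrt n" using m ka(3) by (intro mult_right_mono add_mono) auto
  finally show ?thesis by simp
 qed
 then show ?thesis using ka by blast
qed

text \<open>The standard deviations divided by \<open>sqrt n\<close> are uniformly close to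
  convergent sequences, hence converge themselves. Characteristic functions are compared in the same
  way, and the bound independent of the mesh keeps the limit positive.\<close>

theorem zeros_clt:
 shows "\<exists>V>0. (%n. variance (Nz n) / n) \<longlonglongrightarrow> V"
  and "weak_conv_m (%n. distr M borel (%s. (Nz n s - expectation (Nz n)) / sqrt (variance (Nz n)))) SN"
proof -
 \<comment> \<open>The maximum keeps the scaling factor nonzero at \<open>n = 0\<close>, so that the
   normalized variables agree for every \<open>n\<close>.\<close>
 define W where "W n s = (Nz n s - expectation (Nz n)) / sqrt (max 1 (real n))" for n s
 define r where "r n = sqrt (expectation (%s. (W n s)^2))" for n
 define WY where "WY m ka n s = (sgnt m n (ka * n) s - expectation (sgnt m n (ka * n))) / sqrt n" for m ka n s
 define y where "y m ka n = sqrt (gv.cv (sgnt m n (ka * n)) (sgnt m n (ka * n)) / n)" for m ka n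
 have [measurable]: "W n \<in> borel_measurable M" for n unfolding W_def[abs_def] by measurable
 have EW: "expectation (%s. (W n s)^2) = variance (Nz n) / max 1 (real n)" for n by (simp add: W_def power_divide)
 have X2: "integrable M (%s. (Nz n s)^2)" if n: "good n" for n
 proof -
  have "n >= 1" using n by (simp add: good_def)
  obtain ka :: nat where "ka >= 1" "pi / ka <= 1 / 40000" using small_mesh[of 1] by auto
  then show ?thesis using zeros_sgnc(1)[OF n, of "ka * n"] pt_grid(2)[of n ka] \<open>n >= 1\<close> by simp
 qed
 have Y2: "integrable M (%s. (sgnt m n c s)^2)" for m n c by (rule gv.integrable_sq_bounded[OF sgnt_meas sgnt_bounds])
 have XY: "integrable M (%s. (Nz n s - sgnt m n c s)^2)" if n: "good n" for m n c
  using gv.sq_integrable_add[OF Nz_meas _ X2[OF n], of "%s. - sgnt m n c s"] Y2 by auto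
 have rg: "r n = gv.sd (Nz n) / sqrt n" if n: "good n" for n
  unfolding r_def EW gv.sd_def gv.cv_self[OF X2[OF n] Nz_meas] using n by (simp add: good_def real_sqrt_divide max_def)
 have cvm: "gv.cv (%s. - f s) (%s. - f s) = gv.cv f f" for f by (simp add: gv.cv_def)
 have close: "\<bar>r n - y m ka n\<bar> <= ep" "\<bar>expectation (%s. h (t * W n s)) - expectation (%s. h (t * WY m ka n s))\<bar> <= \<bar>t\<bar> * ep"
  if n: "good n" and d: "gv.sd (%s. Nz n s - sgnt m n (ka * n) s) <= ep * sqrt n"
   and h: "!!x y. \<bar>h x - h y\<bar> <= \<bar>x - y\<bar>" "!!x. \<bar>h x\<bar> <= 1" "h \<in> borel_measurable borel" for n m ka ep t and h :: "real => real"
 proof -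
  have n1: "n >= 1" using n by (simp add: good_def)
  let ?Y = "sgnt m n (ka * n)"
  have "gv.sd (Nz n) <= gv.sd ?Y + gv.sd (%s. Nz n s - ?Y s)" using gv.sd_triangle[of ?Y "%s. Nz n s - ?Y s"] Y2 XY[OF n] by simp
  moreover have "gv.sd ?Y <= gv.sd (Nz n) + gv.sd (%s. - (Nz n s - ?Y s))"
   using gv.sd_triangle[of "Nz n" "%s. - (Nz n s - ?Y s)"] X2[OF n] XY[OF n, of m "ka * n"] by (simp add: power2_commute)
  moreover have "gv.sd (%s. - (Nz n s - ?Y s)) = gv.sd (%s. Nz n s - ?Y s)" unfolding gv.sd_def cvm ..
  ultimately have "\<bar>gv.sd (Nz n) - gv.sd ?Y\<bar> <= ep * sqrt n" using d by linarith
  from divide_right_mono[OF this, of "sqrt n"] show "\<bar>r n - y m ka n\<bar> <= ep"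
   unfolding rg[OF n] y_def real_sqrt_divide gv.sd_def using n1 by (simp add: diff_divide_distrib[symmetric] abs_divide)
  have i: "integrable M (Nz n)" "integrable M ?Y"
   by (rule square_integrable_imp_integrable[OF _ X2[OF n]], simp) (rule square_integrable_imp_integrable[OF _ Y2], simp)
  have e: "(t * W n s - t * WY m ka n s)^2 = t^2 / n * ((Nz n s - ?Y s) - expectation (%s. Nz n s - ?Y s))^2" for s
  proof -
   have "t * W n s - t * WY m ka n s = t / sqrt n * ((Nz n s - ?Y s) - expectation (%s. Nz n s - ?Y s))"
    using n1 i by (simp add: W_def WY_def max_def diff_divide_distrib algebra_simps)
   then show ?thesis by (simp add: power_mult_distrib power_divide)
  qed
  have v: "integrable M (%s. ((Nz n s - ?Y s) - expectation (%s. Nz n s - ?Y s))^2)"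
   using gv.sq_integrable_add[OF _ _ XY[OF n, of m "ka * n"], of "%s. - expectation (%s. Nz n s - ?Y s)"] by simp
  have "\<bar>expectation (%s. h (t * W n s)) - expectation (%s. h (t * WY m ka n s))\<bar> <= sqrt (expectation (%s. (t * W n s - t * WY m ka n s)^2))"
   by (rule expectation_lipschitz[OF _ _ h(3,1,2)]) (unfold e, simp_all add: v W_def[abs_def] WY_def[abs_def] del: times_divide_eq_left)
  also have "\<dots> = sqrt (t^2 / n * gv.cv (%s. Nz n s - ?Y s) (%s. Nz n s - ?Y s))"
   unfolding e using gv.cv_self[OF XY[OF n]] by (simp del: times_divide_eq_left)
  also have "\<dots> = \<bar>t\<bar> * (gv.sd (%s. Nz n s - ?Y s) / sqrt n)" by (simp add: gv.sd_def real_sqrt_mult real_sqrt_divide)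
  also have "\<dots> <= \<bar>t\<bar> * ep" using d n1 by (intro mult_left_mono) (simp_all add: field_simps)
  finally show "\<bar>expectation (%s. h (t * W n s)) - expectation (%s. h (t * WY m ka n s))\<bar> <= \<bar>t\<bar> * ep" .
 qed
 have yc: "convergent (y m ka)" if "ka >= 1" "pi / real ka <= 1 / 40000" for m ka
  using sgnt_limits(1)[OF that, of m] tendsto_real_sqrt unfolding convergent_def y_def[abs_def] by blast
 have "convergent r"
 proof (rule convergent_of_approx)
  fix ep :: real assume "ep > 0"
  from Nz_sgnt[OF this] obtain m ka where k: "ka >= 1" "pi / real ka <= 1 / 40000"
   "!!n. good n ==> gv.sd (%s. Nz n s - sgnt m n (ka * n) s) <= ep * sqrt n" by blast
  have "\<bar>r n - y m ka n\<bar> <= ep" if "good n" for n by (rule close(1)[OF that k(3)[OF that], of cos]) (simp_all add: cos_sin_lipschitz)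
  then show "\<exists>y. convergent y \<and> eventually (%n. \<bar>r n - y n\<bar> <= ep) sequentially"
   by (intro exI[of _ "y m ka"] conjI yc[OF k(1,2)] eventually_mono[OF eventually_good])
 qed
 then obtain sg where sg: "r \<longlonglongrightarrow> sg" by (auto simp: convergent_def)
 \<comment> \<open>The grid count has standard deviation at least \<open>sqrt n / 2000\<close>, and
   the mesh is chosen so that the number of zeros differs from it by at most half of that.\<close>
 have sg0: "1 / 4000 <= sg"
 proof (rule LIMSEQ_le_const[OF sg])
  obtain ka :: nat where ka: "ka >= 1" "pi / ka <= 1 / 40000" "CZ * (pi / ka) powr (1/4) <= 1 / 4000" using small_mesh[of "1 / 4000"] by auto
  have "1 / 4000 <= r n" if n: "good n" for n
  proof -
   have n1: "n >= 1" using n by (simp add: good_def)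
   have c: "ka * n >= 1" and h: "mesh n (ka * n) = pi / ka" using n1 ka(1) pt_grid(2)[OF n1] by auto
   let ?S = "sgnc n (ka * n)"
   note X = zeros_sgnc[OF n c, unfolded h, OF ka(2)] and Y = sgnc_lower[OF n c, unfolded h, OF ka(2)]
   have i: "integrable M (%s. (?S s)^2)"
    by (rule gv.integrable_sq_bounded[of _ "real (ka * n)"], use sgnc_bounds in \<open>auto simp: abs_le_iff intro: order_trans[of _ 0] simp del: of_nat_mult\<close>)
   have d: "integrable M (%s. (- (Nz n s - ?S s))^2)" using gv.sq_integrable_add[OF Nz_meas _ X(1), of "%s. - ?S s"] i by (auto simp: power2_commute)
   have "gv.sd ?S <= gv.sd (Nz n) + gv.sd (%s. - (Nz n s - ?S s))" using gv.sd_triangle[OF Nz_meas _ X(1) d] by simp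
   also have "gv.sd (%s. - (Nz n s - ?S s)) = gv.sd (%s. Nz n s - ?S s)" unfolding gv.sd_def cvm ..
   also have "gv.sd (%s. Nz n s - ?S s) <= CZ * (pi / ka) powr (1/4) * sqrt n" using X(2) by (simp add: mult_ac)
   also have "\<dots> <= 1 / 4000 * sqrt n" using ka(3) by (intro mult_right_mono) auto
   finally have "1 / 4000 * sqrt n <= gv.sd (Nz n)" using Y by simp
   then show ?thesis unfolding rg[OF n] using n1 by (simp add: field_simps)
  qed
  then show "\<exists>N. \<forall>n\<ge>N. 1 / 4000 <= r n" using eventually_good unfolding eventually_sequentially by blast
 qed
 \<comment> \<open>The limit for an approximating count belongs to its own deviation
   \<open>\<tau>\<close>; closeness of \<open>\<tau>\<close> to \<open>sg\<close> is inherited from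
   closeness of the standard deviations.\<close>
 have char_lim: "(%n. expectation (%s. h (t * W n s))) \<longlonglongrightarrow> l"
  if h: "!!x y. \<bar>h x - h y\<bar> <= \<bar>x - y\<bar>" "!!x. \<bar>h x\<bar> <= 1" "h \<in> borel_measurable borel"
   and a: "!!m ka \<tau>. ka >= 1 ==> pi / real ka <= 1 / 40000 ==> y m ka \<longlonglongrightarrow> \<tau> ==>
    \<exists>l'. (%n. expectation (%s. h (t * WY m ka n s))) \<longlonglongrightarrow> l' \<and> \<bar>l' - l\<bar> <= \<bar>t\<bar> * \<bar>\<tau> - sg\<bar>"
  for h :: "real => real" and t l
 proof (rule tendsto_of_approx)
  fix ep' :: real assume e: "ep' > 0"
  define ep where "ep = ep' / (\<bar>t\<bar> + 1)"
  have ep: "ep > 0" "\<bar>t\<bar> * ep <= ep'" using e by (auto simp: ep_def field_simps)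
  from Nz_sgnt[OF ep(1)] obtain m ka where k: "ka >= 1" "pi / real ka <= 1 / 40000"
   "!!n. good n ==> gv.sd (%s. Nz n s - sgnt m n (ka * n) s) <= ep * sqrt n" by blast
  obtain \<tau> where \<tau>: "y m ka \<longlonglongrightarrow> \<tau>" using yc[OF k(1,2), of m] by (auto simp: convergent_def)
  have c: "\<bar>r n - y m ka n\<bar> <= ep" "\<bar>expectation (%s. h (t * W n s)) - expectation (%s. h (t * WY m ka n s))\<bar> <= \<bar>t\<bar> * ep" if "good n" for n
   using close[OF that k(3)[OF that] h] by auto
  have "\<bar>sg - \<tau>\<bar> <= ep"
   by (rule tendsto_upperbound[OF tendsto_rabs[OF tendsto_diff[OF sg \<tau>]] eventually_mono[OF eventually_good c(1)]]) simp_all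
  then have "\<bar>t\<bar> * \<bar>\<tau> - sg\<bar> <= ep'" using ep(2) mult_left_mono[of "\<bar>\<tau> - sg\<bar>" ep "\<bar>t\<bar>"] by (simp add: abs_minus_commute)
  moreover have "eventually (%n. \<bar>expectation (%s. h (t * W n s)) - expectation (%s. h (t * WY m ka n s))\<bar> <= ep') sequentially"
   by (rule eventually_mono[OF eventually_good]) (use c(2) ep(2) in fastforce)
  ultimately show "\<exists>y l'. y \<longlonglongrightarrow> l' \<and> \<bar>l' - l\<bar> <= ep' \<and> eventually (%n. \<bar>expectation (%s. h (t * W n s)) - y n\<bar> <= ep') sequentially"
   using a[OF k(1,2) \<tau>] by (meson order_trans)
 qed
 have C: "(%n. expectation (%s. cos (t * W n s))) \<longlonglongrightarrow> exp (- (sg * t)\<^sup>2 / 2)" for t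
 proof (rule char_lim)
  fix m ka \<tau> assume k: "ka >= 1" "pi / real ka <= 1 / 40000" and \<tau>: "y m ka \<longlonglongrightarrow> \<tau>"
  have "(%n. exp (- ((y m ka n)^2 * t^2) / 2)) \<longlonglongrightarrow> exp (- (\<tau>^2 * t^2) / 2)" by (intro tendsto_intros \<tau>) simp
  moreover have "(y m ka n)^2 = gv.cv (sgnt m n (ka * n)) (sgnt m n (ka * n)) / n" for n
   unfolding y_def gv.cv_self[OF Y2 sgnt_meas] by (intro real_sqrt_pow2 divide_nonneg_nonneg integral_nonneg_AE) auto
  ultimately have "(%n. expectation (%s. cos (t * WY m ka n s))) \<longlonglongrightarrow> exp (- (\<tau>^2 * t^2) / 2)"
   using tendsto_add[OF sgnt_limits(2)[OF k, of t m]] by (fastforce simp: WY_def)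
  moreover have "\<bar>exp (- (\<tau>^2 * t^2) / 2) - exp (- (sg * t)\<^sup>2 / 2)\<bar> <= \<bar>t\<bar> * \<bar>\<tau> - sg\<bar>"
   using exp_half_sq_lipschitz[of "\<tau> * t" "sg * t"] by (simp add: power_mult_distrib left_diff_distrib[symmetric] abs_mult mult.commute)
  ultimately show "\<exists>l'. (%n. expectation (%s. cos (t * WY m ka n s))) \<longlonglongrightarrow> l' \<and> \<bar>l' - exp (- (sg * t)\<^sup>2 / 2)\<bar> <= \<bar>t\<bar> * \<bar>\<tau> - sg\<bar>"
   by blast
 qed (simp_all add: cos_sin_lipschitz)
 have S: "(%n. expectation (%s. sin (t * W n s))) \<longlonglongrightarrow> 0" for t
 proof (rule char_lim)
  fix m ka \<tau> assume k: "ka >= 1" "pi / real ka <= 1 / 40000"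
  show "\<exists>l'. (%n. expectation (%s. sin (t * WY m ka n s))) \<longlonglongrightarrow> l' \<and> \<bar>l' - 0\<bar> <= \<bar>t\<bar> * \<bar>\<tau> - sg\<bar>"
   using sgnt_limits(3)[OF k, of t m] by (intro exI[of _ 0]) (simp add: WY_def)
 qed (simp_all add: cos_sin_lipschitz)
 have "weak_conv_m (%n. distr M borel (%s. W n s / sqrt (expectation (%s. (W n s)^2)))) SN"
 proof (rule weak_conv_normalized)
  show "eventually (%n. integrable M (%s. (W n s)^2)) sequentially" using eventually_good
  proof eventually_elim
   case (elim n)
   show ?case using gv.sq_integrable_add[OF Nz_meas _ X2[OF elim], of "%s. - expectation (Nz n)"] by (simp add: W_def power_divide)
  qed
  show "(%n. sqrt (expectation (%s. (W n s)^2))) \<longlonglongrightarrow> sg" using sg by (simp add: r_def[abs_def])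
 qed (use sg0 C S in auto)
 moreover have "W n s / sqrt (expectation (%s. (W n s)^2)) = (Nz n s - expectation (Nz n)) / sqrt (variance (Nz n))" for n s
  unfolding EW by (simp add: W_def real_sqrt_divide)
 ultimately show "weak_conv_m (%n. distr M borel (%s. (Nz n s - expectation (Nz n)) / sqrt (variance (Nz n)))) SN" by simp
 have "(%n. (r n)^2) \<longlonglongrightarrow> sg^2" by (intro tendsto_intros sg)
 moreover have "eventually (%n. (r n)^2 = variance (Nz n) / n) sequentially" using eventually_ge_at_top[of 1]
 proof eventually_elim
  case (elim n)
  have "0 <= variance (Nz n)" by (rule integral_nonneg_AE) simp
  then show ?case using elim unfolding r_def EW by (simp add: max_def)
 qed
 ultimately have "(%n. variance (Nz n) / n) \<longlonglongrightarrow> sg^2" by (rule Lim_transform_eventually)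
 moreover have "sg^2 > 0" using sg0 by simp
 ultimately show "\<exists>V>0. (%n. variance (Nz n) / n) \<longlonglongrightarrow> V" by blast
qed

end

subsection \<open>Sturm--Liouville systems\<close>

lemma deriv_ivl_works:
 assumes "f differentiable_on ivl" "x \<in> ivl"
 shows "(f has_real_derivative deriv_ivl f x) (at x within ivl)" using assms unfolding deriv_ivl_def has_real_derivative_iff_has_vector_derivative
 by (auto simp: differentiable_on_def vector_derivative_works)

lemma bounded_on_ivl: "continuous_on ivl f ==> \<exists>B. \<forall>x\<in>ivl. \<bar>f x\<bar> <= B" for f :: "real => real"
 using compact_imp_bounded[OF compact_continuous_image[OF _ compact_Icc], of 0 "2 * pi" f] by (simp add: bounded_iff)

lemma uniform_bound_all:
 fixes f :: "nat => real => real"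
 assumes ev: "eventually (%k. \<forall>y\<in>S. \<bar>f k y\<bar> <= K * h k) sequentially"
  and b: "!!k. k >= 1 ==> \<exists>B. \<forall>y\<in>S. \<bar>f k y\<bar> <= B" and h: "!!k. k >= 1 ==> h k > 0"
 shows "\<exists>A\<ge>0. \<forall>k\<ge>1. \<forall>y\<in>S. \<bar>f k y\<bar> <= A * h k"
proof -
 obtain m where m: "!!k y. k >= m ==> y \<in> S ==> \<bar>f k y\<bar> <= K * h k" using ev by (auto simp: eventually_sequentially)
 have "\<forall>k. \<exists>B. k >= 1 --> (\<forall>y\<in>S. \<bar>f k y\<bar> <= B)" using b by blast
 then obtain B where B: "!!k y. k >= 1 ==> y \<in> S ==> \<bar>f k y\<bar> <= B k" by metis
 define A where "A = \<bar>K\<bar> + (\<Sum>k<m. \<bar>B k / h k\<bar>)"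
 have "\<bar>f k y\<bar> <= A * h k" if k: "k >= 1" and y: "y \<in> S" for k y
 proof (cases "k < m")
  case True
  have "\<bar>B k / h k\<bar> <= (\<Sum>k<m. \<bar>B k / h k\<bar>)" using True by (intro member_le_sum) auto
  then have "B k / h k <= A" using abs_ge_self[of "B k / h k"] unfolding A_def by linarith
  then have "B k <= A * h k" using h[OF k] by (simp add: divide_le_eq)
  then show ?thesis using B[OF k y] by linarith
 next
  case False
  have "K <= A" by (simp add: A_def sum_nonneg add_increasing2)
  then have "K * h k <= A * h k" using h[OF k] by (intro mult_right_mono) auto
  then show ?thesis using m[of k y] False y by simp
 qed
 moreover have "A >= 0" by (simp add: A_def sum_nonneg)
 ultimately show ?thesis by blast
qed

text \<open>The Landau-Kolmogorov inequality. On an interval of length \<open>h\<close> the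
  derivative is at most \<open>2 * A / h\<close> at some point, and it varies by at most
  \<open>B * h\<close> over the interval.\<close>

lemma landau_interpolation:
 fixes f :: "real => real"
 assumes d: "!!y. y \<in> ivl ==> (f has_real_derivative f' y) (at y within ivl)"
  "!!y. y \<in> ivl ==> (f' has_real_derivative f'' y) (at y within ivl)"
  and A: "!!y. y \<in> ivl ==> \<bar>f y\<bar> <= A" and B: "!!y. y \<in> ivl ==> \<bar>f'' y\<bar> <= B"
  and h: "0 < h" "h <= 1" and y: "y \<in> ivl"
 shows "\<bar>f' y\<bar> <= 2 * A / h + B * h"
proof -
 \<comment> \<open>The point \<open>y\<close> is made an end of a window inside the interval, on the
   side with enough room; \<open>h <= 1 < pi\<close> guarantees it.\<close>
 obtain l where l: "0 <= l" "l + h <= 2 * pi" "y = l \<or> y = l + h" using that[of y] that[of "y - h"] y h pi_gt3 by (cases "y <= pi") auto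
 have sub: "{l..l + h} \<subseteq> ivl" using l h by auto
 have "\<exists>z\<in>{l<..<l + h}. f (l + h) - f l = f' z * (l + h - l)"
 proof (rule mvt_simple)
  show "(f has_derivative (*) (f' x)) (at x within {l..l + h})" if "l <= x" "x <= l + h" for x
   using DERIV_subset[OF d(1) sub, of x] that sub unfolding has_field_derivative_def by auto
 qed (use h in simp)
 then obtain z where z: "l < z" "z < l + h" "f (l + h) - f l = h * f' z" by (auto simp: mult.commute)
 have zi: "z \<in> ivl" using z sub by auto
 have "\<bar>h * f' z\<bar> <= 2 * A" unfolding z(3)[symmetric] using A[of l] A[of "l + h"] sub h by auto
 then have 1: "\<bar>f' z\<bar> <= 2 * A / h" using h by (simp add: abs_mult field_simps)
 have "norm (f' y - f' z) <= B * norm (y - z)" by (rule field_differentiable_bound[where S=ivl, OF _ d(2)]) (use B y zi in auto)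
 moreover have "B * norm (y - z) <= B * h" using l z B[OF y] by (intro mult_left_mono) auto
 ultimately show ?thesis using 1 by simp
qed

locale sl_weight =
 fixes \<omega> :: "real => real"
 assumes pos: "!!x. x \<in> ivl ==> \<omega> x > 0" and C2: "C2_ivl \<omega>" and total: "integral ivl \<omega> = 2 * pi"
begin

lemma continuous: "continuous_on ivl \<omega>" "continuous_on ivl (deriv_ivl \<omega>)" "continuous_on ivl (deriv_ivl (deriv_ivl \<omega>))"
 using C2 by (auto simp: C2_ivl_def twice_diff_ivl_def differentiable_imp_continuous_on)

lemma Omega_deriv: "x \<in> ivl ==> (Omega \<omega> has_real_derivative \<omega> x) (at x within ivl)"
 unfolding Omega_def[abs_def] by (rule integral_has_real_derivative[OF continuous(1)]) auto

text \<open>Positivity of the weight gives strict monotonicity, the total mass fixes the end points,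
  and the intermediate value theorem gives surjectivity.\<close>

lemma Omega_bij: "bij_betw (Omega \<omega>) ivl ivl"
proof -
 have c: "continuous_on ivl (Omega \<omega>)" by (rule DERIV_continuous_on[OF Omega_deriv])
 have lt: "Omega \<omega> x < Omega \<omega> y" if "x \<in> ivl" "y \<in> ivl" "x < y" for x y
 proof (rule DERIV_pos_imp_increasing_open[OF that(3)])
  fix z assume z: "x < z" "z < y"
  then have zi: "z \<in> ivl" and "0 < z" "z < 2 * pi" using that by auto
  then have "(Omega \<omega> has_real_derivative \<omega> z) (at z)" using Omega_deriv[OF zi] by (simp only: at_within_Icc_at)
  then show "\<exists>d. (Omega \<omega> has_real_derivative d) (at z) \<and> d > 0" using pos[OF zi] by blast
 qed (use that in \<open>auto intro: continuous_on_subset[OF c]\<close>)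
 have e: "Omega \<omega> 0 = 0" "Omega \<omega> (2 * pi) = 2 * pi" using total by (simp_all add: Omega_def)
 have le: "Omega \<omega> x <= Omega \<omega> y" if "x \<in> ivl" "y \<in> ivl" "x <= y" for x y using lt[of x y] that by (cases "x = y") auto
 have "Omega \<omega> ` ivl = ivl"
 proof
  show "Omega \<omega> ` ivl \<subseteq> ivl" using le[of 0] le[of _ "2 * pi"] e by auto
  show "ivl \<subseteq> Omega \<omega> ` ivl"
  proof
   fix y assume "y \<in> ivl"
   then obtain x where "0 <= x" "x <= 2 * pi" "Omega \<omega> x = y" using IVT'[of "Omega \<omega>" 0 y "2 * pi"] e c by auto
   then show "y \<in> Omega \<omega> ` ivl" by auto
  qed
 qed
 moreover have "inj_on (Omega \<omega>) ivl" by (rule linorder_inj_onI') (use lt in force)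
 ultimately show ?thesis by (simp add: bij_betw_def)
qed

lemma potential_bounded: "\<exists>Q\<ge>0. \<forall>y\<in>ivl. \<bar>sl_potential \<omega> y\<bar> <= Q"
proof -
 let ?f = "%x. deriv_ivl (deriv_ivl \<omega>) x / (2 * \<omega> x ^ 3) - 3 / 4 * ((deriv_ivl \<omega> x)^2 / \<omega> x ^ 4)"
 have "continuous_on ivl ?f" using pos by (intro continuous_intros continuous) force+
 from bounded_on_ivl[OF this] obtain Q where Q: "!!x. x \<in> ivl ==> \<bar>?f x\<bar> <= Q" by blast
 have "\<bar>sl_potential \<omega> y\<bar> <= Q" if "y \<in> ivl" for y
 proof -
  have "the_inv_into ivl (Omega \<omega>) y \<in> ivl" using Omega_bij that by (intro the_inv_into_into) (auto simp: bij_betw_def)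
  from Q[OF this] show ?thesis by (simp add: sl_potential_def Let_def)
 qed
 moreover have "Q >= 0" using Q[of 0] by force
 ultimately show ?thesis by blast
qed

text \<open>The error in the derivative is obtained by interpolation from the error in the function and
 the error in the second derivative, which is given by the differential equation.\<close>

lemma system_data:
 fixes e :: "nat => nat + nat"
 assumes sys: "sl_system_in_x \<omega> bc w"
  and asy: "unif_bigo (%k x. w k x - 1 / sqrt (\<omega> x) * \<tau> 0 (e k) (Omega \<omega> x)) (%k. 1 / real k)"
  and e: "!!k. kk (e k) = k"
 shows "\<exists>\<psi> K. K >= 0 \<and> (\<forall>k\<ge>1. (\<forall>a<2. \<forall>y\<in>ivl. (\<psi> a k has_real_derivative \<psi> (Suc a) k y) (at y within ivl)) \<and>
  (\<forall>a\<le>2. \<forall>y\<in>ivl. \<bar>\<psi> a k y - \<tau> a (e k) y\<bar> <= K * real k ^ a / k) \<and> (\<forall>x\<in>ivl. w k x = \<psi> 0 k (Omega \<omega> x) / sqrt (\<omega> x)))"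
proof -
 obtain lam g c where orth: "sl_orthogonal_system \<omega> bc lam g"
  and w: "!!k x. k >= 1 ==> x \<in> ivl ==> w k x = c k * (1 / sqrt (\<omega> x) * g k (Omega \<omega> x))"
  using sys unfolding sl_system_in_x_def by blast
 \<comment> \<open>The scale \<open>c k\<close> is included, so that these functions are the
   normalized eigenfunctions and their derivatives.\<close>
 define \<psi> where "\<psi> a k y = c k * (deriv_ivl ^^ a) (g k) y" for a k y
 have eig: "sl_eigenfunction \<omega> (lam k) (g k)" if "k >= 1" for k using orth that by (auto simp: sl_orthogonal_system_def)
 have td: "g k differentiable_on ivl" "deriv_ivl (g k) differentiable_on ivl" if "k >= 1" for k
  using eig[OF that] by (auto simp: sl_eigenfunction_def twice_diff_ivl_def)
 have der: "(\<psi> a k has_real_derivative \<psi> (Suc a) k y) (at y within ivl)" if "k >= 1" "a < 2" "y \<in> ivl" for a k y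
 proof -
  have "(deriv_ivl ^^ a) (g k) differentiable_on ivl" using td[OF that(1)] that(2) by (auto simp: less_Suc_eq numeral_2_eq_2)
  from deriv_ivl_works[OF this that(3)] show ?thesis unfolding \<psi>_def[abs_def] by (auto intro!: derivative_eq_intros)
 qed
 have ode: "\<psi> 2 k y = (sl_potential \<omega> y - lam k) * \<psi> 0 k y" if "k >= 1" "y \<in> ivl" for k y
 proof -
  have "sl_operator \<omega> (g k) y = lam k * g k y" using eig[OF that(1)] that(2) by (auto simp: sl_eigenfunction_def)
  then have "deriv_ivl (deriv_ivl (g k)) y = (sl_potential \<omega> y - lam k) * g k y" by (simp add: sl_operator_def algebra_simps)
  then show ?thesis by (simp add: \<psi>_def numeral_2_eq_2)
 qed
 have w\<psi>: "w k x = \<psi> 0 k (Omega \<omega> x) / sqrt (\<omega> x)" if "k >= 1" "x \<in> ivl" for k x using w[OF that] by (simp add: \<psi>_def)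
 have \<tau>1: "\<bar>\<tau> 0 i y\<bar> <= 1" for i y by (cases i) (auto simp: \<tau>_def)
 have \<tau>2: "\<tau> 2 (e k) y = - ((real k / 2)^2 * \<tau> 0 (e k) y)" for k y
  using e[of k] by (cases "e k") (simp_all add: \<tau>_def kk_def cos_add sin_add)
 obtain Q where Q: "Q >= 0" "!!y. y \<in> ivl ==> \<bar>sl_potential \<omega> y\<bar> <= Q" using potential_bounded by blast
 have "\<exists>A\<ge>0. \<forall>k\<ge>1. \<forall>y\<in>ivl. \<bar>\<psi> 0 k y - \<tau> 0 (e k) y\<bar> <= A * (1 / real k)"
 proof -
  obtain W where W: "!!x. x \<in> ivl ==> \<bar>\<omega> x\<bar> <= W" using bounded_on_ivl[OF continuous(1)] by blast
  obtain K where K: "eventually (%k. \<forall>x\<in>ivl. \<bar>w k x - 1 / sqrt (\<omega> x) * \<tau> 0 (e k) (Omega \<omega> x)\<bar> <= K * (1 / real k)) sequentially"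
   using asy unfolding unif_bigo_def by blast
  show ?thesis
  proof (rule uniform_bound_all[where K="sqrt W * K"])
   show "eventually (%k. \<forall>y\<in>ivl. \<bar>\<psi> 0 k y - \<tau> 0 (e k) y\<bar> <= sqrt W * K * (1 / real k)) sequentially"
    using K eventually_ge_at_top[of 1]
   proof eventually_elim
    case (elim k)
    show ?case
    proof
     fix y assume "y \<in> ivl"
     then obtain x where x: "x \<in> ivl" "y = Omega \<omega> x" using Omega_bij unfolding bij_betw_def by (metis imageE)
     have "\<psi> 0 k y - \<tau> 0 (e k) y = sqrt (\<omega> x) * (w k x - 1 / sqrt (\<omega> x) * \<tau> 0 (e k) (Omega \<omega> x))"
      using w\<psi>[OF elim(2) x(1)] pos[OF x(1)] by (simp add: x(2) right_diff_distrib)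
     then have "\<bar>\<psi> 0 k y - \<tau> 0 (e k) y\<bar> = sqrt (\<omega> x) * \<bar>w k x - 1 / sqrt (\<omega> x) * \<tau> 0 (e k) (Omega \<omega> x)\<bar>"
      using pos[OF x(1)] by (simp add: abs_mult)
     also have "\<dots> <= sqrt W * (K * (1 / real k))" using elim(1) x(1) W[OF x(1)] pos[OF x(1)] by (intro mult_mono) auto
     finally show "\<bar>\<psi> 0 k y - \<tau> 0 (e k) y\<bar> <= sqrt W * K * (1 / real k)" by simp
    qed
   qed
   show "\<exists>B. \<forall>y\<in>ivl. \<bar>\<psi> 0 k y - \<tau> 0 (e k) y\<bar> <= B" if "k >= 1" for k
   proof -
    have "continuous_on ivl (\<psi> 0 k)" by (rule DERIV_continuous_on[OF der[OF that]]) auto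
    from bounded_on_ivl[OF this] obtain B where B: "\<forall>y\<in>ivl. \<bar>\<psi> 0 k y\<bar> <= B" by blast
    show ?thesis
    proof (intro exI[of _ "B + 1"] ballI)
     fix y assume "y \<in> ivl"
     then have "\<bar>\<psi> 0 k y\<bar> <= B" using B by blast
     then show "\<bar>\<psi> 0 k y - \<tau> 0 (e k) y\<bar> <= B + 1" using \<tau>1[of "e k" y] by linarith
    qed
   qed
  qed simp
 qed
 then obtain A where A: "A >= 0" "!!k y. k >= 1 ==> y \<in> ivl ==> \<bar>\<psi> 0 k y - \<tau> 0 (e k) y\<bar> <= A * (1 / real k)" by blast
 \<comment> \<open>A phase error of order \<open>1 / k\<close> times a sum of order \<open>k\<close>
   leaves \<open>lam k - (k / 2)^2\<close> bounded. The dummy set \<open>{0}\<close> makes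
   \<open>uniform_bound_all\<close> applicable to a sequence of numbers.\<close>
 have "\<exists>L\<ge>0. \<forall>k\<ge>1. \<forall>y\<in>{0::real}. \<bar>lam k - (real k / 2)^2\<bar> <= L * 1"
 proof -
  obtain C where C: "C > 0" "eventually (%k. \<bar>sqrt (lam k) - real k / 2\<bar> <= C * (1 / real k)) sequentially"
   using orth unfolding sl_orthogonal_system_def by (auto elim!: landau_o.bigE)
  have "eventually (%k. real k / 2 > C) sequentially" by real_asymp
  then have "eventually (%k. \<forall>y\<in>{0::real}. \<bar>lam k - (real k / 2)^2\<bar> <= C * (1 + C) * 1) sequentially"
   using C(2) eventually_ge_at_top[of 1]
  proof eventually_elim
   case (elim k)
   define s where "s = sqrt (lam k)"
   have d: "\<bar>s - real k / 2\<bar> <= C / k" using elim by (simp add: s_def)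
   have ck: "C / k <= C" using C(1) elim(3) by (simp add: field_simps)
   \<comment> \<open>A positive root excludes negative eigenvalues, for which \<open>sqrt\<close>
     would be negative and its square not \<open>lam k\<close>.\<close>
   then have "s > 0" using d elim(1) by linarith
   then have "lam k = s^2" by (simp add: s_def)
   then have "\<bar>lam k - (real k / 2)^2\<bar> = \<bar>s - real k / 2\<bar> * \<bar>s + real k / 2\<bar>"
    by (simp add: abs_mult[symmetric] power2_eq_square algebra_simps)
   also have "\<dots> <= C / k * (k + C)" using d ck \<open>s > 0\<close> C(1) by (intro mult_mono) auto
   also have "\<dots> <= C * (1 + C)" using C(1) elim(3) ck by (simp add: field_simps)
   finally show ?case by simp
  qed
  then show ?thesis by (rule uniform_bound_all) auto
 qed
 then obtain L where L: "L >= 0" "!!k. k >= 1 ==> \<bar>lam k - (real k / 2)^2\<bar> <= L" by auto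
 define K2 where "K2 = (Q + L) * (1 + A) + A"
 have K2: "K2 >= 0" using Q L A by (simp add: K2_def)
 have b2: "\<bar>\<psi> 2 k y - \<tau> 2 (e k) y\<bar> <= K2 * k" if k: "k >= 1" and y: "y \<in> ivl" for k y
 proof -
  have Ak: "A * (1 / real k) <= A" using mult_left_mono[of "1 / real k" 1 A] A(1) k by simp
  have p0: "\<bar>\<psi> 0 k y\<bar> <= 1 + A" using A(2)[OF k y] \<tau>1[of "e k" y] Ak by linarith
  have "\<psi> 2 k y - \<tau> 2 (e k) y = (sl_potential \<omega> y - (lam k - (real k / 2)^2)) * \<psi> 0 k y - (real k / 2)^2 * (\<psi> 0 k y - \<tau> 0 (e k) y)"
   unfolding ode[OF k y] \<tau>2 by (simp add: algebra_simps)
  moreover have "\<bar>(sl_potential \<omega> y - (lam k - (real k / 2)^2)) * \<psi> 0 k y\<bar> <= (Q + L) * (1 + A)"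
   unfolding abs_mult using Q(2)[OF y] L(2)[OF k] p0 Q(1) L(1) by (intro mult_mono) linarith+
  moreover have "(Q + L) * (1 + A) * 1 <= (Q + L) * (1 + A) * k" using Q L A k by (intro mult_left_mono) auto
  moreover have "\<bar>(real k / 2)^2 * (\<psi> 0 k y - \<tau> 0 (e k) y)\<bar> <= A * k"
  proof -
   have "\<bar>(real k / 2)^2 * (\<psi> 0 k y - \<tau> 0 (e k) y)\<bar> <= (real k)^2 * (A * (1 / real k))"
    unfolding abs_mult using A(2)[OF k y] by (intro mult_mono) (auto simp: power_divide)
   then show ?thesis using k by (simp add: power2_eq_square mult.commute)
  qed
  ultimately show ?thesis by (simp add: K2_def distrib_right)
 qed
 have b1: "\<bar>\<psi> 1 k y - \<tau> 1 (e k) y\<bar> <= 2 * A + K2" if k: "k >= 1" and y: "y \<in> ivl" for k y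
 proof -
  \<comment> \<open>The step \<open>1 / k\<close> balances an error of order \<open>1 / k\<close> in
    the function against one of order \<open>k\<close> in the second derivative.\<close>
  have "\<bar>\<psi> 1 k y - \<tau> 1 (e k) y\<bar> <= 2 * (A * (1 / real k)) / (1 / real k) + K2 * k * (1 / real k)"
  proof (rule landau_interpolation[where f="%y. \<psi> 0 k y - \<tau> 0 (e k) y" and f'="%y. \<psi> 1 k y - \<tau> 1 (e k) y" and f''="%y. \<psi> 2 k y - \<tau> 2 (e k) y"])
   show "((%y. \<psi> 0 k y - \<tau> 0 (e k) y) has_real_derivative \<psi> 1 k y - \<tau> 1 (e k) y) (at y within ivl)"
    "((%y. \<psi> 1 k y - \<tau> 1 (e k) y) has_real_derivative \<psi> 2 k y - \<tau> 2 (e k) y) (at y within ivl)" if "y \<in> ivl" for y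
    using DERIV_diff[OF der[OF k _ that] \<tau>_deriv, of 0 0 "e k"] DERIV_diff[OF der[OF k _ that] \<tau>_deriv, of 1 1 "e k"]
    by (simp_all add: numeral_2_eq_2)
  qed (use A(2) b2 k y in auto)
  then show ?thesis using k by simp
 qed
 have "\<bar>\<psi> a k y - \<tau> a (e k) y\<bar> <= (2 * A + K2) * real k ^ a / k" if k: "k >= 1" and a: "a <= 2" and y: "y \<in> ivl" for a k y
 proof -
  consider "a = 0" | "a = 1" | "a = 2" using a by linarith
  then show ?thesis
  proof cases
   case 1
   have "A * (1 / real k) <= (2 * A + K2) * (1 / real k)" using A K2 by (intro mult_right_mono) auto
   then show ?thesis using A(2)[OF k y] 1 by simp
  next
   case 2
   then show ?thesis using b1[OF k y] k by simp
  next
   case 3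
   have "K2 * k <= (2 * A + K2) * k" using A by (intro mult_right_mono) auto
   from order_trans[OF b2[OF k y] this] show ?thesis using 3 k by (simp add: power2_eq_square)
  qed
 qed
 moreover have "2 * A + K2 >= 0" using A K2 by simp
 ultimately show ?thesis using der w\<psi> by (intro exI[of _ \<psi>] exI[of _ "2 * A + K2"]) blast
qed

end

theorem theorem1:
  fixes \<omega> :: "real \<Rightarrow> real"
    and M :: "'s measure"
    and a b :: "nat \<Rightarrow> 's \<Rightarrow> real"
    and u v :: "nat \<Rightarrow> real \<Rightarrow> real"
    and F :: "nat \<Rightarrow> 's \<Rightarrow> real \<Rightarrow> real"
    and N :: "nat \<Rightarrow> 's \<Rightarrow> real"
  defines "F \<equiv> random_sum a b u v"
    and "N \<equiv> (\<lambda>n s. num_zeros (F n s))"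
  assumes "\<And>x. x \<in> ivl \<Longrightarrow> \<omega> x > 0"
    and "C2_ivl \<omega>"
    and "integral ivl \<omega> = 2 * pi"
    and "prob_space M"
    and "\<And>k. k \<ge> 1 \<Longrightarrow> distributed M lborel (a k) std_normal_density"
    and "\<And>k. k \<ge> 1 \<Longrightarrow> distributed M lborel (b k) std_normal_density"
    and "prob_space.indep_vars M (\<lambda>_. borel) (case_sum a b) ({1..} <+> {1..})"
    and "sl_system_u \<omega> u"
    and "sl_system_v \<omega> v"
  shows "(\<forall>\<^sub>F n in sequentially. AE s in M. finite (zeros (F n s))) \<and>
    (\<exists>V>0. (\<lambda>n. prob_space.variance M (N n) / real n) \<longlonglongrightarrow> V) \<and>
    weak_conv_m
      (\<lambda>n. distr M borel (\<lambda>s. (N n s - prob_space.expectation M (N n))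
                                / sqrt (prob_space.variance M (N n))))
      std_normal_distribution"
proof -
 interpret sl_weight \<omega> by unfold_locales fact+
 interpret prob_space M by fact
 have "\<exists>\<psi> K. K >= 0 \<and> (\<forall>k\<ge>1. (\<forall>a<2. \<forall>y\<in>ivl. (\<psi> a k has_real_derivative \<psi> (Suc a) k y) (at y within ivl)) \<and>
  (\<forall>a\<le>2. \<forall>y\<in>ivl. \<bar>\<psi> a k y - \<tau> a (Inl k) y\<bar> <= K * real k ^ a / k) \<and> (\<forall>x\<in>ivl. u k x = \<psi> 0 k (Omega \<omega> x) / sqrt (\<omega> x)))"
  by (rule system_data[where bc=cond_C]) (use \<open>sl_system_u \<omega> u\<close> in \<open>simp_all add: sl_system_u_def \<tau>_def kk_def\<close>)
 then obtain \<psi>u Ku where U: "Ku >= 0" "!!k a y. k >= 1 ==> a < 2 ==> y \<in> ivl ==> (\<psi>u a k has_real_derivative \<psi>u (Suc a) k y) (at y within ivl)"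
  "!!k a y. k >= 1 ==> a <= 2 ==> y \<in> ivl ==> \<bar>\<psi>u a k y - \<tau> a (Inl k) y\<bar> <= Ku * real k ^ a / k"
  "!!k x. k >= 1 ==> x \<in> ivl ==> u k x = \<psi>u 0 k (Omega \<omega> x) / sqrt (\<omega> x)" by blast
 have "\<exists>\<psi> K. K >= 0 \<and> (\<forall>k\<ge>1. (\<forall>a<2. \<forall>y\<in>ivl. (\<psi> a k has_real_derivative \<psi> (Suc a) k y) (at y within ivl)) \<and>
  (\<forall>a\<le>2. \<forall>y\<in>ivl. \<bar>\<psi> a k y - \<tau> a (Inr k) y\<bar> <= K * real k ^ a / k) \<and> (\<forall>x\<in>ivl. v k x = \<psi> 0 k (Omega \<omega> x) / sqrt (\<omega> x)))"
  by (rule system_data[where bc=cond_D]) (use \<open>sl_system_v \<omega> v\<close> in \<open>simp_all add: sl_system_v_def \<tau>_def kk_def\<close>)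
 then obtain \<psi>v Kv where V: "Kv >= 0" "!!k a y. k >= 1 ==> a < 2 ==> y \<in> ivl ==> (\<psi>v a k has_real_derivative \<psi>v (Suc a) k y) (at y within ivl)"
  "!!k a y. k >= 1 ==> a <= 2 ==> y \<in> ivl ==> \<bar>\<psi>v a k y - \<tau> a (Inr k) y\<bar> <= Kv * real k ^ a / k"
  "!!k x. k >= 1 ==> x \<in> ivl ==> v k x = \<psi>v 0 k (Omega \<omega> x) / sqrt (\<omega> x)" by blast
 define \<phi> where "\<phi> a = case_sum (\<psi>u a) (\<psi>v a)" for a
 define K where "K = Ku + Kv"
 interpret sl_process \<phi> K M "case_sum a b"
 proof
  show "K >= 0" using U V by (simp add: K_def)
  fix i :: "nat + nat" and c :: nat and y :: real assume i: "1 <= kk i" and y: "y \<in> ivl"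
  show "(\<phi> c i has_real_derivative \<phi> (Suc c) i y) (at y within ivl)" if "c < 2"
   using i y that U(2) V(2) by (cases i) (auto simp: \<phi>_def kk_def)
  show "\<bar>\<phi> c i y - \<tau> c i y\<bar> <= K * kk i ^ c / kk i" if "c <= 2"
  proof -
   have "Ku * real k ^ c / k <= K * real k ^ c / k" "Kv * real k ^ c / k <= K * real k ^ c / k" for k :: nat
    using U(1) V(1) by (intro divide_right_mono mult_right_mono; simp add: K_def)+
   then show ?thesis using i y that U(3)[of _ c y] V(3)[of _ c y] by (cases i) (fastforce simp: \<phi>_def kk_def intro: order_trans)+
  qed
 next
  show "distributed M lborel (case_sum a b i) std_normal_density" if "i \<in> {1..} <+> {1..}" for i using that assms(7,8) by auto
 qed fact
 \<comment> \<open>The change of variables multiplies the random sum by the positive factor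
   \<open>sqrt (\<omega> x)\<close>, so zeros correspond one to one; \<open>n = 0\<close> is
   excluded because the map is then constant.\<close>
 have bij: "bij_betw (%x. n * Omega \<omega> x) (zeros (F n s)) {t \<in> dom n. fz n t s = 0}" if n: "n >= 1" for n s
 proof -
  have eq: "fz n (n * Omega \<omega> x) s = sqrt (\<omega> x) * F n s x" if x: "x \<in> ivl" for x
  proof -
   have w: "sqrt (\<omega> x) ~= 0" using assms(3)[OF x] by simp
   have "fz n (n * Omega \<omega> x) s = (\<Sum>k=1..n. \<psi>u 0 k (Omega \<omega> x) / sqrt n * a k s + \<psi>v 0 k (Omega \<omega> x) / sqrt n * b k s)"
    using n by (simp add: fz_def gv.Z_def V_def sum_J \<phi>_def)
   also have "\<dots> = (\<Sum>k=1..n. sqrt (\<omega> x) * (1 / sqrt n * (a k s * u k x + b k s * v k x)))"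
    using x w by (intro sum.cong refl) (simp add: U(4) V(4) field_simps)
   finally show ?thesis by (simp add: F_def random_sum_def sum_distrib_left)
  qed
  have z: "F n s x = 0 \<longleftrightarrow> fz n (n * Omega \<omega> x) s = 0" if "x \<in> ivl" for x
   unfolding eq[OF that] using assms(3)[OF that] by simp
  have im: "Omega \<omega> ` ivl = ivl" and inj: "inj_on (Omega \<omega>) ivl" using Omega_bij by (auto simp: bij_betw_def)
  have "(%x. n * Omega \<omega> x) ` zeros (F n s) = {t \<in> dom n. fz n t s = 0}"
  proof (intro equalityI subsetI)
   fix t assume "t \<in> (%x. n * Omega \<omega> x) ` zeros (F n s)"
   then obtain x where x: "x \<in> ivl" "F n s x = 0" "t = n * Omega \<omega> x" by (auto simp: zeros_def)
   have "Omega \<omega> x \<in> ivl" using x(1) im by blast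
   then have "0 <= real n * Omega \<omega> x" "real n * Omega \<omega> x <= real n * (2 * pi)" by (auto intro: mult_left_mono)
   then have "t \<in> dom n" using x(3) by (simp add: mult.commute)
   then show "t \<in> {t \<in> dom n. fz n t s = 0}" using z[OF x(1)] x by simp
  next
   fix t assume t: "t \<in> {t \<in> dom n. fz n t s = 0}"
   then have "t / n \<in> ivl" using n by (auto simp: field_simps)
   then obtain x where x: "x \<in> ivl" "t / n = Omega \<omega> x" using im by (metis imageE)
   then have "t = n * Omega \<omega> x" using n by (simp add: field_simps)
   then show "t \<in> (%x. n * Omega \<omega> x) ` zeros (F n s)" using z[OF x(1)] t x(1) by (auto simp: zeros_def)
  qed
  moreover have "inj_on (%x. n * Omega \<omega> x) (zeros (F n s))"
  proof (rule inj_onI)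
   fix x y assume xy: "x \<in> zeros (F n s)" "y \<in> zeros (F n s)" and "n * Omega \<omega> x = n * Omega \<omega> y"
   then have "Omega \<omega> x = Omega \<omega> y" using n by simp
   then show "x = y" by (rule inj_onD[OF inj]) (use xy in \<open>simp_all add: zeros_def\<close>)
  qed
  ultimately show ?thesis by (simp add: bij_betw_def)
 qed
 have N: "N n = Nz n" if "n >= 1" for n using bij_betw_same_card[OF bij[OF that]] by (simp add: N_def num_zeros_def Nz_def fun_eq_iff)
 have "eventually (%n. AE s in M. finite (zeros (F n s))) sequentially" using eventually_good
 proof eventually_elim
  case (elim n)
  then have "n >= 1" by (simp add: good_def)
  then show ?case using AE_finite_zeros[OF elim] bij_betw_finite[OF bij] by simp
 qed
 moreover obtain V0 where "V0 > 0" "(%n. variance (Nz n) / n) \<longlonglongrightarrow> V0" using zeros_clt(1) by blast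
 then have "\<exists>V>0. (%n. variance (N n) / real n) \<longlonglongrightarrow> V"
  using Lim_transform_eventually[OF _ eventually_mono[OF eventually_ge_at_top[of 1]], of "%n. variance (Nz n) / n" V0 "%n. variance (N n) / n"]
  by (intro exI[of _ V0] conjI) (simp_all add: N)
 moreover have "weak_conv_m (%n. distr M borel (%s. (N n s - expectation (N n)) / sqrt (variance (N n)))) SN" unfolding weak_conv_m_def weak_conv_def
 proof (intro allI impI)
  fix x assume "isCont (cdf SN) x"
  then have "(%n. cdf (distr M borel (%s. (Nz n s - expectation (Nz n)) / sqrt (variance (Nz n)))) x) \<longlonglongrightarrow> cdf SN x"
   using zeros_clt(2) unfolding weak_conv_m_def weak_conv_def by blast
  \<comment> \<open>The two counts agree for all \<open>n >= 1\<close>, which is enough for the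
    limit.\<close>
  then show "(%n. cdf (distr M borel (%s. (N n s - expectation (N n)) / sqrt (variance (N n)))) x) \<longlonglongrightarrow> cdf SN x"
   by (rule Lim_transform_eventually) (rule eventually_mono[OF eventually_ge_at_top[of 1]], simp add: N)
 qed
 ultimately show ?thesis by blast
qed

end
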